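(* Let $H^+=\mathbb{F}_q(t,\zeta,\nu)$ be the narrow class field of $\mathcal{A}$, with the relation $$\nu^{q+1}=-\frac{1}{(t-\zeta)(t^q-\zeta)}.$$ The normalized modular curves $\dot{\mathbf{x}}_0(I_\infty^k)$, $k\ge 0$, are represented by the function field tower $$\mathcal{F}_0\xrightarrow{\,q+1\,}\mathcal{F}_1\xrightarrow{\,q\,}\mathcal{F}_2\xrightarrow{\,q\,}\mathcal{F}_3\xrightarrow{\,q\,}\mathcal{F}_4\xrightarrow{\,q\,}\cdots,$$ where the number on each arrow denotes the extension degree, and where $\mathcal{F}_k$ is generated by variables $\lambda_0,\dots,\lambda_k$ as follows. 1. For $k=0$, $\mathcal{F}_0=H^+(\lambda_0)$ (with $\lambda_0$ an independent variable). 2. For $k=1$, $\mathcal{F}_1=H^+(\lambda_0,\lambda_1)$, where the defining equation of $\lambda_0$ and $\lambda_1$ is $$\lambda_1^{q+1}-\lambda_0^{q}\lambda_1^{q}-\frac{\zeta^{1-q}-1}{\zeta\lambda_0}(t-\zeta^q)\,\nu\,\lambda_1+\left((\zeta^{-q}-\zeta^{-1})(t-\zeta^q)+(\zeta^{q-1}-1)^{q+1}\right)\nu\,\lambda_0^{q-1}=0.$$ 3. For $k\ge 2$, $\mathcal{F}_k=\mathcal{F}_1(\lambda_2,\dots,\lambda_k)=H^+(\lambda_0,\lambda_1,\dots,\lambda_k)$, where the variables $\lambda_2,\dots,\lambda_k$ are subject, for every $m$ with $2\le m\le k$, to $$\sum_{i=0}^{q-1}\left(\frac{\nu^{\sigm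a^m}(1-\zeta^{1-q})^{q+1}\lambda_{m-2}^{q-1}}{\lambda_{m-1}-\lambda_{m-2}^{q}}\right)^{i}(\lambda_m-\lambda_{m-1}^{q})^{q-i}-\frac{\nu^{\sigma^{m-1}}}{\nu^{\sigma^{m-2}}}\cdot\frac{\lambda_{m-1}-\lambda_{m-2}^{q}}{\lambda_{m-2}^{q-1}}\,\lambda_{m-1}^{q-1}=0.$$
   Context: Let $q$ be a prime power, $\zeta\in\mathbb{F}_{q^2}\setminus\mathbb{F}_q$, $\rho(t)=(t-\zeta)(t-\zeta^q)\in\mathbb{F}_q[t]$, $K=\mathbb{F}_q(t)$, and let $P_\rho$ be the degree-two place of $K$ given by $\rho$. $\mathcal{A}$ is the ring of elements of $K$ regular away from $P_\rho$ (so $P_\rho$ is the place at infinity); with $x=1/\rho(t)$, $y=t/\rho(t)$ one has $\mathcal{A}=\mathbb{F}_q[x,y]$ with the single relation $y^2-(\zeta+\zeta^q)xy+\zeta^{q+1}x^2-x=0$. Put $I_\infty=(x,y)\subset\mathcal{A}$. The Hilbert class field of $\mathcal{A}$ is $H=\mathbb{F}_q(t,\zeta)$; put $T=1/(t-\zeta^q)$. The narrow class field is $H^+=H(\nu)$. The automorphism $\sigma$ of $H^+$ over $K$ is given by $\zeta\mapsto\zeta^q$, $\nu\mapsto\nu^\sigma=T^{1-q}\nu^q=-x/\nu$; it satisfies $\sigma^2=\mathrm{id}$, and $\nu^{\sigma^k}$ denotes $\sigma^k(\nu)$. For a field $L$ with an $\mathbb{F}_q$-homomorphism $\mathcal{A}\to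 L$ (here $L$ is an extension of $H^+$ with the inclusion map), $L\{\tau\}$ is the twisted polynomial ring with $\tau a=a^q\tau$. For $a\in\mathcal A$, $\deg a=\log_q|\mathcal{A}/(a)|$. A Drinfeld $\mathcal{A}$-module of rank $r$ over $L$ is an $\mathbb{F}_q$-algebra homomorphism $\phi:\mathcal{A}\to L\{\tau\}$, $a\mapsto\phi_a$ (with constant coefficient of $\phi_a$ the image of $a$ in $L$), with $\deg_\tau\phi_a=r\deg a$. A rank-two $\phi$ is normalized if the leading coefficient of $\phi_x$ is $1$; it is of $\zeta^q$-type (resp. $\zeta$-type) if (leading coefficient of $\phi_y$)/(leading coefficient of $\phi_x$) equals $\zeta^q$ (resp. $\zeta$). For an ideal $\mathfrak{n}$, $\phi[\mathfrak{n}]=\bigcap_{f\in\mathfrak{n}}\ker\phi_f$, an $\mathcal{A}$-module via $\phi$; a primitive $\mathfrak{n}$-torsion of $\phi$ is an $\mathcal{A}$-submodule of $\phi[\mathfrak{n}]$ isomorphic to $\mathcal{A}/\mathfrak{n}$. The ($\zeta^q$-type) normalized modular curve $\dot{\mathbf{x}}_0(\mathfrak{n})$ is the algebraic curve parametrizing pairs $(\phi,G)$ with $\phi$ a $\zeta^q$-type rank-two normalized Drinfeld $\mathcal{A}$-module and $G$ a primitive $\mathfrak{n}$-torsion of $\phi$. The covering $\dot{\mathbf{x}}_0(I_\infty^{k+1})\to\dot{\mathbf{x}}_0(I_\infty^{k})$ is $(\phi,G)\mapsto(\phi,I_\infty\cdot G)$, where $I_\infty\cdot G=\{\phi_z(\mu):\mu\in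 G,\ z\in I_\infty\}$. The $\zeta^q$-type normalized Drinfeld modules of rank two form the complete one-parameter family $\phi^{\lambda}$ (every $\zeta^q$-type rank-two normalized Drinfeld module over $\bar L$ is isomorphic to some $\phi^{\lambda_0}$): $$\phi^\lambda_x=\left(\tau^2+\tilde\alpha\tau+\tfrac{x}{\nu\lambda^{q-1}}\right)\left(\tau^2+\alpha\tau+\nu\lambda^{q-1}\right),\qquad \phi^\lambda_y=\zeta^q\left(\tau^2+\tilde\beta\tau+\tfrac{y}{\zeta^q\nu\lambda^{q-1}}\right)\left(\tau^2+\alpha\tau+\nu\lambda^{q-1}\right),$$ with, writing $T^\sigma=1/(t-\zeta)$, $$\tilde\alpha=-\frac{\nu\,(T^{\sigma})^{q}}{\zeta\,T^{q}T^{\sigma}\lambda^{q^2}}+\frac{\zeta^q\lambda}{\zeta-\zeta^q},\quad \tilde\beta=-\frac{\nu\,(T^{\sigma})^{q}}{\zeta\,T^{q}T^{\sigma}\lambda^{q^2}}+\frac{\zeta\lambda}{\zeta-\zeta^q},\quad \alpha=\frac{\lambda^{q^2}}{1-\zeta^{1-q}}+\frac{\nu}{\zeta T\lambda}.$$ "Represented" means that $\mathcal{F}_k$ is the function field of $\dot{\mathbf{x}}_0(I_\infty^k)$, with $\lambda_0$ being the parameter of $\phi^{\lambda_0}$, so that tuples $(\lambda_0,\dots,\lambda_k)$ correspond one-to-one to pairs consisting of $\phi^{\lambda_0}$ and a primitive $I_\infty^k$-torsion of $\phi^{\lambda_0}$. *)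

theory Defs
  imports
    "HOL-Algebra.Algebraic_Closure_Type"
    "HOL-Algebra.Finite_Extensions"
    "HOL-Algebra.Generated_Fields"
    "HOL-Algebra.Ideal_Product"
    "HOL-Algebra.QuotRing"
    Complex_Main
begin

text \<open>
  All fields live inside one algebraically closed field of characteristic \<open>p\<close>, the type \<open>'a\<close>,
  regarded as a ring with carrier by \<^const>\<open>ring_of_type_algebra\<close>. The field with \<open>q\<close> elements,
  where \<open>q\<close> is a power of \<open>p\<close>, is the set of roots of \<open>X^q - X\<close>.
\<close>

definition Fq :: "nat \<Rightarrow> 'a::field set" where
  "Fq q = {c. c ^ q = c}"

abbreviation gen_field :: "'a::field set \<Rightarrow> 'a set" where
  "gen_field S \<equiv> generate_field ring_of_type_algebra S"

abbreviation transcendental_over :: "'a::field set \<Rightarrow> 'a \<Rightarrow> bool" where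
  "transcendental_over \<equiv> ring.transcendental ring_of_type_algebra"

abbreviation ext_degree :: "nat \<Rightarrow> 'a::field set \<Rightarrow> 'a set \<Rightarrow> bool" where
  "ext_degree \<equiv> ring.dimension ring_of_type_algebra"

definition K_field :: "nat \<Rightarrow> 'a::field \<Rightarrow> 'a set" where
  "K_field q t = gen_field (Fq q \<union> {t})"

definition H_plus :: "nat \<Rightarrow> 'a::field \<Rightarrow> 'a \<Rightarrow> 'a \<Rightarrow> 'a set" where
  "H_plus q t \<zeta> \<nu> = gen_field (Fq q \<union> {t, \<zeta>, \<nu>})"

abbreviation H_plus_ring :: "nat \<Rightarrow> 'a::field \<Rightarrow> 'a \<Rightarrow> 'a \<Rightarrow> 'a ring" where
  "H_plus_ring q t \<zeta> \<nu> \<equiv> ring_of_type_algebra \<lparr> carrier := H_plus q t \<zeta> \<nu> \<rparr>"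


section \<open>The coefficient ring\<close>

definition rho :: "nat \<Rightarrow> 'a::field \<Rightarrow> 'a \<Rightarrow> 'a" where
  "rho q t \<zeta> = (t - \<zeta>) * (t - \<zeta> ^ q)"

definition x_elt :: "nat \<Rightarrow> 'a::field \<Rightarrow> 'a \<Rightarrow> 'a" where
  "x_elt q t \<zeta> = 1 / rho q t \<zeta>"

definition y_elt :: "nat \<Rightarrow> 'a::field \<Rightarrow> 'a \<Rightarrow> 'a" where
  "y_elt q t \<zeta> = t / rho q t \<zeta>"

text \<open>
  The elements of \<open>\<F>\<^sub>q(t)\<close> that are regular away from the place of \<open>\<rho>\<close>: regularity at the other
  finite places forces the denominator to be a power of \<open>\<rho>\<close>, and regularity at \<open>t = \<infinity>\<close>
  is the bound on the degree of the numerator.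
\<close>

definition A_carrier :: "nat \<Rightarrow> 'a::field \<Rightarrow> 'a \<Rightarrow> 'a set" where
  "A_carrier q t \<zeta> =
     {poly f t / rho q t \<zeta> ^ n | f n. (\<forall>i. poly.coeff f i \<in> Fq q) \<and> Polynomial.degree f \<le> 2 * n}"

definition A_ring :: "nat \<Rightarrow> 'a::field \<Rightarrow> 'a \<Rightarrow> 'a ring" where
  "A_ring q t \<zeta> = ring_of_type_algebra \<lparr> carrier := A_carrier q t \<zeta> \<rparr>"

definition I_inf :: "nat \<Rightarrow> 'a::field \<Rightarrow> 'a \<Rightarrow> 'a set" where
  "I_inf q t \<zeta> = genideal (A_ring q t \<zeta>) {x_elt q t \<zeta>, y_elt q t \<zeta>}"

definition I_inf_pow :: "nat \<Rightarrow> 'a::field \<Rightarrow> 'a \<Rightarrow> nat \<Rightarrow> 'a set" where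
  "I_inf_pow q t \<zeta> k = I_inf q t \<zeta> [^]\<^bsub>ideals_set (A_ring q t \<zeta>)\<^esub> k"

definition deg_A :: "nat \<Rightarrow> 'a::field \<Rightarrow> 'a \<Rightarrow> 'a \<Rightarrow> real" where
  "deg_A q t \<zeta> a =
     log (real q) (real (card (carrier (A_ring q t \<zeta> Quot cgenideal (A_ring q t \<zeta>) a))))"


section \<open>Twisted polynomials and Drinfeld modules\<close>

text \<open>
  A twisted polynomial \<open>\<Sum> a\<^sub>i \<tau>\<^sup>i\<close> is represented by the ordinary polynomial with coefficients
  \<open>a\<^sub>i\<close>. Addition, left multiplication by scalars, degree and leading coefficient are the ordinary
  ones; multiplication is twisted by \<open>\<tau> a = a\<^sup>q \<tau>\<close>.
\<close>

definition tw_mult :: "nat \<Rightarrow> 'a::field poly \<Rightarrow> 'a poly \<Rightarrow> 'a poly" where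
  "tw_mult q f g = (\<Sum>i\<le>Polynomial.degree f. \<Sum>j\<le>Polynomial.degree g.
     Polynomial.monom (poly.coeff f i * poly.coeff g j ^ (q ^ i)) (i + j))"

definition tw_ring :: "nat \<Rightarrow> 'a::field poly ring" where
  "tw_ring q = \<lparr> carrier = UNIV, monoid.mult = tw_mult q, one = 1, ring.zero = 0, add = (+) \<rparr>"

definition tw_app :: "nat \<Rightarrow> 'a::field poly \<Rightarrow> 'a \<Rightarrow> 'a" where
  "tw_app q f z = (\<Sum>i\<le>Polynomial.degree f. poly.coeff f i * z ^ (q ^ i))"

definition drinfeld_module ::
  "nat \<Rightarrow> 'a::field \<Rightarrow> 'a \<Rightarrow> nat \<Rightarrow> ('a \<Rightarrow> 'a poly) \<Rightarrow> bool" where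
  "drinfeld_module q t \<zeta> r \<phi> \<longleftrightarrow>
     \<phi> \<in> extensional (A_carrier q t \<zeta>) \<and>
     \<phi> \<in> ring_hom (A_ring q t \<zeta>) (tw_ring q) \<and>
     (\<forall>c\<in>Fq q. \<phi> c = [:c:]) \<and>
     (\<forall>a\<in>A_carrier q t \<zeta>. poly.coeff (\<phi> a) 0 = a) \<and>
     (\<forall>a\<in>A_carrier q t \<zeta> - {0}. real (Polynomial.degree (\<phi> a)) = real r * deg_A q t \<zeta> a)"

definition normalized :: "nat \<Rightarrow> 'a::field \<Rightarrow> 'a \<Rightarrow> ('a \<Rightarrow> 'a poly) \<Rightarrow> bool" where
  "normalized q t \<zeta> \<phi> \<longleftrightarrow> lead_coeff (\<phi> (x_elt q t \<zeta>)) = 1"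

definition zeta_q_type :: "nat \<Rightarrow> 'a::field \<Rightarrow> 'a \<Rightarrow> ('a \<Rightarrow> 'a poly) \<Rightarrow> bool" where
  "zeta_q_type q t \<zeta> \<phi> \<longleftrightarrow>
     lead_coeff (\<phi> (y_elt q t \<zeta>)) / lead_coeff (\<phi> (x_elt q t \<zeta>)) = \<zeta> ^ q"

definition torsion :: "nat \<Rightarrow> ('a::field \<Rightarrow> 'a poly) \<Rightarrow> 'a set \<Rightarrow> 'a set" where
  "torsion q \<phi> \<nn> = {z. \<forall>f\<in>\<nn>. tw_app q (\<phi> f) z = 0}"

definition primitive_torsion ::
  "nat \<Rightarrow> 'a::field \<Rightarrow> 'a \<Rightarrow> ('a \<Rightarrow> 'a poly) \<Rightarrow> 'a set \<Rightarrow> 'a set \<Rightarrow> bool" where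
  "primitive_torsion q t \<zeta> \<phi> \<nn> G \<longleftrightarrow>
     (let A = A_ring q t \<zeta>; Q = A Quot \<nn> in
      G \<subseteq> torsion q \<phi> \<nn> \<and> 0 \<in> G \<and> (\<forall>u\<in>G. \<forall>v\<in>G. u + v \<in> G) \<and>
      (\<forall>a\<in>carrier A. \<forall>u\<in>G. tw_app q (\<phi> a) u \<in> G) \<and>
      (\<exists>h. bij_betw h (carrier Q) G \<and>
         (\<forall>u\<in>carrier Q. \<forall>v\<in>carrier Q. h (u \<oplus>\<^bsub>Q\<^esub> v) = h u + h v) \<and>
         (\<forall>a\<in>carrier A. \<forall>u\<in>carrier Q.
            h ((\<nn> +>\<^bsub>A\<^esub> a) \<otimes>\<^bsub>Q\<^esub> u) = tw_app q (\<phi> a) (h u))))"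


section \<open>The normalized modular curve and its parametrization\<close>

definition x0_points ::
  "nat \<Rightarrow> 'a::field \<Rightarrow> 'a \<Rightarrow> 'a set \<Rightarrow> (('a \<Rightarrow> 'a poly) \<times> 'a set) set" where
  "x0_points q t \<zeta> \<nn> =
     {(\<phi>, G). drinfeld_module q t \<zeta> 2 \<phi> \<and> normalized q t \<zeta> \<phi> \<and> zeta_q_type q t \<zeta> \<phi> \<and>
        primitive_torsion q t \<zeta> \<phi> \<nn> G}"

definition pair_iso ::
  "nat \<Rightarrow> 'a::field \<Rightarrow> 'a \<Rightarrow> ('a \<Rightarrow> 'a poly) \<times> 'a set \<Rightarrow> ('a \<Rightarrow> 'a poly) \<times> 'a set \<Rightarrow> bool" where
  "pair_iso q t \<zeta> P P' \<longleftrightarrow>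
     (\<exists>c. c \<noteq> 0 \<and>
        (\<forall>a\<in>A_carrier q t \<zeta>. tw_mult q [:c:] (fst P a) = tw_mult q (fst P' a) [:c:]) \<and>
        snd P' = (\<lambda>z. c * z) ` snd P)"

definition covering ::
  "nat \<Rightarrow> 'a::field \<Rightarrow> 'a \<Rightarrow> ('a \<Rightarrow> 'a poly) \<times> 'a set \<Rightarrow> ('a \<Rightarrow> 'a poly) \<times> 'a set" where
  "covering q t \<zeta> P =
     (fst P, {tw_app q (fst P z) \<mu> | \<mu> z. \<mu> \<in> snd P \<and> z \<in> I_inf q t \<zeta>})"

definition T_elt :: "nat \<Rightarrow> 'a::field \<Rightarrow> 'a \<Rightarrow> 'a" where
  "T_elt q t \<zeta> = 1 / (t - \<zeta> ^ q)"

definition T_conj :: "'a::field \<Rightarrow> 'a \<Rightarrow> 'a" where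
  "T_conj t \<zeta> = 1 / (t - \<zeta>)"

definition alpha :: "nat \<Rightarrow> 'a::field \<Rightarrow> 'a \<Rightarrow> 'a \<Rightarrow> 'a \<Rightarrow> 'a" where
  "alpha q t \<zeta> \<nu> l =
     l ^ (q ^ 2) / (1 - \<zeta> powi (1 - int q)) + \<nu> / (\<zeta> * T_elt q t \<zeta> * l)"

definition alpha_tilde :: "nat \<Rightarrow> 'a::field \<Rightarrow> 'a \<Rightarrow> 'a \<Rightarrow> 'a \<Rightarrow> 'a" where
  "alpha_tilde q t \<zeta> \<nu> l =
     - (\<nu> * T_conj t \<zeta> ^ q / (\<zeta> * T_elt q t \<zeta> ^ q * T_conj t \<zeta> * l ^ (q ^ 2)))
     + \<zeta> ^ q * l / (\<zeta> - \<zeta> ^ q)"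

definition beta_tilde :: "nat \<Rightarrow> 'a::field \<Rightarrow> 'a \<Rightarrow> 'a \<Rightarrow> 'a \<Rightarrow> 'a" where
  "beta_tilde q t \<zeta> \<nu> l =
     - (\<nu> * T_conj t \<zeta> ^ q / (\<zeta> * T_elt q t \<zeta> ^ q * T_conj t \<zeta> * l ^ (q ^ 2)))
     + \<zeta> * l / (\<zeta> - \<zeta> ^ q)"

definition phi_x :: "nat \<Rightarrow> 'a::field \<Rightarrow> 'a \<Rightarrow> 'a \<Rightarrow> 'a \<Rightarrow> 'a poly" where
  "phi_x q t \<zeta> \<nu> l =
     tw_mult q [:x_elt q t \<zeta> / (\<nu> * l ^ (q - 1)), alpha_tilde q t \<zeta> \<nu> l, 1:]
               [:\<nu> * l ^ (q - 1), alpha q t \<zeta> \<nu> l, 1:]"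

definition phi_y :: "nat \<Rightarrow> 'a::field \<Rightarrow> 'a \<Rightarrow> 'a \<Rightarrow> 'a \<Rightarrow> 'a poly" where
  "phi_y q t \<zeta> \<nu> l = Polynomial.smult (\<zeta> ^ q)
     (tw_mult q [:y_elt q t \<zeta> / (\<zeta> ^ q * \<nu> * l ^ (q - 1)), beta_tilde q t \<zeta> \<nu> l, 1:]
                [:\<nu> * l ^ (q - 1), alpha q t \<zeta> \<nu> l, 1:])"

text \<open>
  \<open>\<phi> = \<phi>\<^sup>\<lambda>\<close>: as \<open>x\<close> and \<open>y\<close> generate the coefficient ring over \<open>\<F>\<^sub>q\<close>, a Drinfeld module is
  determined by its values there.
\<close>

definition is_phi :: "nat \<Rightarrow> 'a::field \<Rightarrow> 'a \<Rightarrow> 'a \<Rightarrow> 'a \<Rightarrow> ('a \<Rightarrow> 'a poly) \<Rightarrow> bool" where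
  "is_phi q t \<zeta> \<nu> l \<phi> \<longleftrightarrow>
     \<phi> (x_elt q t \<zeta>) = phi_x q t \<zeta> \<nu> l \<and> \<phi> (y_elt q t \<zeta>) = phi_y q t \<zeta> \<nu> l"

definition x0_family_points ::
  "nat \<Rightarrow> 'a::field \<Rightarrow> 'a \<Rightarrow> 'a \<Rightarrow> 'a set \<Rightarrow> (('a \<Rightarrow> 'a poly) \<times> 'a set) set" where
  "x0_family_points q t \<zeta> \<nu> \<nn> =
     {P \<in> x0_points q t \<zeta> \<nn>. \<exists>l. l \<noteq> 0 \<and> is_phi q t \<zeta> \<nu> l (fst P)}"

text \<open>
  The smallest extension of \<open>F\<close> over which \<open>(\<phi>, G)\<close> is defined. The finite group \<open>G\<close> is defined
  over a field iff the polynomial \<open>\<Prod>\<^sub>\<mu> (X - \<mu>)\<close>, \<open>\<mu> \<in> G\<close>, has its coefficients there. For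
  \<open>\<phi> = \<phi>\<^sup>\<lambda>\<close> with \<open>\<lambda>\<close> transcendental over \<open>F\<close>, the pair is a generic point of the curve and this field
  is the function field of the curve over \<open>F\<close>.
\<close>

definition field_of_definition ::
  "nat \<Rightarrow> 'a::field \<Rightarrow> 'a \<Rightarrow> 'a set \<Rightarrow> ('a \<Rightarrow> 'a poly) \<times> 'a set \<Rightarrow> 'a set" where
  "field_of_definition q t \<zeta> F P =
     gen_field (F \<union> {poly.coeff (fst P a) i | a i. a \<in> A_carrier q t \<zeta>}
                  \<union> range (poly.coeff (\<Prod>\<mu>\<in>snd P. [:- \<mu>, 1:])))"


section \<open>The tower\<close>

definition tower_eq1 :: "nat \<Rightarrow> 'a::field \<Rightarrow> 'a \<Rightarrow> 'a \<Rightarrow> 'a \<Rightarrow> 'a \<Rightarrow> bool" where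
  "tower_eq1 q t \<zeta> \<nu> l0 l1 \<longleftrightarrow>
     l1 ^ (q + 1) - l0 ^ q * l1 ^ q
       - (\<zeta> powi (1 - int q) - 1) / (\<zeta> * l0) * (t - \<zeta> ^ q) * \<nu> * l1
       + ((\<zeta> powi (- int q) - \<zeta> powi (-1)) * (t - \<zeta> ^ q) + (\<zeta> ^ (q - 1) - 1) ^ (q + 1))
         * \<nu> * l0 ^ (q - 1) = 0"

text \<open>
  In \<open>tower_eq\<close> the arguments \<open>l\<close>, \<open>l'\<close>, \<open>l''\<close> are \<open>\<lambda>\<^bsub>m-2\<^esub>\<close>, \<open>\<lambda>\<^bsub>m-1\<^esub>\<close>, \<open>\<lambda>\<^bsub>m\<^esub>\<close>. The denominators are
  required to be nonzero explicitly, because division by zero gives zero in HOL.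
\<close>

definition tower_eq ::
  "nat \<Rightarrow> 'a::field \<Rightarrow> 'a \<Rightarrow> ('a \<Rightarrow> 'a) \<Rightarrow> nat \<Rightarrow> 'a \<Rightarrow> 'a \<Rightarrow> 'a \<Rightarrow> bool" where
  "tower_eq q \<zeta> \<nu> \<sigma> m l l' l'' \<longleftrightarrow>
     l \<noteq> 0 \<and> l' - l ^ q \<noteq> 0 \<and>
     (\<Sum>i = 0..q - 1.
        ((\<sigma> ^^ m) \<nu> * (1 - \<zeta> powi (1 - int q)) ^ (q + 1) * l ^ (q - 1) / (l' - l ^ q)) ^ i
        * (l'' - l' ^ q) ^ (q - i))
     - (\<sigma> ^^ (m - 1)) \<nu> / (\<sigma> ^^ (m - 2)) \<nu> * ((l' - l ^ q) / l ^ (q - 1)) * l' ^ (q - 1) = 0"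

definition tower_points ::
  "nat \<Rightarrow> 'a::field \<Rightarrow> 'a \<Rightarrow> 'a \<Rightarrow> ('a \<Rightarrow> 'a) \<Rightarrow> nat \<Rightarrow> 'a list set" where
  "tower_points q t \<zeta> \<nu> \<sigma> k =
     {ls. length ls = Suc k \<and> ls ! 0 \<noteq> 0 \<and>
        (k \<ge> 1 \<longrightarrow> tower_eq1 q t \<zeta> \<nu> (ls ! 0) (ls ! 1)) \<and>
        (\<forall>m. 2 \<le> m \<and> m \<le> k \<longrightarrow> tower_eq q \<zeta> \<nu> \<sigma> m (ls ! (m - 2)) (ls ! (m - 1)) (ls ! m))}"

definition tower_field :: "nat \<Rightarrow> 'a::field \<Rightarrow> 'a \<Rightarrow> 'a \<Rightarrow> 'a list \<Rightarrow> 'a set" where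
  "tower_field q t \<zeta> \<nu> ls = gen_field (H_plus q t \<zeta> \<nu> \<union> set ls)"

end

theory Submission
  imports Defs
begin

text \<open>
  Write \<open>\<phi>\<^sup>\<lambda>\<^sub>x = R P\<close>, \<open>\<phi>\<^sup>\<lambda>\<^sub>y = \<zeta>\<^sup>q N P\<close> with the common right factor \<open>P = \<tau>\<^sup>2 + \<alpha> \<tau> + \<nu> \<lambda>\<^sup>q\<^sup>-\<^sup>1\<close>, so that
  \<open>\<phi>\<^sup>\<lambda>[I\<^sub>\<infinity>]\<close> is the kernel of \<open>P\<close>. A right factor \<open>\<tau> - u\<close> of \<open>P\<close> is an isogeny from \<open>\<phi>\<^sup>\<lambda>\<close> to the member
  with parameter \<open>\<lambda>' = \<lambda>\<^sup>q + (1 - \<zeta>\<^sup>q\<^sup>-\<^sup>1) u\<close> of the conjugate family, in which \<open>\<zeta>, \<nu>\<close> are replaced by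
  \<open>\<zeta>\<^sup>q, \<nu>\<^sup>\<sigma>\<close>; the condition on \<open>u\<close> becomes the equation between \<open>\<lambda>\<^sub>0\<close> and \<open>\<lambda>\<^sub>1\<close>. A primitive
  \<open>I\<^sub>\<infinity>\<^sup>k\<close>-torsion is the kernel of a chain of \<open>k\<close> such isogenies in which none is followed by its dual,
  and dividing the equation for \<open>(\<lambda>\<^sub>m\<^sub>-\<^sub>1, \<lambda>\<^sub>m)\<close> by the linear factor of the dual isogeny leaves the equation
  for \<open>\<lambda>\<^sub>m\<close> with \<open>m \<ge> 2\<close>. Conversely, right division by \<open>P\<close> shows that each \<open>u\<close>, and so each \<open>\<lambda>\<^sub>i\<close>, lies in
  the field of definition of the pair.

  For the degrees, choose a place with a zero of \<open>\<lambda>\<^sub>0\<close> and a pole of \<open>\<lambda>\<^sub>1\<close>. There every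
  \<open>\<lambda>\<^sub>m\<^sup>q \<lambda>\<^sub>m\<^sub>-\<^sub>1\<close> is a unit, so the ramification index of \<open>\<F>\<^sub>k\<close> over \<open>\<F>\<^sub>0\<close> is at least \<open>q\<^sup>k\<close>. Each step with
  \<open>m \<ge> 2\<close> has degree at most \<open>q\<close>, and the first one has degree \<open>q + 1\<close>: its equation has a root of
  degree at least \<open>q\<close>, by ramification, and no root in \<open>\<F>\<^sub>0\<close>; as \<open>(q + 1) (q - 1) < q\<^sup>2\<close>, no step can have smaller degree.
\<close>

section \<open>Twisted polynomials\<close>

text \<open>The values at \<open>xA\<close> and \<open>yA\<close> must commute and satisfy a
  quadratic relation. With \<open>U = \<phi> yA - \<zeta>^q \<phi> xA\<close> both conditions yield
  the single equation \<open>U U = EE U (\<phi> xA)\<close>, where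
  \<open>EE U = 1 + \<zeta> U - U \<zeta>^q\<close>; conversely it returns commutation when
  \<open>EE U\<close> is nonzero. For modules of \<open>\<zeta>^q\<close>-type the leading terms of
  \<open>U\<close> cancel, so \<open>U = N P\<close> with \<open>N\<close> of degree at most 1;
  cancelling \<open>P\<close> leaves \<open>N P N = EE (N P) R\<close>, five coefficient equations.
  They serve twice: solved, they show that the family is complete; verified, that it consists of
  Drinfeld modules. As \<open>EE U\<close> cancels, \<open>U\<close> determines the value at
  \<open>xA\<close>, so an isogeny needs to be matched on \<open>U\<close> only. The conjugate
  family satisfies the same hypotheses with \<open>\<zeta>^q\<close> and
  \<open>- xA / \<nu>\<close>; statements along the tower are therefore inductions in which these
  parameters are swapped at every step. Places are valuation rings of the ambient algebraically
  closed field. This makes q-th roots of the parameters available, which expose the dominant terms;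
  in place of a value group only the form "power of \<pi> times a unit" is used.\<close>

locale frobenius_field =
  fixes q :: nat and ty :: "'a::alg_closed_field itself"
  assumes prime_char: "prime CHAR('a)"
    and q_prime_power: "\<exists>e>0. q = CHAR('a) ^ e"
begin

abbreviation star :: "'a poly \<Rightarrow> 'a poly \<Rightarrow> 'a poly" (infixl \<open>\<star>\<close> 70) where
  "f \<star> g \<equiv> tw_mult q f g"

abbreviation app :: "'a poly \<Rightarrow> 'a \<Rightarrow> 'a" where
  "app \<equiv> tw_app q"

lemma q_ge_2: "q \<ge> 2"
proof -
  obtain e where e: "e > 0" "q = CHAR('a) ^ e" using q_prime_power by blast
  have "CHAR('a) \<ge> 2" using prime_char by (rule prime_ge_2_nat)
  also have "CHAR('a) \<le> CHAR('a) ^ e" using e(1) prime_char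
    by (metis One_nat_def Suc_leI power_increasing power_one_right prime_ge_1_nat)
  finally show ?thesis using e by simp
qed

lemma q_pos [simp]: "q > 0" "q \<noteq> 0" using q_ge_2 by auto

lemma pow_q_pow: "\<exists>e. q ^ i = CHAR('a) ^ e"
  using q_prime_power by (metis power_mult)

lemma frob_add: "(a + b :: 'a) ^ (q ^ i) = a ^ (q ^ i) + b ^ (q ^ i)"
  using pow_q_pow[of i] freshmans_dream'[OF prime_char] by blast

lemma frob_sum: "(\<Sum>x\<in>A. f x :: 'a) ^ (q ^ i) = (\<Sum>x\<in>A. f x ^ (q ^ i))"
  using pow_q_pow[of i] freshmans_dream_sum'[OF prime_char] by blast

lemma frob_minus: "(- a :: 'a) ^ (q ^ i) = - (a ^ (q ^ i))"
proof -
  have "(a + - a) ^ (q ^ i) = a ^ (q ^ i) + (- a) ^ (q ^ i)" by (rule frob_add)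
  moreover have "(a + - a) ^ (q ^ i) = 0" by simp
  ultimately show ?thesis by (metis minus_unique)
qed

lemma frob_diff: "(a - b :: 'a) ^ (q ^ i) = a ^ (q ^ i) - b ^ (q ^ i)"
  using frob_add[of a "- b" i] by (simp add: frob_minus)

lemmas frob_add1 = frob_add[where i = 1, simplified]
lemmas frob_diff1 = frob_diff[where i = 1, simplified]
lemmas frob_minus1 = frob_minus[where i = 1, simplified]
lemmas frob_sum1 = frob_sum[where i = 1, simplified]

lemma frob_inj: "(a :: 'a) ^ (q ^ i) = b ^ (q ^ i) \<longleftrightarrow> a = b"
proof
  assume "a ^ (q ^ i) = b ^ (q ^ i)"
  then have "(a - b) ^ (q ^ i) = 0" by (simp add: frob_diff)
  then show "a = b" by simp
qed simp

lemma frob_inj1: "(a :: 'a) ^ q = b ^ q \<longleftrightarrow> a = b"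
  using frob_inj[of a 1 b] by simp

lemma of_nat_q: "of_nat q = (0 :: 'a)"
proof -
  obtain e where "e > 0" "q = CHAR('a) ^ e" using q_prime_power by blast
  then have "CHAR('a) dvd q" by (metis dvd_power)
  then show ?thesis by (simp add: of_nat_eq_0_iff_char_dvd)
qed

lemma pow_q_minus_1: "(a :: 'a) ^ q = a * a ^ (q - 1)"
  using q_pos by (metis power_eq_if)

lemma pow_q_minus_1_div: "a \<noteq> 0 \<Longrightarrow> (a :: 'a) ^ (q - 1) = a ^ q / a"
  by (simp add: pow_q_minus_1)

subsection \<open>Evaluation and products\<close>

lemma tw_app_altdef: "Polynomial.degree f \<le> n \<Longrightarrow> app f z = (\<Sum>i\<le>n. poly.coeff f i * z ^ (q ^ i))"
  unfolding tw_app_def by (rule sum.mono_neutral_left) (auto simp: coeff_eq_0)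

lemma tw_app_poly_add [simp]: "app (f + g) z = app f z + app g z"
proof -
  let ?n = "max (Polynomial.degree f) (Polynomial.degree g)"
  have "Polynomial.degree (f + g) \<le> ?n" by (rule degree_add_le) auto
  then show ?thesis
    by (simp add: tw_app_altdef[of _ ?n] sum.distrib algebra_simps)
qed

lemma tw_app_smult [simp]: "app (Polynomial.smult c f) z = c * app f z"
  by (simp add: tw_app_altdef[OF degree_smult_le] tw_app_def sum_distrib_left algebra_simps)

lemma tw_app_poly_minus [simp]: "app (- f) z = - app f z"
  using tw_app_smult[of "-1" f z] by simp

lemma tw_app_poly_diff [simp]: "app (f - g) z = app f z - app g z"
  using tw_app_poly_add[of f "- g" z] by simp

lemma tw_app_poly_0 [simp]: "app 0 z = 0" by (simp add: tw_app_def)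

lemma tw_app_poly_sum: "app (\<Sum>i\<in>A. f i) z = (\<Sum>i\<in>A. app (f i) z)"
  by (induction A rule: infinite_finite_induct) auto

lemma tw_app_monom [simp]: "app (Polynomial.monom c n) z = c * z ^ (q ^ n)"
proof -
  have "app (Polynomial.monom c n) z = (\<Sum>i\<le>n. (if n = i then c else 0) * z ^ (q ^ i))"
    by (simp add: tw_app_altdef[OF degree_monom_le])
  also have "\<dots> = (\<Sum>i\<le>n. if i = n then c * z ^ (q ^ i) else 0)" by (rule sum.cong) auto
  finally show ?thesis by simp
qed

lemma tw_app_pCons [simp]: "app (pCons a f) z = a * z + app f (z ^ q)"
proof -
  have "app (pCons a f) z = (\<Sum>i\<le>Suc (Polynomial.degree f). poly.coeff (pCons a f) i * z ^ (q ^ i))"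
    by (rule tw_app_altdef) (simp add: degree_pCons_le)
  also have "\<dots> = a * z + (\<Sum>i\<le>Polynomial.degree f. poly.coeff f i * z ^ (q ^ Suc i))"
    by (subst sum.atMost_Suc_shift) simp
  finally show ?thesis by (simp add: tw_app_def power_mult)
qed

lemma tw_app_1 [simp]: "app 1 z = z"
  using tw_app_pCons[of 1 0 z] by (simp add: one_pCons)

lemma tw_app_add [simp]: "app f (z + w) = app f z + app f w"
  by (simp add: tw_app_def frob_add algebra_simps sum.distrib)

lemma tw_app_0 [simp]: "app f 0 = 0" by (simp add: tw_app_def power_0_left)

lemma tw_app_minus [simp]: "app f (- z) = - app f z"
  by (simp add: tw_app_def frob_minus sum_negf)

lemma tw_app_diff [simp]: "app f (z - w) = app f z - app f w"
  using tw_app_add[of f z "- w"] by simp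

lemma Fq_pow: "c \<in> Fq q \<Longrightarrow> (c :: 'a) ^ (q ^ i) = c"
  by (induction i) (simp_all add: Fq_def power_mult)

lemma tw_app_scale: "c \<in> Fq q \<Longrightarrow> app f (c * z) = c * app f z"
  by (simp add: tw_app_def power_mult_distrib Fq_pow sum_distrib_left algebra_simps)

lemma tw_app_mult [simp]: "app (f \<star> g) z = app f (app g z)"
proof -
  have "app (f \<star> g) z = (\<Sum>i\<le>Polynomial.degree f. \<Sum>j\<le>Polynomial.degree g.
      (poly.coeff f i * poly.coeff g j ^ (q ^ i)) * z ^ (q ^ (i + j)))"
    by (simp add: tw_mult_def tw_app_poly_sum)
  also have "\<dots> = (\<Sum>i\<le>Polynomial.degree f. poly.coeff f i *
      (\<Sum>j\<le>Polynomial.degree g. (poly.coeff g j * z ^ (q ^ j)) ^ (q ^ i)))"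
    by (simp add: sum_distrib_left power_mult_distrib mult.assoc power_add
        flip: power_mult, simp add: mult.commute)
  also have "\<dots> = app f (app g z)"
    by (simp add: tw_app_def frob_sum)
  finally show ?thesis .
qed

text \<open>The additive polynomial attached to \<open>f\<close>. It carries ordinary root counting
  and factorization over to kernels, and links a kernel to the product over its elements in
  \<open>field_of_definition\<close>.\<close>

definition lin :: "'a poly \<Rightarrow> 'a poly" where
  "lin f = (\<Sum>i\<le>Polynomial.degree f. Polynomial.monom (poly.coeff f i) (q ^ i))"

lemma poly_lin [simp]: "poly (lin f) z = app f z"
  by (simp add: lin_def tw_app_def poly_sum poly_monom)

lemma pow_q_inj: "q ^ i = q ^ j \<longleftrightarrow> i = j"
  using q_ge_2 by (simp add: power_inject_exp)

lemma coeff_lin_pow [simp]: "poly.coeff (lin f) (q ^ i) = poly.coeff f i"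
proof -
  have "poly.coeff (lin f) (q ^ i) = (\<Sum>j\<le>Polynomial.degree f. if j = i then poly.coeff f j else 0)"
    unfolding lin_def coeff_sum by (rule sum.cong) (auto simp: pow_q_inj)
  also have "\<dots> = poly.coeff f i" by (simp add: coeff_eq_0)
  finally show ?thesis .
qed

lemma coeff_lin_other: "n \<notin> range (\<lambda>i. q ^ i) \<Longrightarrow> poly.coeff (lin f) n = 0"
  unfolding lin_def coeff_sum by (rule sum.neutral) auto

lemma lin_0 [simp]: "lin 0 = 0" by (simp add: lin_def)

lemma lin_eq_0_iff [simp]: "lin f = 0 \<longleftrightarrow> f = 0"
  by (metis coeff_lin_pow lin_0 coeff_0 poly_eqI)

lemma degree_lin: "f \<noteq> 0 \<Longrightarrow> Polynomial.degree (lin f) = q ^ Polynomial.degree f"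
proof (rule antisym)
  show "Polynomial.degree (lin f) \<le> q ^ Polynomial.degree f"
    unfolding lin_def
    by (rule degree_sum_le) (auto intro!: order.trans[OF degree_monom_le] power_increasing
        simp: Suc_le_eq)
  assume "f \<noteq> 0"
  then show "q ^ Polynomial.degree f \<le> Polynomial.degree (lin f)"
    by (intro le_degree) simp
qed

lemma infinite_field: "infinite (UNIV :: 'a set)"
proof
  assume fin: "finite (UNIV :: 'a set)"
  \<comment> \<open>In a finite field this nonconstant polynomial would be identically 1, hence
    without a root.\<close>
  define p where "p = 1 + (\<Prod>x\<in>(UNIV :: 'a set). [:- x, 1:])"
  have "poly p x = 1" for x
    using fin by (auto simp: p_def poly_prod)
  moreover have "Polynomial.degree (\<Prod>x\<in>(UNIV :: 'a set). [:- x, 1:]) = card (UNIV :: 'a set)"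
    by (subst degree_prod_eq_sum_degree) auto
  then have "Polynomial.degree p > 0"
    using fin unfolding p_def by (subst degree_add_eq_right) (auto simp: card_gt_0_iff)
  then have "\<exists>x. poly p x = 0" by (rule alg_closed_imp_poly_has_root)
  ultimately show False by simp
qed

lemma tw_app_eq_0_imp: "(\<And>z. app f z = 0) \<Longrightarrow> f = 0"
proof -
  assume "\<And>z. app f z = 0"
  then have "{z. poly (lin f) z = 0} = UNIV" by simp
  then have "lin f = 0" using poly_roots_finite[of "lin f"] infinite_field by auto
  then show ?thesis by simp
qed

text \<open>A twisted polynomial is determined by the additive map it induces, since the field is
  infinite. Ring identities are from here on checked by evaluation; associativity, for instance,
  becomes composition of maps.\<close>

lemma tw_eqI: "(\<And>z. app f z = app g z) \<Longrightarrow> f = g"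
  using tw_app_eq_0_imp[of "f - g"] by simp

lemma star_assoc: "(f \<star> g) \<star> h = f \<star> (g \<star> h)" by (rule tw_eqI) simp
lemma star_add_left: "(f + g) \<star> h = f \<star> h + g \<star> h" by (rule tw_eqI) simp
lemma star_add_right: "f \<star> (g + h) = f \<star> g + f \<star> h" by (rule tw_eqI) simp
lemma star_diff_left: "(f - g) \<star> h = f \<star> h - g \<star> h" by (rule tw_eqI) simp
lemma star_diff_right: "f \<star> (g - h) = f \<star> g - f \<star> h" by (rule tw_eqI) simp
lemma star_1 [simp]: "1 \<star> f = f" "f \<star> 1 = f" by (rule tw_eqI, simp)+
lemma star_0 [simp]: "0 \<star> f = 0" "f \<star> 0 = 0" by (rule tw_eqI, simp)+
lemma star_smult: "Polynomial.smult c f \<star> g = Polynomial.smult c (f \<star> g)"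
  by (rule tw_eqI) simp
lemma star_const: "[:c:] \<star> f = Polynomial.smult c f" by (rule tw_eqI) simp

lemma coeff_star: "poly.coeff (f \<star> g) n = (\<Sum>i\<le>n. poly.coeff f i * poly.coeff g (n - i) ^ (q ^ i))"
proof -
  let ?df = "Polynomial.degree f" and ?dg = "Polynomial.degree g"
  have "poly.coeff (f \<star> g) n = (\<Sum>i\<le>?df. \<Sum>j\<le>?dg.
      if i + j = n then poly.coeff f i * poly.coeff g j ^ (q ^ i) else 0)"
    by (simp add: tw_mult_def coeff_sum)
  also have "\<dots> = (\<Sum>i\<le>?df. if i \<le> n then poly.coeff f i * poly.coeff g (n - i) ^ (q ^ i) else 0)"
  proof (rule sum.cong)
    fix i
    have "(\<Sum>j\<le>?dg. if i + j = n then poly.coeff f i * poly.coeff g j ^ (q ^ i) else 0)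
        = (\<Sum>j\<le>?dg. if j = n - i then (if i \<le> n then poly.coeff f i * poly.coeff g (n - i) ^ (q ^ i) else 0) else 0)"
      by (rule sum.cong) auto
    also have "\<dots> = (if i \<le> n then poly.coeff f i * poly.coeff g (n - i) ^ (q ^ i) else 0)"
      by (auto simp: coeff_eq_0)
    finally show "(\<Sum>j\<le>?dg. if i + j = n then poly.coeff f i * poly.coeff g j ^ (q ^ i) else 0)
      = (if i \<le> n then poly.coeff f i * poly.coeff g (n - i) ^ (q ^ i) else 0)" .
  qed simp
  also have "\<dots> = (\<Sum>i\<le>max ?df n. if i \<le> n then poly.coeff f i * poly.coeff g (n - i) ^ (q ^ i) else 0)"
    by (rule sum.mono_neutral_left) (auto simp: coeff_eq_0)
  also have "\<dots> = (\<Sum>i\<le>n. poly.coeff f i * poly.coeff g (n - i) ^ (q ^ i))"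
    by (rule sum.mono_neutral_cong_right) auto
  finally show ?thesis .
qed

lemma coeff_star_0 [simp]: "poly.coeff (f \<star> g) 0 = poly.coeff f 0 * poly.coeff g 0"
  by (simp add: coeff_star)

lemma degree_star_le: "Polynomial.degree (f \<star> g) \<le> Polynomial.degree f + Polynomial.degree g"
proof (rule degree_le, safe)
  fix n assume n: "Polynomial.degree f + Polynomial.degree g < n"
  show "poly.coeff (f \<star> g) n = 0"
    unfolding coeff_star
  proof (rule sum.neutral, safe)
    fix i assume "i \<le> n"
    with n have "Polynomial.degree f < i \<or> Polynomial.degree g < n - i" by linarith
    then show "poly.coeff f i * poly.coeff g (n - i) ^ (q ^ i) = 0"
      by (auto simp: coeff_eq_0)
  qed
qed

lemma coeff_star_degree: "poly.coeff (f \<star> g) (Polynomial.degree f + Polynomial.degree g)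
    = lead_coeff f * lead_coeff g ^ (q ^ Polynomial.degree f)"
proof -
  have "poly.coeff (f \<star> g) (Polynomial.degree f + Polynomial.degree g) =
    (\<Sum>i\<in>{Polynomial.degree f}. poly.coeff f i *
       poly.coeff g (Polynomial.degree f + Polynomial.degree g - i) ^ (q ^ i))"
    unfolding coeff_star
  proof (rule sum.mono_neutral_right, goal_cases)
    case 3
    show ?case
    proof
      fix i assume "i \<in> {..Polynomial.degree f + Polynomial.degree g} - {Polynomial.degree f}"
      then have "Polynomial.degree f < i \<or> Polynomial.degree g < Polynomial.degree f + Polynomial.degree g - i"
        by auto
      then show "poly.coeff f i * poly.coeff g (Polynomial.degree f + Polynomial.degree g - i) ^ (q ^ i) = 0"
        by (auto simp: coeff_eq_0)
    qed
  qed auto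
  then show ?thesis by simp
qed

lemma degree_star: "f \<noteq> 0 \<Longrightarrow> g \<noteq> 0 \<Longrightarrow>
    Polynomial.degree (f \<star> g) = Polynomial.degree f + Polynomial.degree g"
  by (intro antisym degree_star_le le_degree) (simp add: coeff_star_degree)

lemma lead_coeff_star: "lead_coeff (f \<star> g) = lead_coeff f * lead_coeff g ^ (q ^ Polynomial.degree f)"
proof (cases "f = 0 \<or> g = 0")
  case False
  then show ?thesis using coeff_star_degree[of f g] by (simp add: degree_star)
qed (auto simp: power_0_left)

lemma star_eq_0_iff [simp]: "f \<star> g = 0 \<longleftrightarrow> f = 0 \<or> g = 0"
proof
  assume "f \<star> g = 0"
  then have "lead_coeff (f \<star> g) = 0" by simp
  then show "f = 0 \<or> g = 0" by (simp add: lead_coeff_star)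
qed auto

lemma star_cancel_left: "f \<noteq> 0 \<Longrightarrow> f \<star> g = f \<star> h \<Longrightarrow> g = h"
  using star_eq_0_iff[of f "g - h"] by (simp add: star_diff_right)

lemma star_cancel_right: "h \<noteq> 0 \<Longrightarrow> f \<star> h = g \<star> h \<Longrightarrow> f = g"
  using star_eq_0_iff[of "f - g" h] by (simp add: star_diff_left)

subsection \<open>Separable polynomials\<close>

text \<open>A root of multiplicity at least two would also be a root of the derivative, so the
  multiset of roots is a set.\<close>

lemma separable_split:
  fixes f :: "'a poly"
  assumes "f \<noteq> 0" "\<And>a. poly f a = 0 \<Longrightarrow> poly (pderiv f) a \<noteq> 0"
  shows "f = Polynomial.smult (lead_coeff f) (\<Prod>a | poly f a = 0. [:- a, 1:])"
    and "card {a. poly f a = 0} = Polynomial.degree f"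
proof -
  obtain A where A: "size A = Polynomial.degree f"
      "f = Polynomial.smult (lead_coeff f) (\<Prod>x\<in>#A. [:- x, 1:])"
    using alg_closed_imp_factorization[OF assms(1)] by blast
  have roots: "set_mset A = {a. poly f a = 0}"
  proof -
    have "poly f a = 0 \<longleftrightarrow> a \<in># A" for a
      by (subst A(2)) (use assms(1) in \<open>auto simp: poly_prod_mset\<close>)
    then show ?thesis by auto
  qed
  have "count A a \<le> 1" for a
  proof (rule ccontr)
    assume "\<not> count A a \<le> 1"
    then have "2 \<le> count A a" by simp
    then have "replicate_mset 2 a \<subseteq># A" by (simp add: count_le_replicate_mset_subset_eq)
    then obtain B where B: "A = replicate_mset 2 a + B" by (metis subset_mset.add_diff_inverse)
    define h where "h = Polynomial.smult (lead_coeff f) (\<Prod>x\<in>#B. [:- x, 1:])"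
    have f: "f = [:- a, 1:] * ([:- a, 1:] * h)"
      by (subst A(2)) (simp add: B h_def eval_nat_numeral mult.assoc)
    have "poly (pderiv f) a = 0" "poly f a = 0"
      by (subst f, simp add: pderiv_mult pderiv_pCons del: mult_pCons_left)+
    then show False using assms(2) by blast
  qed
  then have "A = mset_set (set_mset A)"
    by (intro multiset_eqI) (metis count_mset_set(1) count_mset_set(3) finite_set_mset
      le_neq_implies_less less_one not_in_iff)
  then have A': "A = mset_set {a. poly f a = 0}" by (simp add: roots)
  show "f = Polynomial.smult (lead_coeff f) (\<Prod>a | poly f a = 0. [:- a, 1:])"
    using A(2) unfolding A' by (simp add: prod_unfold_prod_mset)
  show "card {a. poly f a = 0} = Polynomial.degree f"
    using A(1) unfolding A' by simp
qed

text \<open>The exponents \<open>q ^ i\<close> with \<open>i > 0\<close> vanish in the field. A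
  nonzero constant coefficient of \<open>f\<close> thus makes \<open>lin f\<close> separable, which
  gives kernels their exact size.\<close>

lemma pderiv_lin: "pderiv (lin f) = [:poly.coeff f 0:]"
proof (rule poly_eqI)
  fix n
  show "poly.coeff (pderiv (lin f)) n = poly.coeff [:poly.coeff f 0:] n"
  proof (cases n)
    case 0
    then show ?thesis using coeff_lin_pow[of f 0] by (simp add: coeff_pderiv)
  next
    case (Suc m)
    have "of_nat (Suc n) * poly.coeff (lin f) (Suc n) = 0"
    proof (cases "Suc n \<in> range (\<lambda>i. q ^ i)")
      case True
      then obtain i where i: "Suc n = q ^ i" by auto
      with Suc have "i \<noteq> 0" by (cases i) auto
      then have "of_nat (q ^ i) = (0 :: 'a)" using of_nat_q by simp
      then show ?thesis by (simp only: i mult_zero_left)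
    qed (simp add: coeff_lin_other)
    then show ?thesis by (simp add: coeff_pderiv Suc)
  qed
qed

lemma lin_split:
  assumes "poly.coeff f 0 \<noteq> 0"
  shows "lin f = Polynomial.smult (lead_coeff f) (\<Prod>a | app f a = 0. [:- a, 1:])"
    and "card {a. app f a = 0} = q ^ Polynomial.degree f"
proof -
  have f: "f \<noteq> 0" using assms by auto
  have "poly (pderiv (lin f)) a \<noteq> 0" for a using assms by (simp add: pderiv_lin)
  note * = separable_split[OF _ this]
  have "lead_coeff (lin f) = lead_coeff f" using f by (simp add: degree_lin)
  then show "lin f = Polynomial.smult (lead_coeff f) (\<Prod>a | app f a = 0. [:- a, 1:])"
    using *(1) f by simp
  show "card {a. app f a = 0} = q ^ Polynomial.degree f"
    using *(2) f by (simp add: degree_lin)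
qed

lemma finite_ker: "f \<noteq> 0 \<Longrightarrow> finite {a. app f a = 0}"
  using poly_roots_finite[of "lin f"] by simp

lemma card_ker_le: "f \<noteq> 0 \<Longrightarrow> card {a. app f a = 0} \<le> q ^ Polynomial.degree f"
  using card_poly_roots_bound[of "lin f"] by (simp add: degree_lin)

lemma tw_app_surj: "Polynomial.degree f > 0 \<or> f \<noteq> 0 \<Longrightarrow> \<exists>z. app f z = w"
proof -
  assume "Polynomial.degree f > 0 \<or> f \<noteq> 0"
  then have f: "f \<noteq> 0" by auto
  have "Polynomial.degree (lin f - [:w:]) > 0"
  proof -
    have "Polynomial.degree (lin f + [:- w:]) = Polynomial.degree (lin f)"
      using f by (intro degree_add_eq_left) (simp add: degree_lin)
    moreover have "lin f - [:w:] = lin f + [:- w:]" by simp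
    ultimately show ?thesis using f by (metis degree_lin q_pos(1) zero_less_power)
  qed
  then obtain z where "poly (lin f - [:w:]) z = 0" using alg_closed_imp_poly_has_root by blast
  then show ?thesis by auto
qed

subsection \<open>The finite field\<close>

lemma card_Fq: "card (Fq q :: 'a set) = q"
proof -
  have "card {a. app [:- 1, 1:] a = 0} = q ^ Polynomial.degree ([:- 1, 1:] :: 'a poly)"
    by (rule lin_split(2)) simp
  moreover have "{a. app [:- 1, 1:] a = 0} = (Fq q :: 'a set)" by (auto simp: Fq_def)
  ultimately show ?thesis by simp
qed

lemma finite_Fq: "finite (Fq q :: 'a set)"
  using card_Fq q_pos by (metis card.infinite)

lemma Fq_0 [simp, intro]: "(0::'a) \<in> Fq q" by (simp add: Fq_def)
lemma Fq_1 [simp, intro]: "(1::'a) \<in> Fq q" by (simp add: Fq_def)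
lemma Fq_add [intro]: "a \<in> Fq q \<Longrightarrow> b \<in> Fq q \<Longrightarrow> (a + b :: 'a) \<in> Fq q" by (simp add: Fq_def frob_add1)
lemma Fq_diff [intro]: "a \<in> Fq q \<Longrightarrow> b \<in> Fq q \<Longrightarrow> (a - b :: 'a) \<in> Fq q" by (simp add: Fq_def frob_diff1)
lemma Fq_minus [intro]: "a \<in> Fq q \<Longrightarrow> (- a :: 'a) \<in> Fq q" by (simp add: Fq_def frob_minus1)
lemma Fq_mult [intro]: "a \<in> Fq q \<Longrightarrow> b \<in> Fq q \<Longrightarrow> (a * b :: 'a) \<in> Fq q" by (simp add: Fq_def power_mult_distrib)
lemma Fq_sum [intro]: "(\<And>i. i \<in> A \<Longrightarrow> f i \<in> Fq q) \<Longrightarrow> (\<Sum>i\<in>A. f i :: 'a) \<in> Fq q"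
  by (induction A rule: infinite_finite_induct) auto

text \<open>The kernel of \<open>\<tau> - u\<close> is a line over \<open>Fq q\<close>: the quotient
  of two nonzero solutions is fixed by Frobenius.\<close>

lemma Fq_ratio:
  assumes "e ^ q = u * e" "z ^ q = u * z" "e \<noteq> (0::'a)"
  obtains c where "c \<in> Fq q" "z = c * e"
proof (cases "u = 0")
  case True
  then have "z = 0 * e" using assms by simp
  then show ?thesis using that by blast
next
  case False
  have "z / e \<in> Fq q" unfolding Fq_def using assms False by (simp add: power_divide)
  moreover have "z = z / e * e" using assms by simp
  ultimately show ?thesis using that by blast
qed

subsection \<open>Right division\<close>

text \<open>The divisor is monic and stands on the right, so neither inverses nor q-th roots of
  coefficients are taken. The set \<open>S\<close> is kept general in order to divide over the whole
  field and over a field of definition by the same induction.\<close>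

lemma right_division:
  fixes P :: "'a poly"
  assumes S0: "0 \<in> S" and Sadd: "\<And>a b. a \<in> S \<Longrightarrow> b \<in> S \<Longrightarrow> a + b \<in> S"
    and Smult: "\<And>a b. a \<in> S \<Longrightarrow> b \<in> S \<Longrightarrow> a * b \<in> S" and Sminus: "\<And>a. a \<in> S \<Longrightarrow> - a \<in> S"
    and P: "\<And>i. poly.coeff P i \<in> S" "lead_coeff P = 1" "Polynomial.degree P = Suc n"
    and f: "\<And>i. poly.coeff f i \<in> S"
  shows "\<exists>h r. f = h \<star> P + r \<and> Polynomial.degree r \<le> n \<and> (\<forall>i. poly.coeff h i \<in> S) \<and> (\<forall>i. poly.coeff r i \<in> S)"
  using f
proof (induction "Polynomial.degree f" arbitrary: f rule: less_induct)
  case less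
  have Spow: "a ^ Suc i \<in> S" if "a \<in> S" for a i by (induction i) (use that Smult in auto)
  have Spow': "a ^ (q ^ i) \<in> S" if "a \<in> S" for a i
    using Spow[OF that, of "q ^ i - 1"] by (simp del: power_Suc)
  have Ssum: "(\<Sum>i\<in>A. g i) \<in> S" if "\<And>i. g i \<in> S" for g :: "nat \<Rightarrow> 'a" and A
    by (induction A rule: infinite_finite_induct) (use that S0 Sadd in auto)
  show ?case
  proof (cases "Polynomial.degree f \<le> n")
    case True
    then show ?thesis using less.prems S0 by (intro exI[of _ 0] exI[of _ f]) auto
  next
    case False
    define m where "m = Polynomial.degree f - Suc n"
    define c where "c = lead_coeff f"
    define g where "g = f - Polynomial.monom c m \<star> P"
    have deg: "Polynomial.degree f = m + Suc n" using False by (simp add: m_def)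
    have c: "c \<noteq> 0" "c \<in> S" using False less.prems by (auto simp: c_def)
    have "P \<noteq> 0" using P(2) by auto
    then have degm: "Polynomial.degree (Polynomial.monom c m \<star> P) = m + Suc n"
      using c P(3) by (simp add: degree_star degree_monom_eq)
    have "poly.coeff (Polynomial.monom c m \<star> P) (m + Suc n) = c"
      using coeff_star_degree[of "Polynomial.monom c m" P] P c by (simp add: degree_monom_eq)
    then have "poly.coeff g (m + Suc n) = 0" by (simp add: g_def c_def deg)
    moreover have "Polynomial.degree g \<le> m + Suc n"
      unfolding g_def by (rule degree_diff_le) (simp_all add: deg degm)
    ultimately have less': "Polynomial.degree g < Polynomial.degree f"
      unfolding deg by (metis add_Suc_right le_neq_implies_less leading_coeff_0_iff
          degree_0 zero_less_Suc)
    have monomS: "poly.coeff (Polynomial.monom c m) i \<in> S" for i using c S0 by simp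
    have coeffS: "poly.coeff (Polynomial.monom c m \<star> P) i \<in> S" for i
      unfolding coeff_star by (rule Ssum) (intro Smult monomS Spow' P(1))
    have "poly.coeff g i \<in> S" for i
      using Sadd[OF less.prems[of i] Sminus[OF coeffS[of i]]] by (simp add: g_def)
    from less.hyps[OF less' this] obtain h r where hr: "g = h \<star> P + r" "Polynomial.degree r \<le> n"
      "\<forall>i. poly.coeff h i \<in> S" "\<forall>i. poly.coeff r i \<in> S" by blast
    have "f = (Polynomial.monom c m + h) \<star> P + r"
      using hr(1) by (simp add: g_def star_add_left algebra_simps)
    moreover have "poly.coeff (Polynomial.monom c m + h) i \<in> S" for i
      using Sadd[OF monomS[of i]] hr(3) by simp
    ultimately show ?thesis using hr by blast
  qed
qed

lemma right_division_UNIV: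
  fixes P :: "'a poly"
  assumes "lead_coeff P = 1" "Polynomial.degree P = Suc n"
  obtains h r where "f = h \<star> P + r" "Polynomial.degree r \<le> n"
  using right_division[of UNIV P n f] assms by auto

text \<open>The remainder has degree at most \<open>n\<close> but vanishes on the
  \<open>q ^ Suc n\<close> elements of the kernel of the separable \<open>P\<close>.\<close>

lemma right_factor:
  fixes P :: "'a poly"
  assumes "lead_coeff P = 1" "Polynomial.degree P = Suc n" "poly.coeff P 0 \<noteq> 0"
    and ker: "\<And>z. app P z = 0 \<Longrightarrow> app f z = 0"
  obtains h where "f = h \<star> P"
proof -
  obtain h r where hr: "f = h \<star> P + r" "Polynomial.degree r \<le> n"
    using right_division_UNIV[OF assms(1,2)] by blast
  have "r = 0"
  proof (rule ccontr)
    assume r: "r \<noteq> 0"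
    have "{z. app P z = 0} \<subseteq> {z. app r z = 0}" using ker by (auto simp: hr(1))
    then have "card {z. app P z = 0} \<le> card {z. app r z = 0}"
      by (rule card_mono[OF finite_ker[OF r]])
    also have "\<dots> \<le> q ^ Polynomial.degree r" by (rule card_ker_le[OF r])
    also have "\<dots> \<le> q ^ n" by (rule power_increasing[OF hr(2)]) (simp add: Suc_le_eq)
    also have "\<dots> < q ^ Suc n" using q_ge_2 by (intro power_strict_increasing) auto
    finally show False using lin_split(2)[OF assms(3)] assms(2) by simp
  qed
  then show ?thesis using that hr by simp
qed

end

section \<open>The coefficient ring\<close>

lemma ring_of_type_algebra_simps [simp]:
  "carrier (ring_of_type_algebra :: 'a::field ring) = UNIV"
  "monoid.mult (ring_of_type_algebra :: 'a ring) = (*)"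
  "ring.add (ring_of_type_algebra :: 'a ring) = (+)"
  "monoid.one (ring_of_type_algebra :: 'a ring) = 1"
  "ring.zero (ring_of_type_algebra :: 'a ring) = 0"
  by (simp_all add: ring_of_type_algebra_def)

interpretation univ: cring "ring_of_type_algebra :: 'a::field ring"
  by (rule cring_from_type_algebra)

lemma univ_a_inv [simp]: "\<ominus>\<^bsub>ring_of_type_algebra\<^esub> (a::'a::field) = - a"
  by (rule univ.minus_equality) auto

lemma univ_m_inv [simp]: "(a::'a::field) \<noteq> 0 \<Longrightarrow> inv\<^bsub>ring_of_type_algebra\<^esub> a = inverse a"
  by (rule univ.inv_char) auto

lemma univ_nat_pow [simp]: "(a::'a::field) [^]\<^bsub>ring_of_type_algebra\<^esub> (n::nat) = a ^ n"
  by (induction n) auto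

text \<open>Polynomials of \<open>HOL-Algebra\<close> are coefficient lists with the leading
  coefficient first, hence the reversal.\<close>

lemma eval_rev: "univ.eval (rev xs) (x::'a::field) = foldr (\<lambda>a s. a + x * s) xs 0"
proof (induction xs)
  case (Cons a xs)
  then show ?case by (simp add: univ.eval_append_aux mult.commute add.commute)
qed simp

lemma eval_rev_coeffs: "univ.eval (rev (coeffs f)) (x::'a::field) = poly f x"
  by (simp add: eval_rev poly_def horner_sum_foldr)

lemma transcendental_over_root:
  fixes x :: "'a::field"
  assumes "transcendental_over K x" "\<And>i. poly.coeff f i \<in> K" "poly f x = 0"
  shows "f = 0"
proof (rule ccontr)
  assume f: "f \<noteq> 0"
  have "hd (rev (coeffs f)) = last (coeffs f)" using f by (simp add: hd_rev)
  then have "hd (rev (coeffs f)) \<noteq> 0" using f by (simp add: last_coeffs_eq_coeff_degree)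
  moreover have "set (coeffs f) \<subseteq> K" using assms(2) by (auto simp: coeffs_def)
  ultimately have "rev (coeffs f) \<in> carrier (univ_poly ring_of_type_algebra K)"
    by (simp add: univ_poly_def polynomial_def f)
  then have "rev (coeffs f) = []"
    using univ.eval_transcendental[of K x "rev (coeffs f)"] assms(1,3)
    by (simp add: over_def eval_rev_coeffs)
  then show False using f by simp
qed

locale drinfeld_setup = frobenius_field q "TYPE('a::alg_closed_field)" for q :: nat +
  fixes t \<zeta> \<nu> :: "'a::alg_closed_field"
  assumes \<zeta>_Fq2: "\<zeta> \<in> Fq (q ^ 2)" and \<zeta>_notin: "\<zeta> \<notin> Fq q"
    and t_transc: "transcendental_over (Fq q) t"
    and \<nu>_eq: "\<nu> ^ (q + 1) = - 1 / ((t - \<zeta>) * (t ^ q - \<zeta>))"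
begin

abbreviation "\<rho> \<equiv> rho q t \<zeta>"
abbreviation "xA \<equiv> x_elt q t \<zeta>"
abbreviation "yA \<equiv> y_elt q t \<zeta>"
abbreviation "A \<equiv> A_carrier q t \<zeta>"
abbreviation "AR \<equiv> A_ring q t \<zeta>"
abbreviation "II \<equiv> I_inf q t \<zeta>"
abbreviation "Ik \<equiv> I_inf_pow q t \<zeta>"
definition "Fqp = {f. \<forall>i. poly.coeff f i \<in> (Fq q :: 'a set)}"
definition "tr = \<zeta> + \<zeta> ^ q"
definition "nm = \<zeta> * \<zeta> ^ q"
definition "rp = [:nm, - tr, 1:]"

lemma \<zeta>_qq: "(\<zeta> ^ q) ^ q = \<zeta>"
  using \<zeta>_Fq2 by (simp add: Fq_def power2_eq_square power_mult)

lemma \<zeta>_q_neq: "\<zeta> ^ q \<noteq> \<zeta>" using \<zeta>_notin by (simp add: Fq_def)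

lemma \<zeta>_nz [simp]: "\<zeta> \<noteq> 0" using \<zeta>_notin by auto

lemma tr_Fq: "tr \<in> Fq q" by (simp add: tr_def Fq_def frob_add1 \<zeta>_qq add.commute)
lemma nm_Fq: "nm \<in> Fq q" by (simp add: nm_def Fq_def power_mult_distrib \<zeta>_qq mult.commute)

lemma Fqp_0 [intro, simp]: "0 \<in> Fqp" by (simp add: Fqp_def)
lemma Fqp_add [intro]: "f \<in> Fqp \<Longrightarrow> g \<in> Fqp \<Longrightarrow> f + g \<in> Fqp" by (auto simp: Fqp_def)
lemma Fqp_diff [intro]: "f \<in> Fqp \<Longrightarrow> g \<in> Fqp \<Longrightarrow> f - g \<in> Fqp" by (auto simp: Fqp_def)
lemma Fqp_mult [intro]: "f \<in> Fqp \<Longrightarrow> g \<in> Fqp \<Longrightarrow> f * g \<in> Fqp"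
  by (auto simp: Fqp_def coeff_mult intro!: Fq_sum)
lemma Fqp_pCons [simp]: "pCons a f \<in> Fqp \<longleftrightarrow> a \<in> Fq q \<and> f \<in> Fqp"
  unfolding Fqp_def by (auto simp: coeff_pCons split: nat.splits)
lemma Fqp_1 [intro, simp]: "1 \<in> Fqp" by (simp add: one_pCons)
lemma Fqp_power [intro]: "f \<in> Fqp \<Longrightarrow> f ^ n \<in> Fqp" by (induction n) auto
lemma Fqp_monom [intro]: "c \<in> Fq q \<Longrightarrow> Polynomial.monom c n \<in> Fqp" by (simp add: Fqp_def)
lemma Fqp_rp [intro, simp]: "rp \<in> Fqp" using tr_Fq nm_Fq by (auto simp: rp_def)

lemma rp_nz [simp]: "rp \<noteq> 0" by (simp add: rp_def)
lemma degree_rp [simp]: "Polynomial.degree rp = 2" by (simp add: rp_def)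
lemma degree_rp_pow: "Polynomial.degree (rp ^ n) = 2 * n" by (simp add: degree_power_eq)
lemma poly_rp: "poly rp z = (z - \<zeta>) * (z - \<zeta> ^ q)"
  by (simp add: rp_def tr_def nm_def algebra_simps)
lemma poly_rp_t: "poly rp t = \<rho>" by (simp add: poly_rp rho_def)

lemma t_root: "f \<in> Fqp \<Longrightarrow> poly f t = 0 \<Longrightarrow> f = 0"
  using transcendental_over_root[OF t_transc] by (simp add: Fqp_def)

lemma t_root_eq: "f \<in> Fqp \<Longrightarrow> g \<in> Fqp \<Longrightarrow> poly f t = poly g t \<Longrightarrow> f = g"
  using t_root[of "f - g"] by auto

lemma t_pow_neq: "t ^ (q ^ Suc j) \<noteq> t"
proof
  assume *: "t ^ (q ^ Suc j) = t"
  have "Polynomial.monom 1 (q ^ Suc j) = [:0, 1 :: 'a:]"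
    by (rule t_root_eq) (use * in \<open>auto simp: poly_monom\<close>)
  then have "Polynomial.degree (Polynomial.monom (1::'a) (q ^ Suc j)) = Polynomial.degree [:0, 1 :: 'a:]"
    by simp
  then have "q ^ Suc j = 1" by (simp add: degree_monom_eq)
  then show False using q_ge_2 by simp
qed

lemma t_notin_Fq2: "t \<notin> Fq (q ^ 2)"
  using t_pow_neq[of 1] by (simp add: Fq_def power2_eq_square)

lemma \<zeta>q_Fq2: "\<zeta> ^ q \<in> Fq (q ^ 2)"
  by (simp add: Fq_def power2_eq_square power_mult \<zeta>_qq)

lemma t_neq [simp]: "t - \<zeta> \<noteq> 0" "t - \<zeta> ^ q \<noteq> 0" "t \<noteq> \<zeta>" "t \<noteq> \<zeta> ^ q"
  using t_notin_Fq2 \<zeta>_Fq2 \<zeta>q_Fq2 by auto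

lemma t_nz [simp]: "t \<noteq> 0" using t_pow_neq[of 0] by auto

lemma \<rho>_nz [simp]: "\<rho> \<noteq> 0" by (simp add: rho_def)

lemma X_nz [simp]: "xA \<noteq> 0" by (simp add: x_elt_def)
lemma Y_nz [simp]: "yA \<noteq> 0" by (simp add: y_elt_def)

lemma X_pow_neq: "xA ^ (q ^ Suc j) \<noteq> xA"
proof
  assume "xA ^ (q ^ Suc j) = xA"
  then have *: "\<rho> ^ (q ^ Suc j) = \<rho>" by (simp add: x_elt_def field_simps)
  have "rp ^ (q ^ Suc j) = rp"
    by (rule t_root_eq) (use * in \<open>auto simp: poly_rp_t\<close>)
  then have "2 * q ^ Suc j = 2" using degree_rp_pow[of "q ^ Suc j"] degree_rp by metis
  then show False using q_ge_2 by simp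
qed

subsection \<open>Order of vanishing at the place at infinity of t\<close>

text \<open>Elements of \<open>A\<close> vanishing to order at least \<open>k\<close> at
  \<open>t = \<infinity>\<close>, the zero of the ideal \<open>II\<close>: the order of
  \<open>xA\<close> is 2 and that of \<open>yA\<close> is 1. The sets \<open>J k\<close> contain the
  powers of \<open>II\<close> and thereby show that \<open>yA ^ k\<close> is not in the next
  power.\<close>

definition "J k = {poly f t / \<rho> ^ n | f n. f \<in> Fqp \<and> Polynomial.degree f + k \<le> 2 * n}"

lemma A_eq_J: "A = J 0" by (auto simp: A_carrier_def J_def Fqp_def)

lemma J_I: "f \<in> Fqp \<Longrightarrow> Polynomial.degree f + k \<le> 2 * n \<Longrightarrow> poly f t / \<rho> ^ n \<in> J k"
  by (auto simp: J_def)

lemma J_I': "a = poly f t / \<rho> ^ n \<Longrightarrow> f \<in> Fqp \<Longrightarrow> Polynomial.degree f + k \<le> 2 * n \<Longrightarrow> a \<in> J k"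
  by (auto simp: J_def)

lemma J_E:
  assumes "a \<in> J k"
  obtains f n where "a = poly f t / \<rho> ^ n" "f \<in> Fqp" "Polynomial.degree f + k \<le> 2 * n"
  using assms by (auto simp: J_def)

lemma J_add: assumes "a \<in> J k" "b \<in> J k" shows "a + b \<in> J k"
proof -
  from assms(1) obtain f n where a: "a = poly f t / \<rho> ^ n" "f \<in> Fqp" "Polynomial.degree f + k \<le> 2 * n"
    by (rule J_E)
  from assms(2) obtain g m where b: "b = poly g t / \<rho> ^ m" "g \<in> Fqp" "Polynomial.degree g + k \<le> 2 * m"
    by (rule J_E)
  have "a + b = poly (f * rp ^ m + g * rp ^ n) t / \<rho> ^ (n + m)"
    by (simp add: a b poly_rp_t field_simps power_add)
  moreover have "Polynomial.degree (f * rp ^ m + g * rp ^ n) \<le> 2 * (n + m) - k"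
    using degree_mult_le[of f "rp ^ m"] degree_mult_le[of g "rp ^ n"] a(3) b(3)
    by (intro degree_add_le) (auto simp: degree_rp_pow)
  ultimately show ?thesis using a b by (intro J_I'[of _ "f * rp ^ m + g * rp ^ n" "n + m"]) auto
qed

lemma J_mult: assumes "a \<in> J k" "b \<in> J l" shows "a * b \<in> J (k + l)"
proof -
  from assms(1) obtain f n where a: "a = poly f t / \<rho> ^ n" "f \<in> Fqp" "Polynomial.degree f + k \<le> 2 * n"
    by (rule J_E)
  from assms(2) obtain g m where b: "b = poly g t / \<rho> ^ m" "g \<in> Fqp" "Polynomial.degree g + l \<le> 2 * m"
    by (rule J_E)
  have "a * b = poly (f * g) t / \<rho> ^ (n + m)" by (simp add: a b power_add)
  then show ?thesis
    using a b degree_mult_le[of f g] by (intro J_I'[of _ "f * g" "n + m"]) auto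
qed

lemma J_0: "0 \<in> J k" using J_I[of 0 k k] by simp

lemma J_Fq: "c \<in> Fq q \<Longrightarrow> c \<in> J 0" using J_I[of "[:c:]" 0 0] by simp

lemma J_minus: "a \<in> J k \<Longrightarrow> - a \<in> J k"
  using J_mult[of "-1" 0 a k] J_Fq[of "-1"] by auto

lemma J_X: "xA \<in> J 2" using J_I[of 1 2 1] by (simp add: x_elt_def)
lemma J_Y: "yA \<in> J 1" using J_I[of "[:0,1:]" 1 1] by (simp add: y_elt_def)

lemma J_antimono: "l \<le> k \<Longrightarrow> J k \<subseteq> J l" by (fastforce simp: J_def)

lemma Y_pow_notin_J: "yA ^ k \<notin> J (Suc k)"
proof
  assume "yA ^ k \<in> J (Suc k)"
  then obtain f n where f: "yA ^ k = poly f t / \<rho> ^ n" "f \<in> Fqp" "Polynomial.degree f + Suc k \<le> 2 * n"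
    by (rule J_E)
  have "t ^ k * \<rho> ^ n = poly f t * \<rho> ^ k" using f(1) by (simp add: y_elt_def field_simps)
  then have "Polynomial.monom 1 k * rp ^ n = f * rp ^ k"
    using f(2) by (intro t_root_eq) (auto simp: poly_monom poly_rp_t)
  moreover from this have "f \<noteq> 0" by (metis degree_0 mult_zero_left mult_eq_0_iff monom_eq_0_iff
        rp_nz power_not_zero one_neq_zero)
  ultimately have "k + 2 * n = Polynomial.degree f + 2 * k"
    by (metis degree_monom_eq degree_mult_eq degree_rp_pow monom_eq_0_iff one_neq_zero power_not_zero rp_nz)
  then show False using f(3) by simp
qed

lemma A_add [intro]: "a \<in> A \<Longrightarrow> b \<in> A \<Longrightarrow> a + b \<in> A" unfolding A_eq_J by (rule J_add)
lemma A_mult [intro]: "a \<in> A \<Longrightarrow> b \<in> A \<Longrightarrow> a * b \<in> A" unfolding A_eq_J using J_mult[of a 0 b 0] by simp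
lemma A_minus [intro]: "a \<in> A \<Longrightarrow> - a \<in> A" unfolding A_eq_J by (rule J_minus)
lemma A_diff [intro]: "a \<in> A \<Longrightarrow> b \<in> A \<Longrightarrow> a - b \<in> A" using A_add[of a "- b"] by auto
lemma A_Fq [intro]: "c \<in> Fq q \<Longrightarrow> c \<in> A" unfolding A_eq_J by (rule J_Fq)
lemma A_0 [intro, simp]: "0 \<in> A" and A_1 [intro, simp]: "1 \<in> A" by auto
lemma A_X [intro, simp]: "xA \<in> A" using J_X J_antimono[of 0 2] by (auto simp: A_eq_J)
lemma A_Y [intro, simp]: "yA \<in> A" using J_Y J_antimono[of 0 1] by (auto simp: A_eq_J)
lemma A_pow [intro]: "a \<in> A \<Longrightarrow> a ^ n \<in> A" by (induction n) auto

lemma X_rel: "yA ^ 2 - tr * (xA * yA) + nm * xA ^ 2 = xA"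
  by (simp add: x_elt_def y_elt_def tr_def nm_def field_simps power2_eq_square) (simp add: rho_def algebra_simps)

text \<open>Generation of \<open>A\<close> by \<open>xA\<close> and \<open>yA\<close> over
  \<open>Fq q\<close>. Every monomial \<open>t ^ i / \<rho> ^ n\<close> with
  \<open>i \<le> 2 * n\<close> is a product of the three elements \<open>1 / \<rho>\<close>,
  \<open>t / \<rho>\<close>, \<open>t ^ 2 / \<rho>\<close>, and the last one is
  \<open>1 + tr * yA - nm * xA\<close>.\<close>

lemma A_induct [consumes 1, case_names const xA yA add mult]:
  assumes "a \<in> A" and const: "\<And>c. c \<in> Fq q \<Longrightarrow> P c" and xA: "P xA" and yA: "P yA"
    and add: "\<And>a b. a \<in> A \<Longrightarrow> b \<in> A \<Longrightarrow> P a \<Longrightarrow> P b \<Longrightarrow> P (a + b)"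
    and mult: "\<And>a b. a \<in> A \<Longrightarrow> b \<in> A \<Longrightarrow> P a \<Longrightarrow> P b \<Longrightarrow> P (a * b)"
  shows "P a"
proof -
  have z2: "t ^ 2 / \<rho> = 1 + (tr * yA + (- nm) * xA)"
    by (simp add: x_elt_def y_elt_def tr_def nm_def field_simps power2_eq_square) (simp add: rho_def algebra_simps)
  have Pz2: "P (t ^ 2 / \<rho>)"
    unfolding z2 using tr_Fq nm_Fq by (intro add mult const xA yA) auto
  have z2A: "t ^ 2 / \<rho> \<in> A" unfolding z2 using tr_Fq nm_Fq by auto
  have tA: "t ^ i / \<rho> ^ n \<in> A" if "i \<le> 2 * n" for i n
    using J_I[of "Polynomial.monom 1 i" 0 n] that by (auto simp: A_eq_J poly_monom degree_monom_eq)
  have Pt: "P (t ^ i / \<rho> ^ n)" if "i \<le> 2 * n" for i n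
    using that
  proof (induction n arbitrary: i)
    case 0
    then show ?case using const[of 1] by auto
  next
    case (Suc n)
    have "i \<le> 2 * n \<or> i = 2 * n + 1 \<or> i = 2 * n + 2" using Suc.prems by auto
    then consider "i \<le> 2 * n" | "i = 2 * n + 1" | "i = 2 * n + 2" by blast
    then show ?case
    proof cases
      case 1
      have "P (t ^ i / \<rho> ^ n * xA)" by (intro mult tA Suc.IH 1 xA) auto
      then show ?thesis by (simp add: x_elt_def mult.commute)
    next
      case 2
      have "P (t ^ (2 * n) / \<rho> ^ n * yA)" by (intro mult tA Suc.IH yA) auto
      then show ?thesis by (simp add: y_elt_def mult.commute 2)
    next
      case 3
      have "P (t ^ (2 * n) / \<rho> ^ n * (t ^ 2 / \<rho>))" by (intro mult tA Suc.IH Pz2 z2A) auto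
      then show ?thesis by (simp add: 3 power2_eq_square ac_simps)
    qed
  qed
  from assms(1) obtain f n where f: "a = poly f t / \<rho> ^ n" "f \<in> Fqp" "Polynomial.degree f \<le> 2 * n"
    unfolding A_eq_J by (auto elim: J_E)
  have a: "a = (\<Sum>i\<le>Polynomial.degree f. poly.coeff f i * (t ^ i / \<rho> ^ n))"
    by (simp add: f(1) poly_altdef sum_divide_distrib)
  have "(\<Sum>i\<in>B. poly.coeff f i * (t ^ i / \<rho> ^ n)) \<in> A \<and> P (\<Sum>i\<in>B. poly.coeff f i * (t ^ i / \<rho> ^ n))"
    if "finite B" "B \<subseteq> {..Polynomial.degree f}" for B
    using that
  proof (induction B rule: finite_induct)
    case empty
    then show ?case using const[of 0] by auto
  next
    case (insert i B)
    have "poly.coeff f i \<in> Fq q" using f(2) by (simp add: Fqp_def)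
    moreover have "t ^ i / \<rho> ^ n \<in> A" "P (t ^ i / \<rho> ^ n)" using insert f(3) tA Pt by auto
    ultimately have "poly.coeff f i * (t ^ i / \<rho> ^ n) \<in> A" "P (poly.coeff f i * (t ^ i / \<rho> ^ n))"
      using mult const by blast+
    moreover have "(\<Sum>i\<in>insert i B. poly.coeff f i * (t ^ i / \<rho> ^ n)) =
        poly.coeff f i * (t ^ i / \<rho> ^ n) + (\<Sum>i\<in>B. poly.coeff f i * (t ^ i / \<rho> ^ n))"
      using insert.hyps by (rule sum.insert)
    ultimately show ?case using insert add by (simp only:) auto
  qed
  then show ?thesis unfolding a by blast
qed

subsection \<open>Powers of the ideal\<close>

lemma AR_simps [simp]: "carrier AR = A" "monoid.mult AR = (*)" "ring.add AR = (+)" "monoid.one AR = 1" "ring.zero AR = 0"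
  by (simp_all add: A_ring_def)

lemma cring_AR: "cring AR"
proof (rule cringI)
  show "abelian_group AR"
    by (rule abelian_groupI) (auto simp: add.assoc add.commute intro!: bexI[of _ "- x" for x])
  show "comm_monoid AR"
    by (rule comm_monoidI) (auto simp: mult.assoc mult.commute)
qed (auto simp: algebra_simps)

sublocale AR: cring AR by (rule cring_AR)

lemma AR_a_inv [simp]: "a \<in> A \<Longrightarrow> \<ominus>\<^bsub>AR\<^esub> a = - a"
  by (rule AR.minus_equality) auto

lemma idealI_AR:
  assumes "K \<subseteq> A" "0 \<in> K" "\<And>a b. a \<in> K \<Longrightarrow> b \<in> K \<Longrightarrow> a + b \<in> K"
    "\<And>a b. a \<in> A \<Longrightarrow> b \<in> K \<Longrightarrow> a * b \<in> K"
  shows "ideal K AR"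
proof (rule idealI)
  show "ring AR" by (rule AR.ring_axioms)
  have "- b \<in> K" if "b \<in> K" for b using assms(4)[of "-1" b] that by auto
  then show "subgroup K (add_monoid AR)"
    using assms by (intro AR.add.subgroupI) (auto simp flip: a_inv_def)
  show "x \<otimes>\<^bsub>AR\<^esub> a \<in> K" "a \<otimes>\<^bsub>AR\<^esub> x \<in> K" if "a \<in> K" "x \<in> carrier AR" for a x
    using assms(4)[of x a] that by (simp_all add: mult.commute)
qed

lemma ideal_AR_props:
  assumes "ideal K AR"
  shows "K \<subseteq> A" "0 \<in> K" "a \<in> K \<Longrightarrow> b \<in> K \<Longrightarrow> a + b \<in> K"
    "a \<in> K \<Longrightarrow> - a \<in> K" "a \<in> A \<Longrightarrow> b \<in> K \<Longrightarrow> a * b \<in> K"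
proof -
  interpret K: ideal K AR by fact
  show "K \<subseteq> A" using K.a_subset by simp
  show "0 \<in> K" using K.zero_closed by simp
  show "a \<in> K \<Longrightarrow> b \<in> K \<Longrightarrow> a + b \<in> K" using K.a_closed by simp
  show "a \<in> A \<Longrightarrow> b \<in> K \<Longrightarrow> a * b \<in> K" using K.I_l_closed by simp
  show "a \<in> K \<Longrightarrow> - a \<in> K" using K.I_l_closed[of a "-1"] by auto
qed

lemma ideal_J: "ideal (J k) AR"
  by (rule idealI_AR) (use J_mult[of _ 0 _ k] J_antimono[of 0 k] in \<open>auto simp: J_0 J_add A_eq_J\<close>)

lemma ideal_I: "ideal II AR"
  unfolding I_inf_def by (rule AR.genideal_ideal) auto

lemma X_in_I: "xA \<in> II" and Y_in_I: "yA \<in> II"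
  using AR.genideal_self[of "{xA, yA}"] by (auto simp: I_inf_def)

lemma I_subset_J: "II \<subseteq> J 1"
  unfolding I_inf_def
  by (rule AR.genideal_minimal[OF ideal_J]) (use J_X J_Y J_antimono[of 1 2] in auto)

lemma Ik_0: "Ik 0 = A"
  by (simp add: I_inf_pow_def nat_pow_def ideals_set_def)

lemma Ik_Suc: "Ik (Suc k) = ideal_prod AR (Ik k) II"
  by (simp add: I_inf_pow_def nat_pow_def ideals_set_def)

lemma ideal_Ik: "ideal (Ik k) AR"
proof (induction k)
  case 0
  then show ?case using AR.oneideal by (simp add: Ik_0)
next
  case (Suc k)
  then show ?case unfolding Ik_Suc by (rule AR.ideal_prod_is_ideal[OF _ ideal_I])
qed

lemma Ik_Suc_subset: "Ik (Suc k) \<subseteq> Ik k"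
  unfolding Ik_Suc using AR.ideal_prod_inter[OF ideal_Ik ideal_I] by blast

lemma Ik_SucI: "a \<in> Ik k \<Longrightarrow> b \<in> II \<Longrightarrow> a * b \<in> Ik (Suc k)"
  unfolding Ik_Suc using ideal_prod.prod[of a "Ik k" b II AR] by simp

lemma Ik_Suc_induct [consumes 1, case_names prod add]:
  assumes "s \<in> Ik (Suc k)" "\<And>a b. a \<in> Ik k \<Longrightarrow> b \<in> II \<Longrightarrow> P (a * b)"
    "\<And>a b. a \<in> Ik (Suc k) \<Longrightarrow> b \<in> Ik (Suc k) \<Longrightarrow> P a \<Longrightarrow> P b \<Longrightarrow> P (a + b)"
  shows "P s"
  using assms(1) unfolding Ik_Suc
proof (induction rule: ideal_prod.induct)
  case (sum s1 s2)
  then show ?case using assms(3)[of s1 s2] by (simp add: Ik_Suc)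
qed (use assms(2) in simp)

lemma Ik_1: "Ik (Suc 0) = II"
proof
  show "Ik (Suc 0) \<subseteq> II"
    unfolding Ik_Suc using AR.ideal_prod_inter[OF ideal_Ik ideal_I] by blast
  show "II \<subseteq> Ik (Suc 0)" using Ik_SucI[of 1 0] by (auto simp: Ik_0)
qed

lemma Ik_subset_A: "Ik k \<subseteq> A" and I_subset_A: "II \<subseteq> A"
  using ideal_AR_props(1)[OF ideal_Ik] ideal_AR_props(1)[OF ideal_I] by auto

lemma Ik_subset_J: "Ik k \<subseteq> J k"
proof (induction k)
  case (Suc k)
  have "s \<in> J (Suc k)" if "s \<in> Ik (Suc k)" for s
    using that
  proof (induction rule: Ik_Suc_induct)
    case (prod a b)
    then show ?case using J_mult[of a k b 1] Suc I_subset_J by auto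
  qed (rule J_add)
  then show ?case by blast
qed (simp add: Ik_0 A_eq_J)

lemma Y_pow_in_Ik: "yA ^ k \<in> Ik k"
  by (induction k) (use Ik_SucI[OF _ Y_in_I] in \<open>auto simp: Ik_0 power_Suc2 simp del: power_Suc\<close>)

lemma Y_pow_notin_Ik: "yA ^ k \<notin> Ik (Suc k)"
  using Y_pow_notin_J Ik_subset_J by blast

lemma A_decomp: assumes "a \<in> A" obtains c b where "c \<in> Fq q" "b \<in> II" "a = c + b"
proof -
  note II = ideal_AR_props[OF ideal_I]
  have "\<exists>c\<in>Fq q. \<exists>b\<in>II. a = c + b"
    using assms
  proof (induction rule: A_induct)
    case (const c)
    then show ?case using II(2) by force
  next
    case (add a1 a2)
    then obtain c1 c2 b1 b2 where "c1 \<in> Fq q" "c2 \<in> Fq q" "b1 \<in> II" "b2 \<in> II" "a1 = c1 + b1" "a2 = c2 + b2"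
      by blast
    then show ?case using II(3) by (intro bexI[of _ "c1 + c2"] bexI[of _ "b1 + b2"]) auto
  next
    case (mult a1 a2)
    then obtain c1 c2 b1 b2 where *: "c1 \<in> Fq q" "c2 \<in> Fq q" "b1 \<in> II" "b2 \<in> II" "a1 = c1 + b1" "a2 = c2 + b2"
      by blast
    have "c1 * b2 + a2 * b1 \<in> II" using * mult by (intro II(3) II(5)) auto
    moreover have "a1 * a2 = c1 * c2 + (c1 * b2 + a2 * b1)" by (simp add: * algebra_simps)
    ultimately show ?case using * by blast
  qed (use X_in_I Y_in_I in \<open>force+\<close>)
  then show ?thesis using that by blast
qed

text \<open>The relation \<open>X_rel\<close> writes \<open>xA\<close> as a combination of products
  of two generators. Hence \<open>yA\<close> alone generates the ideal modulo its square.\<close>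

lemma X_in_I2: "xA \<in> Ik (Suc (Suc 0))"
proof -
  note II = ideal_AR_props[OF ideal_Ik[of "Suc (Suc 0)"]]
  have P: "a * b \<in> Ik (Suc (Suc 0))" if "a \<in> II" "b \<in> II" for a b
    using Ik_SucI[of a "Suc 0" b] that by (simp add: Ik_1)
  have "yA * yA + (- tr * (xA * yA) + nm * (xA * xA)) \<in> Ik (Suc (Suc 0))"
    using tr_Fq nm_Fq by (intro II(3) II(5) P X_in_I Y_in_I) auto
  moreover have "yA * yA + (- tr * (xA * yA) + nm * (xA * xA)) = yA ^ 2 - tr * (xA * yA) + nm * xA ^ 2"
    by (simp add: power2_eq_square algebra_simps)
  ultimately show ?thesis using X_rel by simp
qed

text \<open>The set of all \<open>c * yA + b\<close> is itself an ideal, because modulo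
  \<open>II\<close> every element of \<open>A\<close> is a constant; it contains both
  generators.\<close>

lemma I_decomp: assumes "a \<in> II" obtains c b where "c \<in> Fq q" "b \<in> Ik (Suc (Suc 0))" "a = c * yA + b"
proof -
  note K = ideal_AR_props[OF ideal_Ik[of "Suc (Suc 0)"]]
  define L where "L = {c * yA + b | c b. c \<in> Fq q \<and> b \<in> Ik (Suc (Suc 0))}"
  have LI: "c \<in> Fq q \<Longrightarrow> b \<in> Ik (Suc (Suc 0)) \<Longrightarrow> c * yA + b \<in> L" for c b by (auto simp: L_def)
  have "ideal L AR"
  proof (rule idealI_AR)
    show "L \<subseteq> A" using Ik_subset_A by (auto simp: L_def)
    show "0 \<in> L" using LI[of 0 0] K(2) by simp
    fix a b assume b: "b \<in> L"
    then obtain c2 b2 where 2: "c2 \<in> Fq q" "b2 \<in> Ik (Suc (Suc 0))" "b = c2 * yA + b2" by (auto simp: L_def)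
    {
      assume "a \<in> L"
      then obtain c1 b1 where "c1 \<in> Fq q" "b1 \<in> Ik (Suc (Suc 0))" "a = c1 * yA + b1" by (auto simp: L_def)
      then show "a + b \<in> L" using LI[of "c1 + c2" "b1 + b2"] K(3) 2 by (auto simp: algebra_simps)
    }
    assume a: "a \<in> A"
    then obtain c b1 where c: "c \<in> Fq q" "b1 \<in> II" "a = c + b1" by (rule A_decomp)
    have "b1 * yA \<in> Ik (Suc (Suc 0))" using Ik_SucI[of b1 "Suc 0" yA] c Y_in_I by (simp add: Ik_1)
    then have "c2 * (b1 * yA) + a * b2 \<in> Ik (Suc (Suc 0))" 
      using 2 a K(3)[OF K(5)[of c2 "b1 * yA"] K(5)[of a b2]] by auto
    then have "c * c2 * yA + (c2 * (b1 * yA) + a * b2) \<in> L" using 2 c by (intro LI) auto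
    then show "a * b \<in> L" by (simp add: 2 c algebra_simps)
  qed
  moreover have "{xA, yA} \<subseteq> L" using LI[of 0 xA] LI[of 1 0] X_in_I2 K(2) by auto
  ultimately have "II \<subseteq> L" unfolding I_inf_def by (rule AR.genideal_minimal)
  then show ?thesis using that assms by (auto simp: L_def)
qed

text \<open>Together with \<open>Y_pow_notin_Ik\<close> this makes every quotient of consecutive
  powers a line over \<open>Fq q\<close>, spanned by \<open>yA ^ k\<close>. It is the reason why the
  last layer of a cyclic torsion module is the kernel of a single \<open>\<tau> - u\<close>.\<close>

lemma Ik_decomp: assumes "a \<in> Ik k" obtains c b where "c \<in> Fq q" "b \<in> Ik (Suc k)" "a = c * yA ^ k + b"
proof -
  have "\<exists>c\<in>Fq q. \<exists>b\<in>Ik (Suc k). a = c * yA ^ k + b"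
    using assms
  proof (induction k arbitrary: a)
    case 0
    then have "a \<in> A" by (simp add: Ik_0)
    then obtain c b where "c \<in> Fq q" "b \<in> II" "a = c + b" by (rule A_decomp)
    then show ?case by (intro bexI[of _ c] bexI[of _ b]) (simp_all add: Ik_1)
  next
    case (Suc k)
    note K = ideal_AR_props[OF ideal_Ik[of "Suc (Suc k)"]]
    show ?case using Suc.prems
    proof (induction rule: Ik_Suc_induct)
      case (prod a1 a2)
      obtain c1 b1 where 1: "c1 \<in> Fq q" "b1 \<in> Ik (Suc k)" "a1 = c1 * yA ^ k + b1"
        using Suc.IH[OF prod(1)] by blast
      obtain c2 b2 where 2: "c2 \<in> Fq q" "b2 \<in> Ik (Suc (Suc 0))" "a2 = c2 * yA + b2"
        using I_decomp[OF prod(2)] by blast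
      have *: "yA ^ k * b2 \<in> Ik (Suc (Suc k))"
      proof -
        have "y * b \<in> Ik (Suc (Suc k))" if "b \<in> Ik (Suc (Suc 0))" "y \<in> Ik k" for b y
          using that(1)
        proof (induction rule: Ik_Suc_induct)
          case (prod a b)
          then have "y * a \<in> Ik (Suc k)" using Ik_SucI[OF that(2)] by (simp add: Ik_1)
          then show ?case using Ik_SucI[of "y * a"] prod by (simp add: mult.assoc)
        qed (simp add: distrib_left K(3))
        then show ?thesis using 2 Y_pow_in_Ik by blast
      qed
      have "c1 * (yA ^ k * b2) + b1 * a2 \<in> Ik (Suc (Suc k))"
        using * 1 2 prod K(3)[OF K(5)[of c1 "yA ^ k * b2"] Ik_SucI[of b1 "Suc k" a2]] by auto
      moreover have "a1 * a2 = (c1 * c2) * yA ^ Suc k + (c1 * (yA ^ k * b2) + b1 * a2)"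
        by (simp add: 1 2 algebra_simps)
      ultimately show ?case using 1 2 by blast
    next
      case (add a1 a2)
      then obtain c1 c2 b1 b2 where *: "c1 \<in> Fq q" "c2 \<in> Fq q" "b1 \<in> Ik (Suc (Suc k))" "b2 \<in> Ik (Suc (Suc k))"
        "a1 = c1 * yA ^ Suc k + b1" "a2 = c2 * yA ^ Suc k + b2" by blast
      then have "a1 + a2 = (c1 + c2) * yA ^ Suc k + (b1 + b2)" by (simp add: algebra_simps)
      then show ?case using * K(3) by blast
    qed
  qed
  then show ?thesis using that by blast
qed

end

context drinfeld_setup
begin

subsection \<open>Degrees in the coefficient ring\<close>

lemma poly_frob: "f \<in> Fqp \<Longrightarrow> poly f (z ^ q) = poly f z ^ q"
  by (simp add: poly_altdef frob_sum1 power_mult_distrib Fqp_def Fq_def mult.commute flip: power_mult)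

lemma rp_dvd:
  assumes "f \<in> Fqp" "poly f \<zeta> = 0"
  obtains g where "g \<in> Fqp" "f = rp * g"
proof -
  have "[:- \<zeta>, 1:] dvd f" using assms(2) by (simp add: poly_eq_0_iff_dvd)
  then obtain h where h: "f = [:- \<zeta>, 1:] * h" by (elim dvdE)
  have "poly f (\<zeta> ^ q) = 0" using assms by (simp add: poly_frob)
  then have "poly h (\<zeta> ^ q) = 0" using \<zeta>_q_neq by (simp add: h)
  then obtain g where g: "h = [:- (\<zeta> ^ q), 1:] * g" by (metis poly_eq_0_iff_dvd dvdE)
  have "[:- \<zeta>, 1:] * [:- (\<zeta> ^ q), 1:] = rp" by (simp add: rp_def tr_def nm_def)
  then have f: "f = rp * g" unfolding h g by (metis mult.assoc)
  \<comment> \<open>Comparison of coefficients in \<open>f = rp * g\<close>. As \<open>rp\<close> is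
    monic, the coefficients of \<open>g\<close> are determined from the top downwards, without
    division.\<close>
  have rec: "poly.coeff g i = poly.coeff f (i + 2) + tr * poly.coeff g (i + 1) - nm * poly.coeff g (i + 2)" for i
    unfolding f rp_def by (simp add: coeff_pCons numeral_2_eq_2 algebra_simps split: nat.splits)
  have "poly.coeff g i \<in> Fq q" for i
  proof (induction "Suc (Polynomial.degree g) - i" arbitrary: i rule: less_induct)
    case less
    show ?case
    proof (cases "i \<le> Polynomial.degree g")
      case True
      then have "poly.coeff g (i + 1) \<in> Fq q" "poly.coeff g (i + 2) \<in> Fq q"
        by (intro less; simp)+
      then show ?thesis
        using assms(1) tr_Fq nm_Fq by (subst rec) (auto simp: Fqp_def)
    qed (simp add: coeff_eq_0)
  qed
  then have "g \<in> Fqp" by (simp add: Fqp_def)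
  then show ?thesis using that f by blast
qed

text \<open>The elements 1 and \<zeta> form a basis of the quadratic extension; \<open>d\<close> is
  found by subtracting the expressions for \<open>w\<close> and \<open>w ^ q\<close>.\<close>

lemma Fq2_decomp:
  assumes "(w ^ q) ^ q = w"
  obtains c d where "c \<in> Fq q" "d \<in> Fq q" "w = c + d * \<zeta>" "w ^ q = c + d * \<zeta> ^ q"
proof -
  define d where "d = (w ^ q - w) / (\<zeta> ^ q - \<zeta>)"
  have nz: "\<zeta> ^ q - \<zeta> \<noteq> 0" using \<zeta>_q_neq by simp
  have "d ^ q = (w - w ^ q) / (\<zeta> - \<zeta> ^ q)"
    unfolding d_def by (simp add: power_divide frob_diff1 assms \<zeta>_qq)
  also have "\<dots> = d" unfolding d_def using minus_divide_divide[of "w ^ q - w" "\<zeta> ^ q - \<zeta>"] by simp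
  finally have dq: "d ^ q = d" .
  have d: "d * (\<zeta> ^ q - \<zeta>) = w ^ q - w" unfolding d_def using nz by simp
  have "d \<in> Fq q" using dq by (simp add: Fq_def)
  moreover have "w - d * \<zeta> \<in> Fq q"
    using dq d by (simp add: Fq_def frob_diff1 power_mult_distrib algebra_simps)
  moreover have "w ^ q = w - d * \<zeta> + d * \<zeta> ^ q" using d by (simp add: algebra_simps)
  ultimately show thesis by (intro that[of "w - d * \<zeta>" d]) simp_all
qed

definition "An n = {poly f t / \<rho> ^ n | f. f \<in> Fqp \<and> Polynomial.degree f \<le> 2 * n}"

text \<open>A reduced fraction: since \<zeta> is no root of the numerator, \<open>n\<close> is the
  exact pole order of \<open>a\<close> at the place of \<rho>, and the degree of \<open>a\<close>
  will be \<open>2 * n\<close>.\<close>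

definition "rep a n f \<longleftrightarrow> a = poly f t / \<rho> ^ n \<and> f \<in> Fqp \<and> Polynomial.degree f \<le> 2 * n \<and> poly f \<zeta> \<noteq> 0"

lemma An_subset: "An n \<subseteq> A" by (auto simp: An_def A_eq_J J_def)

lemma A_An: "a \<in> A \<Longrightarrow> \<exists>n. a \<in> An n" by (auto simp: An_def A_eq_J J_def)

lemma rep_exists: assumes "a \<in> A" "a \<noteq> 0" obtains n f where "rep a n f"
proof -
  have "\<exists>n f. rep a n f" if "a = poly f t / \<rho> ^ n" "f \<in> Fqp" "Polynomial.degree f \<le> 2 * n" for f n
    using that
  proof (induction n arbitrary: f)
    case 0
    then obtain c where c: "f = [:c:]" by (auto elim: degree_eq_zeroE)
    then have "rep a 0 f" using 0 assms(2) by (auto simp: rep_def)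
    then show ?case by blast
  next
    case (Suc n)
    show ?case
    proof (cases "poly f \<zeta> = 0")
      case True
      then obtain g where g: "g \<in> Fqp" "f = rp * g" using Suc.prems rp_dvd by blast
      then have "g \<noteq> 0" using Suc.prems assms(2) by auto
      then have "Polynomial.degree f = 2 + Polynomial.degree g" by (simp add: g degree_mult_eq)
      moreover have "a = poly g t / \<rho> ^ n" using Suc.prems by (simp add: g poly_rp_t)
      ultimately show ?thesis using Suc.IH[of g] Suc.prems g by auto
    next
      case False
      then have "rep a (Suc n) f" using Suc.prems by (simp add: rep_def)
      then show ?thesis by blast
    qed
  qed
  moreover obtain f n where "a = poly f t / \<rho> ^ n" "f \<in> Fqp" "Polynomial.degree f \<le> 2 * n"
    using assms(1) by (auto simp: A_eq_J elim: J_E)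
  ultimately show ?thesis using that by blast
qed

lemma rep_mult: "rep a n f \<Longrightarrow> rep b m g \<Longrightarrow> rep (a * b) (n + m) (f * g)"
  unfolding rep_def using degree_mult_le[of f g] by (auto simp: power_add)

lemma rep_An: assumes "rep a n f" "a \<in> An m" shows "n \<le> m"
proof (rule ccontr)
  assume "\<not> n \<le> m"
  then obtain k where k: "n = m + Suc k" by (metis add_Suc_right less_imp_Suc_add not_le)
  obtain g where g: "a = poly g t / \<rho> ^ m" "g \<in> Fqp" using assms(2) by (auto simp: An_def)
  have "poly f t = poly g t * \<rho> ^ Suc k"
    using assms(1) g by (simp add: rep_def k power_add field_simps)
  then have "f = g * rp ^ Suc k"
    using assms(1) g by (intro t_root_eq) (auto simp: rep_def poly_rp_t)
  then have "poly f \<zeta> = 0" by (simp add: poly_rp)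
  then show False using assms(1) by (simp add: rep_def)
qed

lemma card_Fqp_degree: "card {f \<in> Fqp. Polynomial.degree f \<le> m} = q ^ (m + 1)"
  and finite_Fqp_degree: "finite {f \<in> Fqp. Polynomial.degree f \<le> m}"
proof (induction m)
  case 0
  have "{f \<in> Fqp. Polynomial.degree f \<le> 0} = (\<lambda>c. [:c:]) ` Fq q"
    by (auto elim!: degree_eq_zeroE)
  moreover have "inj_on (\<lambda>c. [:c::'a:]) (Fq q)" by (rule inj_onI) simp
  ultimately show "card {f \<in> Fqp. Polynomial.degree f \<le> 0} = q ^ (0 + 1)"
    and "finite {f \<in> Fqp. Polynomial.degree f \<le> 0}"
    by (simp_all only: card_image card_Fq) (simp_all add: finite_Fq)
next
  case (Suc m)
  have eq: "{f \<in> Fqp. Polynomial.degree f \<le> Suc m} =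
      (\<lambda>(c, f). pCons c f) ` (Fq q \<times> {f \<in> Fqp. Polynomial.degree f \<le> m})"
  proof (intro equalityI subsetI)
    fix f :: "'a poly" assume f: "f \<in> {f \<in> Fqp. Polynomial.degree f \<le> Suc m}"
    obtain c g where fg: "f = pCons c g" by (cases f)
    have "(c, g) \<in> Fq q \<times> {f \<in> Fqp. Polynomial.degree f \<le> m}"
      using f unfolding fg by (auto simp: degree_pCons_eq_if split: if_splits)
    then show "f \<in> (\<lambda>(c, f). pCons c f) ` (Fq q \<times> {f \<in> Fqp. Polynomial.degree f \<le> m})"
      unfolding fg by force
  qed (auto simp: degree_pCons_eq_if)
  have inj: "inj_on (\<lambda>(c, f). pCons c f) (Fq q \<times> {f \<in> Fqp. Polynomial.degree f \<le> m})"
    by (rule inj_onI) auto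
  show "card {f \<in> Fqp. Polynomial.degree f \<le> Suc m} = q ^ (Suc m + 1)"
    unfolding eq card_image[OF inj] card_cartesian_product by (simp add: Suc.IH card_Fq)
  show "finite {f \<in> Fqp. Polynomial.degree f \<le> Suc m}"
    unfolding eq by (intro finite_imageI finite_cartesian_product Suc.IH finite_Fq)
qed

lemma card_An: "card (An n) = q ^ (2 * n + 1)" and finite_An: "finite (An n)"
proof -
  have An: "An n = (\<lambda>f. poly f t / \<rho> ^ n) ` {f \<in> Fqp. Polynomial.degree f \<le> 2 * n}"
    by (auto simp: An_def)
  have "inj_on (\<lambda>f. poly f t / \<rho> ^ n) {f \<in> Fqp. Polynomial.degree f \<le> 2 * n}"
    by (rule inj_onI) (use t_root_eq in auto)
  then show "card (An n) = q ^ (2 * n + 1)" unfolding An by (simp add: card_image card_Fqp_degree)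
  show "finite (An n)" unfolding An by (intro finite_imageI finite_Fqp_degree)
qed

lemma An_diff: assumes "a \<in> An n" "b \<in> An n" shows "a - b \<in> An n"
proof -
  obtain f g where fg: "a = poly f t / \<rho> ^ n" "f \<in> Fqp" "Polynomial.degree f \<le> 2 * n"
    "b = poly g t / \<rho> ^ n" "g \<in> Fqp" "Polynomial.degree g \<le> 2 * n"
    using assms by (auto simp: An_def)
  then have "a - b = poly (f - g) t / \<rho> ^ n" "f - g \<in> Fqp" "Polynomial.degree (f - g) \<le> 2 * n"
    by (auto simp: diff_divide_distrib intro: degree_diff_le)
  then show ?thesis unfolding An_def by blast
qed

lemma An_0: "An 0 = Fq q"
proof
  show "An 0 \<subseteq> Fq q" by (auto simp: An_def elim!: degree_eq_zeroE)
  show "Fq q \<subseteq> An 0" by (auto simp: An_def intro!: exI[of _ "[:_:]"])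
qed

lemma An_reduce:
  assumes "rep a n f" "b \<in> A"
  shows "\<exists>r\<in>An n. \<exists>s\<in>A. b = r + s * a"
proof -
  have "\<exists>r\<in>An n. \<exists>s\<in>A. b = r + s * a" if "b \<in> An (n + m)" for m b
    using that
  proof (induction m arbitrary: b)
    case 0
    then show ?case by (intro bexI[of _ b] bexI[of _ 0]) auto
  next
    case (Suc m)
    then obtain g where g: "b = poly g t / \<rho> ^ (n + Suc m)" "g \<in> Fqp" "Polynomial.degree g \<le> 2 * (n + Suc m)"
      by (auto simp: An_def)
    have f: "a = poly f t / \<rho> ^ n" "f \<in> Fqp" "Polynomial.degree f \<le> 2 * n" "poly f \<zeta> \<noteq> 0"
      using assms(1) by (auto simp: rep_def)
    \<comment> \<open>The residue field at \<rho> is \<open>Fq (q ^ 2)\<close>, so a linear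
      \<open>h\<close> over \<open>Fq q\<close> can take the value \<open>w\<close> at \<zeta>. Then
      \<open>rp\<close> divides \<open>g - f * h\<close>, and the pole order drops by one.\<close>
    define w where "w = poly g \<zeta> / poly f \<zeta>"
    have "(w ^ q) ^ q = w" using f(2) g(2) by (simp add: w_def power_divide \<zeta>_qq flip: poly_frob)
    then obtain c d where cd: "c \<in> Fq q" "d \<in> Fq q" "w = c + d * \<zeta>" by (rule Fq2_decomp)
    define h where "h = [:c, d:]"
    have h: "h \<in> Fqp" "Polynomial.degree h \<le> 1" using cd by (auto simp: h_def)
    have "poly (g - f * h) \<zeta> = 0"
      using cd(3) f(4) by (simp add: h_def w_def field_simps)
    then obtain k where k: "k \<in> Fqp" "g - f * h = rp * k"
      using rp_dvd[of "g - f * h"] f(2) g(2) h(1) by blast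
    have degk: "Polynomial.degree k \<le> 2 * (n + m)"
    proof (cases "k = 0")
      case False
      then have "2 + Polynomial.degree k = Polynomial.degree (g - f * h)"
        by (simp add: k degree_mult_eq)
      also have "\<dots> \<le> 2 * (n + Suc m)"
        using g(3) f(3) h(2) degree_mult_le[of f h] by (intro degree_diff_le) auto
      finally show ?thesis by simp
    qed simp
    define s where "s = poly h t / \<rho> ^ Suc m"
    have "s \<in> A" unfolding s_def A_eq_J using h by (intro J_I) auto
    have "poly g t - poly f t * poly h t = \<rho> * poly k t"
      using arg_cong[OF k(2), of "\<lambda>p. poly p t"] by (simp add: poly_rp_t)
    then have b: "b = poly k t / \<rho> ^ (n + m) + s * a"
      by (simp add: g(1) s_def f(1) power_add field_simps)
    have "poly k t / \<rho> ^ (n + m) \<in> An (n + m)" using k degk by (auto simp: An_def)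
    from Suc.IH[OF this] obtain r s' where "r \<in> An n" "s' \<in> A" "poly k t / \<rho> ^ (n + m) = r + s' * a" by blast
    then show ?case unfolding b using \<open>s \<in> A\<close>
      by (intro bexI[of _ r] bexI[of _ "s + s'"]) (auto simp: algebra_simps)
  qed
  moreover obtain m where m: "b \<in> An m" using A_An assms(2) by blast
  have "b \<in> An (n + m)"
  proof -
    obtain g where g: "b = poly g t / \<rho> ^ m" "g \<in> Fqp" "Polynomial.degree g \<le> 2 * m"
      using m by (auto simp: An_def)
    have "b = poly (g * rp ^ n) t / \<rho> ^ (n + m)" by (simp add: g(1) poly_rp_t power_add)
    moreover have "Polynomial.degree (g * rp ^ n) \<le> 2 * (n + m)"
      using degree_mult_le[of g "rp ^ n"] g(3) by (simp add: degree_rp_pow)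
    ultimately show ?thesis using g(2) unfolding An_def by blast
  qed
  ultimately show ?thesis by blast
qed

lemma cgenideal_AR: "a \<in> A \<Longrightarrow> cgenideal AR a = {s * a | s. s \<in> A}"
  by (simp add: cgenideal_def)

text \<open>By \<open>An_reduce\<close> every class meets \<open>An n\<close>, which has
  \<open>q ^ (2 * n + 1)\<close> elements. A class meets it in a translate of the line
  \<open>Fq q * a\<close>: pole orders add, so \<open>s * a\<close> has pole order at most
  \<open>n\<close> only for constant \<open>s\<close>. Dividing by \<open>q\<close> gives the
  count.\<close>

lemma card_quotient:
  assumes "rep a n f"
  shows "card (carrier (AR Quot cgenideal AR a)) = q ^ (2 * n)"
proof -
  have aA: "a \<in> A" using assms by (auto simp: rep_def A_eq_J intro!: J_I)
  have anz: "a \<noteq> 0" using assms t_root[of f] by (auto simp: rep_def)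
  define L where "L = cgenideal AR a"
  have L: "L = {s * a | s. s \<in> A}" by (simp add: L_def cgenideal_AR[OF aA])
  have idL: "ideal L AR" unfolding L_def by (rule AR.cgenideal_ideal) (simp add: aA)
  note Lp = ideal_AR_props[OF idL]
  define cls where "cls r = a_r_coset AR L r" for r
  have cls: "cls r = (\<lambda>h. h + r) ` L" for r by (auto simp: cls_def a_r_coset_def')
  have cls_eq: "cls r = cls r' \<longleftrightarrow> r - r' \<in> L" for r r'
  proof
    assume "cls r = cls r'"
    moreover have "r \<in> cls r" using Lp(2) by (force simp: cls)
    ultimately obtain h where "h \<in> L" "r = h + r'" by (auto simp: cls)
    then show "r - r' \<in> L" by simp
  next
    assume d: "r - r' \<in> L"
    have "h + r = (h + (r - r')) + r'" "h + r' = (h + - (r - r')) + r" for h by simp_all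
    then show "cls r = cls r'" unfolding cls
      using Lp(3)[OF _ d] Lp(3)[OF _ Lp(4)[OF d]] by (fastforce intro: image_eqI)
  qed
  have carrier: "carrier (AR Quot L) = cls ` A"
    by (auto simp: FactRing_def A_RCOSETS_def' cls_def)
  also have "cls ` A = cls ` An n"
  proof (intro equalityI subsetI)
    fix z assume "z \<in> cls ` A"
    then obtain b where b: "b \<in> A" "z = cls b" by auto
    from An_reduce[OF assms b(1)] obtain r s where rs: "r \<in> An n" "s \<in> A" "b = r + s * a" by blast
    then have "b - r \<in> L" by (auto simp: L)
    then show "z \<in> cls ` An n" using b rs(1) cls_eq by blast
  qed (use An_subset in auto)
  finally have carr: "carrier (AR Quot L) = cls ` An n" .
  have fibre: "card {r' \<in> An n. cls r' = cls r} = q" if r: "r \<in> An n" for r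
  proof -
    have "{r' \<in> An n. cls r' = cls r} = (\<lambda>c. r + c * a) ` Fq q"
    proof (intro equalityI subsetI)
      fix r' assume r': "r' \<in> {r' \<in> An n. cls r' = cls r}"
      then have "r' - r \<in> L" by (simp add: cls_eq)
      then obtain s where s: "s \<in> A" "r' - r = s * a" by (auto simp: L)
      have "s \<in> Fq q"
      proof (cases "s = 0")
        case False
        obtain m g where rep: "rep s m g" using rep_exists[OF s(1) False] by blast
        from rep_An[OF rep_mult[OF rep assms], of n] have "m = 0"
          using An_diff[of r' n r] r r' s by simp
        then have "s \<in> An 0" using rep by (auto simp: rep_def An_def)
        then show ?thesis by (simp add: An_0)
      qed auto
      then show "r' \<in> (\<lambda>c. r + c * a) ` Fq q" using s(2) by (intro image_eqI[of _ _ s]) (auto simp: algebra_simps)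
    next
      fix r' assume "r' \<in> (\<lambda>c. r + c * a) ` Fq q"
      then obtain c where c: "c \<in> Fq q" "r' = r + c * a" by auto
      obtain g where g: "r = poly g t / \<rho> ^ n" "g \<in> Fqp" "Polynomial.degree g \<le> 2 * n"
        using r by (auto simp: An_def)
      have "r' = poly (g + Polynomial.smult c f) t / \<rho> ^ n"
        using assms by (simp add: c g rep_def add_divide_distrib)
      moreover have "g + Polynomial.smult c f \<in> Fqp" using c g assms by (auto simp: Fqp_def rep_def)
      moreover have "Polynomial.degree (g + Polynomial.smult c f) \<le> 2 * n"
        using g(3) assms degree_smult_le[of c f] by (intro degree_add_le) (auto simp: rep_def)
      ultimately have "r' \<in> An n" unfolding An_def by blast
      moreover have "r' - r \<in> L" using c by (auto simp: L)
      ultimately show "r' \<in> {r' \<in> An n. cls r' = cls r}" by (simp add: cls_eq)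
    qed
    moreover have "inj_on (\<lambda>c. r + c * a) (Fq q)" using anz by (intro inj_onI) simp
    ultimately show ?thesis by (simp add: card_image card_Fq)
  qed
  have "q ^ (2 * n + 1) = (\<Sum>r\<in>An n. 1)" by (simp add: card_An)
  also have "\<dots> = (\<Sum>y\<in>cls ` An n. \<Sum>r\<in>{r \<in> An n. cls r = y}. 1)"
    by (rule sum.group[symmetric]) (auto simp: finite_An)
  also have "\<dots> = (\<Sum>y\<in>cls ` An n. q)" by (rule sum.cong) (auto simp: fibre)
  finally have "q * q ^ (2 * n) = q * card (cls ` An n)" by (simp add: mult.commute)
  then have "card (cls ` An n) = q ^ (2 * n)" by simp
  then show ?thesis using carr by (simp add: L_def)
qed

lemma deg_A_rep: "rep a n f \<Longrightarrow> deg_A q t \<zeta> a = 2 * n"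
  using q_ge_2 by (simp add: deg_A_def card_quotient log_nat_power)

lemma deg_A_X: "deg_A q t \<zeta> xA = 2"
  using deg_A_rep[of xA 1 1] by (simp add: rep_def x_elt_def)

lemma deg_A_Y: "deg_A q t \<zeta> yA = 2"
  using deg_A_rep[of yA 1 "[:0, 1:]"] by (simp add: rep_def y_elt_def)

subsection \<open>Drinfeld modules and centralizers\<close>

text \<open>The constant coefficient is injective on the centralizer of any twisted polynomial with constant
  coefficient \<open>xA\<close>, since no proper Frobenius power fixes \<open>xA\<close>. Hence a Drinfeld
  module is determined by its value at \<open>xA\<close>, and one exists as soon as the values at \<open>xA\<close> and
  \<open>yA\<close> commute.\<close>

lemma centralizer_zero:
  assumes S: "poly.coeff S 0 = xA" and f: "f \<star> S = S \<star> f" "poly.coeff f 0 = 0"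
  shows "f = 0"
proof -
  have "poly.coeff f j = 0" for j
  proof (induction j rule: less_induct)
    case (less j)
    show ?case
    proof (cases j)
      case 0
      then show ?thesis using f by simp
    next
      case (Suc m)
      have "poly.coeff (f \<star> S) j = (\<Sum>i\<in>{j}. poly.coeff f i * poly.coeff S (j - i) ^ (q ^ i))"
        unfolding coeff_star by (rule sum.mono_neutral_right) (use less in auto)
      also have "\<dots> = poly.coeff f j * xA ^ (q ^ j)" using S by simp
      finally have 1: "poly.coeff (f \<star> S) j = poly.coeff f j * xA ^ (q ^ j)" .
      have "poly.coeff (S \<star> f) j = (\<Sum>i\<in>{0}. poly.coeff S i * poly.coeff f (j - i) ^ (q ^ i))"
        unfolding coeff_star
        by (rule sum.mono_neutral_right) (use less f(2) in \<open>auto simp: Suc power_0_left\<close>)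
      then have "poly.coeff (S \<star> f) j = poly.coeff f j * xA" using S by simp
      then have "poly.coeff f j * xA ^ (q ^ j) = poly.coeff f j * xA" using 1 f(1) by metis
      then have "poly.coeff f j * (xA ^ (q ^ j) - xA) = 0"
        by (metis right_diff_distrib eq_iff_diff_eq_0)
      moreover have "xA ^ (q ^ j) \<noteq> xA" unfolding Suc by (rule X_pow_neq)
      ultimately show ?thesis by simp
    qed
  qed
  then show ?thesis by (intro poly_eqI) simp
qed

lemma centralizer_unique:
  assumes "poly.coeff S 0 = xA" "f \<star> S = S \<star> f" "g \<star> S = S \<star> g" "poly.coeff f 0 = poly.coeff g 0"
  shows "f = g"
  using centralizer_zero[of S "f - g"] assms by (simp add: star_diff_left star_diff_right)

definition phi_of :: "'a poly \<Rightarrow> 'a \<Rightarrow> 'a poly" where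
  "phi_of S = restrict (\<lambda>a. THE f. poly.coeff f 0 = a \<and> f \<star> S = S \<star> f) A"

lemma phi_of_eqI:
  assumes "poly.coeff S 0 = xA" "f \<star> S = S \<star> f" "poly.coeff f 0 = a" "a \<in> A"
  shows "phi_of S a = f"
  unfolding phi_of_def using assms centralizer_unique[OF assms(1)]
  by (auto intro!: the_equality)

lemma drinfeld_props:
  assumes "drinfeld_module q t \<zeta> r \<phi>"
  shows "a \<in> A \<Longrightarrow> b \<in> A \<Longrightarrow> \<phi> (a + b) = \<phi> a + \<phi> b"
    and "a \<in> A \<Longrightarrow> b \<in> A \<Longrightarrow> \<phi> (a * b) = \<phi> a \<star> \<phi> b"
    and "c \<in> Fq q \<Longrightarrow> \<phi> c = [:c:]"
    and "a \<in> A \<Longrightarrow> poly.coeff (\<phi> a) 0 = a"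
    and "\<phi> \<in> extensional A"
  using assms by (auto simp: drinfeld_module_def ring_hom_def tw_ring_def)

lemma drinfeld_commute:
  assumes "drinfeld_module q t \<zeta> r \<phi>" "a \<in> A" "b \<in> A"
  shows "\<phi> a \<star> \<phi> b = \<phi> b \<star> \<phi> a"
  using drinfeld_props(2)[OF assms(1)] assms(2,3) by (metis mult.commute)

lemma drinfeld_eq_phi_of:
  assumes "drinfeld_module q t \<zeta> r \<phi>"
  shows "\<phi> = phi_of (\<phi> xA)"
proof (rule extensionalityI[of _ A])
  fix a assume "a \<in> A"
  then show "\<phi> a = phi_of (\<phi> xA) a"
    using assms by (intro phi_of_eqI[symmetric] drinfeld_commute drinfeld_props) auto
qed (use drinfeld_props(5)[OF assms] in \<open>auto simp: phi_of_def\<close>)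

lemma drinfeld_degrees:
  assumes "drinfeld_module q t \<zeta> 2 \<phi>"
  shows "Polynomial.degree (\<phi> xA) = 4" "Polynomial.degree (\<phi> yA) = 4"
proof -
  have "real (Polynomial.degree (\<phi> a)) = 2 * deg_A q t \<zeta> a" if "a \<in> A" "a \<noteq> 0" for a
    using assms that by (simp add: drinfeld_module_def)
  from this[of xA] this[of yA] show "Polynomial.degree (\<phi> xA) = 4" "Polynomial.degree (\<phi> yA) = 4"
    by (simp_all add: deg_A_X deg_A_Y)
qed

context
  fixes S W :: "'a poly"
  assumes S0: "poly.coeff S 0 = xA" and W0: "poly.coeff W 0 = yA" and comm: "S \<star> W = W \<star> S"
begin

lemma phi_of_props:
  assumes "a \<in> A"
  shows "poly.coeff (phi_of S a) 0 = a" "phi_of S a \<star> S = S \<star> phi_of S a"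
proof -
  have "\<exists>f. poly.coeff f 0 = a \<and> f \<star> S = S \<star> f" using assms
  proof (induction rule: A_induct)
    case (const c)
    have "[:c:] \<star> S = S \<star> [:c:]"
      by (rule tw_eqI) (simp add: star_const tw_app_scale[OF const])
    then show ?case by (intro exI[of _ "[:c:]"]) simp
  next
    case xA then show ?case using S0 by blast
  next
    case yA then show ?case using W0 comm by metis
  next
    case (add a b)
    then obtain f g where "poly.coeff f 0 = a" "f \<star> S = S \<star> f" "poly.coeff g 0 = b" "g \<star> S = S \<star> g" by blast
    then show ?case by (intro exI[of _ "f + g"]) (simp add: star_add_left star_add_right)
  next
    case (mult a b)
    then obtain f g where "poly.coeff f 0 = a" "f \<star> S = S \<star> f" "poly.coeff g 0 = b" "g \<star> S = S \<star> g" by blast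
    then show ?case by (intro exI[of _ "f \<star> g"]) (metis coeff_star_0 star_assoc)
  qed
  then obtain f where f: "poly.coeff f 0 = a" "f \<star> S = S \<star> f" by blast
  have "phi_of S a = f" using f assms by (intro phi_of_eqI S0) auto
  then show "poly.coeff (phi_of S a) 0 = a" "phi_of S a \<star> S = S \<star> phi_of S a" using f by auto
qed

lemma phi_of_add: "a \<in> A \<Longrightarrow> b \<in> A \<Longrightarrow> phi_of S (a + b) = phi_of S a + phi_of S b"
  by (rule phi_of_eqI[OF S0]) (auto simp: phi_of_props star_add_left star_add_right)

lemma phi_of_mult: "a \<in> A \<Longrightarrow> b \<in> A \<Longrightarrow> phi_of S (a * b) = phi_of S a \<star> phi_of S b"
  by (rule phi_of_eqI[OF S0]) (auto simp: phi_of_props, metis phi_of_props(2) star_assoc)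

lemma phi_of_const: "c \<in> Fq q \<Longrightarrow> phi_of S c = [:c:]"
  by (rule phi_of_eqI[OF S0]) (auto intro!: tw_eqI simp: tw_app_scale)

lemma phi_of_X: "phi_of S xA = S" by (rule phi_of_eqI[OF S0]) (auto simp: S0)
lemma phi_of_Y: "phi_of S yA = W" by (rule phi_of_eqI[OF S0]) (auto simp: W0 comm)

context
  assumes S4: "Polynomial.degree S = 4" "lead_coeff S = 1"
    and W4: "Polynomial.degree W = 4" "lead_coeff W = \<zeta> ^ q"
begin

text \<open>Induction on the pole order: subtract \<open>(c * xA + d * yA) * xA ^ n\<close> with
  \<open>c + d * \<zeta>\<close> the value of \<open>f\<close> at \<zeta>. The leading coefficients
  1 and \<open>\<zeta> ^ q\<close> of \<open>S\<close> and \<open>W\<close> turn this term into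
  \<open>c + d * \<zeta> ^ q\<close>, the value of \<open>f\<close> at \<open>\<zeta> ^ q\<close>.
  For a reduced fraction it is nonzero, so the degree is exact.\<close>

lemma phi_of_degree:
  assumes "f \<in> Fqp" "Polynomial.degree f \<le> 2 * n"
  shows "Polynomial.degree (phi_of S (poly f t / \<rho> ^ n)) \<le> 4 * n \<and>
    poly.coeff (phi_of S (poly f t / \<rho> ^ n)) (4 * n) = poly f (\<zeta> ^ q)"
  using assms
proof (induction n arbitrary: f)
  case 0
  then obtain c where "f = [:c:]" by (auto elim: degree_eq_zeroE)
  then show ?case using 0 by (simp add: phi_of_const)
next
  case (Suc n)
  have "((poly f \<zeta>) ^ q) ^ q = poly f \<zeta>" using Suc.prems(1) by (simp add: \<zeta>_qq flip: poly_frob)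
  then obtain c d where cd: "c \<in> Fq q" "d \<in> Fq q" "poly f \<zeta> = c + d * \<zeta>"
      "poly f \<zeta> ^ q = c + d * \<zeta> ^ q" by (rule Fq2_decomp)
  have "poly (f - [:c, d:]) \<zeta> = 0" using cd by (simp add: mult.commute)
  then obtain g where g: "g \<in> Fqp" "f - [:c, d:] = rp * g"
    using rp_dvd[of "f - [:c, d:]"] cd(1,2) Suc.prems(1) by (metis Fqp_0 Fqp_diff Fqp_pCons)
  have degg: "Polynomial.degree g \<le> 2 * n"
  proof (cases "g = 0")
    case False
    then have "2 + Polynomial.degree g = Polynomial.degree (f - [:c, d:])" by (simp add: g degree_mult_eq)
    also have "\<dots> \<le> 2 * Suc n" using Suc.prems by (intro degree_diff_le) auto
    finally show ?thesis by simp
  qed simp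
  define b where "b = poly g t / \<rho> ^ n"
  have bA: "b \<in> A" unfolding b_def A_eq_J using g degg by (intro J_I) auto
  have "f = [:c, d:] + rp * g" using g(2) by (simp add: algebra_simps)
  then have "poly f t = c + d * t + \<rho> * poly g t" by (simp add: poly_rp_t mult.commute)
  then have a: "poly f t / \<rho> ^ Suc n = (c * xA + d * yA) * xA ^ n + b"
    by (simp add: b_def x_elt_def y_elt_def field_simps)
  define Z where "Z = phi_of S (xA ^ n)"
  have Z: "Polynomial.degree Z = 4 * n \<and> lead_coeff Z = 1 \<and> Z \<noteq> 0"
  proof -
    have "Polynomial.degree (phi_of S (xA ^ n)) = 4 * n \<and> lead_coeff (phi_of S (xA ^ n)) = 1" for n
    proof (induction n)
      case (Suc n)
      have "phi_of S (xA ^ Suc n) = S \<star> phi_of S (xA ^ n)"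
        by (simp add: phi_of_mult phi_of_X A_pow)
      moreover have "phi_of S (xA ^ n) \<noteq> 0" "S \<noteq> 0" using Suc S4 by auto
      moreover have "poly.coeff (phi_of S (xA ^ n)) (4 * n) = 1" using Suc by metis
      ultimately show ?case
        using Suc S4 coeff_star_degree[of S "phi_of S (xA ^ n)"] by (simp add: degree_star)
    qed (simp add: phi_of_const)
    from this[of n] show ?thesis by (auto simp: Z_def)
  qed
  have SW: "S \<noteq> 0" "W \<noteq> 0" using S4 W4 by auto
  have "phi_of S (poly f t / \<rho> ^ Suc n) = Polynomial.smult c (S \<star> Z) + Polynomial.smult d (W \<star> Z) + phi_of S b"
    unfolding a using cd bA
    by (simp add: phi_of_add phi_of_mult phi_of_const phi_of_X phi_of_Y A_pow A_Fq A_mult A_add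
        Z_def star_const star_add_left star_smult)
  moreover have "Polynomial.degree (Polynomial.smult c (S \<star> Z) + Polynomial.smult d (W \<star> Z) + phi_of S b) \<le> 4 * Suc n"
    using Suc.IH[OF g(1) degg] SW Z S4 W4 unfolding b_def
    by (intro degree_add_le order.trans[OF degree_smult_le]) (auto simp: degree_star)
  moreover have "poly.coeff Z (4 * n) = 1" using Z by metis
  then have "poly.coeff (S \<star> Z) (4 * Suc n) = 1" "poly.coeff (W \<star> Z) (4 * Suc n) = \<zeta> ^ q"
    using coeff_star_degree[of S Z] coeff_star_degree[of W Z] Z S4 W4 by simp_all
  moreover have "poly.coeff (phi_of S b) (4 * Suc n) = 0"
    using Suc.IH[OF g(1) degg] unfolding b_def by (intro coeff_eq_0) auto
  ultimately show ?case using cd(4) Suc.prems by (simp add: poly_frob)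
qed

lemma drinfeld_phi_of: "drinfeld_module q t \<zeta> 2 (phi_of S)"
  unfolding drinfeld_module_def
proof (intro conjI ballI)
  show "phi_of S \<in> extensional A" by (simp add: phi_of_def)
  show "phi_of S \<in> ring_hom AR (tw_ring q)"
    using phi_of_const[of 1] by (auto simp: ring_hom_def tw_ring_def phi_of_add phi_of_mult one_pCons)
  fix a assume a: "a \<in> A - {0}"
  then obtain n f where f: "rep a n f" using rep_exists by blast
  then have f': "a = poly f t / \<rho> ^ n" "f \<in> Fqp" "Polynomial.degree f \<le> 2 * n" "poly f \<zeta> \<noteq> 0"
    by (auto simp: rep_def)
  have "poly f (\<zeta> ^ q) \<noteq> 0" using f' by (simp add: poly_frob)
  then have "Polynomial.degree (phi_of S a) = 4 * n"
    using phi_of_degree[OF f'(2,3)] unfolding f'(1)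
    by (metis le_antisym le_degree)
  then show "real (Polynomial.degree (phi_of S a)) = real 2 * deg_A q t \<zeta> a"
    by (simp add: deg_A_rep[OF f])
qed (auto simp: phi_of_const phi_of_props)

lemma normalized_phi_of: "normalized q t \<zeta> (phi_of S)"
  using S4 by (simp add: normalized_def phi_of_X)

lemma zeta_q_type_phi_of: "zeta_q_type q t \<zeta> (phi_of S)"
  using S4 W4 by (simp add: zeta_q_type_def phi_of_X phi_of_Y)

end
end

end

section \<open>Multiplication of explicit twisted polynomials\<close>

context frobenius_field
begin

definition frob_poly :: "'a poly \<Rightarrow> 'a poly" where "frob_poly = map_poly (\<lambda>c. c ^ q)"

lemma frob_poly_pCons [simp]: "frob_poly (pCons a f) = pCons (a ^ q) (frob_poly f)"
  unfolding frob_poly_def by (rule map_poly_pCons) (simp add: power_0_left)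

lemma frob_poly_0 [simp]: "frob_poly 0 = 0" by (simp add: frob_poly_def)

lemma tw_app_frob_poly: "app (frob_poly f) (z ^ q) = app f z ^ q"
  by (induction f arbitrary: z) (simp_all add: power_0_left frob_add1 power_mult_distrib)

text \<open>From \<open>\<tau> g = (frob_poly g) \<tau>\<close>; as a rewrite rule it multiplies
  explicit coefficient lists.\<close>

lemma star_pCons: "pCons a f \<star> g = Polynomial.smult a g + pCons 0 (f \<star> frob_poly g)"
  by (rule tw_eqI) (simp add: tw_app_frob_poly)

lemma power_q2: "(a :: 'a) ^ (q ^ 2) = (a ^ q) ^ q" by (simp add: power2_eq_square power_mult)

lemma pow_q_minus_Suc_div: "a \<noteq> 0 \<Longrightarrow> (a :: 'a) ^ (q - Suc 0) = a ^ q / a"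
  using pow_q_minus_1_div by simp

end

context drinfeld_setup
begin

section \<open>The one-parameter family\<close>

abbreviation "T \<equiv> T_elt q t \<zeta>"
abbreviation "Ts \<equiv> T_conj t \<zeta>"

lemma T_nz [simp]: "T \<noteq> 0" and Ts_nz [simp]: "Ts \<noteq> 0" by (simp_all add: T_elt_def T_conj_def)

lemma \<zeta>_diff_nz [simp]: "\<zeta> - \<zeta> ^ q \<noteq> 0" "\<zeta> ^ q - \<zeta> \<noteq> 0" "\<zeta> \<noteq> \<zeta> ^ q" "\<zeta> ^ q \<noteq> \<zeta>"
  using \<zeta>_q_neq by auto

lemma X_T: "xA = T * Ts" by (simp add: x_elt_def rho_def T_elt_def T_conj_def)
lemma T_diff: "T - Ts = (\<zeta> ^ q - \<zeta>) * xA"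
  by (simp add: X_T T_elt_def T_conj_def field_simps)
lemma Y_Ts: "yA - \<zeta> ^ q * xA = Ts"
  by (simp add: x_elt_def y_elt_def flip: diff_divide_distrib) (simp add: rho_def T_conj_def)
lemma tq_diff: "(t - \<zeta> ^ q) ^ q = t ^ q - \<zeta>" "(t - \<zeta>) ^ q = t ^ q - \<zeta> ^ q"
  by (simp_all add: frob_diff1 \<zeta>_qq)
lemma tq_nz [simp]: "t ^ q - \<zeta> \<noteq> 0" "t ^ q - \<zeta> ^ q \<noteq> 0" "t ^ q \<noteq> \<zeta>" "t ^ q \<noteq> \<zeta> ^ q"
  using tq_diff t_neq by (metis power_not_zero, metis power_not_zero, metis eq_iff_diff_eq_0 power_not_zero,
      metis eq_iff_diff_eq_0 power_not_zero)

lemma Tq: "T ^ q = 1 / (t ^ q - \<zeta>)" "Ts ^ q = 1 / (t ^ q - \<zeta> ^ q)"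
  by (simp_all add: T_elt_def T_conj_def power_divide tq_diff)

lemma \<nu>_rel: "\<nu> * \<nu> ^ q = - (Ts * T ^ q)"
  using \<nu>_eq by (simp add: Tq T_conj_def)

lemma \<nu>_nz [simp]: "\<nu> \<noteq> 0" using \<nu>_rel by auto

lemma app_\<zeta>q: "app f (\<zeta> ^ q * v) = tr * app f v - app f (\<zeta> * v)"
proof -
  have "app f (\<zeta> ^ q * v) + app f (\<zeta> * v) = app f (tr * v)"
    by (simp only: tw_app_add[symmetric]) (simp add: tr_def algebra_simps)
  then show ?thesis by (simp only: tw_app_scale[OF tr_Fq] eq_diff_eq)
qed

lemma \<zeta>q_square: "\<zeta> ^ q * (\<zeta> ^ q * v) = tr * (\<zeta> ^ q * v) - nm * v"
  by (simp add: tr_def nm_def algebra_simps)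

lemma app_\<zeta>q2: "app f (\<zeta> ^ q * (\<zeta> ^ q * v)) = tr * app f (\<zeta> ^ q * v) - nm * app f v"
  unfolding \<zeta>q_square by (simp add: tw_app_scale[OF tr_Fq] tw_app_scale[OF nm_Fq])

text \<open>The left factor that appears when the quadratic relation of \<open>xA\<close> and
  \<open>yA\<close> is rewritten for \<open>U\<close>, the value at \<open>yA\<close> minus
  \<open>\<zeta> ^ q\<close> times the value at \<open>xA\<close>. It measures how far
  \<open>U\<close> is from commuting with scalars of the quadratic field.\<close>

definition EE :: "'a poly \<Rightarrow> 'a poly" where
  "EE U = 1 + Polynomial.smult \<zeta> U - U \<star> [:\<zeta> ^ q:]"

lemma app_EE: "app (EE U) v = v + \<zeta> * app U v - app U (\<zeta> ^ q * v)"
  by (simp add: EE_def)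

text \<open>\<open>EE U\<close> commutes with the scalar \<open>\<zeta> ^ q\<close>, a root of
  \<open>X^2 - tr X + nm\<close>, because \<open>tr\<close> and \<open>nm\<close> lie in
  \<open>Fq q\<close> and are central.\<close>

lemma app_EE_\<zeta>q: "app (EE U) (\<zeta> ^ q * v) = \<zeta> ^ q * app (EE U) v"
  by (simp add: app_EE app_\<zeta>q2) (simp add: tr_def nm_def algebra_simps)

text \<open>Multiply the commutator by \<open>EE U\<close> on the left: since \<open>EE U\<close>
  passes \<open>\<zeta> ^ q\<close>, every product \<open>EE U S\<close> can be replaced by
  \<open>U U\<close>, and all terms cancel. Then \<open>EE U\<close> itself is cancelled.\<close>

lemma pair_commute:
  assumes UU: "U \<star> U = EE U \<star> S" and E: "EE U \<noteq> 0"
  defines "W \<equiv> Polynomial.smult (\<zeta> ^ q) S + U"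
  shows "S \<star> W = W \<star> S"
proof -
  have h: "app U (app U v) = app (EE U) (app S v)" for v using UU by (metis tw_app_mult)
  have "app (EE U \<star> (S \<star> W - W \<star> S)) v = 0" for v
  proof -
    let ?s = "app S v"
    have "app U (app U (app U v)) = app U ?s + app U (\<zeta> * app U ?s) - app U (app U (\<zeta> ^ q * ?s))"
      unfolding h[of v] by (simp add: app_EE)
    moreover have "app U (\<zeta> ^ q * app U ?s) = tr * app U (app U ?s) - app U (\<zeta> * app U ?s)"
      by (rule app_\<zeta>q)
    moreover have "app (EE U) (\<zeta> ^ q * app S ?s) = \<zeta> ^ q * app U (app U ?s)"
      by (simp add: app_EE_\<zeta>q h)
    moreover have "app (EE U) (app U ?s) = app U ?s + \<zeta> * app U (app U ?s) - app U (\<zeta> ^ q * app U ?s)"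
      by (rule app_EE)
    ultimately show ?thesis
      by (simp add: W_def flip: h) (simp add: tr_def algebra_simps)
  qed
  then have "EE U \<star> (S \<star> W - W \<star> S) = 0" by (rule tw_app_eq_0_imp)
  then show ?thesis using E by simp
qed

lemma pair_square:
  assumes comm: "S \<star> W = W \<star> S"
    and rel: "W \<star> W - Polynomial.smult tr (S \<star> W) + Polynomial.smult nm (S \<star> S) = S"
  defines "U \<equiv> W - Polynomial.smult (\<zeta> ^ q) S"
  shows "U \<star> U = EE U \<star> S"
proof (rule tw_eqI)
  fix v
  have W: "app W w = \<zeta> ^ q * app S w + app U w" for w by (simp add: U_def)
  have c: "app S (app W w) = app W (app S w)" for w using comm by (metis tw_app_mult)
  have "app (W \<star> W - Polynomial.smult tr (S \<star> W) + Polynomial.smult nm (S \<star> S)) v = app S v"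
    unfolding rel ..
  then have "app W (app W v) - tr * app W (app S v) + nm * app S (app S v) = app S v"
    by (simp add: c)
  moreover have "app W (app W v) = \<zeta> ^ q * app W (app S v) + (app U (\<zeta> ^ q * app S v) + app U (app U v))"
    by (subst W) (simp add: c, simp add: W)
  ultimately show "app (U \<star> U) v = app (EE U \<star> S) v"
    by (simp add: app_EE) (simp add: W tr_def nm_def algebra_simps)
qed

lemma drinfeld_relation:
  assumes "drinfeld_module q t \<zeta> r \<phi>"
  shows "\<phi> yA \<star> \<phi> yA - Polynomial.smult tr (\<phi> xA \<star> \<phi> yA) + Polynomial.smult nm (\<phi> xA \<star> \<phi> xA) = \<phi> xA"
proof -
  note D = drinfeld_props[OF assms(1)]
  have "\<phi> (yA ^ 2 + - tr * (xA * yA) + nm * (xA * xA)) = \<phi> xA"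
    using X_rel by (simp add: power2_eq_square)
  moreover have "\<phi> (yA ^ 2 + - tr * (xA * yA) + nm * (xA * xA)) =
      \<phi> yA \<star> \<phi> yA + [:- tr:] \<star> (\<phi> xA \<star> \<phi> yA) + [:nm:] \<star> (\<phi> xA \<star> \<phi> xA)"
    using tr_Fq nm_Fq by (simp add: D A_add A_mult A_Fq A_minus Fq_minus power2_eq_square del: mult_minus_left)
  ultimately show ?thesis by (simp add: star_const)
qed

lemma drinfeld_square:
  assumes "drinfeld_module q t \<zeta> r \<phi>"
  defines "U \<equiv> \<phi> yA - Polynomial.smult (\<zeta> ^ q) (\<phi> xA)"
  shows "U \<star> U = EE U \<star> \<phi> xA"
  unfolding U_def
  by (rule pair_square[OF _ drinfeld_relation[OF assms(1)]]) (rule drinfeld_commute[OF assms(1)]; simp)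

subsection \<open>Consequences of the defining relation\<close>

text \<open>The constant coefficient of \<open>EE U\<close>, because that of \<open>U\<close> is
  \<open>Ts\<close>.\<close>

lemma e0: "1 + (\<zeta> - \<zeta> ^ q) * Ts = Ts / T"
  by (simp add: T_elt_def T_conj_def field_simps)

lemma star_N_P: "[:n0, n1:] \<star> [:\<delta>, \<alpha>, 1:] = [:n0 * \<delta>, n0 * \<alpha> + n1 * \<delta> ^ q, n0 + n1 * \<alpha> ^ q, n1:]"
  by (simp add: star_pCons)

text \<open>The odd coefficients vanish because an even power of Frobenius fixes \<zeta>. So
  \<open>EE U\<close> has degree at most 2, although \<open>U\<close> is cubic.\<close>

lemma EE_cubic: "EE [:u0, u1, u2, u3:] = [:1 + (\<zeta> - \<zeta> ^ q) * u0, 0, (\<zeta> - \<zeta> ^ q) * u2:]"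
  by (simp add: EE_def star_pCons \<zeta>_qq one_pCons algebra_simps)

lemma square_iff:
  "[:u0, u1, u2, u3:] \<star> [:n0, n1:] = EE [:u0, u1, u2, u3:] \<star> [:r0, r1, 1:] \<longleftrightarrow>
    u0 * n0 = (1 + (\<zeta> - \<zeta> ^ q) * u0) * r0 \<and>
    u0 * n1 + u1 * n0 ^ q = (1 + (\<zeta> - \<zeta> ^ q) * u0) * r1 \<and>
    u1 * n1 ^ q + u2 * (n0 ^ q) ^ q = (1 + (\<zeta> - \<zeta> ^ q) * u0) + (\<zeta> - \<zeta> ^ q) * u2 * (r0 ^ q) ^ q \<and>
    u2 * (n1 ^ q) ^ q + u3 * ((n0 ^ q) ^ q) ^ q = (\<zeta> - \<zeta> ^ q) * u2 * (r1 ^ q) ^ q \<and>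
    u3 * ((n1 ^ q) ^ q) ^ q = (\<zeta> - \<zeta> ^ q) * u2"
  unfolding EE_cubic by (simp add: star_pCons algebra_simps)

text \<open>Solves the coefficient equations with \<open>l\<close> as the only free parameter. The
  top one gives \<alpha>, the commutator of \<open>S\<close> and \<open>W\<close> gives
  \<open>r1\<close>, and eliminating \<open>u1\<close> from those of degree 1 and 2 leaves the
  condition on \<delta>, which fixes \<delta> up to a factor whose power \<open>q + 1\<close> is
  1.\<close>

lemma pair_shape:
  assumes d: "\<delta> \<noteq> 0" and r0: "r0 * \<delta> = xA" and n0: "n0 * \<delta> = Ts"
    and sq: "[:n0, n1:] \<star> [:\<delta>, \<alpha>, 1:] \<star> [:n0, n1:] = EE ([:n0, n1:] \<star> [:\<delta>, \<alpha>, 1:]) \<star> [:r0, r1, 1:]"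
    and comm: "S \<star> W = W \<star> S" and S: "S = [:r0, r1, 1:] \<star> [:\<delta>, \<alpha>, 1:]"
    and W: "W = Polynomial.smult (\<zeta> ^ q) S + [:n0, n1:] \<star> [:\<delta>, \<alpha>, 1:]"
  defines "l \<equiv> n1 / \<zeta> ^ q"
  shows "l \<noteq> 0" "n1 = \<zeta> ^ q * l"
    "\<alpha> ^ q = \<zeta> * ((l ^ q) ^ q) ^ q / (\<zeta> - \<zeta> ^ q) - n0 / n1"
    "r1 = \<zeta> ^ q * l / (\<zeta> - \<zeta> ^ q) + (n0 / n1) ^ q"
    "l * \<delta> * \<delta> ^ q = - (Ts * T ^ q * (l ^ q) ^ q)"
proof -
  define a where "a = \<zeta> - \<zeta> ^ q"
  have a: "a \<noteq> 0" by (simp add: a_def)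
  define u1 where "u1 = n0 * \<alpha> + n1 * \<delta> ^ q"
  define u2 where "u2 = n0 + n1 * \<alpha> ^ q"
  have "1 + a * (n0 * \<delta>) = Ts / T" unfolding n0 a_def by (rule e0)
  from sq[unfolded star_N_P square_iff, folded u1_def u2_def a_def, unfolded this, unfolded n0]
  have 1: "Ts * n1 + u1 * n0 ^ q = Ts / T * r1"
    and 2: "u1 * n1 ^ q + u2 * (n0 ^ q) ^ q = Ts / T + a * u2 * (r0 ^ q) ^ q"
    and 4: "n1 * ((n1 ^ q) ^ q) ^ q = a * u2" by auto
  have n0nz: "n0 \<noteq> 0" using n0 by auto
  have n1: "n1 \<noteq> 0"
  proof
    assume "n1 = 0"
    then have "a * n0 = 0" using 4 by (simp add: u2_def power_0_left)
    then show False using a n0nz by simp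
  qed
  then show l: "l \<noteq> 0" by (simp add: l_def)
  show n1l: "n1 = \<zeta> ^ q * l" by (simp add: l_def)
  let ?l3 = "((l ^ q) ^ q) ^ q"
  have n1q: "n1 ^ q = \<zeta> * l ^ q" "(n1 ^ q) ^ q = \<zeta> ^ q * (l ^ q) ^ q" "((n1 ^ q) ^ q) ^ q = \<zeta> * ?l3"
    "(((n1 ^ q) ^ q) ^ q) ^ q = \<zeta> ^ q * ?l3 ^ q"
    by (simp_all add: n1l power_mult_distrib \<zeta>_qq)
  have u2: "u2 = n1 * (\<zeta> * ?l3) / a" using 4 a unfolding n1q(3) by (simp add: field_simps)
  show al: "\<alpha> ^ q = \<zeta> * ?l3 / (\<zeta> - \<zeta> ^ q) - n0 / n1"
    using u2 n1 a by (simp add: u2_def flip: a_def) (simp add: field_simps)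
  have alq: "(\<alpha> ^ q) ^ q = - (\<zeta> ^ q * ?l3 ^ q / (\<zeta> - \<zeta> ^ q)) - (n0 / n1) ^ q"
    unfolding al by (simp add: frob_diff1 power_divide power_mult_distrib \<zeta>_qq
        minus_divide_right del: minus_divide_left)
  have "r1 * a = n1 - (((n1 ^ q) ^ q) ^ q) ^ q - (\<alpha> ^ q) ^ q * a"
  proof -
    have "S = [:r0 * \<delta>, r0 * \<alpha> + r1 * \<delta> ^ q, r0 + r1 * \<alpha> ^ q + (\<delta> ^ q) ^ q, r1 + (\<alpha> ^ q) ^ q, 1:]"
      unfolding S by (simp add: star_pCons algebra_simps)
    then obtain s0 s1 s2 s3 where S': "S = [:s0, s1, s2, s3, 1:]" and s3: "s3 = r1 + (\<alpha> ^ q) ^ q" by blast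
    obtain w0 w1 w2 where W': "W = [:w0, w1, w2, \<zeta> ^ q * s3 + n1, \<zeta> ^ q:]"
      unfolding W S' star_N_P by simp
    \<comment> \<open>Degree 7 involves only the two highest coefficients of each factor, so
      \<open>r1\<close> can be isolated.\<close>
    from comm have "poly.coeff (S \<star> W) 7 = poly.coeff (W \<star> S) 7" by simp
    then have "s3 * \<zeta> + (((( \<zeta> ^ q * s3 + n1) ^ q) ^ q) ^ q) ^ q =
        \<zeta> ^ q * s3 + n1 + \<zeta> ^ q * (((s3 ^ q) ^ q) ^ q) ^ q"
      unfolding S' W' by (simp add: star_pCons \<zeta>_qq eval_nat_numeral power_0_left)
    then show ?thesis
      by (simp add: s3 frob_add1 power_mult_distrib \<zeta>_qq a_def algebra_simps)
  qed
  moreover define Q where "Q = (n0 / n1) ^ q"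
  moreover have "(\<alpha> ^ q) ^ q * a = - (\<zeta> ^ q * ?l3 ^ q) - Q * a"
    unfolding alq Q_def[symmetric] using a by (simp add: left_diff_distrib flip: a_def)
  ultimately have "r1 * a = \<zeta> ^ q * l + Q * a" unfolding n1q(4) by (simp add: n1l)
  then have "r1 = \<zeta> ^ q * l / a + Q" using a by (simp add: field_simps)
  then show r1: "r1 = \<zeta> ^ q * l / (\<zeta> - \<zeta> ^ q) + (n0 / n1) ^ q"
    by (simp add: Q_def a_def)
  have Td: "(n0 ^ q) ^ q - a * (r0 ^ q) ^ q = ((T ^ q) ^ q) / ((\<delta> ^ q) ^ q)"
  proof -
    have "n0 - a * r0 = T / \<delta>"
    proof -
      have "(n0 - a * r0) * \<delta> = Ts - a * xA" using n0 r0 by (simp add: algebra_simps)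
      also have "\<dots> = T" using T_diff by (simp add: a_def algebra_simps)
      finally show ?thesis using d by (simp add: field_simps)
    qed
    then have "((n0 - a * r0) ^ q) ^ q = ((T / \<delta>) ^ q) ^ q" by simp
    then show ?thesis
      by (simp add: frob_diff1 power_mult_distrib power_divide a_def \<zeta>_qq)
  qed
  have "Ts / T - u2 * ((n0 ^ q) ^ q - a * (r0 ^ q) ^ q) = u1 * n1 ^ q"
    using 2 by (simp add: algebra_simps)
  \<comment> \<open>The factor \<open>n0 ^ q\<close> makes \<open>u1\<close> appear as
    \<open>u1 * n0 ^ q\<close>, whose value is known from the equation of degree 1.\<close>
  then have "n0 ^ q * (Ts / T - u2 * ((n0 ^ q) ^ q - a * (r0 ^ q) ^ q)) = n0 ^ q * (u1 * n1 ^ q)"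
    by (simp only:)
  also have "\<dots> = n1 ^ q * (Ts / T * r1 - Ts * n1)"
  proof -
    have "u1 * n0 ^ q = Ts / T * r1 - Ts * n1" using 1 by (simp add: algebra_simps)
    then have "n1 ^ q * (u1 * n0 ^ q) = n1 ^ q * (Ts / T * r1 - Ts * n1)" by (simp only:)
    then show ?thesis by (simp only: ac_simps)
  qed
  finally have "n0 ^ q * (Ts / T - u2 * ((T ^ q) ^ q / (\<delta> ^ q) ^ q)) = n1 ^ q * (Ts / T * r1 - Ts * n1)"
    unfolding Td .
  moreover have "n1 ^ q * (Ts / T * r1 - Ts * n1) = n1 ^ q * n1 / a + n0 ^ q * (Ts / T)"
  proof -
    have "Ts / T * r1 - Ts * n1 = n1 * (Ts / T / a - Ts) + Ts / T * (n0 / n1) ^ q"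
      unfolding r1 by (simp add: n1l flip: a_def) (simp add: algebra_simps add_divide_distrib)
    also have "Ts / T / a - Ts = 1 / a" using a by (simp add: a_def flip: e0) (simp add: field_simps)
    finally have "n1 ^ q * (Ts / T * r1 - Ts * n1) = n1 ^ q * (n1 * (1 / a) + Ts / T * Q)"
      unfolding Q_def by (simp only:)
    also have "\<dots> = n1 ^ q * n1 / a + (n1 ^ q * Q) * (Ts / T)" by (simp add: algebra_simps)
    also have "n1 ^ q * Q = n0 ^ q" using n1 by (simp add: Q_def power_divide)
    finally show ?thesis .
  qed
  ultimately have "n0 ^ q * (Ts / T - u2 * ((T ^ q) ^ q / (\<delta> ^ q) ^ q)) = n1 ^ q * n1 / a + n0 ^ q * (Ts / T)"
    by (simp only:)
  moreover have "- (x * v) = C" if "x * (y - v) = C + x * y" for x y v C :: 'a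
  proof -
    have "- (x * v) = x * (y - v) - x * y" by (simp add: right_diff_distrib)
    then show ?thesis using that by simp
  qed
  ultimately have "- (n0 ^ q * (u2 * ((T ^ q) ^ q / (\<delta> ^ q) ^ q))) = n1 ^ q * n1 / a"
    by blast
  then have "- (n0 ^ q * ?l3 * ((T ^ q) ^ q / (\<delta> ^ q) ^ q)) = l ^ q"
  proof -
    assume "- (n0 ^ q * (u2 * ((T ^ q) ^ q / (\<delta> ^ q) ^ q))) = n1 ^ q * n1 / a"
    then have "\<zeta> * n1 / a * - (n0 ^ q * ?l3 * ((T ^ q) ^ q / (\<delta> ^ q) ^ q)) = \<zeta> * n1 / a * l ^ q"
      unfolding u2 n1q(1) by (simp add: ac_simps)
    moreover have "\<zeta> * n1 / a \<noteq> 0" using n1 a by simp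
    ultimately show ?thesis by (metis mult_left_cancel)
  qed
  then have "- (n0 ^ q * ?l3 * (T ^ q) ^ q) = l ^ q * (\<delta> ^ q) ^ q" using d by (simp add: field_simps)
  then have "- (n0 ^ q * ?l3 * (T ^ q) ^ q) * \<delta> ^ q = l ^ q * (\<delta> ^ q) ^ q * \<delta> ^ q" by simp
  \<comment> \<open>After multiplication by \<open>\<delta> ^ q\<close> both sides are q-th powers,
    and Frobenius is injective.\<close>
  then have "- (((n0 * \<delta>) * T ^ q * (l ^ q) ^ q) ^ q) = (l * \<delta> * \<delta> ^ q) ^ q"
    by (simp add: power_mult_distrib ac_simps)
  then have "(- (Ts * T ^ q * (l ^ q) ^ q)) ^ q = (l * \<delta> * \<delta> ^ q) ^ q"
    unfolding n0 by (simp add: frob_minus1)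
  then show "l * \<delta> * \<delta> ^ q = - (Ts * T ^ q * (l ^ q) ^ q)" by (simp add: frob_inj1)
qed

subsection \<open>The members of the family\<close>

text \<open>\<open>- hh l\<close> is the summand of \<alpha> with \<lambda> in the denominator. Its
  q-th power simplifies by the relation for \<nu> to \<open>- gg l\<close>, and \<open>gg l\<close>
  is at the same time the ratio of the two coefficients of \<open>Np l\<close>.\<close>

definition "hh l = - (\<nu> * (t - \<zeta> ^ q) / (\<zeta> * l))"
definition "gg l = Ts / (\<nu> * \<zeta> ^ q * l ^ q)"

lemma hh_q: "l \<noteq> 0 \<Longrightarrow> hh l ^ q = gg l"
proof -
  assume l: "l \<noteq> 0"
  have "hh l ^ q = - (\<nu> ^ q * (t ^ q - \<zeta>) / (\<zeta> ^ q * l ^ q))"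
    by (simp add: hh_def frob_minus1 power_divide power_mult_distrib tq_diff)
  moreover have "\<nu> ^ q = - (Ts * T ^ q) / \<nu>" using \<nu>_rel by (simp add: field_simps)
  ultimately have "hh l ^ q = Ts * (T ^ q * (t ^ q - \<zeta>)) / (\<nu> * \<zeta> ^ q * l ^ q)"
    by (simp add: mult.assoc)
  also have "T ^ q * (t ^ q - \<zeta>) = 1" by (simp add: Tq)
  finally show ?thesis by (simp add: gg_def)
qed

lemma zeta_powi: "\<zeta> powi (1 - int q) = \<zeta> / \<zeta> ^ q" "\<zeta> ^ (q - 1) = \<zeta> ^ q / \<zeta>"
  by (simp_all add: power_int_diff pow_q_minus_Suc_div)

lemma alpha_eq: "l \<noteq> 0 \<Longrightarrow> alpha q t \<zeta> \<nu> l = \<zeta> ^ q * (l ^ q) ^ q / (\<zeta> ^ q - \<zeta>) - hh l"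
  by (simp add: alpha_def hh_def zeta_powi power_q2 T_elt_def field_simps)

lemma alpha_q: "l \<noteq> 0 \<Longrightarrow> alpha q t \<zeta> \<nu> l ^ q = \<zeta> * ((l ^ q) ^ q) ^ q / (\<zeta> - \<zeta> ^ q) - gg l"
  by (simp add: alpha_eq frob_diff1 hh_q power_divide power_mult_distrib \<zeta>_qq)

lemma gg_q: "gg l ^ q = - (\<nu> * Ts ^ q / (\<zeta> * T ^ q * Ts * (l ^ q) ^ q))"
proof -
  have 1: "\<nu> ^ q = - (Ts * T ^ q) / \<nu>" using \<nu>_rel by (simp add: field_simps)
  have "gg l ^ q = Ts ^ q / (\<nu> ^ q * \<zeta> * (l ^ q) ^ q)"
    by (simp add: gg_def power_divide power_mult_distrib \<zeta>_qq)
  then show ?thesis unfolding 1 by (simp add: field_simps)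
qed

lemma alpha_tilde_eq: "alpha_tilde q t \<zeta> \<nu> l = \<zeta> ^ q * l / (\<zeta> - \<zeta> ^ q) + gg l ^ q"
  by (simp add: alpha_tilde_def gg_q power_q2)

lemma beta_tilde_eq: "beta_tilde q t \<zeta> \<nu> l = alpha_tilde q t \<zeta> \<nu> l + l"
  by (simp add: beta_tilde_def alpha_tilde_def field_simps)

abbreviation "del l \<equiv> \<nu> * l ^ (q - 1)"
definition "Pp l = [:del l, alpha q t \<zeta> \<nu> l, 1:]"
definition "Rp l = [:xA / del l, alpha_tilde q t \<zeta> \<nu> l, 1:]"
text \<open>The quotient of \<open>Sy l - \<zeta> ^ q * Sx l\<close> by \<open>Pp l\<close> on the
  right. It has degree 1, with leading coefficient a constant multiple of the parameter.\<close>

definition "Np l = [:Ts / del l, \<zeta> ^ q * l:]"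
abbreviation "Sx l \<equiv> phi_x q t \<zeta> \<nu> l"
abbreviation "Sy l \<equiv> phi_y q t \<zeta> \<nu> l"

lemma del_eq: "l \<noteq> 0 \<Longrightarrow> del l = \<nu> * l ^ q / l" by (simp add: pow_q_minus_Suc_div)

lemma Sx_eq: "Sx l = Rp l \<star> Pp l" by (simp add: phi_x_def Rp_def Pp_def)

lemma Sy_eq: assumes "l \<noteq> 0" shows "Sy l = Polynomial.smult (\<zeta> ^ q) (Sx l) + Np l \<star> Pp l"
proof -
  have "yA / (\<zeta> ^ q * \<nu> * l ^ (q - 1)) * \<zeta> ^ q = \<zeta> ^ q * (xA / del l) + Ts / del l"
    using assms by (simp add: field_simps flip: Y_Ts)
  then have "Polynomial.smult (\<zeta> ^ q) [:yA / (\<zeta> ^ q * \<nu> * l ^ (q - 1)), beta_tilde q t \<zeta> \<nu> l, 1:]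
      = Polynomial.smult (\<zeta> ^ q) (Rp l) + Np l"
    by (simp add: Rp_def Np_def beta_tilde_eq algebra_simps)
  then show ?thesis
    by (simp add: phi_y_def Sx_eq flip: star_smult) (simp add: Pp_def star_add_left star_smult)
qed

lemma Np_gg: "l \<noteq> 0 \<Longrightarrow> Ts / del l = gg l * (\<zeta> ^ q * l)"
  unfolding del_eq gg_def by (simp add: field_simps)

text \<open>The converse of \<open>pair_shape\<close>: the five equations of
  \<open>square_iff\<close>, checked as \<open>c0\<close> to \<open>c4\<close> for the explicit
  coefficients. The product with \<open>Pp l\<close> on the right is the equation required by
  \<open>pair_commute\<close>.\<close>

lemma family_square:
  assumes l: "l \<noteq> 0"
  shows "Np l \<star> Pp l \<star> Np l = EE (Np l \<star> Pp l) \<star> Rp l"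
proof -
  define g where "g = gg l"
  define al where "al = alpha q t \<zeta> \<nu> l"
  define d where "d = del l"
  define n0 where "n0 = Ts / d"
  define n1 where "n1 = \<zeta> ^ q * l"
  define l1 l2 l3 where "l1 = l ^ q" and "l2 = l1 ^ q" and "l3 = l2 ^ q"
  define r0 where "r0 = xA / d"
  define r1 where "r1 = alpha_tilde q t \<zeta> \<nu> l"
  define a where "a = \<zeta> - \<zeta> ^ q"
  define u1 where "u1 = n0 * al + n1 * d ^ q"
  define u2 where "u2 = n0 + n1 * al ^ q"
  have nz: "a \<noteq> 0" "d \<noteq> 0" "n1 \<noteq> 0" "l1 \<noteq> 0" "l2 \<noteq> 0" "l3 \<noteq> 0"
    using l by (simp_all add: a_def d_def n1_def l1_def l2_def l3_def)
  have n0: "n0 = g * n1" using Np_gg[OF l] by (simp add: n0_def d_def g_def n1_def)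
  have n0d: "n0 * d = Ts" and r0d: "r0 * d = xA" using nz by (simp_all add: n0_def r0_def)
  have n1q: "n1 ^ q = \<zeta> * l1" "(n1 ^ q) ^ q = \<zeta> ^ q * l2" "((n1 ^ q) ^ q) ^ q = \<zeta> * l3"
    by (simp_all add: n1_def l1_def l2_def l3_def power_mult_distrib \<zeta>_qq)
  have alq: "al ^ q = \<zeta> * l3 / a - g"
    using alpha_q[OF l] by (simp add: al_def g_def a_def l1_def l2_def l3_def)
  have al: "al = - (\<zeta> ^ q * l2 / a) - hh l"
  proof -
    have "\<zeta> ^ q * l2 / (\<zeta> ^ q - \<zeta>) = - (\<zeta> ^ q * l2 / a)"
      unfolding a_def by (metis minus_diff_eq minus_divide_right)
    then show ?thesis using alpha_eq[OF l] by (simp add: al_def l1_def l2_def)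
  qed
  have r1: "r1 = n1 / a + g ^ q"
    using alpha_tilde_eq[of l] by (simp add: r1_def g_def n1_def a_def)
  have u2: "u2 = n1 * \<zeta> * l3 / a" by (simp add: u2_def n0 alq algebra_simps)
  have e0: "1 + a * Ts = Ts / T" unfolding a_def by (rule e0)
  have dq: "d ^ q = \<nu> ^ q * l2 / l1" using del_eq[OF l] by (simp add: d_def l1_def l2_def power_divide power_mult_distrib)
  have gh: "g * hh l = - (Ts / T) / (\<zeta> * l1 * n1)"
    using l by (simp add: g_def gg_def hh_def n1_def l1_def T_elt_def field_simps)
  have gl: "g * l1 * \<zeta> ^ q = Ts / \<nu>" using nz by (simp add: g_def gg_def l1_def)
  have Ts\<nu>: "Ts / \<nu> = - (\<nu> ^ q * (t ^ q - \<zeta>))"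
  proof -
    have "Ts = - (\<nu> * \<nu> ^ q) * (t ^ q - \<zeta>)" by (simp add: \<nu>_rel Tq)
    then show ?thesis by (simp add: field_simps)
  qed
  have gq: "g ^ q * l2 * \<zeta> = Ts ^ q / \<nu> ^ q"
    using arg_cong[OF gl, of "\<lambda>z. z ^ q"] by (simp add: power_mult_distrib power_divide \<zeta>_qq l2_def)
  have u1: "u1 * (\<zeta> * l1) = Ts / T + n1 * \<zeta> * l1 * (d ^ q - g * \<zeta> ^ q * l2 / a)"
  proof -
    have "u1 * (\<zeta> * l1) = - (g * hh l) * (\<zeta> * l1 * n1) + n1 * \<zeta> * l1 * (d ^ q - g * \<zeta> ^ q * l2 / a)"
      by (simp add: u1_def n0 al algebra_simps)
    then show ?thesis unfolding gh using nz by simp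
  qed
  have c0: "n0 * d * n0 = (1 + a * (n0 * d)) * r0"
    unfolding n0d e0 unfolding r0_def n0_def X_T by simp
  have c1: "n0 * d * n1 + u1 * n0 ^ q = (1 + a * (n0 * d)) * r1"
  proof -
    have "n0 ^ q = g ^ q * (\<zeta> * l1)" by (simp add: n0 power_mult_distrib n1q)
    then have "u1 * n0 ^ q = g ^ q * (u1 * (\<zeta> * l1))" by simp
    also have "\<dots> = g ^ q * (Ts / T) + n1 * (g ^ q * \<zeta> * l1 * d ^ q - g ^ q * \<zeta> * l2 * (g * \<zeta> ^ q * l1) / a)"
      unfolding u1 by (simp add: algebra_simps)
    also have "g ^ q * \<zeta> * l1 * d ^ q = Ts ^ q"
      using gq nz by (simp add: dq field_simps)
    also have "g ^ q * \<zeta> * l2 * (g * \<zeta> ^ q * l1) = - (Ts ^ q * (t ^ q - \<zeta>))"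
    proof -
      have "g ^ q * \<zeta> * l2 * (g * \<zeta> ^ q * l1) = (g ^ q * l2 * \<zeta>) * (g * l1 * \<zeta> ^ q)" by simp
      also have "\<dots> = - (Ts ^ q * (t ^ q - \<zeta>))" unfolding gq gl Ts\<nu> by simp
      finally show ?thesis .
    qed
    finally have *: "u1 * n0 ^ q = g ^ q * (Ts / T) + n1 * (Ts ^ q - - (Ts ^ q * (t ^ q - \<zeta>)) / a)" .
    have "Ts ^ q - - (Ts ^ q * (t ^ q - \<zeta>)) / a = Ts ^ q * (t ^ q - \<zeta> ^ q) / a"
      using nz by (simp add: field_simps) (simp add: a_def algebra_simps)
    also have "\<dots> = 1 / a" by (simp add: Tq)
    finally have K: "Ts ^ q - - (Ts ^ q * (t ^ q - \<zeta>)) / a = 1 / a" .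
    have "n0 * d * n1 + u1 * n0 ^ q = g ^ q * (Ts / T) + n1 * (Ts + 1 / a)"
      unfolding n0d *[unfolded K] by (simp add: algebra_simps)
    also have "Ts + 1 / a = Ts / T / a" using nz by (simp add: field_simps flip: e0)
    finally show ?thesis unfolding n0d e0 r1 by (simp add: algebra_simps add_divide_distrib)
  qed
  have c2: "u1 * n1 ^ q + u2 * (n0 ^ q) ^ q = (1 + a * (n0 * d)) + a * u2 * (r0 ^ q) ^ q"
  proof -
    have Td: "(n0 ^ q) ^ q - a * (r0 ^ q) ^ q = ((T ^ q) ^ q) / ((d ^ q) ^ q)"
    proof -
      have "n0 - a * r0 = T / d"
        using T_diff nz by (simp add: n0_def r0_def field_simps) (simp add: a_def algebra_simps)
      then have "((n0 - a * r0) ^ q) ^ q = ((T / d) ^ q) ^ q" by simp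
      then show ?thesis by (simp add: frob_diff1 power_mult_distrib power_divide a_def \<zeta>_qq)
    qed
    have "(T ^ q) ^ q / (\<nu> ^ q) ^ q = - (\<nu> ^ q * (t ^ q - \<zeta> ^ q))"
    proof -
      have "\<nu> ^ q * (\<nu> ^ q) ^ q = - (Ts ^ q * (T ^ q) ^ q)"
        using arg_cong[OF \<nu>_rel, of "\<lambda>z. z ^ q"] by (simp add: power_mult_distrib frob_minus1)
      then have "- (\<nu> ^ q * (\<nu> ^ q) ^ q) * (t ^ q - \<zeta> ^ q) = (T ^ q) ^ q" by (simp add: Tq(2))
      then show ?thesis by (simp add: field_simps)
    qed
    moreover have "(T ^ q) ^ q / (d ^ q) ^ q * l3 = (T ^ q) ^ q / (\<nu> ^ q) ^ q * l2"
      using nz by (simp add: dq power_divide power_mult_distrib flip: l2_def l3_def)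
    ultimately have T2: "(T ^ q) ^ q / (d ^ q) ^ q * l3 = - (\<nu> ^ q * (t ^ q - \<zeta> ^ q)) * l2" by simp
    have "u1 * n1 ^ q + u2 * (n0 ^ q) ^ q - ((1 + a * (n0 * d)) + a * u2 * (r0 ^ q) ^ q)
      = u1 * (\<zeta> * l1) - Ts / T + u2 * ((n0 ^ q) ^ q - a * (r0 ^ q) ^ q)"
      unfolding n0d e0 n1q by (simp add: algebra_simps)
    also have "\<dots> = n1 * \<zeta> * (l1 * d ^ q - (g * l1 * \<zeta> ^ q) * l2 / a + (T ^ q) ^ q / (d ^ q) ^ q * l3 / a)"
      unfolding Td u1 u2 by (simp add: algebra_simps)
    also have "\<dots> = n1 * \<zeta> * (\<nu> ^ q * l2 * (1 + (t ^ q - \<zeta>) / a - (t ^ q - \<zeta> ^ q) / a))"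
      unfolding T2 gl Ts\<nu> using nz
      by (simp add: dq algebra_simps add_divide_distrib diff_divide_distrib)
    also have "1 + (t ^ q - \<zeta>) / a - (t ^ q - \<zeta> ^ q) / a = 0"
    proof -
      have "(t ^ q - \<zeta> ^ q) / a = (t ^ q - \<zeta>) / a + a / a"
        unfolding add_divide_distrib[symmetric] by (simp add: a_def)
      then show ?thesis using nz by simp
    qed
    finally show ?thesis by simp
  qed
  have c3: "u2 * (n1 ^ q) ^ q + n1 * ((n0 ^ q) ^ q) ^ q = a * u2 * (r1 ^ q) ^ q"
  proof -
    have X1: "((n0 ^ q) ^ q) ^ q = ((g ^ q) ^ q) ^ q * (\<zeta> * l3)" by (simp only: n0 power_mult_distrib n1q(3))
    have X2: "(r1 ^ q) ^ q = \<zeta> ^ q * l2 / a + ((g ^ q) ^ q) ^ q"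
      unfolding r1 frob_add1 power_divide n1q(2) by (simp add: a_def frob_diff1 \<zeta>_qq)
    show ?thesis unfolding X1 X2 u2 n1q(2) using nz by (simp add: field_simps)
  qed
  have c4: "n1 * ((n1 ^ q) ^ q) ^ q = a * u2" unfolding u2 n1q(3) using nz by simp
  have N: "Np l = [:n0, n1:]" "Pp l = [:d, al, 1:]" "Rp l = [:r0, r1, 1:]"
    by (simp_all add: Np_def Pp_def Rp_def n0_def n1_def d_def al_def r0_def r1_def)
  show ?thesis
    unfolding N star_N_P square_iff a_def[symmetric] u1_def[symmetric] u2_def[symmetric]
    using c0 c1 c2 c3 c4 by blast
qed

lemma EE_nz: assumes "l \<noteq> 0" shows "EE (Np l \<star> Pp l) \<noteq> 0"
proof
  assume "EE (Np l \<star> Pp l) = 0"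
  then have "Np l \<star> Pp l \<star> Np l = 0" using family_square[OF assms] by simp
  then show False using assms by (simp add: Np_def Pp_def)
qed

lemma family_square': "l \<noteq> 0 \<Longrightarrow> (Np l \<star> Pp l) \<star> (Np l \<star> Pp l) = EE (Np l \<star> Pp l) \<star> Sx l"
  by (metis family_square star_assoc Sx_eq)

lemma family_commute: "l \<noteq> 0 \<Longrightarrow> Sx l \<star> Sy l = Sy l \<star> Sx l"
  unfolding Sy_eq by (rule pair_commute[OF family_square' EE_nz])

lemma Sx_0: "l \<noteq> 0 \<Longrightarrow> poly.coeff (Sx l) 0 = xA"
  by (simp add: Sx_eq Rp_def Pp_def)

lemma Sy_0: "l \<noteq> 0 \<Longrightarrow> poly.coeff (Sy l) 0 = yA"
  by (simp add: Sy_eq Sx_eq Rp_def Pp_def Np_def flip: Y_Ts)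

lemma Sx_deg: "Polynomial.degree (Sx l) = 4" "lead_coeff (Sx l) = 1"
proof -
  show d: "Polynomial.degree (Sx l) = 4" by (simp add: Sx_eq Rp_def Pp_def degree_star)
  show "lead_coeff (Sx l) = 1"
    unfolding Sx_eq lead_coeff_star by (simp add: Rp_def Pp_def)
qed

lemma Sy_deg: assumes "l \<noteq> 0" shows "Polynomial.degree (Sy l) = 4" "lead_coeff (Sy l) = \<zeta> ^ q"
proof -
  have "Polynomial.degree (Np l \<star> Pp l) = 3" using assms by (simp add: Np_def Pp_def degree_star)
  then have c: "poly.coeff (Sy l) 4 = \<zeta> ^ q" "Polynomial.degree (Sy l) \<le> 4"
    unfolding Sy_eq[OF assms] using Sx_deg[of l]
    by (auto simp: coeff_eq_0 intro!: degree_add_le order.trans[OF degree_smult_le])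
  show "Polynomial.degree (Sy l) = 4"
  proof (rule antisym[OF c(2)])
    show "4 \<le> Polynomial.degree (Sy l)" by (rule le_degree) (simp add: c)
  qed
  then show "lead_coeff (Sy l) = \<zeta> ^ q" using c by simp
qed

definition "Phi l = phi_of (Sx l)"

lemma family_drinfeld:
  assumes "l \<noteq> 0"
  shows "drinfeld_module q t \<zeta> 2 (Phi l)" "normalized q t \<zeta> (Phi l)" "zeta_q_type q t \<zeta> (Phi l)"
    "Phi l xA = Sx l" "Phi l yA = Sy l"
proof -
  note * = Sx_0[OF assms] Sy_0[OF assms] family_commute[OF assms]
  note ** = * Sx_deg Sy_deg[OF assms]
  show "drinfeld_module q t \<zeta> 2 (Phi l)" unfolding Phi_def by (rule drinfeld_phi_of[OF **])
  show "normalized q t \<zeta> (Phi l)" unfolding Phi_def by (rule normalized_phi_of[OF **])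
  show "zeta_q_type q t \<zeta> (Phi l)" unfolding Phi_def by (rule zeta_q_type_phi_of[OF **])
  show "Phi l xA = Sx l" "Phi l yA = Sy l"
    unfolding Phi_def using phi_of_X[OF *] phi_of_Y[OF *] by auto
qed

text \<open>The coefficient of \<open>\<tau>^3\<close> in \<open>Np l\<close> times
  \<open>Pp l\<close> is \<open>\<zeta> ^ q * l\<close>. The parameter is thus a rational expression
  in the coefficients of the module, which gives injectivity and places it in the field of
  definition.\<close>

lemma family_parameter: "l \<noteq> 0 \<Longrightarrow> l = poly.coeff (Sy l) 3 / \<zeta> ^ q - poly.coeff (Sx l) 3"
  by (simp add: Sy_eq Np_def Pp_def star_N_P add_divide_distrib numeral_3_eq_3)

lemma is_phi_iff: "l \<noteq> 0 \<Longrightarrow> drinfeld_module q t \<zeta> 2 \<phi> \<Longrightarrow> is_phi q t \<zeta> \<nu> l \<phi> \<longleftrightarrow> \<phi> = Phi l"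
  unfolding is_phi_def using drinfeld_eq_phi_of[of 2 \<phi>] family_drinfeld(4,5)[of l]
  by (auto simp: Phi_def)

lemma Phi_inj: "l \<noteq> 0 \<Longrightarrow> l' \<noteq> 0 \<Longrightarrow> Phi l = Phi l' \<Longrightarrow> l = l'"
  using family_parameter[of l] family_parameter[of l'] family_drinfeld(4,5) by metis

text \<open>The factors \<open>Np l\<close> and \<open>Rp l\<close> have no common nonzero zero: on
  the kernel of \<open>Np l\<close> Frobenius acts as multiplication by \<open>- gg l\<close>, and
  substitution turns \<open>Rp l\<close> into multiplication by a nonzero constant.\<close>

lemma family_torsion:
  assumes l: "l \<noteq> 0"
  shows "app (Sx l) z = 0 \<and> app (Sy l) z = 0 \<longleftrightarrow> app (Pp l) z = 0"
proof
  assume *: "app (Sx l) z = 0 \<and> app (Sy l) z = 0"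
  define p where "p = app (Pp l) z"
  define g where "g = gg l"
  have "app (Rp l) p = 0" using * by (simp add: p_def Sx_eq)
  moreover have "app (Np l) p = 0" using * by (auto simp: p_def Sy_eq[OF l])
  then have "Ts / del l * p + \<zeta> ^ q * l * p ^ q = 0" by (simp only: Np_def tw_app_pCons tw_app_poly_0 add_0_right)
  then have "(\<zeta> ^ q * l) * (g * p + p ^ q) = 0" unfolding Np_gg[OF l] g_def by (simp add: algebra_simps)
  then have pq: "p ^ q = - g * p" using l by (simp add: add_eq_0_iff)
  then have "(p ^ q) ^ q = g ^ q * g * p" by (simp add: power_mult_distrib frob_minus1)
  ultimately have "(xA / del l - alpha_tilde q t \<zeta> \<nu> l * g + g ^ q * g) * p = 0"
    by (simp add: Rp_def pq algebra_simps)
  moreover have "xA / del l - alpha_tilde q t \<zeta> \<nu> l * g + g ^ q * g = - T / (del l * (\<zeta> - \<zeta> ^ q))"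
  proof -
    have "alpha_tilde q t \<zeta> \<nu> l * g = Ts / del l / (\<zeta> - \<zeta> ^ q) + g ^ q * g"
      unfolding alpha_tilde_eq Np_gg[OF l] g_def by (simp add: algebra_simps)
    have "xA * (\<zeta> - \<zeta> ^ q) - Ts = - T" using T_diff by (simp add: algebra_simps)
    moreover have "xA / del l - Ts / del l / (\<zeta> - \<zeta> ^ q) =
        (xA * (\<zeta> - \<zeta> ^ q) - Ts) / (del l * (\<zeta> - \<zeta> ^ q))"
      using l by (simp add: diff_divide_distrib)
    ultimately have "xA / del l - Ts / del l / (\<zeta> - \<zeta> ^ q) = - T / (del l * (\<zeta> - \<zeta> ^ q))"
      by simp
    then show ?thesis using \<open>alpha_tilde q t \<zeta> \<nu> l * g = Ts / del l / (\<zeta> - \<zeta> ^ q) + g ^ q * g\<close> by simp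
  qed
  ultimately show "app (Pp l) z = 0" using l by (simp add: p_def)
qed (simp add: Sx_eq Sy_eq l)

end

context drinfeld_setup
begin

section \<open>The conjugate family and isogenies\<close>

lemma rho_conj: "rho q t (\<zeta> ^ q) = rho q t \<zeta>"
  by (simp add: rho_def \<zeta>_qq)

lemma conj_simps [simp]:
  "x_elt q t (\<zeta> ^ q) = xA" "y_elt q t (\<zeta> ^ q) = yA" "A_carrier q t (\<zeta> ^ q) = A" "A_ring q t (\<zeta> ^ q) = AR"
  "I_inf q t (\<zeta> ^ q) = II" "I_inf_pow q t (\<zeta> ^ q) = Ik"
  by (simp_all add: x_elt_def y_elt_def A_carrier_def A_ring_def I_inf_def I_inf_pow_def rho_conj fun_eq_iff)

abbreviation "\<nu>' \<equiv> - (xA / \<nu>)"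

lemma \<nu>'_conj: "- (x_elt q t (\<zeta> ^ q) / \<nu>') = \<nu>" by simp

text \<open>The conjugate data satisfy the same hypotheses, so everything proved for the family
  holds for its conjugate, and conjugating twice returns the original data.\<close>

lemma conj: "drinfeld_setup q t (\<zeta> ^ q) \<nu>'"
proof
  show "\<zeta> ^ q \<in> Fq (q\<^sup>2)" by (rule \<zeta>q_Fq2)
  show "\<zeta> ^ q \<notin> Fq q" using \<zeta>_q_neq by (simp add: Fq_def \<zeta>_qq)
  show "transcendental_over (Fq q) t" by (rule t_transc)
  have "\<nu>' ^ (q + 1) = xA * xA ^ q / (\<nu> * \<nu> ^ q)"
    by (simp add: power_divide frob_minus1)
  also have "\<dots> = - (T * Ts ^ q)"
    by (simp add: \<nu>_rel) (simp add: X_T power_mult_distrib)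
  also have "\<dots> = - 1 / ((t - \<zeta> ^ q) * (t ^ q - \<zeta> ^ q))"
    by (simp add: Tq T_elt_def)
  finally show "\<nu>' ^ (q + 1) = - 1 / ((t - \<zeta> ^ q) * (t ^ q - \<zeta> ^ q))" .
qed

definition "lnext l u = l ^ q + (1 - \<zeta> ^ q / \<zeta>) * u"

context
  fixes l u :: 'a
  assumes l: "l \<noteq> 0" and u: "u * u ^ q + alpha q t \<zeta> \<nu> l * u + del l = 0"
begin

interpretation c: drinfeld_setup q t "\<zeta> ^ q" "\<nu>'" by (rule conj)

lemma u_nz: "u \<noteq> 0"
proof
  assume "u = 0"
  then have "del l = 0" using u by simp
  then show False using l by simp
qed

lemma u_rel: "u * u ^ q = - (alpha q t \<zeta> \<nu> l * u) - del l"
proof -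
  have "u * u ^ q = (u * u ^ q + alpha q t \<zeta> \<nu> l * u + del l) - alpha q t \<zeta> \<nu> l * u - del l" by simp
  then show ?thesis unfolding u by simp
qed

lemma Pp_factor: "Pp l = [:- (del l / u), 1:] \<star> [:- u, 1:]"
proof -
  have "alpha q t \<zeta> \<nu> l * u = (- (del l / u) - u ^ q) * u"
    using u_nz by (simp add: left_diff_distrib mult.commute[of "u ^ q"] u_rel)
  then have "alpha q t \<zeta> \<nu> l = - (del l / u) - u ^ q" using u_nz by (metis mult_right_cancel)
  then show ?thesis using u_nz by (simp add: Pp_def star_pCons frob_minus1)
qed

lemma lnext_q_u: "lnext l u ^ q * u = (1 - \<zeta> / \<zeta> ^ q) * (hh l * u - del l)"
proof -
  have s: "(1 - \<zeta> ^ q / \<zeta>) ^ q = 1 - \<zeta> / \<zeta> ^ q"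
    by (simp add: frob_diff1 power_divide \<zeta>_qq)
  have "(1 - \<zeta> / \<zeta> ^ q) * (\<zeta> ^ q * (l ^ q) ^ q / (\<zeta> ^ q - \<zeta>)) = (l ^ q) ^ q"
    by (simp add: field_simps)
  then have a: "(1 - \<zeta> / \<zeta> ^ q) * alpha q t \<zeta> \<nu> l = (l ^ q) ^ q - (1 - \<zeta> / \<zeta> ^ q) * hh l"
    unfolding alpha_eq[OF l] right_diff_distrib by simp
  have "lnext l u ^ q * u = (l ^ q) ^ q * u + (1 - \<zeta> / \<zeta> ^ q) * (u * u ^ q)"
    unfolding lnext_def frob_add1 power_mult_distrib s by (simp add: algebra_simps)
  also have "u * u ^ q = - (alpha q t \<zeta> \<nu> l * u) - del l" by (rule u_rel)
  also have "(l ^ q) ^ q * u + (1 - \<zeta> / \<zeta> ^ q) * (- (alpha q t \<zeta> \<nu> l * u) - del l)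
      = (l ^ q) ^ q * u - ((1 - \<zeta> / \<zeta> ^ q) * alpha q t \<zeta> \<nu> l) * u - (1 - \<zeta> / \<zeta> ^ q) * del l"
    by (simp only: right_diff_distrib mult_minus_right mult.assoc) simp
  also have "\<dots> = (1 - \<zeta> / \<zeta> ^ q) * (hh l * u - del l)"
    unfolding a by (simp only: left_diff_distrib right_diff_distrib mult.assoc) simp
  finally show ?thesis .
qed

text \<open>The quadratic condition on \<open>u\<close> in a form that expresses
  \<open>lnext l u ^ q * u\<close> linearly. It shows that the new parameter is nonzero and, in
  \<open>vv'_eq\<close>, identifies the linear factors of the target.\<close>

lemma lnext_key: "lnext l u * (t - \<zeta> ^ q) - l ^ q * (t - \<zeta>) = \<zeta> ^ q * (lnext l u ^ q * u) * l / \<nu>"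
proof -
  have 1: "hh l * u - del l = - (\<nu> / l) * ((t - \<zeta> ^ q) * u / \<zeta> + l ^ q)"
    unfolding hh_def del_eq[OF l] using l by (simp add: field_simps)
  have "\<zeta> ^ q * (lnext l u ^ q * u) * l / \<nu> = (\<zeta> - \<zeta> ^ q) * ((t - \<zeta> ^ q) * u / \<zeta> + l ^ q)"
  proof -
    have "\<zeta> ^ q * (1 - \<zeta> / \<zeta> ^ q) = - (\<zeta> - \<zeta> ^ q)" by (simp add: field_simps)
    then have "\<zeta> ^ q * (lnext l u ^ q * u) * l / \<nu> = - (\<zeta> - \<zeta> ^ q) * (- (\<nu> / l) * ((t - \<zeta> ^ q) * u / \<zeta> + l ^ q)) * l / \<nu>"
      unfolding lnext_q_u 1 by (simp only: mult.assoc[symmetric])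
    moreover have "- d * (- (n / l) * K) * l / n = d * K" if "n \<noteq> 0" for d n K :: 'a
      using l that by simp
    ultimately show ?thesis by (metis \<nu>_nz)
  qed
  also have "\<dots> = lnext l u * (t - \<zeta> ^ q) - l ^ q * (t - \<zeta>)"
    by (simp add: lnext_def field_simps)
  finally show ?thesis by simp
qed

lemma lnext_nz: "lnext l u \<noteq> 0"
proof
  assume "lnext l u = 0"
  then have "l ^ q * (t - \<zeta>) = 0" using lnext_key by (simp add: power_0_left)
  then show False using l by simp
qed

text \<open>\<open>Pp l\<close> is \<open>(\<tau> - vv) (\<tau> - u)\<close>, and the corresponding
  factor of the target is \<open>(\<tau> - vv') (\<tau> - vv)\<close>. Hence
  \<open>\<tau> - vv\<close> is the dual isogeny.\<close>

definition "vv = del l / u"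
definition "vv' = c.del (lnext l u) / vv"

lemma vv_nz: "vv \<noteq> 0" "vv' \<noteq> 0"
  using l u_nz lnext_nz by (simp_all add: vv_def vv'_def)

lemma lnext_qq: "\<zeta> * (lnext l u ^ q) ^ q / (\<zeta> - \<zeta> ^ q) = gg l - vv ^ q"
proof -
  have "(lnext l u ^ q * u) ^ q = ((1 - \<zeta> / \<zeta> ^ q) * (hh l * u - del l)) ^ q" by (simp only: lnext_q_u)
  then have "(lnext l u ^ q) ^ q * u ^ q = (1 - \<zeta> ^ q / \<zeta>) * (gg l * u ^ q - del l ^ q)"
    by (simp only: power_mult_distrib[of _ _ q] frob_diff1 power_divide \<zeta>_qq hh_q[OF l] power_one)
  then have "\<zeta> / (\<zeta> - \<zeta> ^ q) * ((lnext l u ^ q) ^ q * u ^ q) = (\<zeta> / (\<zeta> - \<zeta> ^ q) * (1 - \<zeta> ^ q / \<zeta>)) * (gg l * u ^ q - del l ^ q)"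
    by (simp only: mult.assoc)
  moreover have "\<zeta> / (\<zeta> - \<zeta> ^ q) * (1 - \<zeta> ^ q / \<zeta>) = 1" by (simp add: field_simps)
  ultimately have "\<zeta> / (\<zeta> - \<zeta> ^ q) * ((lnext l u ^ q) ^ q * u ^ q) = gg l * u ^ q - del l ^ q"
    by (simp only: mult_1_left)
  then have "\<zeta> * (lnext l u ^ q) ^ q / (\<zeta> - \<zeta> ^ q) * u ^ q = gg l * u ^ q - del l ^ q"
    by (simp add: mult.assoc)
  also have "\<dots> = (gg l - vv ^ q) * u ^ q" using u_nz by (simp add: vv_def power_divide left_diff_distrib)
  finally show ?thesis using u_nz by (metis mult_right_cancel power_not_zero)
qed

lemma c_T: "c.T = Ts" "c.Ts = T" by (simp_all add: T_elt_def T_conj_def \<zeta>_qq)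

lemma vv'_eq: "vv' = c.hh (lnext l u) - gg l"
proof -
  have hh: "c.hh (lnext l u) = T / (\<nu> * \<zeta> ^ q * lnext l u)"
    unfolding c.hh_def by (simp add: \<zeta>_qq X_T) (simp add: T_conj_def)
  have "vv' = - (T * Ts) * (lnext l u ^ q * u * l) / (\<nu> * \<nu> * lnext l u * l ^ q)"
    unfolding vv'_def vv_def c.del_eq[OF lnext_nz] del_eq[OF l] unfolding X_T
    using l lnext_nz u_nz by (simp add: ac_simps)
  also have "\<dots> = - (T * Ts) * (\<zeta> ^ q * (lnext l u ^ q * u) * l / \<nu>) / (\<nu> * \<zeta> ^ q * lnext l u * l ^ q)"
    by (simp add: ac_simps)
  also have "\<dots> = (- (T * (Ts * (lnext l u * (t - \<zeta> ^ q) - l ^ q * (t - \<zeta>))))) / (\<nu> * \<zeta> ^ q * lnext l u * l ^ q)"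
    unfolding lnext_key[symmetric] by simp
  also have "T * (Ts * (lnext l u * (t - \<zeta> ^ q) - l ^ q * (t - \<zeta>))) = Ts * (lnext l u) - T * l ^ q"
  proof -
    have "x * (y * (A * p - B * r)) = y * A * (x * p) - x * B * (y * r)" for x y A B p r :: 'a
      by (simp add: algebra_simps)
    moreover have "T * (t - \<zeta> ^ q) = 1" "Ts * (t - \<zeta>) = 1" by (simp_all add: T_elt_def T_conj_def)
    ultimately show ?thesis by simp
  qed
  also have "- (Ts * (lnext l u) - T * l ^ q) / (\<nu> * \<zeta> ^ q * lnext l u * l ^ q) = c.hh (lnext l u) - gg l"
    unfolding hh gg_def using l lnext_nz by (simp add: field_simps)
  finally show ?thesis .
qed

lemma c_alpha: "alpha q t (\<zeta> ^ q) \<nu>' (lnext l u) = - vv' - vv ^ q"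
  using c.alpha_eq[OF lnext_nz] lnext_qq by (simp add: \<zeta>_qq vv'_eq)

lemma c_Pp: "c.Pp (lnext l u) = [:- vv', 1:] \<star> [:- vv, 1:]"
  unfolding c.Pp_def c_alpha using vv_nz by (simp add: star_pCons frob_minus1 vv'_def)

text \<open>The compatibility of \<open>U\<close> with the isogeny after cancelling the common right
  factor \<open>Pp l\<close>. The extra multiple of \<open>Rp l\<close> arises from moving
  \<open>\<zeta> ^ q\<close> past \<open>\<tau> - u\<close>.\<close>

lemma c_Np: "c.Np (lnext l u) \<star> [:- vv', 1:] = [:- u, 1:] \<star> Np l - Polynomial.smult (u * (\<zeta> ^ q - \<zeta>)) (Rp l)"
proof -
  have n0: "Ts / del l = gg l * (\<zeta> ^ q * l)" by (rule Np_gg[OF l])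
  have n0': "T / c.del (lnext l u) = c.gg (lnext l u) * (\<zeta> * lnext l u)" using c.Np_gg[OF lnext_nz] by (simp add: \<zeta>_qq c_T)
  have e2: "\<zeta> * (lnext l u) = \<zeta> * l ^ q - u * (\<zeta> ^ q - \<zeta>)" by (simp add: lnext_def field_simps)
  have e1: "T / c.del (lnext l u) - \<zeta> * lnext l u * vv' ^ q = (Ts / del l) ^ q - u * (\<zeta> ^ q * l) - u * (\<zeta> ^ q - \<zeta>) * alpha_tilde q t \<zeta> \<nu> l"
  proof -
    have vq: "vv' ^ q = c.gg (lnext l u) - gg l ^ q" by (simp add: vv'_eq frob_diff1 c.hh_q[OF lnext_nz])
    have "(Ts / del l) ^ q - u * (\<zeta> ^ q * l) - u * (\<zeta> ^ q - \<zeta>) * alpha_tilde q t \<zeta> \<nu> l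
      = gg l ^ q * (\<zeta> * l ^ q - u * (\<zeta> ^ q - \<zeta>)) - u * \<zeta> ^ q * l * (1 + (\<zeta> ^ q - \<zeta>) / (\<zeta> - \<zeta> ^ q))"
      unfolding n0 alpha_tilde_eq by (simp add: power_mult_distrib \<zeta>_qq algebra_simps add_divide_distrib diff_divide_distrib)
    also have "1 + (\<zeta> ^ q - \<zeta>) / (\<zeta> - \<zeta> ^ q) = 0" by (simp add: field_simps)
    finally show ?thesis unfolding n0' vq e2[symmetric] by (simp add: algebra_simps)
  qed
  have e0: "T / c.del (lnext l u) * vv' = u * (Ts / del l) + u * (\<zeta> ^ q - \<zeta>) * (xA / del l)"
  proof -
    have "T / c.del (lnext l u) * vv' = T / vv" using lnext_nz vv_nz by (simp add: vv'_def)
    also have "\<dots> = u * ((Ts + (\<zeta> ^ q - \<zeta>) * xA) / del l)"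
    proof -
      have "Ts + (\<zeta> ^ q - \<zeta>) * xA = T" using T_diff by (simp add: algebra_simps)
      then show ?thesis by (simp only: vv_def) (simp add: mult.commute)
    qed
    finally show ?thesis by (simp add: algebra_simps add_divide_distrib diff_divide_distrib)
  qed
  define \<kappa> where "\<kappa> = u * (\<zeta> ^ q - \<zeta>)"
  have lin: "[:a, b:] \<star> [:- d, 1:] = [:- (a * d), a - b * d ^ q, b:]" for a b d
    by (simp add: star_pCons frob_minus1)
  have "[:- u, 1:] \<star> [:a, b:] - Polynomial.smult \<kappa> [:x, y, 1:] =
      [:- (u * a + \<kappa> * x), a ^ q - u * b - \<kappa> * y, b ^ q - \<kappa>:]" for a b x y
    by (simp add: star_pCons)
  moreover have "(\<zeta> ^ q * l) ^ q - \<kappa> = \<zeta> * (lnext l u)" unfolding e2 \<kappa>_def by (simp add: power_mult_distrib \<zeta>_qq)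
  ultimately show ?thesis
    unfolding c.Np_def Np_def Rp_def c_T lin \<zeta>_qq e0 e1 \<kappa>_def[symmetric] by (simp only:)
qed

lemma isogeny_U: "(c.Np (lnext l u) \<star> c.Pp (lnext l u)) \<star> [:- u, 1:] =
    [:- u, 1:] \<star> (Np l \<star> Pp l) - Polynomial.smult (u * (\<zeta> ^ q - \<zeta>)) (Sx l)"
proof -
  have "(c.Np (lnext l u) \<star> c.Pp (lnext l u)) \<star> [:- u, 1:] = (c.Np (lnext l u) \<star> [:- vv', 1:]) \<star> ([:- vv, 1:] \<star> [:- u, 1:])"
    by (simp add: c_Pp star_assoc)
  also have "[:- vv, 1:] \<star> [:- u, 1:] = Pp l" by (simp add: Pp_factor vv_def)
  finally show ?thesis
    unfolding c_Np by (simp add: star_diff_left star_assoc star_smult Sx_eq)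
qed

text \<open>The pair is transported along \<open>g = \<tau> - u\<close>; commutation and the
  quadratic relation survive because \<open>g\<close> cancels. Only the combination
  \<open>U1\<close> is compared with the conjugate family, and it already determines the
  pair.\<close>

lemma isogeny_xy:
  shows "phi_x q t (\<zeta> ^ q) \<nu>' (lnext l u) \<star> [:- u, 1:] = [:- u, 1:] \<star> Sx l"
    and "phi_y q t (\<zeta> ^ q) \<nu>' (lnext l u) \<star> [:- u, 1:] = [:- u, 1:] \<star> Sy l"
proof -
  define g where "g = [:- u, 1:]"
  have gnz: "g \<noteq> 0" by (simp add: g_def)
  \<comment> \<open>Since \<open>Pp l = (\<tau> - vv) g\<close>, moving the last factor of
    \<open>Sx l\<close> to the front gives a twisted polynomial with
    \<open>\<psi>x g = g (Sx l)\<close>; likewise for \<open>\<psi>y\<close>.\<close>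
  define \<psi>x where "\<psi>x = g \<star> (Rp l \<star> [:- vv, 1:])"
  define \<psi>y where "\<psi>y = g \<star> ((Polynomial.smult (\<zeta> ^ q) (Rp l) + Np l) \<star> [:- vv, 1:])"
  have P: "[:- vv, 1:] \<star> g = Pp l" by (simp add: Pp_factor vv_def g_def)
  have x: "\<psi>x \<star> g = g \<star> Sx l" by (simp add: \<psi>x_def star_assoc P Sx_eq)
  have y: "\<psi>y \<star> g = g \<star> Sy l"
    by (simp add: \<psi>y_def star_assoc P Sy_eq[OF l] star_add_left star_smult Sx_eq)
  have xx: "(\<psi>x \<star> \<psi>x) \<star> g = g \<star> (Sx l \<star> Sx l)" by (metis x star_assoc)
  have xy: "(\<psi>x \<star> \<psi>y) \<star> g = g \<star> (Sx l \<star> Sy l)" by (metis x y star_assoc)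
  have yx: "(\<psi>y \<star> \<psi>x) \<star> g = g \<star> (Sy l \<star> Sx l)" by (metis x y star_assoc)
  have yy: "(\<psi>y \<star> \<psi>y) \<star> g = g \<star> (Sy l \<star> Sy l)" by (metis y star_assoc)
  have comm: "\<psi>x \<star> \<psi>y = \<psi>y \<star> \<psi>x"
    by (rule star_cancel_right[OF gnz]) (simp add: xy yx family_commute[OF l])
  have gs: "g \<star> Polynomial.smult k f = Polynomial.smult k (g \<star> f)" if "k \<in> Fq q" for k f
    by (rule tw_eqI) (simp add: tw_app_scale[OF that])
  have tr': "c.tr = tr" "c.nm = nm" by (simp_all add: c.tr_def c.nm_def tr_def nm_def \<zeta>_qq ac_simps)
  have rel: "\<psi>y \<star> \<psi>y - Polynomial.smult c.tr (\<psi>x \<star> \<psi>y) + Polynomial.smult c.nm (\<psi>x \<star> \<psi>x) = \<psi>x"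
  proof (rule star_cancel_right[OF gnz])
    have "(\<psi>y \<star> \<psi>y - Polynomial.smult c.tr (\<psi>x \<star> \<psi>y) + Polynomial.smult c.nm (\<psi>x \<star> \<psi>x)) \<star> g
      = g \<star> (Sy l \<star> Sy l - Polynomial.smult tr (Sx l \<star> Sy l) + Polynomial.smult nm (Sx l \<star> Sx l))"
      by (simp add: star_add_left star_diff_left star_add_right star_diff_right star_smult xx xy yy tr'
          gs[OF tr_Fq] gs[OF nm_Fq])
    also have "\<dots> = g \<star> Sx l"
      using drinfeld_relation[OF family_drinfeld(1)[OF l]] by (simp add: family_drinfeld(4,5)[OF l])
    finally show "(\<psi>y \<star> \<psi>y - Polynomial.smult c.tr (\<psi>x \<star> \<psi>y) + Polynomial.smult c.nm (\<psi>x \<star> \<psi>x)) \<star> g = \<psi>x \<star> g"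
      by (simp add: x)
  qed
  define U1 where "U1 = c.Np (lnext l u) \<star> c.Pp (lnext l u)"
  have U: "\<psi>y - Polynomial.smult ((\<zeta> ^ q) ^ q) \<psi>x = U1"
  proof (rule star_cancel_right[OF gnz])
    have "app (g \<star> Sy l - Polynomial.smult \<zeta> (g \<star> Sx l)) w =
        app (g \<star> (Np l \<star> Pp l) - Polynomial.smult (u * (\<zeta> ^ q - \<zeta>)) (Sx l)) w" for w
      by (simp add: g_def Sy_eq[OF l] frob_add1 power_mult_distrib \<zeta>_qq algebra_simps)
    then have "g \<star> Sy l - Polynomial.smult \<zeta> (g \<star> Sx l) =
        g \<star> (Np l \<star> Pp l) - Polynomial.smult (u * (\<zeta> ^ q - \<zeta>)) (Sx l)" by (rule tw_eqI)
    then show "(\<psi>y - Polynomial.smult ((\<zeta> ^ q) ^ q) \<psi>x) \<star> g = U1 \<star> g"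
      using isogeny_U by (simp add: star_diff_left star_smult x y \<zeta>_qq U1_def flip: g_def)
  qed
  \<comment> \<open>Both \<open>\<psi>x\<close> and the value of the conjugate family satisfy the
    same equation with the same \<open>U1\<close>; the nonzero left factor \<open>c.EE U1\<close> is
    then cancelled.\<close>
  have "U1 \<star> U1 = c.EE U1 \<star> \<psi>x" using c.pair_square[OF comm rel] unfolding U .
  moreover have "U1 \<star> U1 = c.EE U1 \<star> c.Sx (lnext l u)" unfolding U1_def by (rule c.family_square'[OF lnext_nz])
  moreover have "c.EE U1 \<noteq> 0" unfolding U1_def by (rule c.EE_nz[OF lnext_nz])
  ultimately have X: "c.Sx (lnext l u) = \<psi>x" using star_cancel_left by metis
  have "c.Sy (lnext l u) = Polynomial.smult ((\<zeta> ^ q) ^ q) \<psi>x + U1" using c.Sy_eq[OF lnext_nz] by (simp add: X U1_def)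
  then have Y: "c.Sy (lnext l u) = \<psi>y" using U by (simp add: algebra_simps)
  show "phi_x q t (\<zeta> ^ q) \<nu>' (lnext l u) \<star> [:- u, 1:] = [:- u, 1:] \<star> Sx l"
    "phi_y q t (\<zeta> ^ q) \<nu>' (lnext l u) \<star> [:- u, 1:] = [:- u, 1:] \<star> Sy l"
    using X Y x y by (simp_all add: g_def)
qed

lemma isogeny:
  assumes "a \<in> A"
  shows "drinfeld_setup.Phi q t (\<zeta> ^ q) \<nu>' (lnext l u) a \<star> [:- u, 1:] = [:- u, 1:] \<star> Phi l a"
  using assms
proof (induction rule: A_induct)
  note D = drinfeld_props[OF family_drinfeld(1)[OF l]]
  note D' = c.drinfeld_props[OF c.family_drinfeld(1)[OF lnext_nz], simplified]
  {
    case (const k)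
    show ?case unfolding D(3)[OF const] D'(3)[OF const]
      by (rule tw_eqI) (simp add: tw_app_scale[OF const] power_mult_distrib Fq_pow[OF const, of 1, simplified] algebra_simps)
  next
    case xA
    then show ?case using isogeny_xy(1) family_drinfeld(4)[OF l] c.family_drinfeld(4)[OF lnext_nz] by simp
  next
    case yA
    then show ?case using isogeny_xy(2) family_drinfeld(5)[OF l] c.family_drinfeld(5)[OF lnext_nz] by simp
  next
    case (add a b)
    then show ?case by (simp add: D D' star_add_left star_add_right)
  next
    case (mult a b)
    then show ?case by (simp add: D D') (metis star_assoc)
  }
qed

end

end

section \<open>Finite spaces over \<open>Fq q\<close> and the twisted polynomials that annihilate
  them\<close>

context frobenius_field
begin

lemma card_additive_map:
  fixes h :: "'a \<Rightarrow> 'a"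
  assumes "finite V" "h ` V = K" "\<And>z w. h (z - w) = h z - h w"
    "\<And>z w. z \<in> V \<Longrightarrow> w \<in> V \<Longrightarrow> z - w \<in> V" "\<And>z w. z \<in> V \<Longrightarrow> w \<in> V \<Longrightarrow> z + w \<in> V"
  shows "card V = card K * card {z \<in> V. h z = 0}"
proof -
  have fibre: "card {z \<in> V. h z = y} = card {z \<in> V. h z = 0}" if y: "y \<in> K" for y
  proof -
    obtain w where w: "w \<in> V" "h w = y" using assms(2) y by blast
    have "h (z + w) = h z + h w" for z using assms(3)[of "z + w" w] by simp
    then have "{z \<in> V. h z = y} = (\<lambda>z. z + w) ` {z \<in> V. h z = 0}"
      using w assms(3-5) by (auto intro!: image_eqI[of _ _ "z - w" for z])
    then show ?thesis by (simp add: card_image)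
  qed
  have "card V = (\<Sum>y\<in>h ` V. \<Sum>z\<in>{z \<in> V. h z = y}. 1)"
    using sum.group[of V "h ` V" h "\<lambda>_. 1::nat"] assms(1) by simp
  also have "\<dots> = (\<Sum>y\<in>K. card {z \<in> V. h z = 0})" unfolding assms(2) by (rule sum.cong) (auto simp: fibre)
  finally show ?thesis by simp
qed

lemma ker_linear: "app [:- u, 1:] z = 0 \<longleftrightarrow> z ^ q = u * z"
  by (simp add: algebra_simps)

text \<open>Two linear factors are built one after the other: \<open>\<tau> - u\<close> kills a
  first vector, \<open>\<tau> - v\<close> the image of a second independent one. The kernel of the
  product lies in the plane and has the same size.\<close>

lemma plane_annihilator:
  assumes fin: "card K = q ^ 2" and 0: "0 \<in> K"
    and add: "\<And>z w. z \<in> K \<Longrightarrow> w \<in> K \<Longrightarrow> z + w \<in> K" and scale: "\<And>c z. c \<in> Fq q \<Longrightarrow> z \<in> K \<Longrightarrow> c * z \<in> K"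
  obtains u v :: 'a where "u \<noteq> 0" "v \<noteq> 0" "K = {z. app ([:- v, 1:] \<star> [:- u, 1:]) z = 0}"
proof -
  have finK: "finite K" using fin q_pos by (metis card.infinite power_not_zero)
  have "\<not> K \<subseteq> {0}"
  proof
    assume "K \<subseteq> {0}"
    then have "card K \<le> 1" by (metis card_mono finite.emptyI finite_insert card_insert_le_m1 is_singletonI is_singleton_altdef nat_le_linear)
    moreover have "1 < q ^ 2" using q_ge_2 by (metis one_less_power Suc_1 Suc_le_eq pos2)
    ultimately show False using fin by simp
  qed
  then obtain e1 where e1: "e1 \<in> K" "e1 \<noteq> 0" by blast
  define u where "u = e1 ^ q / e1"
  have u: "e1 ^ q = u * e1" "u \<noteq> 0" using e1 by (simp_all add: u_def)
  define g where "g = [:- u, 1:]"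
  have "card {z. app g z = 0} = q" using u lin_split(2)[of g] by (simp add: g_def)
  moreover have "q < q ^ 2" using q_ge_2 by (simp add: power2_eq_square)
  moreover have "finite {z. app g z = 0}" by (rule finite_ker) (simp add: g_def)
  ultimately have "\<not> K \<subseteq> {z. app g z = 0}" using fin by (metis card_mono not_le)
  then obtain e2 where e2: "e2 \<in> K" "app g e2 \<noteq> 0" by blast
  define e where "e = app g e2"
  define v where "v = e ^ q / e"
  have v: "e ^ q = v * e" "v \<noteq> 0" using e2 by (simp_all add: v_def e_def)
  have sub: "{z. app ([:- v, 1:] \<star> g) z = 0} \<subseteq> K"
  proof
    fix z assume "z \<in> {z. app ([:- v, 1:] \<star> g) z = 0}"
    then have "(app g z) ^ q = v * app g z" by (simp add: algebra_simps)
    from Fq_ratio[OF v(1) this] e2(2) obtain c where c: "c \<in> Fq q" "app g z = c * e" by (auto simp: e_def)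
    then have "app g (z - c * e2) = 0" by (simp add: tw_app_scale e_def)
    then have "(z - c * e2) ^ q = u * (z - c * e2)" unfolding g_def ker_linear .
    from Fq_ratio[OF u(1) this e1(2)] obtain d where d: "d \<in> Fq q" "z - c * e2 = d * e1" .
    then have "z = d * e1 + c * e2" by (simp add: algebra_simps)
    then show "z \<in> K" using add[OF scale scale] c d e1 e2 by simp
  qed
  have "card {z. app ([:- v, 1:] \<star> g) z = 0} = q ^ Polynomial.degree ([:- v, 1:] \<star> g)"
    by (rule lin_split(2)) (use u v in \<open>simp add: g_def\<close>)
  also have "Polynomial.degree ([:- v, 1:] \<star> g) = 2" by (simp add: g_def degree_star)
  finally have "{z. app ([:- v, 1:] \<star> g) z = 0} = K"
    using card_subset_eq[OF finK sub] fin by simp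
  then show ?thesis using that[of u v] u v by (simp add: g_def)
qed

lemma poly_degree_2: "Polynomial.degree f = 2 \<Longrightarrow> \<exists>a b c. f = [:a, b, c :: 'a:]"
  by (metis degree_pCons_eq_if degree_eq_zeroE pCons_cases old.nat.inject Suc_1 nat.distinct(1) One_nat_def)

lemma poly_degree_le_1: assumes "Polynomial.degree f \<le> 1" shows "\<exists>a b. f = [:a, b :: 'a:]"
proof -
  have "f = [:poly.coeff f 0, poly.coeff f 1:]"
    by (rule poly_eqI) (use assms in \<open>auto simp: coeff_pCons coeff_eq_0 split: nat.splits\<close>)
  then show ?thesis by blast
qed

end

context drinfeld_setup
begin

section \<open>The family is complete\<close>

text \<open>On \<open>V\<close>, the kernel of \<open>S\<close> of size \<open>q ^ 4\<close>, the
  quadratic relation gives \<open>W W = 0\<close>. In fact \<open>W\<close> maps \<open>V\<close>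
  onto \<open>K\<close>, and its kernel in \<open>V\<close> is again \<open>K\<close>; so
  \<open>card V\<close> is the square of \<open>card K\<close>.\<close>

lemma card_I_torsion:
  assumes "drinfeld_module q t \<zeta> 2 \<phi>"
  shows "card {z. app (\<phi> xA) z = 0 \<and> app (\<phi> yA) z = 0} = q ^ 2"
proof -
  define S where "S = \<phi> xA"
  define W where "W = \<phi> yA"
  define V where "V = {z. app S z = 0}"
  define K where "K = {z. app S z = 0 \<and> app W z = 0}"
  have SW: "app S (app W z) = app W (app S z)" for z
    using drinfeld_commute[OF assms, of xA yA] by (metis A_X A_Y S_def W_def tw_app_mult)
  have rel: "app W (app W z) = tr * app S (app W z) - nm * app S (app S z) + app S z" for z
    using arg_cong[OF drinfeld_relation[OF assms], of "\<lambda>f. app f z"]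
    by (simp add: S_def W_def algebra_simps)
  have S0: "poly.coeff S 0 = xA" using drinfeld_props(4)[OF assms] by (simp add: S_def)
  have "V \<noteq> {}" by (auto simp: V_def intro!: exI[of _ 0])
  have cardV: "card V = q ^ 4"
    using lin_split(2)[of S] S0 drinfeld_degrees(1)[OF assms] by (simp add: V_def S_def)
  then have finV: "finite V" using q_pos by (metis card.infinite power_not_zero)
  have img: "app W ` V = K"
  proof (intro equalityI subsetI)
    fix k assume "k \<in> app W ` V"
    then obtain z where "app S z = 0" "k = app W z" by (auto simp: V_def)
    then show "k \<in> K" using rel[of z] by (simp add: K_def SW)
  next
    fix k assume k: "k \<in> K"
    have "W \<noteq> 0" using drinfeld_degrees(2)[OF assms] by (auto simp: W_def)
    then obtain w where w: "app W w = k" using tw_app_surj by blast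
    have k0: "app S k = 0" "app W k = 0" using k by (auto simp: K_def)
    have "0 = tr * 0 - nm * app S (app S w) + app S w" using rel[of w] unfolding w k0 .
    then have Sw: "app S w = nm * app S (app S w)" by simp
    \<comment> \<open>Chosen so that \<open>app S w' = 0\<close>, by the equation just found. The
      value of \<open>W\<close> is unchanged, because \<open>S\<close> and \<open>W\<close> commute
      and \<open>S\<close> kills \<open>k\<close>.\<close>
    define w' where "w' = w - nm * app S w"
    have "app S w' = 0" using Sw by (simp add: w'_def tw_app_scale[OF nm_Fq])
    moreover have "app W w' = k"
      using k by (simp add: w'_def tw_app_scale[OF nm_Fq] w K_def flip: SW)
    ultimately show "k \<in> app W ` V" by (auto simp: V_def)
  qed
  have "card V = card K * card {z \<in> V. app W z = 0}"
    by (rule card_additive_map[OF finV img]) (auto simp: V_def)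
  also have "{z \<in> V. app W z = 0} = K" by (auto simp: V_def K_def)
  finally have "card K * card K = q ^ 2 * q ^ 2" using cardV by (simp flip: power_add)
  then have "card K ^ 2 = (q ^ 2) ^ 2" by (simp add: power2_eq_square)
  then have "card K = q ^ 2" by (metis power2_eq_iff_nonneg zero_le)
  then show ?thesis by (simp add: K_def S_def W_def)
qed

text \<open>The monic annihilator of the I-torsion divides both values on the right. By the type
  condition the terms of degree 4 cancel in \<open>U\<close>, which bounds the degree of its
  cofactor by 1.\<close>

lemma drinfeld_factor:
  assumes D: "drinfeld_module q t \<zeta> 2 \<phi>" and N: "normalized q t \<zeta> \<phi>" and Z: "zeta_q_type q t \<zeta> \<phi>"
  obtains \<delta> \<alpha> r0 r1 n0 n1 where "\<delta> \<noteq> 0"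
    "\<phi> xA = [:r0, r1, 1:] \<star> [:\<delta>, \<alpha>, 1:]"
    "\<phi> yA = Polynomial.smult (\<zeta> ^ q) (\<phi> xA) + [:n0, n1:] \<star> [:\<delta>, \<alpha>, 1:]"
proof -
  define S where "S = \<phi> xA"
  define W where "W = \<phi> yA"
  define U where "U = W - Polynomial.smult (\<zeta> ^ q) S"
  note deg = drinfeld_degrees[OF D, folded S_def W_def]
  have lS: "poly.coeff S 4 = 1" using N deg by (simp add: normalized_def S_def)
  have lW: "poly.coeff W 4 = \<zeta> ^ q"
    using Z N deg by (simp add: zeta_q_type_def normalized_def S_def W_def)
  define K where "K = {z. app S z = 0 \<and> app W z = 0}"
  have K: "card K = q ^ 2" using card_I_torsion[OF D] by (simp add: K_def S_def W_def)
  obtain u v where uv: "u \<noteq> 0" "v \<noteq> 0" "K = {z. app ([:- v, 1:] \<star> [:- u, 1:]) z = 0}"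
    by (rule plane_annihilator[OF K]) (auto simp: K_def tw_app_scale)
  define P where "P = [:- v, 1:] \<star> [:- u, 1:]"
  have P: "P = [:v * u, - v - u ^ q, 1:]" by (simp add: P_def star_pCons frob_minus1)
  have Pc: "lead_coeff P = 1" "Polynomial.degree P = Suc 1" "poly.coeff P 0 \<noteq> 0"
    using uv by (simp_all add: P)
  have Pnz: "P \<noteq> 0" by (simp add: P)
  have kerP: "app S z = 0 \<and> app W z = 0" if "app P z = 0" for z
    using that uv(3) unfolding K_def P_def by blast
  obtain R where R: "S = R \<star> P" using right_factor[OF Pc] kerP by blast
  obtain N where N: "U = N \<star> P" using right_factor[OF Pc, of U] kerP by (auto simp: U_def)
  have "R \<noteq> 0" using R deg by auto
  then have "Polynomial.degree R + 2 = 4" using R deg degree_star[of R P] Pnz Pc by simp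
  then obtain r0 r1 r2 where R': "R = [:r0, r1, r2:]" using poly_degree_2[of R] by auto
  have "r2 = 1" using lS unfolding R R' P by (simp add: star_pCons eval_nat_numeral)
  then have R'': "R = [:r0, r1, 1:]" using R' by simp
  have "Polynomial.degree N \<le> 1"
  proof (cases "N = 0")
    case False
    have "poly.coeff U 4 = 0" by (simp add: U_def lS lW)
    moreover have "Polynomial.degree U \<le> 4"
      unfolding U_def using deg by (intro degree_diff_le order.trans[OF degree_smult_le]) auto
    moreover have "U \<noteq> 0" using N False Pnz by simp
    ultimately have "Polynomial.degree U < 4" by (metis le_neq_implies_less leading_coeff_0_iff)
    then show ?thesis using N False Pnz Pc by (simp add: degree_star)
  qed simp
  then obtain n0 n1 where N': "N = [:n0, n1:]" using poly_degree_le_1 by blast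
  have "W = Polynomial.smult (\<zeta> ^ q) S + N \<star> P" using N by (simp add: U_def algebra_simps)
  then show ?thesis
    using that[of "v * u" r0 r1 "- v - u ^ q" n0 n1] uv R by (simp add: S_def W_def P R'' N')
qed

text \<open>Once \<delta> has the value prescribed by \<open>l\<close> nothing is left free:
  \<open>pair_shape\<close> gives \<open>r1\<close> and the q-th power of \<alpha>, and Frobenius is
  injective.\<close>

lemma shape_family:
  assumes d: "\<delta> = del l" and r0: "r0 * \<delta> = xA" and n0: "n0 * \<delta> = Ts"
    and sq: "[:n0, n1:] \<star> [:\<delta>, \<alpha>, 1:] \<star> [:n0, n1:] = EE ([:n0, n1:] \<star> [:\<delta>, \<alpha>, 1:]) \<star> [:r0, r1, 1:]"
    and comm: "S \<star> W = W \<star> S" and S: "S = [:r0, r1, 1:] \<star> [:\<delta>, \<alpha>, 1:]"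
    and W: "W = Polynomial.smult (\<zeta> ^ q) S + [:n0, n1:] \<star> [:\<delta>, \<alpha>, 1:]"
    and l: "l = n1 / \<zeta> ^ q"
  shows "S = Sx l" "W = Sy l" "l \<noteq> 0"
proof -
  have dnz: "\<delta> \<noteq> 0" using n0 by auto
  note sh = pair_shape[OF dnz r0 n0 sq comm S W, folded l]
  show lnz: "l \<noteq> 0" by (rule sh(1))
  have n0': "n0 = Ts / del l" and r0': "r0 = xA / del l" using n0 r0 dnz by (simp_all add: d field_simps)
  have "n0 / n1 = gg l" unfolding n0' Np_gg[OF lnz] sh(2) using lnz by simp
  then have "\<alpha> ^ q = alpha q t \<zeta> \<nu> l ^ q" "r1 = alpha_tilde q t \<zeta> \<nu> l"
    using sh(3,4) alpha_q[OF lnz] alpha_tilde_eq[of l] by simp_all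
  then have *: "[:\<delta>, \<alpha>, 1:] = Pp l" "[:r0, r1, 1:] = Rp l" "[:n0, n1:] = Np l"
    using sh(2) by (simp_all add: Pp_def Rp_def Np_def d n0' r0' frob_inj1)
  show "S = Sx l" "W = Sy l" unfolding W S * Sx_eq[symmetric] Sy_eq[OF lnz] by (rule refl)+
qed

text \<open>What separates a normalized module from the family is a root of unity in \<delta>; it is
  removed by a scaling that keeps the module normalized.\<close>

theorem family_complete:
  assumes D: "drinfeld_module q t \<zeta> 2 \<phi>" and N: "normalized q t \<zeta> \<phi>" and Z: "zeta_q_type q t \<zeta> \<phi>"
  obtains c l where "c \<noteq> 0" "l \<noteq> 0" "\<And>a. a \<in> A \<Longrightarrow> [:c:] \<star> \<phi> a = Phi l a \<star> [:c:]"
proof -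
  obtain \<delta> \<alpha> r0 r1 n0 n1 where dnz: "\<delta> \<noteq> 0"
    and S: "\<phi> xA = [:r0, r1, 1:] \<star> [:\<delta>, \<alpha>, 1:]"
    and W: "\<phi> yA = Polynomial.smult (\<zeta> ^ q) (\<phi> xA) + [:n0, n1:] \<star> [:\<delta>, \<alpha>, 1:]"
    using drinfeld_factor[OF assms] .
  define R where "R = [:r0, r1, 1:]"
  define P where "P = [:\<delta>, \<alpha>, 1:]"
  define Nn where "Nn = [:n0, n1:]"
  have Pnz: "P \<noteq> 0" by (simp add: P_def)
  have comm: "\<phi> xA \<star> \<phi> yA = \<phi> yA \<star> \<phi> xA" by (rule drinfeld_commute[OF D]) auto
  have r0: "r0 * \<delta> = xA" using drinfeld_props(4)[OF D A_X] unfolding S by simp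
  have n0: "n0 * \<delta> = Ts"
  proof -
    have "\<zeta> ^ q * xA + n0 * \<delta> = yA"
      using drinfeld_props(4)[OF D A_Y] drinfeld_props(4)[OF D A_X] unfolding W by simp
    then show ?thesis using Y_Ts by (simp add: algebra_simps)
  qed
  have U: "\<phi> yA - Polynomial.smult (\<zeta> ^ q) (\<phi> xA) = Nn \<star> P" using W by (simp add: Nn_def P_def)
  have sq: "Nn \<star> P \<star> Nn = EE (Nn \<star> P) \<star> R"
  proof (rule star_cancel_right[OF Pnz])
    show "(Nn \<star> P \<star> Nn) \<star> P = (EE (Nn \<star> P) \<star> R) \<star> P"
      using drinfeld_square[OF D] unfolding U by (simp add: S star_assoc R_def P_def)
  qed
  define l0 where "l0 = n1 / \<zeta> ^ q"
  note sh = pair_shape[OF dnz r0 n0 sq[unfolded Nn_def P_def R_def] comm S W, folded l0_def]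
  have l0: "l0 \<noteq> 0" by (rule sh(1))
  \<comment> \<open>The quotient of \<delta> by \<open>del l0\<close>. By the condition on \<delta>
    in \<open>pair_shape\<close> its power \<open>q + 1\<close> is 1.\<close>
  define \<omega> where "\<omega> = \<delta> * l0 / (\<nu> * l0 ^ q)"
  have \<omega>: "\<omega> * \<omega> ^ q = 1"
  proof -
    have "\<omega> * \<omega> ^ q = (l0 * \<delta> * \<delta> ^ q) / (\<nu> * \<nu> ^ q * (l0 ^ q) ^ q)"
      using l0 by (simp add: \<omega>_def power_divide power_mult_distrib ac_simps)
    then show ?thesis unfolding sh(5) \<nu>_rel using l0 by simp
  qed
  have "q - 1 > 0" using q_ge_2 by simp
  then obtain m where "m ^ (q - 1) = \<omega>" using nth_root_exists by blast
  then have m: "m ^ q = \<omega> * m" by (simp add: pow_q_minus_1)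
  have \<omega>nz: "\<omega> \<noteq> 0" using \<omega> by auto
  \<comment> \<open>So \<open>c\<close> raised to \<open>(q - 1) (q^2 + 1)\<close> is \<omega>,
    which corrects \<delta>. Raising to the power \<open>q + 1\<close> gives
    \<open>c^(q^4 - 1) = 1\<close>, so conjugation by \<open>c\<close> keeps leading coefficients of
    degree 4.\<close>
  obtain c where "c ^ (q ^ 2 + 1) = m" using nth_root_exists[of "q ^ 2 + 1" m] by auto
  then have cm: "(c ^ q) ^ q * c = m" by (simp add: power_q2 mult.commute)
  have mnz: "m \<noteq> 0"
  proof
    assume "m = 0"
    then show False using \<open>m ^ (q - 1) = \<omega>\<close> \<omega>nz \<open>q - 1 > 0\<close> by (metis zero_power)
  qed
  then have cnz: "c \<noteq> 0" using cm by auto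
  have c31: "((c ^ q) ^ q) ^ q * c ^ q = \<omega> * ((c ^ q) ^ q * c)"
    using m unfolding cm[symmetric] by (simp only: power_mult_distrib)
  have c4: "(((c ^ q) ^ q) ^ q) ^ q = c"
  proof -
    have "(((c ^ q) ^ q) ^ q * c ^ q) ^ q = \<omega> ^ q * (((c ^ q) ^ q) ^ q * c ^ q)"
      unfolding c31[THEN arg_cong, of "\<lambda>z. z ^ q"] by (simp only: power_mult_distrib)
    also have "\<dots> = (\<omega> * \<omega> ^ q) * ((c ^ q) ^ q * c)" unfolding c31 by (simp only: ac_simps)
    finally have "(((c ^ q) ^ q) ^ q) ^ q * (c ^ q) ^ q = c * (c ^ q) ^ q"
      unfolding \<omega> by (simp add: power_mult_distrib mult.commute)
    then show ?thesis using cnz by simp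
  qed
  define d where "d = (c ^ q) ^ q"
  have dz: "d \<noteq> 0" using cnz by (simp add: d_def)
  define sc where "sc f = [:c:] \<star> f \<star> [:1 / c:]" for f
  have cc: "[:1 / c:] \<star> [:c:] = 1" "[:c:] \<star> [:1 / c:] = 1" "[:1 / d:] \<star> [:d:] = 1"
    using cnz dz by (simp_all add: star_pCons one_pCons)
  have sc_mult: "sc (f \<star> g) = sc f \<star> sc g" for f g
  proof -
    have "sc f \<star> sc g = [:c:] \<star> f \<star> ([:1 / c:] \<star> [:c:]) \<star> g \<star> [:1 / c:]"
      by (simp add: sc_def star_assoc)
    then show ?thesis by (simp add: cc sc_def star_assoc)
  qed
  have sc_smult: "sc (Polynomial.smult k f) = Polynomial.smult k (sc f)" for k f
    by (rule tw_eqI) (simp add: sc_def)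
  have sc_add: "sc (f + g) = sc f + sc g" for f g by (simp add: sc_def star_add_left star_add_right)
  have sc_EE: "sc (EE f) = EE (sc f)" for f
    by (rule tw_eqI) (use cnz in \<open>simp add: sc_def app_EE right_diff_distrib distrib_left mult.assoc\<close>)
  \<comment> \<open>The conjugation by \<open>c\<close> is split between the two factors by
    inserting \<open>d = c^(q^2)\<close>, the value for which \<open>P'\<close> stays monic.\<close>
  define P' where "P' = [:d:] \<star> P \<star> [:1 / c:]"
  define R' where "R' = [:c:] \<star> R \<star> [:1 / d:]"
  define N' where "N' = [:c:] \<star> Nn \<star> [:1 / d:]"
  have RP: "R' \<star> P' = sc (R \<star> P)" and NP: "N' \<star> P' = sc (Nn \<star> P)"
  proof -
    have "[:c:] \<star> f \<star> [:1 / d:] \<star> P' = [:c:] \<star> f \<star> ([:1 / d:] \<star> [:d:]) \<star> P \<star> [:1 / c:]" for f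
      by (simp add: P'_def star_assoc)
    then show "R' \<star> P' = sc (R \<star> P)" "N' \<star> P' = sc (Nn \<star> P)"
      by (simp_all add: R'_def N'_def cc sc_def star_assoc)
  qed
  have P'': "P' = [:d * \<delta> / c, d * \<alpha> / c ^ q, 1:]"
    using cnz dz by (simp add: P'_def P_def star_pCons power_divide d_def)
  have R'': "R' = [:c * r0 / d, c * r1 / d ^ q, 1:]"
    using cnz dz c4 by (simp add: R'_def R_def star_pCons power_divide d_def)
  have N'': "N' = [:c * n0 / d, c * n1 / d ^ q:]"
    using cnz dz by (simp add: N'_def Nn_def star_pCons power_divide d_def)
  define l where "l = c * n1 / d ^ q / \<zeta> ^ q"
  have l_l0: "l = c * l0 / d ^ q" by (simp add: l_def l0_def)
  have sq': "N' \<star> P' \<star> N' = EE (N' \<star> P') \<star> R'"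
  proof -
    have P'nz: "P' \<noteq> 0" by (simp add: P'')
    have "(N' \<star> P' \<star> N') \<star> P' = sc (Nn \<star> P) \<star> sc (Nn \<star> P)" by (simp add: NP star_assoc)
    also have "\<dots> = sc ((Nn \<star> P \<star> Nn) \<star> P)" by (simp add: sc_mult star_assoc)
    also have "\<dots> = (EE (N' \<star> P') \<star> R') \<star> P'"
      unfolding sq by (simp add: sc_mult star_assoc RP NP sc_EE)
    finally show ?thesis by (rule star_cancel_right[OF P'nz])
  qed
  have W': "sc (\<phi> yA) = Polynomial.smult (\<zeta> ^ q) (sc (\<phi> xA)) + N' \<star> P'"
    unfolding W by (simp add: sc_add sc_smult NP Nn_def P_def)
  have S': "sc (\<phi> xA) = R' \<star> P'" unfolding S by (simp add: RP R_def P_def)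
  have comm': "sc (\<phi> xA) \<star> sc (\<phi> yA) = sc (\<phi> yA) \<star> sc (\<phi> xA)" using comm by (metis sc_mult)
  have "\<nu> * l ^ q / l = d * \<delta> / c"
  proof -
    have lq: "l ^ q = c ^ q * l0 ^ q / c" using c4 by (simp add: l_l0 power_divide power_mult_distrib d_def)
    have "\<delta> = \<omega> * \<nu> * l0 ^ q / l0" using l0 by (simp add: \<omega>_def)
    moreover have "c ^ q * d ^ q = \<omega> * (d * c)" using c31 by (simp add: d_def mult.commute)
    moreover have "\<nu> * l ^ q / l = \<nu> * l0 ^ q / l0 * (c ^ q * d ^ q) / (c * c)"
      unfolding lq using cnz dz l0 by (simp add: l_l0 ac_simps)
    ultimately show ?thesis using cnz by simp
  qed
  moreover have "l \<noteq> 0" using cnz dz l0 by (simp add: l_l0)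
  ultimately have del: "d * \<delta> / c = del l" by (metis del_eq)
  note fam = shape_family[OF del _ _ sq'[unfolded P'' R'' N''] comm' S'[unfolded P'' R'']
      W'[unfolded P'' N''] l_def]
  have fam1: "sc (\<phi> xA) = Sx l" using fam(1) r0 n0 cnz dz by simp
  have "[:c:] \<star> \<phi> a = Phi l a \<star> [:c:]" if a: "a \<in> A" for a
  proof -
    have "Phi l a = sc (\<phi> a)"
      unfolding Phi_def
    proof (rule phi_of_eqI[OF Sx_0[OF \<open>l \<noteq> 0\<close>]])
      show "sc (\<phi> a) \<star> Sx l = Sx l \<star> sc (\<phi> a)"
        using drinfeld_commute[OF D a A_X] by (metis fam1 sc_mult)
      show "poly.coeff (sc (\<phi> a)) 0 = a" using cnz by (simp add: sc_def drinfeld_props(4)[OF D a])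
    qed (rule a)
    then show ?thesis by (simp add: sc_def star_assoc cc)
  qed
  then show ?thesis using that cnz \<open>l \<noteq> 0\<close> by blast
qed

end

context drinfeld_setup
begin

section \<open>Cyclic torsion submodules\<close>

definition "orb \<phi> \<mu> = {app (\<phi> a) \<mu> | a. a \<in> A}"
definition "gen \<phi> k \<mu> \<longleftrightarrow> (\<forall>a\<in>A. app (\<phi> a) \<mu> = 0 \<longleftrightarrow> a \<in> Ik k)"
text \<open>Used for \<mu> with annihilator \<open>Ik (Suc k)\<close>: the last nonzero layer of the
  cyclic module, a line over \<open>Fq q\<close>.\<close>

definition "soc \<phi> k \<mu> = {app (\<phi> a) \<mu> | a. a \<in> Ik k}"

lemma drinfeld_app:
  assumes "drinfeld_module q t \<zeta> r \<phi>"
  shows "a \<in> A \<Longrightarrow> b \<in> A \<Longrightarrow> app (\<phi> (a + b)) z = app (\<phi> a) z + app (\<phi> b) z"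
    and "a \<in> A \<Longrightarrow> b \<in> A \<Longrightarrow> app (\<phi> (a - b)) z = app (\<phi> a) z - app (\<phi> b) z"
    and "a \<in> A \<Longrightarrow> b \<in> A \<Longrightarrow> app (\<phi> (a * b)) z = app (\<phi> a) (app (\<phi> b) z)"
    and "k \<in> Fq q \<Longrightarrow> app (\<phi> k) z = k * z"
proof -
  note D = drinfeld_props[OF assms]
  show add: "a \<in> A \<Longrightarrow> b \<in> A \<Longrightarrow> app (\<phi> (a + b)) z = app (\<phi> a) z + app (\<phi> b) z" for a b by (simp add: D)
  show "a \<in> A \<Longrightarrow> b \<in> A \<Longrightarrow> app (\<phi> (a * b)) z = app (\<phi> a) (app (\<phi> b) z)" by (simp add: D)
  show "k \<in> Fq q \<Longrightarrow> app (\<phi> k) z = k * z" by (simp add: D)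
  show "a \<in> A \<Longrightarrow> b \<in> A \<Longrightarrow> app (\<phi> (a - b)) z = app (\<phi> a) z - app (\<phi> b) z"
    using add[of "a - b" b] by (simp add: A_diff)
qed

text \<open>A module isomorphic to \<open>A / n\<close> is a cyclic module with annihilator
  \<open>n\<close>; the generator is the image of the class of 1.\<close>

lemma primitive_torsion_iff:
  assumes D: "drinfeld_module q t \<zeta> r \<phi>" and idl: "ideal n AR"
  shows "primitive_torsion q t \<zeta> \<phi> n G \<longleftrightarrow>
    (\<exists>\<mu>. G = orb \<phi> \<mu> \<and> (\<forall>a\<in>A. app (\<phi> a) \<mu> = 0 \<longleftrightarrow> a \<in> n))"
proof -
  interpret n: ideal n AR by fact
  note np = ideal_AR_props[OF idl]
  note Dp = drinfeld_app[OF D]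
  define cls where "cls a = n +>\<^bsub>AR\<^esub> a" for a
  have carr: "carrier (AR Quot n) = cls ` A"
    by (auto simp: FactRing_def A_RCOSETS_def' cls_def)
  have cmult: "cls a \<otimes>\<^bsub>AR Quot n\<^esub> cls b = cls (a * b)" if "a \<in> A" "b \<in> A" for a b
    using n.rcoset_mult_add[of a b] that by (simp add: FactRing_def cls_def)
  have cadd: "cls a \<oplus>\<^bsub>AR Quot n\<^esub> cls b = cls (a + b)" if "a \<in> A" "b \<in> A" for a b
    using n.a_rcos_sum[of a b] that by (simp add: FactRing_def cls_def)
  have cls: "cls r = (\<lambda>h. h + r) ` n" for r by (auto simp: cls_def a_r_coset_def')
  have cls_eq: "cls r = cls r' \<longleftrightarrow> r - r' \<in> n" for r r'
  proof
    assume "cls r = cls r'"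
    moreover have "r \<in> cls r" using np(2) by (force simp: cls)
    ultimately obtain h where "h \<in> n" "r = h + r'" by (auto simp: cls)
    then show "r - r' \<in> n" by simp
  next
    assume d: "r - r' \<in> n"
    have "h + r = (h + (r - r')) + r'" "h + r' = (h + - (r - r')) + r" for h by simp_all
    then show "cls r = cls r'" unfolding cls
      using np(3)[OF _ d] np(3)[OF _ np(4)[OF d]] by (fastforce intro: image_eqI)
  qed
  show ?thesis
  proof
    assume "primitive_torsion q t \<zeta> \<phi> n G"
    then obtain h where bij: "bij_betw h (cls ` A) G"
      and lin: "\<forall>a\<in>A. \<forall>u\<in>cls ` A. h (cls a \<otimes>\<^bsub>AR Quot n\<^esub> u) = app (\<phi> a) (h u)"
      unfolding primitive_torsion_def Let_def carr cls_def[symmetric] AR_simps by blast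
    define \<mu> where "\<mu> = h (cls 1)"
    have h: "h (cls a) = app (\<phi> a) \<mu>" if "a \<in> A" for a
      using lin[rule_format, OF that, of "cls 1"] cmult[OF that, of 1] by (simp add: \<mu>_def)
    have "G = orb \<phi> \<mu>" using bij h by (force simp: bij_betw_def orb_def)
    moreover have "app (\<phi> a) \<mu> = 0 \<longleftrightarrow> a \<in> n" if a: "a \<in> A" for a
    proof -
      have "app (\<phi> a) \<mu> = 0 \<longleftrightarrow> h (cls a) = h (cls 0)" using a Dp(4)[of 0 \<mu>] by (simp add: h)
      also have "\<dots> \<longleftrightarrow> cls a = cls 0" using bij a inj_on_eq_iff[of h "cls ` A" "cls a" "cls 0"] by (auto simp: bij_betw_def)
      finally show ?thesis by (simp add: cls_eq)
    qed
    ultimately show "\<exists>\<mu>. G = orb \<phi> \<mu> \<and> (\<forall>a\<in>A. app (\<phi> a) \<mu> = 0 \<longleftrightarrow> a \<in> n)" by blast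
  next
    assume "\<exists>\<mu>. G = orb \<phi> \<mu> \<and> (\<forall>a\<in>A. app (\<phi> a) \<mu> = 0 \<longleftrightarrow> a \<in> n)"
    then obtain \<mu> where G: "G = orb \<phi> \<mu>" and ann: "\<And>a. a \<in> A \<Longrightarrow> app (\<phi> a) \<mu> = 0 \<longleftrightarrow> a \<in> n" by blast
    define h where "h u = app (\<phi> (SOME a. a \<in> A \<and> cls a = u)) \<mu>" for u
    have eq: "app (\<phi> a) \<mu> = app (\<phi> b) \<mu> \<longleftrightarrow> cls a = cls b" if "a \<in> A" "b \<in> A" for a b
      using ann[of "a - b"] that by (simp add: Dp cls_eq A_diff)
    have h: "h (cls a) = app (\<phi> a) \<mu>" if "a \<in> A" for a
    proof -
      have "(SOME b. b \<in> A \<and> cls b = cls a) \<in> A \<and> cls (SOME b. b \<in> A \<and> cls b = cls a) = cls a"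
        by (rule someI[of _ a]) (use that in simp)
      then show ?thesis unfolding h_def using that eq by blast
    qed
    have orb: "orb \<phi> \<mu> = (\<lambda>a. app (\<phi> a) \<mu>) ` A" by (auto simp: orb_def)
    have "h ` cls ` A = G" unfolding G orb image_image by (rule image_cong) (simp_all add: h)
    then have "bij_betw h (cls ` A) G"
      by (auto simp: bij_betw_def inj_on_def h eq)
    moreover have "G \<subseteq> torsion q \<phi> n"
    proof
      fix z assume "z \<in> G"
      then obtain a where a: "a \<in> A" "z = app (\<phi> a) \<mu>" by (auto simp: G orb_def)
      have "app (\<phi> f) z = 0" if f: "f \<in> n" for f
      proof -
        have fA: "f \<in> A" using f np(1) by blast
        have "app (\<phi> (f * a)) \<mu> = 0" using ann[of "f * a"] np(5)[OF a(1) f] a fA by (simp add: A_mult mult.commute)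
        then show ?thesis using a fA by (simp add: Dp)
      qed
      then show "z \<in> torsion q \<phi> n" by (simp add: torsion_def)
    qed
    moreover have "app (\<phi> 0) \<mu> = 0" using Dp(4)[of 0 \<mu>] by simp
    then have "0 \<in> G" unfolding G orb by (metis A_0 imageI)
    moreover have "z + w \<in> G" if zw: "z \<in> G" "w \<in> G" for z w
    proof -
      obtain a b where "a \<in> A" "b \<in> A" "z = app (\<phi> a) \<mu>" "w = app (\<phi> b) \<mu>" using zw by (auto simp: G orb_def)
      then show ?thesis unfolding G orb_def using Dp(1)[of a b \<mu>] by (metis (mono_tags, lifting) A_add mem_Collect_eq)
    qed
    moreover have "app (\<phi> a) z \<in> G" if az: "a \<in> A" "z \<in> G" for a z
    proof -
      obtain b where "b \<in> A" "z = app (\<phi> b) \<mu>" using az by (auto simp: G orb_def)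
      then show ?thesis unfolding G orb_def using Dp(3)[of a b \<mu>] az(1) by (metis (mono_tags, lifting) A_mult mem_Collect_eq)
    qed
    moreover have "h (cls a \<oplus>\<^bsub>AR Quot n\<^esub> cls b) = h (cls a) + h (cls b)" if "a \<in> A" "b \<in> A" for a b
      using that by (simp add: cadd h A_add Dp)
    moreover have "h (cls a \<otimes>\<^bsub>AR Quot n\<^esub> cls b) = app (\<phi> a) (h (cls b))" if "a \<in> A" "b \<in> A" for a b
      using that by (simp add: cmult h A_mult Dp)
    ultimately show "primitive_torsion q t \<zeta> \<phi> n G"
      unfolding primitive_torsion_def Let_def carr cls_def[symmetric] by auto
  qed
qed

lemma primitive_torsion_gen:
  assumes "drinfeld_module q t \<zeta> r \<phi>"
  shows "primitive_torsion q t \<zeta> \<phi> (Ik k) G \<longleftrightarrow> (\<exists>\<mu>. G = orb \<phi> \<mu> \<and> gen \<phi> k \<mu>)"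
  by (simp add: primitive_torsion_iff[OF assms ideal_Ik] gen_def)

text \<open>The annihilator of a point is an ideal, so \<open>family_torsion\<close> for the two
  generators suffices.\<close>

lemma I_kills:
  assumes l: "l \<noteq> 0"
  shows "app (Pp l) z = 0 \<longleftrightarrow> (\<forall>i\<in>II. app (Phi l i) z = 0)"
proof
  note D = family_drinfeld(1)[OF l]
  note Dp = drinfeld_app[OF D]
  assume "app (Pp l) z = 0"
  then have xy: "app (Phi l xA) z = 0" "app (Phi l yA) z = 0"
    using family_torsion[OF l, of z] by (simp_all add: family_drinfeld(4,5)[OF l])
  define L where "L = {i \<in> A. app (Phi l i) z = 0}"
  have "ideal L AR"
    by (rule idealI_AR) (use Dp(4)[of 0 z] in \<open>auto simp: L_def Dp A_add A_mult\<close>)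
  moreover have "{xA, yA} \<subseteq> L" using xy by (auto simp: L_def)
  ultimately have "II \<subseteq> L" unfolding I_inf_def by (rule AR.genideal_minimal)
  then show "\<forall>i\<in>II. app (Phi l i) z = 0" by (auto simp: L_def)
next
  assume "\<forall>i\<in>II. app (Phi l i) z = 0"
  then show "app (Pp l) z = 0"
    using X_in_I Y_in_I family_torsion[OF l, of z] family_drinfeld(4,5)[OF l] by metis
qed

context
  fixes l u :: 'a
  assumes l: "l \<noteq> 0" and u: "u * u ^ q + alpha q t \<zeta> \<nu> l * u + del l = 0"
begin

interpretation c: drinfeld_setup q t "\<zeta> ^ q" "\<nu>'" by (rule conj)

lemmas Dp = drinfeld_app[OF family_drinfeld(1)[OF l]]

lemma iso_app: "a \<in> A \<Longrightarrow> app (c.Phi (lnext l u) a) (app [:- u, 1:] z) = app [:- u, 1:] (app (Phi l a) z)"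
  using isogeny[OF l u, of a] by (metis tw_app_mult)

lemma Pp_app: "app (Pp l) z = app [:- vv l u, 1:] (app [:- u, 1:] z)"
  using Pp_factor[OF l u] by (metis tw_app_mult vv_def[OF l u])

lemma kerg_kills: "app [:- u, 1:] z = 0 \<Longrightarrow> i \<in> II \<Longrightarrow> app (Phi l i) z = 0"
  using I_kills[OF l, of z] by (simp add: Pp_app del: tw_app_pCons)

text \<open>When the kernel of \<open>\<tau> - u\<close> is contained in the cyclic module, as its
  last layer, the module is the full preimage of its image.\<close>

lemma orb_preimage:
  assumes "soc (Phi l) k \<mu> = {z. app [:- u, 1:] z = 0}"
  shows "orb (Phi l) \<mu> = {z. app [:- u, 1:] z \<in> c.orb (c.Phi (lnext l u)) (app [:- u, 1:] \<mu>)}"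
proof (intro equalityI subsetI)
  fix z assume "z \<in> orb (Phi l) \<mu>"
  then obtain a where "a \<in> A" "z = app (Phi l a) \<mu>" by (auto simp: orb_def)
  then show "z \<in> {z. app [:- u, 1:] z \<in> c.orb (c.Phi (lnext l u)) (app [:- u, 1:] \<mu>)}"
    unfolding c.orb_def by (auto simp: iso_app simp del: tw_app_pCons intro!: exI[of _ a])
next
  fix z assume "z \<in> {z. app [:- u, 1:] z \<in> c.orb (c.Phi (lnext l u)) (app [:- u, 1:] \<mu>)}"
  then obtain a where a: "a \<in> A" "app [:- u, 1:] z = app (c.Phi (lnext l u) a) (app [:- u, 1:] \<mu>)" by (auto simp: c.orb_def)
  then have "app [:- u, 1:] (z - app (Phi l a) \<mu>) = 0" by (simp add: iso_app del: tw_app_pCons)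
  then obtain b where b: "b \<in> Ik k" "z - app (Phi l a) \<mu> = app (Phi l b) \<mu>"
    using assms unfolding soc_def by blast
  then have "b \<in> A" using Ik_subset_A by blast
  then have "z = app (Phi l (b + a)) \<mu>" using b(2) a by (simp add: Dp algebra_simps)
  then show "z \<in> orb (Phi l) \<mu>" using \<open>b \<in> A\<close> a unfolding orb_def by blast
qed

lemma soc_eq_kerg:
  assumes sub: "\<And>a. a \<in> Ik k \<Longrightarrow> app [:- u, 1:] (app (Phi l a) \<mu>) = 0"
    and ex: "a0 \<in> Ik k" "app (Phi l a0) \<mu> \<noteq> 0"
  shows "soc (Phi l) k \<mu> = {z. app [:- u, 1:] z = 0}"
proof (intro equalityI subsetI)
  fix z assume "z \<in> soc (Phi l) k \<mu>"
  then show "z \<in> {z. app [:- u, 1:] z = 0}" using sub by (auto simp: soc_def)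
next
  fix z assume "z \<in> {z. app [:- u, 1:] z = 0}"
  then have "z ^ q = u * z" using ker_linear by blast
  moreover have "app (Phi l a0) \<mu> ^ q = u * app (Phi l a0) \<mu>" using sub[OF ex(1)] ker_linear by blast
  ultimately obtain k' where k': "k' \<in> Fq q" "z = k' * app (Phi l a0) \<mu>" using Fq_ratio ex(2) by metis
  then have "z = app (Phi l (k' * a0)) \<mu>" using ex(1) Ik_subset_A[of k] by (simp add: Dp A_Fq subset_iff)
  moreover have "k' * a0 \<in> Ik k" using k' ex(1) ideal_AR_props(5)[OF ideal_Ik] by blast
  ultimately show "z \<in> soc (Phi l) k \<mu>" unfolding soc_def by blast
qed

text \<open>Lifting a generator along an isogeny. That \<open>Ik (Suc k)\<close> kills \<mu> is
  immediate; the point is that \<open>Ik k\<close> does not. For \<open>k = 0\<close> this is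
  \<open>\<mu> \<noteq> 0\<close>, otherwise it is where the exclusion of the dual isogeny
  enters.\<close>

lemma gen_up:
  assumes gen: "c.gen (c.Phi (lnext l u)) k (app [:- u, 1:] \<mu>)" and k0: "k = 0 \<Longrightarrow> \<mu> \<noteq> 0"
    and nb: "\<And>j. k = Suc j \<Longrightarrow> \<exists>u2. u2 \<noteq> 0 \<and> u2 \<noteq> vv l u \<and> c.soc (c.Phi (lnext l u)) j (app [:- u, 1:] \<mu>) = {z. app [:- u2, 1:] z = 0}"
  shows "gen (Phi l) (Suc k) \<mu>" "soc (Phi l) k \<mu> = {z. app [:- u, 1:] z = 0}"
proof -
  have IA: "a \<in> Ik j \<Longrightarrow> a \<in> A" for a j using Ik_subset_A by blast
  have gen': "a \<in> A \<Longrightarrow> app (c.Phi (lnext l u) a) (app [:- u, 1:] \<mu>) = 0 \<longleftrightarrow> a \<in> Ik k" for a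
    using gen by (simp add: c.gen_def del: tw_app_pCons)
  have 2: "app [:- u, 1:] (app (Phi l a) \<mu>) = 0" if "a \<in> Ik k" for a
    using gen'[of a] IA[OF that] that by (simp add: iso_app del: tw_app_pCons)
  have 3: "app (Phi l a) \<mu> = 0" if "a \<in> Ik (Suc k)" for a
    using that
  proof (induction rule: Ik_Suc_induct)
    case (prod a b)
    have "app (Phi l (b * a)) \<mu> = 0"
      using kerg_kills[OF 2[OF prod(1)] prod(2)] prod IA I_subset_A by (simp add: Dp subset_iff)
    then show ?case by (simp add: mult.commute)
  next
    case (add a b)
    then show ?case by (simp add: Dp IA)
  qed
  have "\<exists>a\<in>Ik k. app (Phi l a) \<mu> \<noteq> 0"
  proof (cases k)
    case 0
    then show ?thesis using k0 Dp(4)[of 1 \<mu>] by (intro bexI[of _ 1]) (auto simp: Ik_0)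
  next
    case (Suc j)
    then obtain u2 where u2: "u2 \<noteq> 0" "u2 \<noteq> vv l u" "c.soc (c.Phi (lnext l u)) j (app [:- u, 1:] \<mu>) = {z. app [:- u2, 1:] z = 0}"
      using nb by blast
    \<comment> \<open>A nonzero \<open>e2\<close> of the last layer of the image lies outside the
      kernel of \<open>\<tau> - vv\<close>, since \<open>u2 \<noteq> vv l u\<close>. Its preimage
      \<open>m\<close> is therefore not in the kernel of \<open>Pp l\<close>, and some element of
      \<open>II\<close> does not kill it.\<close>
    have "q - 1 > 0" using q_ge_2 by simp
    then obtain e2 where e2: "e2 ^ (q - 1) = u2" using nth_root_exists by blast
    then have e2': "e2 ^ q = u2 * e2" by (simp add: pow_q_minus_1)
    have "e2 \<noteq> 0" using e2 u2(1) \<open>q - 1 > 0\<close> by (metis zero_power)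
    have "e2 \<in> c.soc (c.Phi (lnext l u)) j (app [:- u, 1:] \<mu>)" unfolding u2(3) using e2' ker_linear by blast
    then obtain b where b: "b \<in> Ik j" "e2 = app (c.Phi (lnext l u) b) (app [:- u, 1:] \<mu>)" by (auto simp: c.soc_def)
    define m where "m = app (Phi l b) \<mu>"
    have gm: "app [:- u, 1:] m = e2" using b IA by (simp add: m_def iso_app del: tw_app_pCons)
    have "app (Pp l) m \<noteq> 0"
    proof
      assume "app (Pp l) m = 0"
      then have "app [:- vv l u, 1:] e2 = 0" unfolding Pp_app gm .
      then have "e2 ^ q = vv l u * e2" using ker_linear by blast
      then show False using e2' u2(2) \<open>e2 \<noteq> 0\<close> by simp
    qed
    then obtain i where i: "i \<in> II" "app (Phi l i) m \<noteq> 0" using I_kills[OF l] by blast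
    have "b * i \<in> Ik k" unfolding Suc using Ik_SucI b(1) i(1) by blast
    moreover have "app (Phi l (i * b)) \<mu> = app (Phi l i) m" using i(1) I_subset_A IA[OF b(1)] by (auto simp: m_def Dp)
    ultimately show ?thesis using i(2) by (intro bexI[of _ "b * i"]) (simp_all add: mult.commute)
  qed
  then obtain a0 where a0: "a0 \<in> Ik k" "app (Phi l a0) \<mu> \<noteq> 0" by blast
  show "soc (Phi l) k \<mu> = {z. app [:- u, 1:] z = 0}" by (rule soc_eq_kerg[OF 2 a0])
  \<comment> \<open>By \<open>Ik_decomp\<close> only \<open>yA ^ k\<close> matters modulo
    \<open>Ik (Suc k)\<close>; once it acts nontrivially the annihilator cannot be larger than
    \<open>Ik (Suc k)\<close>.\<close>
  have Yk: "app (Phi l (yA ^ k)) \<mu> \<noteq> 0"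
  proof
    assume *: "app (Phi l (yA ^ k)) \<mu> = 0"
    obtain c b where cb: "c \<in> Fq q" "b \<in> Ik (Suc k)" "a0 = c * yA ^ k + b" using Ik_decomp[OF a0(1)] .
    then have "app (Phi l a0) \<mu> = 0" using 3[OF cb(2)] * IA by (simp add: Dp A_Fq A_pow A_mult)
    then show False using a0(2) by simp
  qed
  show "gen (Phi l) (Suc k) \<mu>"
    unfolding gen_def
  proof (intro ballI iffI)
    fix a assume a: "a \<in> A" "app (Phi l a) \<mu> = 0"
    then have "a \<in> Ik k" using gen'[OF a(1)] by (simp add: iso_app del: tw_app_pCons)
    then obtain c b where cb: "c \<in> Fq q" "b \<in> Ik (Suc k)" "a = c * yA ^ k + b" by (rule Ik_decomp)
    have "app (Phi l a) \<mu> = c * app (Phi l (yA ^ k)) \<mu>"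
      using cb 3[OF cb(2)] IA by (simp add: Dp A_Fq A_pow A_mult)
    then have "c = 0" using a(2) Yk by simp
    then show "a \<in> Ik (Suc k)" using cb by simp
  qed (use 3 in blast)
qed

end

text \<open>The nonzero element \<open>e\<close>, the image of \<mu> under \<open>yA ^ k\<close>,
  spans the last layer and lies in the kernel of \<open>Pp l\<close>; so \<open>u\<close> is its
  power \<open>q - 1\<close>. If the next isogeny were the dual one, \<open>Pp l\<close> would kill
  the image of \<mu> under \<open>yA ^ (k - 1)\<close>, and \<open>e\<close> would vanish.\<close>

lemma gen_down:
  assumes l: "l \<noteq> 0" and gen: "gen (Phi l) (Suc k) \<mu>"
  obtains u where "u * u ^ q + alpha q t \<zeta> \<nu> l * u + del l = 0"
    "soc (Phi l) k \<mu> = {z. app [:- u, 1:] z = 0}"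
    "drinfeld_setup.gen q t (\<zeta> ^ q) (drinfeld_setup.Phi q t (\<zeta> ^ q) \<nu>' (lnext l u)) k (app [:- u, 1:] \<mu>)"
    "\<And>j u2. k = Suc j \<Longrightarrow> drinfeld_setup.soc q t (\<zeta> ^ q) (drinfeld_setup.Phi q t (\<zeta> ^ q) \<nu>' (lnext l u)) j (app [:- u, 1:] \<mu>)
        = {z. app [:- u2, 1:] z = 0} \<Longrightarrow> u2 \<noteq> vv l u"
proof -
  interpret c: drinfeld_setup q t "\<zeta> ^ q" "\<nu>'" by (rule conj)
  note Dp = drinfeld_app[OF family_drinfeld(1)[OF l]]
  have IA: "a \<in> Ik j \<Longrightarrow> a \<in> A" for a j using Ik_subset_A by blast
  have gen': "a \<in> A \<Longrightarrow> app (Phi l a) \<mu> = 0 \<longleftrightarrow> a \<in> Ik (Suc k)" for a using gen by (simp add: gen_def)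
  define e where "e = app (Phi l (yA ^ k)) \<mu>"
  have enz: "e \<noteq> 0" using gen'[of "yA ^ k"] Y_pow_notin_Ik by (simp add: e_def A_pow)
  have I_soc: "app (Phi l i) (app (Phi l a) \<mu>) = 0" if "a \<in> Ik k" "i \<in> II" for a i
  proof -
    have "app (Phi l (i * a)) \<mu> = 0"
      using gen'[of "i * a"] Ik_SucI[OF that] that IA I_subset_A by (auto simp: mult.commute A_mult subset_iff)
    then show ?thesis using that IA I_subset_A by (simp add: Dp subset_iff)
  qed
  have Pe: "app (Pp l) e = 0" using I_kills[OF l, of e] I_soc[OF Y_pow_in_Ik] by (simp add: e_def)
  define u where "u = e ^ q / e"
  have eq: "e ^ q = u * e" using enz by (simp add: u_def)
  have "(u * u ^ q + alpha q t \<zeta> \<nu> l * u + del l) * e = app (Pp l) e"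
    by (simp add: Pp_def eq power_mult_distrib algebra_simps)
  then have u: "u * u ^ q + alpha q t \<zeta> \<nu> l * u + del l = 0" using Pe enz by (metis mult_eq_0_iff)
  have ge: "app [:- u, 1:] e = 0" using eq ker_linear by blast
  have sub: "app [:- u, 1:] (app (Phi l a) \<mu>) = 0" if a: "a \<in> Ik k" for a
  proof -
    obtain c b where cb: "c \<in> Fq q" "b \<in> Ik (Suc k)" "a = c * yA ^ k + b" using Ik_decomp[OF a] .
    have "app (Phi l b) \<mu> = 0" using gen'[OF IA[OF cb(2)]] cb(2) by blast
    then have "app (Phi l a) \<mu> = c * e" using cb IA by (simp add: Dp A_Fq A_pow A_mult e_def)
    then show ?thesis using ge tw_app_scale[OF cb(1), of "[:- u, 1:]" e] by (metis mult_zero_right)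
  qed
  have soc: "soc (Phi l) k \<mu> = {z. app [:- u, 1:] z = 0}"
    by (rule soc_eq_kerg[OF l u sub Y_pow_in_Ik]) (use enz in \<open>simp_all add: e_def\<close>)
  have cgen: "c.gen (c.Phi (lnext l u)) k (app [:- u, 1:] \<mu>)"
    unfolding c.gen_def conj_simps
  proof
    fix a assume a: "a \<in> A"
    have "app (c.Phi (lnext l u) a) (app [:- u, 1:] \<mu>) = 0 \<longleftrightarrow> app (Phi l a) \<mu> \<in> soc (Phi l) k \<mu>"
      unfolding soc iso_app[OF l u a] by blast
    also have "\<dots> \<longleftrightarrow> (\<exists>b\<in>Ik k. app (Phi l (a - b)) \<mu> = 0)"
      using a IA by (auto simp: soc_def Dp)
    also have "\<dots> \<longleftrightarrow> (\<exists>b\<in>Ik k. a - b \<in> Ik (Suc k))" using gen' a IA by (meson A_diff)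
    also have "\<dots> \<longleftrightarrow> a \<in> Ik k"
    proof
      assume "\<exists>b\<in>Ik k. a - b \<in> Ik (Suc k)"
      then obtain b where "b \<in> Ik k" "a - b \<in> Ik k" using Ik_Suc_subset by blast
      then have "(a - b) + b \<in> Ik k" by (intro ideal_AR_props(3)[OF ideal_Ik])
      then show "a \<in> Ik k" by simp
    next
      assume "a \<in> Ik k"
      then show "\<exists>b\<in>Ik k. a - b \<in> Ik (Suc k)"
        using ideal_AR_props(2)[OF ideal_Ik] by (intro bexI[of _ a]) auto
    qed
    finally show "app (c.Phi (lnext l u) a) (app [:- u, 1:] \<mu>) = 0 \<longleftrightarrow> a \<in> Ik k" .
  qed
  have "u2 \<noteq> vv l u" if k: "k = Suc j"
    and s2: "c.soc (c.Phi (lnext l u)) j (app [:- u, 1:] \<mu>) = {z. app [:- u2, 1:] z = 0}" for j u2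
  proof
    assume u2: "u2 = vv l u"
    define m where "m = app (Phi l (yA ^ j)) \<mu>"
    have "app [:- u, 1:] m \<in> c.soc (c.Phi (lnext l u)) j (app [:- u, 1:] \<mu>)"
      unfolding c.soc_def conj_simps m_def
      using iso_app[OF l u, of "yA ^ j" \<mu>] Y_pow_in_Ik[of j] A_pow[OF A_Y, of j]
      by (metis (mono_tags, lifting) mem_Collect_eq)
    then have "app (Pp l) m = 0" unfolding s2 u2 Pp_app[OF l u] by blast
    then have "app (Phi l yA) m = 0" using I_kills[OF l] Y_in_I by blast
    then have "app (Phi l (yA * yA ^ j)) \<mu> = 0" by (simp add: Dp A_pow m_def)
    then show False using enz by (simp add: e_def k)
  qed
  then show ?thesis using that[OF u soc cgen] by blast
qed

end

section \<open>The tower\<close>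

text \<open>\<open>u_of\<close> recovers from consecutive coordinates \<open>l, l'\<close> the isogeny \<open>\<tau> - u\<close> that connects the two
  Drinfeld modules. A tower point is a chain of such isogenies between members of the family and of its
  conjugate in turn, in which no isogeny is followed by its dual.\<close>

definition u_of :: "nat \<Rightarrow> 'a::field \<Rightarrow> 'a \<Rightarrow> 'a \<Rightarrow> 'a" where
  "u_of q \<zeta> l l' = (l' - l ^ q) / (1 - \<zeta> ^ q / \<zeta>)"

definition isog :: "nat \<Rightarrow> 'a::field \<Rightarrow> 'a \<Rightarrow> 'a \<Rightarrow> 'a \<Rightarrow> 'a \<Rightarrow> bool" where
  "isog q t \<zeta> \<nu> l l' \<longleftrightarrow> (let u = u_of q \<zeta> l l' in
     u * u ^ q + alpha q t \<zeta> \<nu> l * u + \<nu> * l ^ (q - 1) = 0)"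

definition nonback :: "nat \<Rightarrow> 'a::field \<Rightarrow> 'a \<Rightarrow> 'a \<Rightarrow> 'a \<Rightarrow> 'a \<Rightarrow> bool" where
  "nonback q \<zeta> \<nu> l l' l'' \<longleftrightarrow> u_of q (\<zeta> ^ q) l' l'' \<noteq> \<nu> * l ^ (q - 1) / u_of q \<zeta> l l'"

fun chain :: "nat \<Rightarrow> 'a::field \<Rightarrow> 'a \<Rightarrow> 'a \<Rightarrow> 'a list \<Rightarrow> bool" where
  "chain q t \<zeta> \<nu> [] = False"
| "chain q t \<zeta> \<nu> [l] = (l \<noteq> 0)"
| "chain q t \<zeta> \<nu> (l # l' # ls) = (l \<noteq> 0 \<and> isog q t \<zeta> \<nu> l l' \<and>
     (case ls of [] \<Rightarrow> True | l'' # _ \<Rightarrow> nonback q \<zeta> \<nu> l l' l'') \<and>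
     chain q t (\<zeta> ^ q) (- (x_elt q t \<zeta> / \<nu>)) (l' # ls))"

fun kernel :: "nat \<Rightarrow> 'a::field \<Rightarrow> 'a list \<Rightarrow> 'a set" where
  "kernel q \<zeta> [] = {0}"
| "kernel q \<zeta> [l] = {0}"
| "kernel q \<zeta> (l # l' # ls) = {z. tw_app q [:- u_of q \<zeta> l l', 1:] z \<in> kernel q (\<zeta> ^ q) (l' # ls)}"

context drinfeld_setup
begin

lemma s_nz [simp]: "1 - \<zeta> ^ q / \<zeta> \<noteq> 0" "1 - \<zeta> / \<zeta> ^ q \<noteq> 0"
  by (simp_all add: divide_eq_1_iff)

lemma lnext_u_of [simp]: "lnext l (u_of q \<zeta> l l') = l'"
  by (simp add: lnext_def u_of_def)

lemma isog_iff: "isog q t \<zeta> \<nu> l l' \<longleftrightarrow>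
    u_of q \<zeta> l l' * u_of q \<zeta> l l' ^ q + alpha q t \<zeta> \<nu> l * u_of q \<zeta> l l' + del l = 0"
  by (simp add: isog_def Let_def)

lemma u_of_lnext [simp]: "u_of q \<zeta> l (lnext l u) = u"
  by (simp add: lnext_def u_of_def)

lemma nonback_iff:
  assumes "l \<noteq> 0" "isog q t \<zeta> \<nu> l l'"
  shows "nonback q \<zeta> \<nu> l l' l'' \<longleftrightarrow> u_of q (\<zeta> ^ q) l' l'' \<noteq> vv l (u_of q \<zeta> l l')"
  using vv_def[OF assms(1) assms(2)[unfolded isog_iff]] by (simp add: nonback_def)

lemma isog_nz: "l \<noteq> 0 \<Longrightarrow> isog q t \<zeta> \<nu> l l' \<Longrightarrow> l' \<noteq> 0 \<and> u_of q \<zeta> l l' \<noteq> 0"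
  using lnext_nz[of l "u_of q \<zeta> l l'"] u_nz[of l "u_of q \<zeta> l l'"] by (simp add: isog_iff)

lemma chain_hd: "chain q t \<zeta> \<nu> ls \<Longrightarrow> hd ls \<noteq> 0"
  by (cases "(q, t, \<zeta>, \<nu>, ls)" rule: chain.cases) auto

end

text \<open>Induction from the far end of the chain by \<open>gen_up\<close>. The clause on the last
  layer is carried along because the condition \<open>nonback\<close> of the next step is tested
  against it.\<close>

lemma chain_gen:
  fixes \<zeta> \<nu> :: "'a::alg_closed_field"
  assumes "drinfeld_setup q t \<zeta> \<nu>" "chain q t \<zeta> \<nu> ls"
  shows "\<exists>\<mu>. drinfeld_setup.gen q t \<zeta> (drinfeld_setup.Phi q t \<zeta> \<nu> (hd ls)) (length ls - 1) \<mu> \<and>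
    kernel q \<zeta> ls = drinfeld_setup.orb q t \<zeta> (drinfeld_setup.Phi q t \<zeta> \<nu> (hd ls)) \<mu> \<and>
    (\<forall>l l' r. ls = l # l' # r \<longrightarrow> drinfeld_setup.soc q t \<zeta> (drinfeld_setup.Phi q t \<zeta> \<nu> l) (length r) \<mu>
       = {z. tw_app q [:- u_of q \<zeta> l l', 1:] z = 0})"
  using assms
proof (induction ls arbitrary: \<zeta> \<nu>)
  case (Cons l ls)
  interpret drinfeld_setup q t \<zeta> \<nu> by fact
  interpret c: drinfeld_setup q t "\<zeta> ^ q" "\<nu>'" by (rule conj)
  have l: "l \<noteq> 0" using chain_hd[OF Cons.prems(2)] by simp
  note Dp = drinfeld_app[OF family_drinfeld(1)[OF l]]
  show ?case
  proof (cases ls)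
    case Nil
    have "gen (Phi l) 0 0" by (simp add: gen_def Ik_0)
    moreover have "orb (Phi l) 0 = {0}" unfolding orb_def by (auto intro: exI[of _ 0])
    ultimately show ?thesis using Nil by auto
  next
    case (Cons l' r)
    define u where "u = u_of q \<zeta> l l'"
    have isg: "isog q t \<zeta> \<nu> l l'" and ch: "chain q t (\<zeta> ^ q) \<nu>' ls"
      and nb: "case r of [] \<Rightarrow> True | l'' # _ \<Rightarrow> nonback q \<zeta> \<nu> l l' l''"
      using Cons.prems(2) by (simp_all add: Cons)
    note ueq = isg[unfolded isog_iff, folded u_def]
    have l': "lnext l u = l'" by (simp add: u_def)
    from Cons.IH[OF conj ch] obtain \<mu>' where gen: "c.gen (c.Phi l') (length r) \<mu>'"
      and ker: "kernel q (\<zeta> ^ q) ls = c.orb (c.Phi l') \<mu>'"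
      and soc: "\<And>l'' r'. r = l'' # r' \<Longrightarrow> c.soc (c.Phi l') (length r') \<mu>' = {z. app [:- u_of q (\<zeta> ^ q) l' l'', 1:] z = 0}"
      by (auto simp: Cons)
    \<comment> \<open>Any preimage of \<open>\<mu>'\<close> will do, except at the end of the chain,
      where \<open>\<mu>' = 0\<close> and a nonzero element of the kernel has to be taken.\<close>
    have "\<exists>\<mu>. app [:- u, 1:] \<mu> = \<mu>' \<and> (length r = 0 \<longrightarrow> \<mu> \<noteq> 0)"
    proof (cases "length r = 0")
      case True
      then have "\<mu>' = 0" using gen c.drinfeld_app(4)[OF c.family_drinfeld(1), of l' 1 \<mu>'] c.isog_nz isog_nz[OF l isg]
        by (auto simp: c.gen_def Ik_0)
      have "q - 1 > 0" using q_ge_2 by simp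
      then obtain e where e: "e ^ (q - 1) = u" using nth_root_exists by blast
      then have "app [:- u, 1:] e = 0" by (simp add: pow_q_minus_1)
      moreover have "e \<noteq> 0" using e u_nz[OF l ueq] \<open>q - 1 > 0\<close> by (metis zero_power)
      ultimately show ?thesis using \<open>\<mu>' = 0\<close> by blast
    next
      case False
      then show ?thesis using tw_app_surj[of "[:- u, 1:]" \<mu>'] by auto
    qed
    then obtain \<mu> where \<mu>: "app [:- u, 1:] \<mu> = \<mu>'" "length r = 0 \<Longrightarrow> \<mu> \<noteq> 0" by blast
    have nb': "\<exists>u2. u2 \<noteq> 0 \<and> u2 \<noteq> vv l u \<and> c.soc (c.Phi l') j (app [:- u, 1:] \<mu>) = {z. app [:- u2, 1:] z = 0}"
      if j: "length r = Suc j" for j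
    proof -
      obtain l'' r' where r: "r = l'' # r'" "length r' = j" using j by (auto simp: length_Suc_conv)
      have "u_of q (\<zeta> ^ q) l' l'' \<noteq> 0"
        using c.isog_nz[of l' l''] isog_nz[OF l isg] ch by (simp add: Cons r)
      moreover have "u_of q (\<zeta> ^ q) l' l'' \<noteq> vv l u" using nb nonback_iff[OF l isg] by (simp add: r u_def)
      ultimately show ?thesis using soc[OF r(1)] r(2) unfolding \<mu>(1) by blast
    qed
    note up = gen_up[OF l ueq, unfolded l', of "length r" \<mu>, unfolded \<mu>(1), OF gen \<mu>(2) nb'[unfolded \<mu>(1)]]
    have "kernel q \<zeta> (l # ls) = orb (Phi l) \<mu>"
    proof -
      have "kernel q \<zeta> (l # ls) = {z. app [:- u, 1:] z \<in> kernel q (\<zeta> ^ q) ls}" by (simp add: Cons u_def)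
      moreover have "orb (Phi l) \<mu> = {z. app [:- u, 1:] z \<in> c.orb (c.Phi l') \<mu>'}"
        using orb_preimage[OF l ueq up(2)] unfolding l' \<mu>(1) .
      ultimately show ?thesis unfolding ker by (simp only:)
    qed
    then show ?thesis using up by (intro exI[of _ \<mu>]) (auto simp: Cons u_def)
  qed
qed simp

text \<open>The I-torsion of a cyclic module is only a line. If \<open>z\<close> lies in it, its
  image is killed by the dual \<open>\<tau> - vv\<close> and, by induction, by the next
  \<open>\<tau> - u2\<close>; as these differ, the image is 0. Thus the group alone determines the
  first isogeny.\<close>

lemma kernel_inter:
  fixes \<zeta> \<nu> :: "'a::alg_closed_field"
  assumes "drinfeld_setup q t \<zeta> \<nu>" "chain q t \<zeta> \<nu> (l # l' # r)"
  shows "{z \<in> kernel q \<zeta> (l # l' # r). tw_app q (drinfeld_setup.Pp q t \<zeta> \<nu> l) z = 0} =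
    {z. tw_app q [:- u_of q \<zeta> l l', 1:] z = 0}"
  using assms
proof (induction r arbitrary: \<zeta> \<nu> l l')
  case Nil
  interpret drinfeld_setup q t \<zeta> \<nu> by fact
  have "l \<noteq> 0" "isog q t \<zeta> \<nu> l l'" using Nil.prems(2) by auto
  then show ?case using Pp_app[of l "u_of q \<zeta> l l'"] by (auto simp: isog_iff simp del: tw_app_pCons)
next
  case (Cons l'' r)
  interpret drinfeld_setup q t \<zeta> \<nu> by fact
  interpret c: drinfeld_setup q t "\<zeta> ^ q" "\<nu>'" by (rule conj)
  have l: "l \<noteq> 0" and isg: "isog q t \<zeta> \<nu> l l'" and nb: "nonback q \<zeta> \<nu> l l' l''"
    and ch: "chain q t (\<zeta> ^ q) \<nu>' (l' # l'' # r)" using Cons.prems(2) by auto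
  define u where "u = u_of q \<zeta> l l'"
  define u2 where "u2 = u_of q (\<zeta> ^ q) l' l''"
  note ueq = isg[unfolded isog_iff, folded u_def]
  have l': "lnext l u = l'" by (simp add: u_def)
  have u2: "u2 \<noteq> vv l u" using nb nonback_iff[OF l isg] by (simp add: u_def u2_def)
  note IH = Cons.IH[OF conj ch, folded u2_def]
  have cP: "app (c.Pp l') w = app [:- vv' l u, 1:] (app [:- vv l u, 1:] w)" for w
    using c_Pp[OF l ueq] unfolding l' by (metis tw_app_mult)
  have "app [:- u, 1:] z = 0" if z: "app [:- u, 1:] z \<in> kernel q (\<zeta> ^ q) (l' # l'' # r)" "app (Pp l) z = 0" for z
  proof -
    let ?w = "app [:- u, 1:] z"
    have v: "app [:- vv l u, 1:] ?w = 0" using z(2) Pp_app[OF l ueq] by metis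
    then have "app (c.Pp l') ?w = 0" by (simp only: cP tw_app_0)
    then have "app [:- u2, 1:] ?w = 0" using IH z(1) by blast
    with v have "?w ^ q = u2 * ?w" "?w ^ q = vv l u * ?w" using ker_linear by blast+
    then show ?thesis using u2 by (metis mult_cancel_right)
  qed
  moreover have "0 \<in> kernel q (\<zeta> ^ q) (l' # l'' # r)"
  proof -
    have "0 \<in> {z. app [:- u2, 1:] z = 0}" by simp
    then show ?thesis using IH by blast
  qed
  ultimately show ?case using Pp_app[OF l ueq] by (auto simp flip: u_def simp del: tw_app_pCons)
qed

lemma kernel_inj:
  fixes \<zeta> \<nu> :: "'a::alg_closed_field"
  assumes "drinfeld_setup q t \<zeta> \<nu>" "chain q t \<zeta> \<nu> ls" "chain q t \<zeta> \<nu> ls'" "length ls = length ls'"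
    "hd ls = hd ls'" "kernel q \<zeta> ls = kernel q \<zeta> ls'"
  shows "ls = ls'"
  using assms
proof (induction ls arbitrary: \<zeta> \<nu> ls')
  case (Cons l ls)
  interpret drinfeld_setup q t \<zeta> \<nu> by fact
  show ?case
  proof (cases ls)
    case Nil
    then show ?thesis using Cons.prems by (cases ls') auto
  next
    case (Cons l1 r)
    then have "length ls' = Suc (Suc (length r))" using Cons.prems(4) by simp
    then obtain x l1' r' where "ls' = x # l1' # r'" by (auto simp: length_Suc_conv)
    then have ls': "ls' = l # l1' # r'" using Cons.prems(5) by simp
    define u where "u = u_of q \<zeta> l l1"
    define u' where "u' = u_of q \<zeta> l l1'"
    have l: "l \<noteq> 0" "isog q t \<zeta> \<nu> l l1" using Cons.prems(2) by (auto simp: Cons)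
    have "{z. app [:- u, 1:] z = 0} = {z. app [:- u', 1:] z = 0}"
      using kernel_inter[OF Cons.prems(1), of l l1 r] kernel_inter[OF Cons.prems(1), of l l1' r']
        Cons.prems(2,3,6) unfolding Cons ls' u_def u'_def by metis
    moreover have "q - 1 > 0" using q_ge_2 by simp
    then obtain e where e: "e ^ (q - 1) = u" using nth_root_exists by blast
    then have eq: "e ^ q = u * e" by (simp add: pow_q_minus_1)
    ultimately have "e ^ q = u' * e" using ker_linear by blast
    moreover have "e \<noteq> 0" using e isog_nz[OF l] \<open>q - 1 > 0\<close> by (metis u_def zero_power)
    ultimately have uu: "u = u'" using eq by simp
    have "l1 = lnext l u" "l1' = lnext l u'" by (simp_all add: u_def u'_def)
    with uu have l1: "l1 = l1'" by simp
    have img: "kernel q (\<zeta> ^ q) (l1 # r'') = app [:- u, 1:] ` kernel q \<zeta> (l # l1 # r'')" for r''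
    proof (intro equalityI subsetI)
      fix z assume z: "z \<in> kernel q (\<zeta> ^ q) (l1 # r'')"
      obtain w where "app [:- u, 1:] w = z" using tw_app_surj[of "[:- u, 1:]" z] by auto
      then show "z \<in> app [:- u, 1:] ` kernel q \<zeta> (l # l1 # r'')" using z unfolding u_def by force
    qed (auto simp: u_def)
    have "kernel q (\<zeta> ^ q) (l1 # r) = kernel q (\<zeta> ^ q) (l1 # r')"
      unfolding img using Cons.prems(6) by (simp only: Cons ls' l1)
    then have "ls = l1 # r'"
      using Cons.prems by (intro Cons.IH[OF conj]) (auto simp: Cons ls' l1)
    then show ?thesis using ls' l1 by simp
  qed
qed auto

text \<open>Repeated use of \<open>gen_down\<close>; the clause on the last layer again supplies
  \<open>nonback\<close> for the preceding step.\<close>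

lemma chain_exists:
  fixes \<zeta> \<nu> :: "'a::alg_closed_field"
  assumes "drinfeld_setup q t \<zeta> \<nu>" "l \<noteq> 0"
    "drinfeld_setup.gen q t \<zeta> (drinfeld_setup.Phi q t \<zeta> \<nu> l) k \<mu>"
  shows "\<exists>ls. chain q t \<zeta> \<nu> ls \<and> hd ls = l \<and> length ls = Suc k \<and>
    kernel q \<zeta> ls = drinfeld_setup.orb q t \<zeta> (drinfeld_setup.Phi q t \<zeta> \<nu> l) \<mu> \<and>
    (\<forall>l' r. ls = l # l' # r \<longrightarrow> drinfeld_setup.soc q t \<zeta> (drinfeld_setup.Phi q t \<zeta> \<nu> l) (length r) \<mu>
       = {z. tw_app q [:- u_of q \<zeta> l l', 1:] z = 0})"
  using assms
proof (induction k arbitrary: \<zeta> \<nu> l \<mu>)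
  case 0
  interpret drinfeld_setup q t \<zeta> \<nu> by fact
  note Dp = drinfeld_app[OF family_drinfeld(1)[OF 0(2)]]
  have z: "app (Phi l a) \<mu> = 0" if "a \<in> A" for a using 0(3) that by (simp add: gen_def Ik_0)
  have "orb (Phi l) \<mu> = {0}" using z A_0 unfolding orb_def by force
  then show ?case using 0(2) by (intro exI[of _ "[l]"]) simp
next
  case (Suc k)
  interpret drinfeld_setup q t \<zeta> \<nu> by fact
  interpret c: drinfeld_setup q t "\<zeta> ^ q" "\<nu>'" by (rule conj)
  note l = Suc.prems(2)
  obtain u where ueq: "u * u ^ q + alpha q t \<zeta> \<nu> l * u + del l = 0"
    and soc: "soc (Phi l) k \<mu> = {z. app [:- u, 1:] z = 0}"
    and gen: "c.gen (c.Phi (lnext l u)) k (app [:- u, 1:] \<mu>)"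
    and nb: "\<And>j u2. k = Suc j \<Longrightarrow> c.soc (c.Phi (lnext l u)) j (app [:- u, 1:] \<mu>)
        = {z. app [:- u2, 1:] z = 0} \<Longrightarrow> u2 \<noteq> vv l u"
    using gen_down[OF l Suc.prems(3)] by metis
  define l' where "l' = lnext l u"
  have l': "l' \<noteq> 0" unfolding l'_def by (rule lnext_nz[OF l ueq])
  have u: "u_of q \<zeta> l l' = u" by (simp add: l'_def)
  have isg: "isog q t \<zeta> \<nu> l l'" using ueq by (simp add: isog_iff u)
  from Suc.IH[OF conj l' gen[folded l'_def]] obtain ls where ls: "chain q t (\<zeta> ^ q) \<nu>' ls" "hd ls = l'" "length ls = Suc k"
    "kernel q (\<zeta> ^ q) ls = c.orb (c.Phi l') (app [:- u, 1:] \<mu>)"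
    "\<forall>l'' r. ls = l' # l'' # r \<longrightarrow> c.soc (c.Phi l') (length r) (app [:- u, 1:] \<mu>)
       = {z. app [:- u_of q (\<zeta> ^ q) l' l'', 1:] z = 0}" by auto
  then obtain r where r: "ls = l' # r" by (cases ls) auto
  have "case r of [] \<Rightarrow> True | l'' # _ \<Rightarrow> nonback q \<zeta> \<nu> l l' l''"
  proof (cases r)
    case (Cons l'' r')
    then have "u_of q (\<zeta> ^ q) l' l'' \<noteq> vv l u"
      using ls(3,5) nb[of "length r'" "u_of q (\<zeta> ^ q) l' l''"] by (simp add: r l'_def)
    then show ?thesis using nonback_iff[OF l isg] by (simp add: Cons u)
  qed simp
  then have "chain q t \<zeta> \<nu> (l # ls)" using l isg ls(1) by (simp add: r)
  moreover have "kernel q \<zeta> (l # ls) = orb (Phi l) \<mu>"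
    using orb_preimage[OF l ueq soc] ls(4) by (simp add: r u l'_def)
  ultimately show ?case using ls(3) soc by (intro exI[of _ "l # ls"]) (auto simp: r u)
qed

text \<open>Multiplication by the ideal removes the last isogeny of the chain. For a chain of one
  isogeny this is \<open>kerg_kills\<close>; longer ones are compared after applying the first
  isogeny.\<close>

lemma kernel_butlast:
  fixes \<zeta> \<nu> :: "'a::alg_closed_field"
  assumes "drinfeld_setup q t \<zeta> \<nu>" "chain q t \<zeta> \<nu> ls" "length ls \<ge> 2"
  shows "kernel q \<zeta> (butlast ls) = {tw_app q (drinfeld_setup.Phi q t \<zeta> \<nu> (hd ls) z) m | m z. m \<in> kernel q \<zeta> ls \<and> z \<in> I_inf q t \<zeta>}"
  using assms
proof (induction ls arbitrary: \<zeta> \<nu>)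
  case (Cons l ls)
  interpret drinfeld_setup q t \<zeta> \<nu> by fact
  interpret c: drinfeld_setup q t "\<zeta> ^ q" "\<nu>'" by (rule conj)
  obtain l' r where ls: "ls = l' # r" using Cons.prems(3) by (cases ls) auto
  have l: "l \<noteq> 0" and isg: "isog q t \<zeta> \<nu> l l'" and ch: "chain q t (\<zeta> ^ q) \<nu>' ls"
    using Cons.prems(2) by (auto simp: ls)
  define u where "u = u_of q \<zeta> l l'"
  note ueq = isg[unfolded isog_iff, folded u_def]
  have l': "lnext l u = l'" by (simp add: u_def)
  note Dp = drinfeld_app[OF family_drinfeld(1)[OF l]]
  have 0: "0 \<in> II" using ideal_AR_props(2)[OF ideal_I] .
  show ?case
  proof (cases r)
    case Nil
    have kill: "app (Phi l z) m = 0" if "z \<in> II" "app [:- u, 1:] m = 0" for z m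
      using kerg_kills[OF l ueq that(2,1)] .
    have ker: "kernel q \<zeta> (l # ls) = {z. app [:- u, 1:] z = 0}"
      by (simp add: ls Nil u_def del: tw_app_pCons)
    have "0 \<in> {app (Phi l z) m | m z. m \<in> kernel q \<zeta> (l # ls) \<and> z \<in> II}"
      unfolding ker using 0 by (intro CollectI exI[of _ 0]) simp
    moreover have "w = 0" if "w \<in> {app (Phi l z) m | m z. m \<in> kernel q \<zeta> (l # ls) \<and> z \<in> II}" for w
      using that kill unfolding ker by blast
    ultimately have "{app (Phi l z) m | m z. m \<in> kernel q \<zeta> (l # ls) \<and> z \<in> II} = {0}" by blast
    then show ?thesis by (simp add: ls Nil)
  next
    case (Cons l'' r')
    have IH: "kernel q (\<zeta> ^ q) (butlast ls) = {app (c.Phi l' z) m | m z. m \<in> kernel q (\<zeta> ^ q) ls \<and> z \<in> II}"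
      using Cons.IH[OF conj ch] by (simp add: ls Cons)
    have bl: "kernel q \<zeta> (butlast (l # ls)) = {z. app [:- u, 1:] z \<in> kernel q (\<zeta> ^ q) (butlast ls)}"
      by (simp add: ls Cons u_def)
    have kl: "kernel q \<zeta> (l # ls) = {z. app [:- u, 1:] z \<in> kernel q (\<zeta> ^ q) ls}"
      by (simp add: ls u_def)
    obtain \<mu> where \<mu>: "kernel q \<zeta> (l # ls) = orb (Phi l) \<mu>" "soc (Phi l) (length r) \<mu> = {z. app [:- u, 1:] z = 0}"
      using chain_gen[OF Cons.prems(1,2)] by (auto simp: ls u_def)
    show ?thesis
    proof (intro equalityI subsetI)
      fix w assume "w \<in> kernel q \<zeta> (butlast (l # ls))"
      then obtain m' i where mi: "m' \<in> kernel q (\<zeta> ^ q) ls" "i \<in> II" "app [:- u, 1:] w = app (c.Phi l' i) m'"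
        unfolding bl IH by blast
      obtain m where m: "app [:- u, 1:] m = m'" using tw_app_surj[of "[:- u, 1:]" m'] by auto
      have iA: "i \<in> A" using mi(2) I_subset_A by blast
      \<comment> \<open>Up to an element of the kernel of \<open>\<tau> - u\<close>,
        \<open>w\<close> has the required form. That kernel is the layer
        \<open>Ik (length r)\<close> applied to \<mu>, and \<open>length r > 0\<close>, so the
        difference is absorbed by an element of \<open>II\<close>.\<close>
      have "app [:- u, 1:] (w - app (Phi l i) m) = 0"
        unfolding tw_app_diff mi(3) m[symmetric] using iso_app[OF l ueq iA, of m] by (simp only: l' diff_self)
      then obtain a where a: "a \<in> Ik (length r)" "w - app (Phi l i) m = app (Phi l a) \<mu>"
        using \<mu>(2) unfolding soc_def by blast
      have "m \<in> orb (Phi l) \<mu>" using mi(1) m kl \<mu>(1) by blast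
      then obtain b where b: "b \<in> A" "m = app (Phi l b) \<mu>" by (auto simp: orb_def)
      have aI: "a \<in> II"
      proof -
        have "Ik (Suc n) \<subseteq> II" for n
          by (induction n) (use Ik_1 Ik_Suc_subset in \<open>blast+\<close>)
        then show ?thesis using a(1) by (auto simp: Cons)
      qed
      then have aA: "a \<in> A" using I_subset_A by blast
      have "w = app (Phi l (i * b + a)) \<mu>"
        using a(2) b iA aA by (simp add: Dp A_mult diff_eq_eq add.commute)
      moreover have "i * b + a \<in> II"
        using ideal_AR_props(3,5)[OF ideal_I] aI mi(2) b(1) by (metis mult.commute)
      moreover have "\<mu> \<in> kernel q \<zeta> (l # ls)"
        unfolding \<mu>(1) orb_def using Dp(4)[of 1 \<mu>] by force
      ultimately show "w \<in> {app (Phi (hd (l # ls)) z) m | m z. m \<in> kernel q \<zeta> (l # ls) \<and> z \<in> II}" by auto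
    next
      fix w assume "w \<in> {app (Phi (hd (l # ls)) z) m | m z. m \<in> kernel q \<zeta> (l # ls) \<and> z \<in> II}"
      then obtain m i where mi: "m \<in> kernel q \<zeta> (l # ls)" "i \<in> II" "w = app (Phi l i) m" by auto
      have iA: "i \<in> A" using mi(2) I_subset_A by blast
      have "app [:- u, 1:] w = app (c.Phi l' i) (app [:- u, 1:] m)"
        unfolding mi(3) using iso_app[OF l ueq iA, of m] by (simp only: l')
      then show "w \<in> kernel q \<zeta> (butlast (l # ls))"
        unfolding bl IH using mi(1,2) unfolding kl by blast
    qed
  qed
qed simp

text \<open>For \<open>b \<noteq> c\<close> the sum is \<open>b\<close> times the quotient of
  \<open>b ^ q - c ^ q = (b - c) ^ q\<close> by \<open>b - c\<close>. For \<open>b = c\<close> it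
  consists of \<open>q\<close> equal terms and is 0. In this form the equation for \<lambda>_m
  becomes a product.\<close>

lemma (in frobenius_field) geometric_q:
  fixes c b :: 'a
  shows "(\<Sum>i = 0..q - 1. c ^ i * b ^ (q - i)) = b * (b - c) ^ (q - 1)"
proof -
  have eq: "{0..q - 1} = {..<q}" using q_ge_2 by auto
  have q1: "q - 1 > 0" using q_ge_2 by simp
  have f: "(b - c) ^ q = (b - c) * (b - c) ^ (q - 1)" by (rule pow_q_minus_1)
  show ?thesis
  proof (cases "b = c")
    case True
    have "(\<Sum>i<q. c ^ i * c ^ (q - i)) = (\<Sum>i<q. c ^ q)" by (rule sum.cong) (auto simp flip: power_add)
    then show ?thesis unfolding eq True using q1 by (simp add: of_nat_q zero_power)
  next
    case False
    have "(b - c) * (\<Sum>i<q. c ^ i * b ^ (q - i)) = b * ((b - c) * (\<Sum>i<q. c ^ i * b ^ (q - Suc i)))"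
    proof -
      have "(\<Sum>i<q. c ^ i * b ^ (q - i)) = b * (\<Sum>i<q. c ^ i * b ^ (q - Suc i))"
        unfolding sum_distrib_left
      proof (rule sum.cong)
        fix i assume "i \<in> {..<q}"
        then have "b ^ (q - i) = b * b ^ (q - Suc i)" by (metis Suc_diff_Suc lessThan_iff power_Suc)
        then show "c ^ i * b ^ (q - i) = b * (c ^ i * b ^ (q - Suc i))" by simp
      qed simp
      then show ?thesis by simp
    qed
    also have "(b - c) * (\<Sum>i<q. c ^ i * b ^ (q - Suc i)) = b ^ q - c ^ q"
    proof -
      define S where "S = (\<Sum>i<q. c ^ i * b ^ (q - Suc i))"
      have "c ^ q - b ^ q = (c - b) * S"
        using power_diff_sumr2[of c q b] by (simp add: S_def mult.commute)
      then have "- ((c - b) * S) = b ^ q - c ^ q" by (metis minus_diff_eq)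
      then show ?thesis unfolding S_def[symmetric] by (simp add: left_diff_distrib)
    qed
    also have "\<dots> = (b - c) * (b - c) ^ (q - 1)" unfolding f[symmetric] by (simp add: frob_diff1)
    finally have "(b - c) * (\<Sum>i<q. c ^ i * b ^ (q - i)) = (b - c) * (b * (b - c) ^ (q - 1))"
      by (simp only: ac_simps)
    then show ?thesis unfolding eq using False by simp
  qed
qed

context drinfeld_setup
begin

lemma kappa: "(1 - \<zeta> powi (1 - int q)) ^ (q + 1) = (1 - \<zeta> / \<zeta> ^ q) * (1 - \<zeta> ^ q / \<zeta>)"
  "(\<zeta> ^ (q - 1) - 1) ^ (q + 1) = (1 - \<zeta> / \<zeta> ^ q) * (1 - \<zeta> ^ q / \<zeta>)"
proof -
  show "(1 - \<zeta> powi (1 - int q)) ^ (q + 1) = (1 - \<zeta> / \<zeta> ^ q) * (1 - \<zeta> ^ q / \<zeta>)"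
    by (simp add: zeta_powi frob_diff1 power_divide \<zeta>_qq)
  have "(\<zeta> ^ (q - 1) - 1) ^ (q + 1) = (\<zeta> ^ q / \<zeta> - 1) * (\<zeta> / \<zeta> ^ q - 1)"
    by (simp add: zeta_powi(2)[simplified] frob_diff1 power_divide \<zeta>_qq)
  then show "(\<zeta> ^ (q - 1) - 1) ^ (q + 1) = (1 - \<zeta> / \<zeta> ^ q) * (1 - \<zeta> ^ q / \<zeta>)"
    by (simp add: algebra_simps)
qed

text \<open>Substituting \<open>l' = l ^ q + s * u\<close> turns the left side of the equation into
  a nonzero constant times the quadratic condition on \<open>u\<close>.\<close>

lemma tower_eq1_iff:
  assumes l: "l \<noteq> 0"
  shows "tower_eq1 q t \<zeta> \<nu> l l' \<longleftrightarrow> isog q t \<zeta> \<nu> l l'"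
proof -
  define u where "u = u_of q \<zeta> l l'"
  define s where "s = 1 - \<zeta> ^ q / \<zeta>"
  define s' where "s' = 1 - \<zeta> / \<zeta> ^ q"
  define h where "h = hh l"
  define L where "L = l ^ q"
  define al where "al = alpha q t \<zeta> \<nu> l"
  have l': "l' = L + s * u" using lnext_u_of[of l l'] by (simp add: lnext_def u_def s_def L_def)
  have sq: "s ^ q = s'" by (simp add: s_def s'_def frob_diff1 power_divide \<zeta>_qq)
  have l'q: "l' ^ q = L ^ q + s' * u ^ q" by (simp add: l' frob_add1 power_mult_distrib sq)
  have "(1 - \<zeta> / \<zeta> ^ q) * (\<zeta> ^ q * (l ^ q) ^ q / (\<zeta> ^ q - \<zeta>)) = (l ^ q) ^ q" by (simp add: field_simps)
  then have a: "s' * al = L ^ q - s' * h"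
    unfolding al_def alpha_eq[OF l] right_diff_distrib h_def s'_def L_def by simp
  have C: "(\<zeta> powi (1 - int q) - 1) / (\<zeta> * l) * (t - \<zeta> ^ q) * \<nu> = s' * h"
    unfolding zeta_powi s'_def h_def hh_def using l by (simp add: field_simps)
  have D: "((\<zeta> powi (- int q) - \<zeta> powi (-1)) * (t - \<zeta> ^ q) + (\<zeta> ^ (q - 1) - 1) ^ (q + 1)) * \<nu> * l ^ (q - 1)
      = s' * h * L + s * s' * del l"
  proof -
    have "(\<zeta> powi (- int q) - \<zeta> powi (-1)) * (t - \<zeta> ^ q) * \<nu> * l ^ (q - 1) = s' * h * L"
      unfolding s'_def h_def hh_def L_def using l
      by (simp add: power_int_minus pow_q_minus_Suc_div field_simps)
    then show ?thesis unfolding kappa(2) s_def s'_def by (simp add: algebra_simps)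
  qed
  have "l' ^ (q + 1) - l ^ q * l' ^ q - (s' * h) * l' + (s' * h * L + s * s' * del l)
      = l' ^ q * (l' - L) - s' * h * l' + (s' * h * L + s * s' * del l)"
    by (simp add: L_def algebra_simps)
  also have "\<dots> = s * (L ^ q * u + s' * (u * u ^ q)) - s' * h * s * u + s * s' * del l"
    unfolding l'q by (simp add: l' algebra_simps)
  also have "L ^ q = s' * al + s' * h" using a by simp
  also have "s * ((s' * al + s' * h) * u + s' * (u * u ^ q)) - s' * h * s * u + s * s' * del l
      = s * s' * (u * u ^ q + al * u + del l)" by (simp add: algebra_simps)
  finally have "tower_eq1 q t \<zeta> \<nu> l l' \<longleftrightarrow> s * s' * (u * u ^ q + al * u + del l) = 0"
    unfolding tower_eq1_def C D by simp
  moreover have "s * s' \<noteq> 0" by (simp add: s_def s'_def)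
  ultimately show ?thesis by (simp add: isog_iff u_def al_def)
qed

text \<open>With \<open>v\<close>, \<open>v'\<close> the roots in the factorization of the target,
  the isogeny condition on \<open>u2\<close> is
  \<open>(u2 - v) * (u2 * (u2 - v) ^ (q - 1) - v') = 0\<close>. The first factor is the dual
  isogeny, the second is the tower equation by \<open>geometric_q\<close>; it has no solution
  \<open>u2 = v\<close>, since \<open>v'\<close> is nonzero.\<close>

lemma tower_eq_iff:
  assumes l: "l \<noteq> 0" and isg: "isog q t \<zeta> \<nu> l l'"
  shows "(l \<noteq> 0 \<and> l' - l ^ q \<noteq> 0 \<and>
     (\<Sum>i = 0..q - 1. (\<nu> * ((1 - \<zeta> / \<zeta> ^ q) * (1 - \<zeta> ^ q / \<zeta>)) * l ^ (q - 1) / (l' - l ^ q)) ^ i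
        * (l'' - l' ^ q) ^ (q - i)) - \<nu>' / \<nu> * ((l' - l ^ q) / l ^ (q - 1)) * l' ^ (q - 1) = 0)
     \<longleftrightarrow> isog q t (\<zeta> ^ q) \<nu>' l' l'' \<and> nonback q \<zeta> \<nu> l l' l''"
proof -
  interpret c: drinfeld_setup q t "\<zeta> ^ q" "\<nu>'" by (rule conj)
  define u where "u = u_of q \<zeta> l l'"
  define u2 where "u2 = u_of q (\<zeta> ^ q) l' l''"
  define s where "s = 1 - \<zeta> ^ q / \<zeta>"
  define s' where "s' = 1 - \<zeta> / \<zeta> ^ q"
  note ueq = isg[unfolded isog_iff, folded u_def]
  have unz: "u \<noteq> 0" by (rule u_nz[OF l ueq])
  have l': "lnext l u = l'" by (simp add: u_def)
  note vnz = vv_nz[OF l ueq]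
  define v where "v = vv l u"
  define v' where "v' = vv' l u"
  have s: "s \<noteq> 0" "s' \<noteq> 0" by (simp_all add: s_def s'_def)
  have sq: "s' ^ q = s" by (simp add: s_def s'_def frob_diff1 power_divide \<zeta>_qq)
  have w: "l' - l ^ q = s * u" unfolding l'[symmetric] by (simp add: lnext_def s_def)
  have X: "l'' - l' ^ q = s' * u2"
  proof -
    have "l' ^ q + s' * u2 = l''"
      using c.lnext_u_of[of l' l''] by (simp add: c.lnext_def u2_def s'_def \<zeta>_qq)
    then show ?thesis by (metis add_diff_cancel_left')
  qed
  have c0: "\<nu> * (s' * s) * l ^ (q - 1) / (s * u) = s' * v"
    unfolding v_def vv_def[OF l ueq] using s unz by simp
  have d: "\<nu>' / \<nu> * (s * u / l ^ (q - 1)) * l' ^ (q - 1) = s * v'"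
    unfolding v'_def vv'_def[OF l ueq] l' vv_def[OF l ueq] using s unz l by (simp add: ac_simps)
  have sum: "(\<Sum>i = 0..q - 1. (s' * v) ^ i * (s' * u2) ^ (q - i)) = s * (u2 * (u2 - v) ^ (q - 1))"
  proof -
    have "(\<Sum>i = 0..q - 1. (s' * v) ^ i * (s' * u2) ^ (q - i)) = s' * u2 * (s' * (u2 - v)) ^ (q - 1)"
      unfolding geometric_q by (simp only: right_diff_distrib)
    also have "\<dots> = (s' * s' ^ (q - 1)) * (u2 * (u2 - v) ^ (q - 1))" by (simp only: power_mult_distrib ac_simps)
    finally show ?thesis unfolding pow_q_minus_1[symmetric] sq .
  qed
  have "isog q t (\<zeta> ^ q) \<nu>' l' l'' \<longleftrightarrow> u2 * u2 ^ q + (- v' - v ^ q) * u2 + v' * v = 0"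
  proof -
    have "c.del l' = v' * v" unfolding v'_def v_def vv'_def[OF l ueq] l' using vnz by simp
    then show ?thesis using c.isog_iff[of l' l''] c_alpha[OF l ueq] by (simp add: l' u2_def v_def v'_def)
  qed
  also have "u2 * u2 ^ q + (- v' - v ^ q) * u2 + v' * v = (u2 - v) * (u2 * (u2 - v) ^ (q - 1) - v')"
  proof -
    have "(u2 - v) * (u2 * (u2 - v) ^ (q - 1) - v') = u2 * ((u2 - v) * (u2 - v) ^ (q - 1)) - (u2 - v) * v'"
      by (simp add: algebra_simps)
    also have "(u2 - v) * (u2 - v) ^ (q - 1) = u2 ^ q - v ^ q"
      unfolding pow_q_minus_1[symmetric] by (rule frob_diff1)
    finally show ?thesis by (simp add: algebra_simps)
  qed
  finally have iso: "isog q t (\<zeta> ^ q) \<nu>' l' l'' \<longleftrightarrow> u2 = v \<or> u2 * (u2 - v) ^ (q - 1) = v'" by simp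
  have nb: "nonback q \<zeta> \<nu> l l' l'' \<longleftrightarrow> u2 \<noteq> v" using nonback_iff[OF l isg] by (simp add: u_def u2_def v_def)
  have "u2 * (u2 - v) ^ (q - 1) = v' \<Longrightarrow> u2 \<noteq> v"
  proof
    assume "u2 * (u2 - v) ^ (q - 1) = v'" "u2 = v"
    moreover have "q - 1 > 0" using q_ge_2 by simp
    ultimately have "v' = 0" by (metis diff_self mult_zero_right zero_power)
    then show False using vnz by (simp add: v'_def)
  qed
  moreover have "s * (u2 * (u2 - v) ^ (q - 1)) - s * v' = 0 \<longleftrightarrow> u2 * (u2 - v) ^ (q - 1) = v'"
    using s by simp
  ultimately show ?thesis
    unfolding w X iso nb s_def[symmetric] s'_def[symmetric] c0 d sum using l s unz by auto
qed

subsection \<open>Tower points are chains\<close>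

definition "zs i = (if even (i::nat) then \<zeta> else \<zeta> ^ q)"
definition "ns i = (if even (i::nat) then \<nu> else \<nu>')"

lemma setup_seq: "drinfeld_setup q t (zs i) (ns i)"
  using conj drinfeld_setup_axioms by (simp add: zs_def ns_def)

lemma zs_Suc: "zs (Suc i) = zs i ^ q" by (simp add: zs_def \<zeta>_qq)
lemma ns_Suc: "ns (Suc i) = - (x_elt q t (zs i) / ns i)" by (simp add: zs_def ns_def)

end

lemma chain_nth:
  fixes \<zeta> \<nu> :: "'a::alg_closed_field"
  assumes "drinfeld_setup q t \<zeta> \<nu>"
  shows "chain q t \<zeta> \<nu> ls \<longleftrightarrow> ls \<noteq> [] \<and> ls ! 0 \<noteq> 0 \<and>
    (\<forall>i. Suc i < length ls \<longrightarrow> isog q t (drinfeld_setup.zs q \<zeta> i) (drinfeld_setup.ns q t \<zeta> \<nu> i) (ls ! i) (ls ! Suc i)) \<and>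
    (\<forall>i. Suc (Suc i) < length ls \<longrightarrow> nonback q (drinfeld_setup.zs q \<zeta> i) (drinfeld_setup.ns q t \<zeta> \<nu> i)
       (ls ! i) (ls ! Suc i) (ls ! Suc (Suc i)))"
  using assms
proof (induction ls arbitrary: \<zeta> \<nu>)
  case (Cons l ls)
  interpret drinfeld_setup q t \<zeta> \<nu> by fact
  interpret c: drinfeld_setup q t "\<zeta> ^ q" "\<nu>'" by (rule conj)
  have zs: "c.zs i = zs (Suc i)" for i by (simp add: c.zs_def zs_def \<zeta>_qq)
  have ns: "c.ns i = ns (Suc i)" for i by (simp add: c.ns_def ns_def)
  have z0: "zs 0 = \<zeta>" "ns 0 = \<nu>" by (simp_all add: zs_def ns_def)
  note IH = Cons.IH[OF conj, unfolded zs ns]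
  show ?case
  proof (cases ls)
    case (Cons l' r)
    have all: "(\<forall>i. P i) \<longleftrightarrow> P 0 \<and> (\<forall>i. P (Suc i))" for P :: "nat \<Rightarrow> bool"
      by (metis not0_implies_Suc)
    have nb: "(case r of [] \<Rightarrow> True | l'' # _ \<Rightarrow> nonback q \<zeta> \<nu> l l' l'') \<longleftrightarrow>
        (Suc (Suc 0) < length (l # ls) \<longrightarrow> nonback q \<zeta> \<nu> l l' ((l # ls) ! Suc (Suc 0)))"
      by (cases r) (simp_all add: Cons)
    have "isog q t \<zeta> \<nu> l l' \<Longrightarrow> l \<noteq> 0 \<Longrightarrow> l' \<noteq> 0" using isog_nz by blast
    then show ?thesis
      unfolding all[of "\<lambda>i. Suc i < length (l # ls) \<longrightarrow> isog q t (zs i) (ns i) ((l # ls) ! i) ((l # ls) ! Suc i)"]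
        all[of "\<lambda>i. Suc (Suc i) < length (l # ls) \<longrightarrow> nonback q (zs i) (ns i) ((l # ls) ! i) ((l # ls) ! Suc i) ((l # ls) ! Suc (Suc i))"] z0
      using IH nb by (auto simp: Cons)
  qed simp
qed simp

text \<open>The tower equations see \<sigma> only through the iterates of \<nu>, so this sequence is
  all that is recorded of \<sigma>.\<close>

locale tower_setup = drinfeld_setup q t \<zeta> \<nu>
  for q :: nat and t \<zeta> \<nu> :: "'a::alg_closed_field" +
  fixes \<sigma> :: "'a \<Rightarrow> 'a"
  assumes \<sigma>_seq: "(\<sigma> ^^ m) \<nu> = ns m"
begin

text \<open>The constant in the equation is invariant under exchanging \<zeta> and
  \<open>\<zeta> ^ q\<close>, so one formula serves the even and the odd steps.\<close>

lemma tower_eq_seq: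
  assumes "l \<noteq> 0" "isog q t (zs i) (ns i) l l'"
  shows "tower_eq q \<zeta> \<nu> \<sigma> (Suc (Suc i)) l l' l'' \<longleftrightarrow>
    isog q t (zs (Suc i)) (ns (Suc i)) l' l'' \<and> nonback q (zs i) (ns i) l l' l''"
proof -
  interpret z: drinfeld_setup q t "zs i" "ns i" by (rule setup_seq)
  have "(1 - \<zeta> powi (1 - int q)) ^ (q + 1) = (1 - zs i / zs (Suc i)) * (1 - zs (Suc i) / zs i)"
    unfolding kappa by (simp add: zs_def)
  moreover have "ns (Suc (Suc i)) = ns i" by (simp add: ns_def)
  ultimately show ?thesis
    unfolding tower_eq_def \<sigma>_seq
    using z.tower_eq_iff[OF assms, of l'', folded zs_Suc ns_Suc] by simp
qed

lemma tower_points_iff: "ls \<in> tower_points q t \<zeta> \<nu> \<sigma> k \<longleftrightarrow> length ls = Suc k \<and> chain q t \<zeta> \<nu> ls"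
proof (cases "length ls = Suc k \<and> ls ! 0 \<noteq> 0 \<and> (k \<ge> 1 \<longrightarrow> isog q t \<zeta> \<nu> (ls ! 0) (ls ! 1))")
  case True
  \<comment> \<open>\<open>Q\<close> and \<open>R\<close> describe initial segments by isogenies and
    by tower equations. They are compared by induction on the length, because translating one
    equation already uses that the preceding step is an isogeny.\<close>
  define Q where "Q n \<longleftrightarrow> (\<forall>i<n. isog q t (zs i) (ns i) (ls ! i) (ls ! Suc i)) \<and>
      (\<forall>i. Suc i < n \<longrightarrow> nonback q (zs i) (ns i) (ls ! i) (ls ! Suc i) (ls ! Suc (Suc i)))" for n
  define R where "R n \<longleftrightarrow> (\<forall>m. 2 \<le> m \<and> m \<le> n \<longrightarrow> tower_eq q \<zeta> \<nu> \<sigma> m (ls ! (m - 2)) (ls ! (m - 1)) (ls ! m))" for n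
  have nz: "Q n \<Longrightarrow> i \<le> n \<Longrightarrow> ls ! i \<noteq> 0" for n i
  proof (induction i)
    case 0 then show ?case using True by simp
  next
    case (Suc i)
    interpret z: drinfeld_setup q t "zs i" "ns i" by (rule setup_seq)
    show ?case using Suc z.isog_nz[of "ls ! i" "ls ! Suc i"] by (simp add: Q_def)
  qed
  have "n \<le> k \<Longrightarrow> R n \<longleftrightarrow> Q n" for n
  proof (induction n)
    case 0 then show ?case by (simp add: Q_def R_def)
  next
    case (Suc n)
    show ?case
    proof (cases n)
      case 0
      then show ?thesis using True Suc.prems by (auto simp: Q_def R_def zs_def ns_def)
    next
      case (Suc j)
      have R: "R (Suc n) \<longleftrightarrow> R n \<and> tower_eq q \<zeta> \<nu> \<sigma> (Suc (Suc j)) (ls ! j) (ls ! Suc j) (ls ! Suc (Suc j))"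
      proof -
        have "(\<forall>m. 2 \<le> m \<and> m \<le> Suc n \<longrightarrow> P m) \<longleftrightarrow> (\<forall>m. 2 \<le> m \<and> m \<le> n \<longrightarrow> P m) \<and> P (Suc n)"
          if "2 \<le> Suc n" for P
          using that by (metis le_Suc_eq order_refl)
        then show ?thesis unfolding R_def by (simp add: Suc)
      qed
      have Q: "Q (Suc n) \<longleftrightarrow> Q n \<and> isog q t (zs n) (ns n) (ls ! n) (ls ! Suc n) \<and>
          nonback q (zs j) (ns j) (ls ! j) (ls ! Suc j) (ls ! Suc (Suc j))"
        unfolding Q_def by (auto simp: Suc less_Suc_eq)
      have "Q n \<Longrightarrow> tower_eq q \<zeta> \<nu> \<sigma> (Suc (Suc j)) (ls ! j) (ls ! Suc j) (ls ! Suc (Suc j)) \<longleftrightarrow>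
          isog q t (zs n) (ns n) (ls ! n) (ls ! Suc n) \<and>
          nonback q (zs j) (ns j) (ls ! j) (ls ! Suc j) (ls ! Suc (Suc j))"
        using tower_eq_seq[of "ls ! j" j "ls ! Suc j" "ls ! Suc (Suc j)"] nz[of n j] by (simp add: Q_def Suc)
      then show ?thesis using Suc.IH Suc.prems unfolding R Q by auto
    qed
  qed
  from this[of k] have "R k \<longleftrightarrow> Q k" by simp
  moreover have "chain q t \<zeta> \<nu> ls \<longleftrightarrow> Q k"
    unfolding chain_nth[OF drinfeld_setup_axioms] Q_def using True by auto
  ultimately show ?thesis
    using True tower_eq1_iff[of "ls ! 0" "ls ! 1"] by (auto simp: tower_points_def R_def)
next
  case False
  then show ?thesis
    unfolding chain_nth[OF drinfeld_setup_axioms] using tower_eq1_iff[of "ls ! 0" "ls ! 1"]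
    by (auto simp: tower_points_def zs_def ns_def)
qed

definition "\<Psi> ls = (Phi (hd ls), kernel q \<zeta> ls)"

lemma family_points:
  "x0_family_points q t \<zeta> \<nu> (Ik k) = {(Phi l, orb (Phi l) \<mu>) | l \<mu>. l \<noteq> 0 \<and> gen (Phi l) k \<mu>}"
proof (intro equalityI subsetI)
  fix P assume "P \<in> x0_family_points q t \<zeta> \<nu> (Ik k)"
  then obtain \<phi> G l where P: "P = (\<phi>, G)" "drinfeld_module q t \<zeta> 2 \<phi>" "primitive_torsion q t \<zeta> \<phi> (Ik k) G"
    "l \<noteq> 0" "is_phi q t \<zeta> \<nu> l \<phi>" by (auto simp: x0_family_points_def x0_points_def)
  then have "\<phi> = Phi l" using is_phi_iff by blast
  then show "P \<in> {(Phi l, orb (Phi l) \<mu>) | l \<mu>. l \<noteq> 0 \<and> gen (Phi l) k \<mu>}"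
    using P primitive_torsion_gen[OF P(2)] by auto
next
  fix P assume "P \<in> {(Phi l, orb (Phi l) \<mu>) | l \<mu>. l \<noteq> 0 \<and> gen (Phi l) k \<mu>}"
  then obtain l \<mu> where "P = (Phi l, orb (Phi l) \<mu>)" "l \<noteq> 0" "gen (Phi l) k \<mu>" by blast
  then show "P \<in> x0_family_points q t \<zeta> \<nu> (Ik k)"
    using family_drinfeld[of l] primitive_torsion_gen[OF family_drinfeld(1)[of l]] is_phi_iff[of l "Phi l"]
    by (auto simp: x0_family_points_def x0_points_def)
qed

lemma \<Psi>_bij: "bij_betw \<Psi> (tower_points q t \<zeta> \<nu> \<sigma> k) (x0_family_points q t \<zeta> \<nu> (Ik k))"
  unfolding bij_betw_def family_points
proof (intro conjI inj_onI equalityI subsetI)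
  fix ls ls' assume "ls \<in> tower_points q t \<zeta> \<nu> \<sigma> k" "ls' \<in> tower_points q t \<zeta> \<nu> \<sigma> k" "\<Psi> ls = \<Psi> ls'"
  then have c: "chain q t \<zeta> \<nu> ls" "chain q t \<zeta> \<nu> ls'" "length ls = length ls'" "Phi (hd ls) = Phi (hd ls')"
    "kernel q \<zeta> ls = kernel q \<zeta> ls'" by (auto simp: tower_points_iff \<Psi>_def)
  then have "hd ls = hd ls'" using Phi_inj chain_hd by blast
  then show "ls = ls'" using kernel_inj[OF drinfeld_setup_axioms] c by blast
next
  fix P assume "P \<in> \<Psi> ` tower_points q t \<zeta> \<nu> \<sigma> k"
  then obtain ls where ls: "length ls = Suc k" "chain q t \<zeta> \<nu> ls" "P = (Phi (hd ls), kernel q \<zeta> ls)"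
    by (auto simp: tower_points_iff \<Psi>_def)
  then show "P \<in> {(Phi l, orb (Phi l) \<mu>) | l \<mu>. l \<noteq> 0 \<and> gen (Phi l) k \<mu>}"
    using chain_gen[OF drinfeld_setup_axioms ls(2)] chain_hd[OF ls(2)] by auto
next
  fix P assume "P \<in> {(Phi l, orb (Phi l) \<mu>) | l \<mu>. l \<noteq> 0 \<and> gen (Phi l) k \<mu>}"
  then obtain l \<mu> where P: "P = (Phi l, orb (Phi l) \<mu>)" "l \<noteq> 0" "gen (Phi l) k \<mu>" by blast
  from chain_exists[OF drinfeld_setup_axioms P(2,3)] obtain ls where
    "chain q t \<zeta> \<nu> ls" "hd ls = l" "length ls = Suc k" "kernel q \<zeta> ls = orb (Phi l) \<mu>" by blast
  then show "P \<in> \<Psi> ` tower_points q t \<zeta> \<nu> \<sigma> k"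
    using P(1) by (intro image_eqI[of _ _ ls]) (auto simp: tower_points_iff \<Psi>_def)
qed

lemma \<Psi>_covering:
  assumes "ls \<in> tower_points q t \<zeta> \<nu> \<sigma> (Suc k)"
  shows "\<Psi> (butlast ls) = covering q t \<zeta> (\<Psi> ls)"
proof -
  have ls: "length ls = Suc (Suc k)" "chain q t \<zeta> \<nu> ls" using assms by (auto simp: tower_points_iff)
  then have "hd (butlast ls) = hd ls" by (cases ls) auto
  then show ?thesis
    using kernel_butlast[OF drinfeld_setup_axioms ls(2)] ls(1) by (simp add: \<Psi>_def covering_def)
qed

lemma all_points:
  assumes "P \<in> x0_points q t \<zeta> (Ik k)"
  shows "\<exists>P'\<in>x0_family_points q t \<zeta> \<nu> (Ik k). pair_iso q t \<zeta> P P'"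
proof -
  obtain \<phi> G where P: "P = (\<phi>, G)" "drinfeld_module q t \<zeta> 2 \<phi>" "normalized q t \<zeta> \<phi>" "zeta_q_type q t \<zeta> \<phi>"
    "primitive_torsion q t \<zeta> \<phi> (Ik k) G" using assms by (auto simp: x0_points_def)
  then obtain \<mu> where \<mu>: "G = orb \<phi> \<mu>" "gen \<phi> k \<mu>" using primitive_torsion_gen by blast
  obtain c l where c: "c \<noteq> 0" "l \<noteq> 0" "\<forall>a\<in>A. [:c:] \<star> \<phi> a = Phi l a \<star> [:c:]"
    by (rule family_complete[OF P(2-4)]) (use that in blast)
  have act: "app (Phi l a) (c * z) = c * app (\<phi> a) z" if "a \<in> A" for a z
    using arg_cong[OF c(3)[rule_format, OF that], of "\<lambda>f. app f z"] by (simp add: mult.commute)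
  have "gen (Phi l) k (c * \<mu>)" using \<mu>(2) c(1) by (simp add: gen_def act)
  moreover have "orb (Phi l) (c * \<mu>) = (\<lambda>z. c * z) ` G"
    unfolding \<mu>(1) orb_def by (auto simp: act image_iff) (metis act)+
  ultimately show ?thesis
    unfolding family_points using c
    by (intro bexI[of _ "(Phi l, orb (Phi l) (c * \<mu>))"]) (auto simp: pair_iso_def P(1))
qed

end

section \<open>Fields of definition\<close>

text \<open>Closure conditions convenient for rewriting; \<open>sfield_gen_field\<close> and
  \<open>sfield_subfield\<close> connect them with the subfields of
  \<open>HOL-Algebra\<close>.\<close>

definition sfield :: "'a::field set \<Rightarrow> bool" where
  "sfield K \<longleftrightarrow> 1 \<in> K \<and> (\<forall>a\<in>K. \<forall>b\<in>K. a - b \<in> K \<and> a * b \<in> K) \<and> (\<forall>a\<in>K. inverse a \<in> K)"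

lemma sfieldD:
  assumes "sfield K"
  shows "1 \<in> K" "0 \<in> K" "a \<in> K \<Longrightarrow> b \<in> K \<Longrightarrow> a - b \<in> K" "a \<in> K \<Longrightarrow> b \<in> K \<Longrightarrow> a * b \<in> K"
    "a \<in> K \<Longrightarrow> inverse a \<in> K" "a \<in> K \<Longrightarrow> - a \<in> K" "a \<in> K \<Longrightarrow> b \<in> K \<Longrightarrow> a + b \<in> K"
    "a \<in> K \<Longrightarrow> b \<in> K \<Longrightarrow> a / b \<in> K" "a \<in> K \<Longrightarrow> a ^ n \<in> K"
proof -
  show 1: "1 \<in> K" and diff: "\<And>a b. a \<in> K \<Longrightarrow> b \<in> K \<Longrightarrow> a - b \<in> K"
    and mult: "\<And>a b. a \<in> K \<Longrightarrow> b \<in> K \<Longrightarrow> a * b \<in> K" and inv: "\<And>a. a \<in> K \<Longrightarrow> inverse a \<in> K"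
    using assms by (auto simp: sfield_def)
  show 0: "0 \<in> K" using diff[OF 1 1] by simp
  show minus: "a \<in> K \<Longrightarrow> - a \<in> K" for a using diff[OF 0, of a] by simp
  show "a \<in> K \<Longrightarrow> b \<in> K \<Longrightarrow> a + b \<in> K" using diff[of a "- b"] minus by simp
  show "a \<in> K \<Longrightarrow> b \<in> K \<Longrightarrow> a / b \<in> K" using mult inv by (simp add: field_class.field_divide_inverse)
  show "a \<in> K \<Longrightarrow> a ^ n \<in> K" by (induction n) (use 1 mult in auto)
qed

lemma sfield_sum: "sfield K \<Longrightarrow> (\<And>i. i \<in> B \<Longrightarrow> f i \<in> K) \<Longrightarrow> (\<Sum>i\<in>B. f i) \<in> K"
  by (induction B rule: infinite_finite_induct) (auto intro: sfieldD)

lemma gen_field_incl: "S \<subseteq> gen_field S"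
  by (auto intro: generate_field.incl)

lemma univ_field: "Ring.field (ring_of_type_algebra :: 'a::field ring)"
  by (rule field_from_type_algebra)

lemma sfield_gen_field: "sfield (gen_field (S :: 'a::field set))"
proof -
  have add: "a + b \<in> gen_field S" if "a \<in> gen_field S" "b \<in> gen_field S" for a b
    using generate_field.eng_add[OF that] by simp
  have minus: "- a \<in> gen_field S" if "a \<in> gen_field S" for a
    using generate_field.a_inv[OF that] by simp
  have "a - b \<in> gen_field S" if "a \<in> gen_field S" "b \<in> gen_field S" for a b
    using add[OF that(1) minus[OF that(2)]] by simp
  moreover have "a * b \<in> gen_field S" if "a \<in> gen_field S" "b \<in> gen_field S" for a b
    using generate_field.eng_mult[OF that] by simp
  moreover have one: "1 \<in> gen_field S" using generate_field.one[of ring_of_type_algebra S] by simp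
  moreover have "inverse a \<in> gen_field S" if "a \<in> gen_field S" for a
  proof (cases "a = 0")
    case True
    then show ?thesis using add[OF one minus[OF one]] by simp
  next
    case False
    then show ?thesis using generate_field.m_inv[OF that] by simp
  qed
  ultimately show ?thesis by (auto simp: sfield_def)
qed

lemma gen_field_minimal:
  assumes "sfield K" "S \<subseteq> K"
  shows "gen_field S \<subseteq> (K :: 'a::field set)"
proof
  fix a assume "a \<in> gen_field S"
  then show "a \<in> K"
    by (induction rule: generate_field.induct) (use assms sfieldD[OF assms(1)] in auto)
qed

lemma subfield_gen_field: "subfield (gen_field S) (ring_of_type_algebra :: 'a::field ring)"
  by (rule field.generate_field_is_subfield[OF univ_field]) simp

definition coeffs_in :: "'a::field set \<Rightarrow> 'a poly \<Rightarrow> bool" where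
  "coeffs_in K f \<longleftrightarrow> (\<forall>i. poly.coeff f i \<in> K)"

lemma coeffs_in_mono: "coeffs_in K f \<Longrightarrow> K \<subseteq> E \<Longrightarrow> coeffs_in E f"
  by (auto simp: coeffs_in_def)

definition sring :: "'a::field set \<Rightarrow> bool" where
  "sring R \<longleftrightarrow> 1 \<in> R \<and> (\<forall>a\<in>R. \<forall>b\<in>R. a - b \<in> R \<and> a * b \<in> R)"

lemma sringD:
  assumes "sring R"
  shows "1 \<in> R" "0 \<in> R" "a \<in> R \<Longrightarrow> b \<in> R \<Longrightarrow> a - b \<in> R" "a \<in> R \<Longrightarrow> b \<in> R \<Longrightarrow> a * b \<in> R"
    "a \<in> R \<Longrightarrow> - a \<in> R" "a \<in> R \<Longrightarrow> b \<in> R \<Longrightarrow> a + b \<in> R" "a \<in> R \<Longrightarrow> a ^ n \<in> R"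
proof -
  show 1: "1 \<in> R" and diff: "\<And>a b. a \<in> R \<Longrightarrow> b \<in> R \<Longrightarrow> a - b \<in> R"
    and mult: "\<And>a b. a \<in> R \<Longrightarrow> b \<in> R \<Longrightarrow> a * b \<in> R"
    using assms by (auto simp: sring_def)
  show 0: "0 \<in> R" using diff[OF 1 1] by simp
  show minus: "a \<in> R \<Longrightarrow> - a \<in> R" for a using diff[OF 0, of a] by simp
  show "a \<in> R \<Longrightarrow> b \<in> R \<Longrightarrow> a + b \<in> R" using diff[of a "- b"] minus by simp
  show "a \<in> R \<Longrightarrow> a ^ n \<in> R" by (induction n) (use 1 mult in auto)
qed

lemma sring_sum: "sring R \<Longrightarrow> (\<And>i. i \<in> B \<Longrightarrow> f i \<in> R) \<Longrightarrow> (\<Sum>i\<in>B. f i) \<in> R"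
  by (induction B rule: infinite_finite_induct) (auto intro: sringD)

lemma sfield_sring: "sfield K \<Longrightarrow> sring K"
  by (auto simp: sfield_def sring_def)

context
  fixes R :: "'a::field set"
  assumes R: "sring R"
begin

lemma coeffs_in_pCons [simp]: "coeffs_in R (pCons a f) \<longleftrightarrow> a \<in> R \<and> coeffs_in R f"
  unfolding coeffs_in_def by (auto simp: coeff_pCons split: nat.splits)

lemma coeffs_in_0 [simp]: "coeffs_in R 0" by (simp add: coeffs_in_def sringD[OF R])
lemma coeffs_in_1 [simp]: "coeffs_in R 1" by (simp add: one_pCons sringD[OF R])
lemma coeffs_in_add: "coeffs_in R f \<Longrightarrow> coeffs_in R g \<Longrightarrow> coeffs_in R (f + g)"
  by (simp add: coeffs_in_def sringD[OF R])
lemma coeffs_in_diff: "coeffs_in R f \<Longrightarrow> coeffs_in R g \<Longrightarrow> coeffs_in R (f - g)"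
  by (simp add: coeffs_in_def sringD[OF R])
lemma coeffs_in_smult: "c \<in> R \<Longrightarrow> coeffs_in R f \<Longrightarrow> coeffs_in R (Polynomial.smult c f)"
  by (simp add: coeffs_in_def sringD[OF R])
lemma coeffs_in_mult: "coeffs_in R f \<Longrightarrow> coeffs_in R g \<Longrightarrow> coeffs_in R (f * g)"
  unfolding coeffs_in_def coeff_mult by (intro allI sring_sum[OF R] sringD[OF R]) auto
lemma coeffs_in_monom: "c \<in> R \<Longrightarrow> coeffs_in R (Polynomial.monom c n)"
  by (simp add: coeffs_in_def sringD[OF R])
lemma coeffs_in_power: "coeffs_in R f \<Longrightarrow> coeffs_in R (f ^ n)"
  by (induction n) (auto intro: coeffs_in_mult)

lemma coeffs_in_prod_mset:
  "(\<And>x. x \<in># B \<Longrightarrow> coeffs_in R (f x)) \<Longrightarrow> coeffs_in R (\<Prod>x\<in>#B. f x)"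
  by (induction B) (auto intro: coeffs_in_mult)

lemma poly_in: "coeffs_in R f \<Longrightarrow> z \<in> R \<Longrightarrow> poly f z \<in> R"
  unfolding coeffs_in_def poly_altdef by (intro sring_sum[OF R] sringD[OF R]) auto

text \<open>The bound on the remainder is stated by vanishing coefficients, so that a divisor of
  degree 0 correctly forces the remainder 0.\<close>

lemma coeffs_in_division:
  assumes g: "coeffs_in R g" "lead_coeff g = 1" and f: "coeffs_in R f"
  shows "\<exists>h r. coeffs_in R h \<and> coeffs_in R r \<and> f = h * g + r \<and> (\<forall>i \<ge> Polynomial.degree g. poly.coeff r i = 0)"
  using f
proof (induction "Polynomial.degree f" arbitrary: f rule: less_induct)
  case less
  show ?case
  proof (cases "f = 0 \<or> Polynomial.degree f < Polynomial.degree g")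
    case True
    then have "\<forall>i \<ge> Polynomial.degree g. poly.coeff f i = 0" using le_degree by fastforce
    then show ?thesis using less.prems by (intro exI[of _ 0] exI[of _ f]) simp
  next
    case False
    define n where "n = Polynomial.degree f - Polynomial.degree g"
    define m where "m = Polynomial.monom (lead_coeff f) n"
    have m: "coeffs_in R m" unfolding m_def using less.prems by (intro coeffs_in_monom) (simp add: coeffs_in_def)
    have gnz: "g \<noteq> 0" using g(2) by auto
    have fnz: "lead_coeff f \<noteq> 0" using False by simp
    then have "m \<noteq> 0" "Polynomial.degree m = n" by (auto simp: m_def degree_monom_eq monom_eq_0_iff)
    then have deg: "Polynomial.degree (m * g) = Polynomial.degree f"
      using False gnz by (simp add: n_def degree_mult_eq)
    have lc: "lead_coeff (m * g) = lead_coeff f" using g(2) using fnz by (simp add: lead_coeff_mult m_def degree_monom_eq)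
    show ?thesis
    proof (cases "f - m * g = 0")
      case True
      then show ?thesis using m by (intro exI[of _ m] exI[of _ 0]) simp
    next
      case ne: False
      have "Polynomial.degree (f - m * g) < Polynomial.degree f"
      proof (rule ccontr)
        assume "\<not> ?thesis"
        moreover have "Polynomial.degree (f - m * g) \<le> Polynomial.degree f" using deg by (simp add: degree_diff_le)
        ultimately have "Polynomial.degree (f - m * g) = Polynomial.degree f" by simp
        then have "lead_coeff (f - m * g) = lead_coeff f - lead_coeff (m * g)" by (simp add: deg)
        then have "lead_coeff (f - m * g) = 0" using lc by (metis diff_self)
        then show False using ne unfolding leading_coeff_0_iff by blast
      qed
      moreover have "coeffs_in R (f - m * g)" by (intro coeffs_in_diff coeffs_in_mult m g less.prems)
      ultimately obtain h r where hr: "coeffs_in R h" "coeffs_in R r" "f - m * g = h * g + r"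
          "\<forall>i \<ge> Polynomial.degree g. poly.coeff r i = 0"
        using less.hyps by blast
      then have "f = (m + h) * g + r" by (simp add: algebra_simps)
      then show ?thesis using hr m by (intro exI[of _ "m + h"] exI[of _ r]) (simp add: coeffs_in_add)
    qed
  qed
qed

end

text \<open>The composite of the isogenies of the chain. It is monic, and \<open>lin\<close> of it
  is the product over the kernel in \<open>field_of_definition\<close>.\<close>

fun kpoly :: "nat \<Rightarrow> 'a::field \<Rightarrow> 'a list \<Rightarrow> 'a poly" where
  "kpoly q \<zeta> [] = 1"
| "kpoly q \<zeta> [l] = 1"
| "kpoly q \<zeta> (l # l' # ls) = tw_mult q (kpoly q (\<zeta> ^ q) (l' # ls)) [:- u_of q \<zeta> l l', 1:]"

lemma kernel_kpoly:
  fixes \<zeta> \<nu> :: "'a::alg_closed_field"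
  assumes "drinfeld_setup q t \<zeta> \<nu>" "chain q t \<zeta> \<nu> ls"
  shows "kernel q \<zeta> ls = {z. tw_app q (kpoly q \<zeta> ls) z = 0}" "lead_coeff (kpoly q \<zeta> ls) = 1"
    "poly.coeff (kpoly q \<zeta> ls) 0 \<noteq> 0"
proof -
  have "kernel q \<zeta> ls = {z. tw_app q (kpoly q \<zeta> ls) z = 0} \<and> lead_coeff (kpoly q \<zeta> ls) = 1 \<and>
    poly.coeff (kpoly q \<zeta> ls) 0 \<noteq> 0"
    using assms
  proof (induction ls arbitrary: \<zeta> \<nu>)
    case (Cons l ls)
    interpret drinfeld_setup q t \<zeta> \<nu> by fact
    show ?case
    proof (cases ls)
      case (Cons l' r)
      have "chain q t (\<zeta> ^ q) \<nu>' ls" "isog q t \<zeta> \<nu> l l'" "l \<noteq> 0" using Cons.prems(2) by (auto simp: Cons)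
      with Cons.IH[OF conj] isog_nz show ?thesis
        by (simp add: Cons lead_coeff_star del: tw_app_pCons)
    qed simp
  qed simp
  then show "kernel q \<zeta> ls = {z. tw_app q (kpoly q \<zeta> ls) z = 0}" "lead_coeff (kpoly q \<zeta> ls) = 1"
    "poly.coeff (kpoly q \<zeta> ls) 0 \<noteq> 0" by blast+
qed

context drinfeld_setup
begin

definition "base K \<longleftrightarrow> sfield K \<and> Fq q \<subseteq> K \<and> t \<in> K \<and> \<zeta> \<in> K \<and> \<nu> \<in> K"

context
  fixes K :: "'a set"
  assumes K: "base K"
begin

lemma sf: "sfield K" using K by (simp add: base_def)
lemmas sfD = sfieldD[OF sf]

lemma base_elts: "t \<in> K" "\<zeta> \<in> K" "\<nu> \<in> K" "c \<in> Fq q \<Longrightarrow> c \<in> K" using K by (auto simp: base_def)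

lemma xA_K: "xA \<in> K" "T \<in> K" "Ts \<in> K"
  unfolding x_elt_def rho_def T_elt_def T_conj_def by (intro sfD base_elts(1-3))+

lemma sr: "sring K" by (rule sfield_sring[OF sf])
lemmas over_pCons [simp] = coeffs_in_pCons[OF sr]
lemmas over_0 [simp] = coeffs_in_0[OF sr]
lemmas over_1 [simp] = coeffs_in_1[OF sr]
lemmas over_add = coeffs_in_add[OF sr]
lemmas over_smult = coeffs_in_smult[OF sr]
lemma over_star: "coeffs_in K f \<Longrightarrow> coeffs_in K g \<Longrightarrow> coeffs_in K (f \<star> g)"
  unfolding coeffs_in_def coeff_star by (intro allI sfield_sum[OF sf] sfD) auto

lemma over_lin: "coeffs_in K (lin f) \<longleftrightarrow> coeffs_in K f"
proof
  assume "coeffs_in K (lin f)"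
  then show "coeffs_in K f" unfolding coeffs_in_def by (metis coeff_lin_pow)
next
  assume f: "coeffs_in K f"
  have "poly.coeff (lin f) n \<in> K" for n
  proof (cases "n \<in> range (\<lambda>i. q ^ i)")
    case True
    then show ?thesis using f by (auto simp: coeffs_in_def)
  qed (simp add: coeff_lin_other sfD)
  then show "coeffs_in K (lin f)" by (simp add: coeffs_in_def)
qed

lemma u_of_K: "l \<in> K \<Longrightarrow> l' \<in> K \<Longrightarrow> u_of q \<zeta> l l' \<in> K"
  unfolding u_of_def by (intro sfD base_elts(1-3))

lemma lnext_K: "l \<in> K \<Longrightarrow> u \<in> K \<Longrightarrow> lnext l u \<in> K"
  unfolding lnext_def by (intro sfD base_elts(1-3))

lemma family_K:
  assumes "l \<in> K" "l \<noteq> 0"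
  shows "coeffs_in K (Pp l)" "coeffs_in K (Sx l)" "coeffs_in K (Sy l)"
proof -
  have del: "del l \<in> K" by (intro sfD base_elts(1-3) assms)
  have "alpha q t \<zeta> \<nu> l \<in> K"
    unfolding alpha_eq[OF assms(2)] hh_def by (intro sfD base_elts(1-3) assms)
  then show P: "coeffs_in K (Pp l)" using del sfD by (simp add: Pp_def)
  have "alpha_tilde q t \<zeta> \<nu> l \<in> K"
    unfolding alpha_tilde_eq gg_def by (intro sfD base_elts(1-3) assms xA_K)
  moreover have "xA / del l \<in> K" by (intro sfD del xA_K)
  ultimately have "coeffs_in K (Rp l)" unfolding Rp_def by (simp add: sfD)
  then show S: "coeffs_in K (Sx l)" unfolding Sx_eq by (intro over_star P)
  have "Ts / del l \<in> K" "\<zeta> ^ q * l \<in> K" by (intro sfD del xA_K base_elts assms)+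
  then have "coeffs_in K (Np l)" unfolding Np_def by simp
  then show "coeffs_in K (Sy l)" unfolding Sy_eq[OF assms(2)]
    by (intro over_add over_smult over_star P S sfD base_elts)
qed

lemma Phi_K:
  assumes "l \<in> K" "l \<noteq> 0" "a \<in> A"
  shows "coeffs_in K (Phi l a)"
  using assms(3)
proof (induction rule: A_induct)
  case (const c)
  then show ?case using drinfeld_props(3)[OF family_drinfeld(1)[OF assms(2)]] by (simp add: base_elts)
next
  case xA then show ?case using family_K(2)[OF assms(1,2)] family_drinfeld(4)[OF assms(2)] by simp
next
  case yA then show ?case using family_K(3)[OF assms(1,2)] family_drinfeld(5)[OF assms(2)] by simp
next
  case (add a b)
  then show ?case using drinfeld_props(1)[OF family_drinfeld(1)[OF assms(2)]] by (simp add: over_add)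
next
  case (mult a b)
  then show ?case using drinfeld_props(2)[OF family_drinfeld(1)[OF assms(2)]] by (simp add: over_star)
qed

lemma right_division_K:
  assumes "coeffs_in K P" "lead_coeff P = 1" "Polynomial.degree P = Suc n" "coeffs_in K f"
  shows "\<exists>h r. f = h \<star> P + r \<and> Polynomial.degree r \<le> n \<and> coeffs_in K h \<and> coeffs_in K r"
  unfolding coeffs_in_def using assms
  by (intro right_division sfD) (auto simp: coeffs_in_def)

text \<open>Division of \<open>f\<close> by \<open>Pp l\<close> takes place over \<open>K\<close>
  and leaves a remainder of degree at most 1 that vanishes on the kernel of
  \<open>\<tau> - u\<close>. So the remainder is \<open>r1 (\<tau> - u)\<close>, and
  \<open>u\<close> is a quotient of its coefficients.\<close>

lemma u_over_K:
  assumes l: "l \<in> K" "l \<noteq> 0" and isg: "isog q t \<zeta> \<nu> l l'" and f: "f = f' \<star> [:- u_of q \<zeta> l l', 1:]" "coeffs_in K f"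
    and ker: "\<And>z. app f z = 0 \<Longrightarrow> app (Pp l) z = 0 \<Longrightarrow> app [:- u_of q \<zeta> l l', 1:] z = 0"
  shows "u_of q \<zeta> l l' \<in> K" "coeffs_in K f'"
proof -
  define u where "u = u_of q \<zeta> l l'"
  define g where "g = [:- u, 1:]"
  note ueq = isg[unfolded isog_iff, folded u_def]
  have unz: "u \<noteq> 0" by (rule u_nz[OF l(2) ueq])
  have q1: "q - 1 > 0" using q_ge_2 by simp
  have ex: "\<exists>e. e \<noteq> 0 \<and> app [:- w, 1:] e = 0" if "w \<noteq> 0" for w
  proof -
    obtain e where e: "e ^ (q - 1) = w" using nth_root_exists q1 by blast
    then have "app [:- w, 1:] e = 0" by (simp add: pow_q_minus_1)
    moreover have "e \<noteq> 0" using e that q1 by (metis zero_power)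
    ultimately show ?thesis by blast
  qed
  obtain e where e: "e \<noteq> 0" "app g e = 0" using ex[OF unz] by (auto simp: g_def)
  have Pg: "app (Pp l) z = app [:- vv l u, 1:] (app g z)" for z unfolding g_def by (rule Pp_app[OF l(2) ueq])
  have "coeffs_in K (Pp l)" "lead_coeff (Pp l) = 1" "Polynomial.degree (Pp l) = Suc 1"
    using family_K(1)[OF l] by (simp_all add: Pp_def)
  from right_division_K[OF this f(2)] obtain h r where hr: "f = h \<star> Pp l + r" "Polynomial.degree r \<le> 1" "coeffs_in K r"
    by blast
  obtain r0 r1 where r: "r = [:r0, r1:]" using poly_degree_le_1[OF hr(2)] by blast
  have fe: "app f e = 0" using e by (simp add: f(1) g_def u_def del: tw_app_pCons)
  have "app (Pp l) e = 0" unfolding Pg e(2) by simp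
  then have "app r e = 0" using fe by (simp add: hr(1))
  then have "(r0 + r1 * u) * e = 0" using e(2) by (simp add: r g_def algebra_simps)
  then have r0: "r0 = - (r1 * u)" using e(1) by (simp add: add_eq_0_iff2)
  \<comment> \<open>Otherwise the whole kernel of \<open>Pp l\<close> would lie in the kernel of
    \<open>f\<close>; a point of it outside the kernel of \<open>\<tau> - u\<close> contradicts
    \<open>ker\<close>.\<close>
  have "r1 \<noteq> 0"
  proof
    assume "r1 = 0"
    then have fP: "f = h \<star> Pp l" using hr(1) r r0 by simp
    obtain e' where e': "e' \<noteq> 0" "app [:- vv l u, 1:] e' = 0" using ex[OF vv_nz(1)[OF l(2) ueq]] by blast
    obtain z where z: "app g z = e'" using tw_app_surj[of g e'] by (auto simp: g_def)
    have "app (Pp l) z = 0" unfolding Pg z by (rule e'(2))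
    then have "app g z = 0" using ker[of z] by (simp add: fP g_def u_def)
    then show False using z e'(1) by simp
  qed
  then have "u = - r0 / r1" by (simp add: r0)
  moreover have "r0 \<in> K" "r1 \<in> K" using hr(3) by (simp_all add: r)
  ultimately have uK: "u \<in> K" by (simp add: sfD)
  then show "u_of q \<zeta> l l' \<in> K" by (simp add: u_def)
  have "coeffs_in K g" "lead_coeff g = 1" "Polynomial.degree g = Suc 0" using uK by (simp_all add: g_def sfD)
  from right_division_K[OF this f(2)] obtain h2 r2 where hr2: "f = h2 \<star> g + r2" "Polynomial.degree r2 \<le> 0" "coeffs_in K h2" by blast
  then obtain c where c: "r2 = [:c:]" by (auto elim: degree_eq_zeroE)
  have "app f e = c * e" using e by (simp add: hr2(1) c)
  then have "r2 = 0" using fe e c by simp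
  then have "f' \<star> g = h2 \<star> g" using f(1) hr2(1) by (simp add: g_def u_def)
  then have "f' = h2" by (rule star_cancel_right[rotated]) (simp add: g_def)
  then show "coeffs_in K f'" using hr2(3) by simp
qed

end

lemma base_conj:
  assumes b: "base K"
  shows "drinfeld_setup.base q t (\<zeta> ^ q) \<nu>' K"
proof -
  note s = sfieldD[OF sf[OF b]]
  have "\<zeta> ^ q \<in> K" by (rule s(9)[OF base_elts(2)[OF b]])
  moreover have "\<nu>' \<in> K" by (rule s(6)[OF s(8)[OF xA_K(1)[OF b] base_elts(3)[OF b]]])
  ultimately show ?thesis
    unfolding drinfeld_setup.base_def[OF conj] using b by (simp add: base_def)
qed

end

lemma kpoly_over:
  fixes \<zeta> \<nu> :: "'a::alg_closed_field"
  assumes "drinfeld_setup q t \<zeta> \<nu>" "drinfeld_setup.base q t \<zeta> \<nu> K" "set ls \<subseteq> K"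
  shows "\<forall>i. poly.coeff (kpoly q \<zeta> ls) i \<in> K"
  using assms
proof (induction ls arbitrary: \<zeta> \<nu>)
  case Nil
  interpret drinfeld_setup q t \<zeta> \<nu> by fact
  show ?case using over_1[OF Nil(2)] by (simp add: coeffs_in_def)
next
  case (Cons l ls)
  interpret drinfeld_setup q t \<zeta> \<nu> by fact
  show ?case
  proof (cases ls)
    case Nil
    then show ?thesis using over_1[OF Cons.prems(2)] by (simp add: coeffs_in_def)
  next
    case (Cons l' r)
    have "coeffs_in K (kpoly q (\<zeta> ^ q) ls)"
      using Cons.IH[OF conj base_conj[OF Cons.prems(2)]] Cons.prems(3) by (simp add: coeffs_in_def)
    moreover have "coeffs_in K [:- u_of q \<zeta> l l', 1:]"
      using u_of_K[OF Cons.prems(2), of l l'] Cons.prems(3) sfieldD[OF sf[OF Cons.prems(2)]]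
      by (simp add: over_pCons[OF Cons.prems(2)] over_0[OF Cons.prems(2)] Cons)
    ultimately have "coeffs_in K (kpoly q \<zeta> (l # ls))"
      using over_star[OF Cons.prems(2)] by (simp add: Cons)
    then show ?thesis by (simp add: coeffs_in_def)
  qed
qed

lemma over_kpoly:
  fixes \<zeta> \<nu> :: "'a::alg_closed_field"
  assumes "drinfeld_setup q t \<zeta> \<nu>" "drinfeld_setup.base q t \<zeta> \<nu> K" "chain q t \<zeta> \<nu> ls" "hd ls \<in> K"
    "\<forall>i. poly.coeff (kpoly q \<zeta> ls) i \<in> K"
  shows "set ls \<subseteq> K"
  using assms
proof (induction ls arbitrary: \<zeta> \<nu>)
  case (Cons l ls)
  interpret drinfeld_setup q t \<zeta> \<nu> by fact
  show ?case
  proof (cases ls)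
    case Nil
    then show ?thesis using Cons.prems by simp
  next
    case (Cons l' r)
    have l: "l \<in> K" "l \<noteq> 0" "isog q t \<zeta> \<nu> l l'" and ch: "chain q t (\<zeta> ^ q) \<nu>' ls"
      using Cons.prems(3,4) by (auto simp: Cons)
    have kp: "kpoly q \<zeta> (l # ls) = kpoly q (\<zeta> ^ q) ls \<star> [:- u_of q \<zeta> l l', 1:]" by (simp add: Cons)
    have ov: "coeffs_in K (kpoly q \<zeta> (l # ls))" using Cons.prems(5) by (simp add: coeffs_in_def)
    have ker: "app [:- u_of q \<zeta> l l', 1:] z = 0" if "app (kpoly q \<zeta> (l # ls)) z = 0" "app (Pp l) z = 0" for z
      using kernel_inter[OF Cons.prems(1), of l l' r] kernel_kpoly(1)[OF Cons.prems(1,3)] Cons.prems(3) that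
      unfolding Cons by blast
    note u = u_over_K[OF Cons.prems(2) l kp ov ker]
    have l'K: "l' \<in> K" using lnext_K[OF Cons.prems(2) l(1) u(1)] by simp
    have "set ls \<subseteq> K"
      by (rule Cons.IH[OF conj base_conj[OF Cons.prems(2)] ch]) (use u(2) l'K in \<open>simp_all add: coeffs_in_def Cons\<close>)
    then show ?thesis using l by simp
  qed
qed simp

context tower_setup
begin

text \<open>From the pair, \<lambda>_0 is read off by \<open>family_parameter\<close> and the
  remaining coordinates by \<open>over_kpoly\<close>; conversely the coordinates give all
  coefficients of the module and of its group.\<close>

lemma tower_field_eq:
  assumes "ls \<in> tower_points q t \<zeta> \<nu> \<sigma> k"
  shows "tower_field q t \<zeta> \<nu> ls = field_of_definition q t \<zeta> (H_plus q t \<zeta> \<nu>) (\<Psi> ls)"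
proof -
  have ls: "length ls = Suc k" "chain q t \<zeta> \<nu> ls" using assms by (auto simp: tower_points_iff)
  define l where "l = hd ls"
  have l: "l \<noteq> 0" unfolding l_def by (rule chain_hd[OF ls(2)])
  have lset: "l \<in> set ls" using ls(1) by (cases ls) (auto simp: l_def)
  define M where "M = H_plus q t \<zeta> \<nu>"
  have M: "Fq q \<union> {t, \<zeta>, \<nu>} \<subseteq> M" unfolding M_def H_plus_def by (rule gen_field_incl)
  have base: "base K" if "sfield K" "M \<subseteq> K" for K using that M by (auto simp: base_def)
  have prod: "(\<Prod>\<mu>\<in>kernel q \<zeta> ls. [:- \<mu>, 1:]) = lin (kpoly q \<zeta> ls)"
    using lin_split(1)[of "kpoly q \<zeta> ls"] kernel_kpoly[OF drinfeld_setup_axioms ls(2)] by simp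
  define C where "C = {poly.coeff (Phi l a) i | a i. a \<in> A} \<union> range (poly.coeff (lin (kpoly q \<zeta> ls)))"
  have fod: "field_of_definition q t \<zeta> M (\<Psi> ls) = gen_field (M \<union> C)"
    by (simp add: field_of_definition_def \<Psi>_def prod C_def l_def Un_assoc)
  have tf: "tower_field q t \<zeta> \<nu> ls = gen_field (M \<union> set ls)" by (simp add: tower_field_def M_def)
  show ?thesis
    unfolding M_def[symmetric] fod tf
  proof (intro equalityI gen_field_minimal sfield_gen_field Un_least)
    show "M \<subseteq> gen_field (M \<union> C)" "M \<subseteq> gen_field (M \<union> set ls)"
      using gen_field_incl by blast+
    let ?K = "gen_field (M \<union> C)"
    have b: "base ?K" using base sfield_gen_field gen_field_incl by blast
    have CK: "C \<subseteq> ?K" using gen_field_incl by blast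
    have "l \<in> ?K"
    proof -
      have "poly.coeff (Phi l a) i \<in> ?K" if "a \<in> A" for a i
        using CK that unfolding C_def by blast
      from this[OF A_X, of 3] this[OF A_Y, of 3]
      have "poly.coeff (Sx l) 3 \<in> ?K" "poly.coeff (Sy l) 3 \<in> ?K"
        unfolding family_drinfeld(4,5)[OF l] by blast+
      moreover have "\<zeta> ^ q \<in> ?K" by (intro sfieldD[OF sfield_gen_field] base_elts[OF b])
      ultimately have "poly.coeff (Sy l) 3 / \<zeta> ^ q - poly.coeff (Sx l) 3 \<in> ?K"
        by (intro sfieldD(3)[OF sfield_gen_field] sfieldD(8)[OF sfield_gen_field])
      then show ?thesis using family_parameter[OF l] by simp
    qed
    moreover have "coeffs_in ?K (kpoly q \<zeta> ls)"
      using CK over_lin[OF b] unfolding coeffs_in_def C_def by blast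
    ultimately show "set ls \<subseteq> ?K"
      using over_kpoly[OF drinfeld_setup_axioms b ls(2)] by (simp add: coeffs_in_def l_def)
    let ?L = "gen_field (M \<union> set ls)"
    have b': "base ?L" using base sfield_gen_field gen_field_incl by blast
    have lsL: "set ls \<subseteq> ?L" using gen_field_incl by blast
    have "coeffs_in ?L (Phi l a)" if "a \<in> A" for a using Phi_K[OF b' _ l that] lsL lset by blast
    moreover have "coeffs_in ?L (lin (kpoly q \<zeta> ls))"
      using kpoly_over[OF drinfeld_setup_axioms b' lsL] over_lin[OF b'] by (simp add: coeffs_in_def)
    ultimately show "C \<subseteq> ?L" unfolding C_def coeffs_in_def by blast
  qed
qed

end

section \<open>Simple extensions and valuation rings\<close>

lemma sring_adjoin:
  fixes z :: "'a::field"
  assumes R: "sring R"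
  defines "E \<equiv> {poly f z | f. coeffs_in R f}"
  shows "sring E" "R \<subseteq> E" "z \<in> E"
proof -
  show "R \<subseteq> E"
  proof
    fix c assume "c \<in> R"
    then have "c = poly [:c:] z \<and> coeffs_in R [:c:]" using R by simp
    then show "c \<in> E" unfolding E_def by blast
  qed
  have "z = poly [:0, 1:] z \<and> coeffs_in R [:0, 1:]" using R sringD[OF R] by simp
  then show "z \<in> E" unfolding E_def by blast
  have "1 \<in> E" using sringD(1)[OF R] \<open>R \<subseteq> E\<close> by blast
  moreover have "a - b \<in> E \<and> a * b \<in> E" if ab: "a \<in> E" "b \<in> E" for a b
  proof -
    obtain f g where fg: "a = poly f z" "b = poly g z" "coeffs_in R f" "coeffs_in R g"
      using ab unfolding E_def by blast
    have "a - b = poly (f - g) z" "a * b = poly (f * g) z" using fg by auto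
    then show ?thesis using fg coeffs_in_diff[OF R] coeffs_in_mult[OF R] unfolding E_def by blast
  qed
  ultimately show "sring E" by (simp add: sring_def)
qed

lemma sfield_gen_field_eq: "sfield K \<Longrightarrow> gen_field K = K"
  using gen_field_minimal[of K K] gen_field_incl[of K] by blast

lemma sfield_subfield: "sfield K \<Longrightarrow> subfield K (ring_of_type_algebra :: 'a::field ring)"
  using subfield_gen_field[of K] by (simp add: sfield_gen_field_eq)

text \<open>Each further power of \<alpha> below \<open>n\<close> is outside the span of the
  preceding ones, so the dimension grows by one line extension at a time.\<close>

lemma dimension_poly:
  fixes K :: "'a::field set"
  assumes K: "sfield K"
    and min: "\<And>f. coeffs_in K f \<Longrightarrow> f \<noteq> 0 \<Longrightarrow> poly f \<alpha> = 0 \<Longrightarrow> n \<le> Polynomial.degree f"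
  shows "ext_degree n K {poly f \<alpha> | f. coeffs_in K f \<and> (\<forall>i\<ge>n. poly.coeff f i = 0)}"
  using min
proof (induction n)
  case 0
  have "{poly f \<alpha> | f. coeffs_in K f \<and> (\<forall>i\<ge>0. poly.coeff f i = 0)} = {0}"
  proof -
    have "(\<forall>i\<ge>0. poly.coeff f i = 0) \<longleftrightarrow> f = 0" for f :: "'a poly" by (auto simp: poly_eq_iff)
    then show ?thesis using coeffs_in_0[OF sfield_sring[OF K]] by auto
  qed
  then show ?case using univ.zero_dim[of K] by simp
next
  case (Suc n)
  note s = sfield_sring[OF K]
  define E where "E n = {poly f \<alpha> | f. coeffs_in K f \<and> (\<forall>i\<ge>n. poly.coeff f i = 0)}" for n
  have "n \<le> Polynomial.degree f" if "coeffs_in K f" "f \<noteq> 0" "poly f \<alpha> = 0" for f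
    using Suc.prems[OF that] by simp
  then have IH: "ext_degree n K (E n)" unfolding E_def by (rule Suc.IH)
  have notin: "\<alpha> ^ n \<notin> E n"
  proof
    assume "\<alpha> ^ n \<in> E n"
    then obtain f where f: "\<alpha> ^ n = poly f \<alpha>" "coeffs_in K f" "\<forall>i\<ge>n. poly.coeff f i = 0" by (auto simp: E_def)
    define g where "g = Polynomial.monom 1 n - f"
    have "poly.coeff g n = 1" using f(3) by (simp add: g_def)
    then have "g \<noteq> 0" by auto
    moreover have "coeffs_in K g" unfolding g_def
      using coeffs_in_diff[OF s coeffs_in_monom[OF s] f(2)] sringD(1)[OF s] by blast
    moreover have "poly g \<alpha> = 0" using f(1) by (simp add: g_def poly_monom)
    ultimately have "Suc n \<le> Polynomial.degree g" using Suc.prems by blast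
    moreover have "Polynomial.degree g \<le> n" by (rule degree_le) (use f(3) in \<open>auto simp: g_def\<close>)
    ultimately show False by simp
  qed
  have "univ.line_extension K (\<alpha> ^ n) (E n) = E (Suc n)"
  proof (intro equalityI subsetI)
    fix z assume "z \<in> univ.line_extension K (\<alpha> ^ n) (E n)"
    then obtain c e where c: "c \<in> K" "e \<in> E n" "z = c * \<alpha> ^ n + e"
      unfolding univ.line_extension_def set_add_def' r_coset_def by auto
    then obtain f where f: "e = poly f \<alpha>" "coeffs_in K f" "\<forall>i\<ge>n. poly.coeff f i = 0" by (auto simp: E_def)
    have "z = poly (Polynomial.monom c n + f) \<alpha>" by (simp add: c f poly_monom)
    moreover have "coeffs_in K (Polynomial.monom c n + f)"
      by (intro coeffs_in_add[OF s] coeffs_in_monom[OF s] c f)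
    moreover have "\<forall>i\<ge>Suc n. poly.coeff (Polynomial.monom c n + f) i = 0" using f(3) by simp
    ultimately show "z \<in> E (Suc n)" unfolding E_def by blast
  next
    fix z assume "z \<in> E (Suc n)"
    then obtain f where f: "z = poly f \<alpha>" "coeffs_in K f" "\<forall>i\<ge>Suc n. poly.coeff f i = 0" by (auto simp: E_def)
    define c where "c = poly.coeff f n"
    define g where "g = f - Polynomial.monom c n"
    have cK: "c \<in> K" using f(2) by (simp add: c_def coeffs_in_def)
    have "coeffs_in K g" unfolding g_def by (intro coeffs_in_diff[OF s] coeffs_in_monom[OF s] f cK)
    moreover have "\<forall>i\<ge>n. poly.coeff g i = 0"
    proof (intro allI impI)
      fix i assume "n \<le> i"
      then show "poly.coeff g i = 0" using f(3) by (cases "i = n") (auto simp: g_def c_def)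
    qed
    ultimately have "poly g \<alpha> \<in> E n" unfolding E_def by blast
    moreover have "z = c * \<alpha> ^ n + poly g \<alpha>" by (simp add: g_def f poly_monom)
    ultimately show "z \<in> univ.line_extension K (\<alpha> ^ n) (E n)"
      unfolding univ.line_extension_def set_add_def' r_coset_def using cK by auto
  qed
  moreover have "ext_degree (Suc n) K (univ.line_extension K (\<alpha> ^ n) (E n))"
    by (rule univ.Suc_dim[OF _ notin IH]) simp
  ultimately show ?case by (simp add: E_def)
qed

text \<open>The space \<open>E\<close> of polynomial values is closed under inverses by descent on
  the degree: division of \<open>m\<close> by the monic multiple of \<open>f\<close> leaves a
  nonzero remainder \<open>r\<close> of smaller degree, and at \<alpha> the inverse of
  \<open>f\<close> is expressed by that of \<open>r\<close>.\<close>

lemma minimal_polynomial: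
  fixes K :: "'a::field set"
  assumes K: "sfield K" and p: "coeffs_in K p" "p \<noteq> 0" "poly p \<alpha> = 0"
  shows "\<exists>m. coeffs_in K m \<and> lead_coeff m = 1 \<and> poly m \<alpha> = 0 \<and>
    ext_degree (Polynomial.degree m) K (gen_field (K \<union> {\<alpha>})) \<and>
    (\<forall>f. coeffs_in K f \<longrightarrow> poly f \<alpha> = 0 \<longrightarrow> (\<exists>h. coeffs_in K h \<and> f = h * m))"
proof -
  note s = sfield_sring[OF K]
  define Q where "Q f \<longleftrightarrow> coeffs_in K f \<and> f \<noteq> 0 \<and> poly f \<alpha> = 0" for f
  obtain m0 where m0: "Q m0" "\<And>f. Q f \<Longrightarrow> Polynomial.degree m0 \<le> Polynomial.degree f"
    using ex_has_least_nat[of Q p Polynomial.degree] p by (auto simp: Q_def)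
  define m where "m = Polynomial.smult (inverse (lead_coeff m0)) m0"
  have lc: "lead_coeff m0 \<noteq> 0" using m0 by (auto simp: Q_def)
  have "lead_coeff m0 \<in> K" using m0 by (auto simp: Q_def coeffs_in_def)
  then have m: "coeffs_in K m" unfolding m_def
    using m0(1) by (intro coeffs_in_smult[OF s] sfieldD(5)[OF K]) (auto simp: Q_def)
  have m1: "lead_coeff m = 1" "poly m \<alpha> = 0" using m0 lc by (auto simp: m_def Q_def)
  define d where "d = Polynomial.degree m"
  have d: "d \<le> Polynomial.degree f" if "coeffs_in K f" "f \<noteq> 0" "poly f \<alpha> = 0" for f
    using m0(2)[of f] that lc by (simp add: Q_def d_def m_def)
  have small: "f = 0" if "coeffs_in K f" "poly f \<alpha> = 0" "\<forall>i\<ge>d. poly.coeff f i = 0" for f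
    using d[OF that(1)] that(2,3) leading_coeff_0_iff by blast
  define E where "E = {poly f \<alpha> | f. coeffs_in K f \<and> (\<forall>i\<ge>d. poly.coeff f i = 0)}"
  have red: "\<exists>r. coeffs_in K r \<and> (\<forall>i\<ge>d. poly.coeff r i = 0) \<and> poly f \<alpha> = poly r \<alpha>" if cf: "coeffs_in K f" for f
  proof -
    obtain h r where "coeffs_in K r" "f = h * m + r" "\<forall>i\<ge>d. poly.coeff r i = 0"
      using coeffs_in_division[OF s m m1(1) cf] by (auto simp: d_def)
    then show ?thesis using m1(2) by auto
  qed
  have polyE: "poly f \<alpha> \<in> E" if f: "coeffs_in K f" for f
    unfolding E_def using red[OF f] by blast
  have EE: "E = {poly f \<alpha> | f. coeffs_in K f}" using polyE unfolding E_def by blast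
  have ring: "sring E" "K \<subseteq> E" "\<alpha> \<in> E" unfolding EE by (rule sring_adjoin[OF s])+
  have inv: "inverse (poly f \<alpha>) \<in> E" if "coeffs_in K f" "f \<noteq> 0" "\<forall>i\<ge>d. poly.coeff f i = 0" for f
    using that
  proof (induction "Polynomial.degree f" arbitrary: f rule: less_induct)
    case less
    note lf = less.prems
    show ?case
    proof (cases "Polynomial.degree f = 0")
      case True
      then obtain c where "f = [:c:]" by (auto elim: degree_eq_zeroE)
      then show ?thesis using lf s sfieldD(5)[OF K] ring(2) by auto
    next
      case False
      define c where "c = inverse (lead_coeff f)"
      define f1 where "f1 = Polynomial.smult c f"
      have cnz: "c \<noteq> 0" "c \<in> K" using lf sfieldD(5)[OF K] by (auto simp: c_def coeffs_in_def)
      have f1: "coeffs_in K f1" "lead_coeff f1 = 1" "Polynomial.degree f1 = Polynomial.degree f"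
        using lf cnz coeffs_in_smult[OF s] by (auto simp: f1_def c_def)
      obtain h r where hr: "coeffs_in K h" "coeffs_in K r" "m = h * f1 + r"
          "\<forall>i \<ge> Polynomial.degree f1. poly.coeff r i = 0"
        using coeffs_in_division[OF s f1(1,2) m] by blast
      have degf: "Polynomial.degree f < d"
        using lf leading_coeff_0_iff not_le by blast
      have rnz: "r \<noteq> 0"
      proof
        assume r0: "r = 0"
        then have hf: "poly h \<alpha> = 0 \<or> poly f1 \<alpha> = 0" using hr(3) m1(2) by auto
        have nz: "h \<noteq> 0" "f1 \<noteq> 0" using hr(3) r0 m1(1) by auto
        have "d = Polynomial.degree h + Polynomial.degree f1"
          using hr(3) r0 nz by (simp add: d_def degree_mult_eq)
        moreover have "d \<le> Polynomial.degree h \<or> d \<le> Polynomial.degree f1"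
          using hf d[OF hr(1) nz(1)] d[OF f1(1) nz(2)] by blast
        ultimately show False using False degf f1(3) by auto
      qed
      then have degr: "Polynomial.degree r < Polynomial.degree f"
        using hr(4) f1(3) leading_coeff_0_iff not_le by metis
      have "\<forall>i\<ge>d. poly.coeff r i = 0" using degr degf coeff_eq_0 by (metis le_trans less_le_trans nat_less_le)
      then have ir: "inverse (poly r \<alpha>) \<in> E" using less.hyps[OF degr hr(2) rnz] by blast
      have rz: "poly r \<alpha> \<noteq> 0" using small[OF hr(2)] \<open>\<forall>i\<ge>d. poly.coeff r i = 0\<close> rnz by blast
      have fz: "poly f \<alpha> \<noteq> 0" using small[OF lf(1)] lf by blast
      have "poly h \<alpha> * (c * poly f \<alpha>) = - poly r \<alpha>"
        using m1(2) hr(3) by (simp add: f1_def add_eq_0_iff)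
      then have "inverse (poly f \<alpha>) = - (c * poly h \<alpha> * inverse (poly r \<alpha>))"
        using rz fz by (simp add: field_simps add_eq_0_iff)
      moreover have "c \<in> E" "poly h \<alpha> \<in> E" using cnz ring(2) polyE[OF hr(1)] by auto
      ultimately show ?thesis using ir sringD[OF ring(1)] by simp
    qed
  qed
  have "sfield E"
    unfolding sfield_def
  proof (intro conjI ballI)
    fix a assume "a \<in> E"
    then obtain f where f: "a = poly f \<alpha>" "coeffs_in K f" "\<forall>i\<ge>d. poly.coeff f i = 0" by (auto simp: E_def)
    show "inverse a \<in> E"
      using inv[OF f(2) _ f(3)] sringD(2)[OF ring(1)] by (cases "f = 0") (auto simp: f(1))
  qed (use sringD[OF ring(1)] in auto)
  then have "gen_field (K \<union> {\<alpha>}) \<subseteq> E" by (rule gen_field_minimal) (use ring in auto)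
  moreover have "E \<subseteq> gen_field (K \<union> {\<alpha>})"
  proof -
    have s': "sring (gen_field (K \<union> {\<alpha>}))" by (intro sfield_sring sfield_gen_field)
    have incl: "K \<subseteq> gen_field (K \<union> {\<alpha>})" "\<alpha> \<in> gen_field (K \<union> {\<alpha>})" using gen_field_incl by blast+
    show ?thesis unfolding E_def using poly_in[OF s' coeffs_in_mono[OF _ incl(1)] incl(2)] by blast
  qed
  ultimately have "E = gen_field (K \<union> {\<alpha>})" by blast
  moreover have "ext_degree d K E" unfolding E_def by (rule dimension_poly[OF K d])
  ultimately have dim: "ext_degree (Polynomial.degree m) K (gen_field (K \<union> {\<alpha>}))" by (simp add: d_def)
  have div: "\<exists>h. coeffs_in K h \<and> f = h * m" if cf: "coeffs_in K f" "poly f \<alpha> = 0" for f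
  proof -
    obtain h r where hr: "coeffs_in K h" "coeffs_in K r" "f = h * m + r" "\<forall>i\<ge>d. poly.coeff r i = 0"
      using coeffs_in_division[OF s m m1(1) cf(1)] by (auto simp: d_def)
    then have "r = 0" using small[OF hr(2) _ hr(4)] cf(2) m1(2) by simp
    then show ?thesis using hr by auto
  qed
  show ?thesis using m m1 dim div by blast
qed

text \<open>The powers of \<alpha> below \<open>n\<close> are independent in \<open>E\<close>; no
  finiteness of the extension generated by \<alpha> enters.\<close>

lemma dimension_lower_bound:
  fixes K :: "'a::field set"
  assumes K: "sfield K" and E: "sfield E" "K \<subseteq> E" "\<alpha> \<in> E" "ext_degree N K E"
    and min: "\<And>f. coeffs_in K f \<Longrightarrow> f \<noteq> 0 \<Longrightarrow> poly f \<alpha> = 0 \<Longrightarrow> n \<le> Polynomial.degree f"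
  shows "n \<le> N"
proof -
  define E' where "E' = {poly f \<alpha> | f. coeffs_in K f \<and> (\<forall>i\<ge>n. poly.coeff f i = 0)}"
  have "ext_degree n K E'" unfolding E'_def by (rule dimension_poly[OF K min])
  then obtain Vs where Vs: "univ.independent K Vs" "length Vs = n" "univ.Span K Vs = E'"
    using univ.exists_base[OF sfield_subfield[OF K]] by blast
  have "set Vs \<subseteq> univ.Span K Vs" by (rule univ.Span_base_incl[OF sfield_subfield[OF K]]) simp
  also have "\<dots> \<subseteq> E"
    unfolding Vs(3) E'_def using poly_in[OF sfield_sring[OF E(1)] coeffs_in_mono[OF _ E(2)] E(3)] by blast
  finally show ?thesis
    using univ.independent_length_le_dimension[OF sfield_subfield[OF K] E(4) Vs(1)] Vs(2) by simp
qed

lemma dimension_tower: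
  assumes "sfield K" "sfield F" "ext_degree n K F" "ext_degree m F E"
  shows "ext_degree (n * m) K E"
  by (rule univ.telescopic_base[OF sfield_subfield[OF assms(1)] sfield_subfield[OF assms(2)] assms(3,4)])

section \<open>Valuation rings: existence and arithmetic\<close>

locale valuation_ring =
  fixes V :: "'a::field set"
  assumes sring: "sring V" and total: "z \<in> V \<or> inverse z \<in> V"

text \<open>If \<open>z\<close> and \<open>1 / z\<close> both satisfy a relation with coefficients in a proper ideal \<open>J\<close> of \<open>R\<close>,
  the relation of larger degree can be shortened by means of the other one.\<close>

lemma shorten_relation:
  fixes R :: "'a::field set"
  assumes R: "sring R" and J: "0 \<in> J" "J \<subseteq> R" "\<And>a b. a \<in> J \<Longrightarrow> b \<in> J \<Longrightarrow> a + b \<in> J" "\<And>a b. a \<in> R \<Longrightarrow> b \<in> J \<Longrightarrow> a * b \<in> J"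
    and a: "\<forall>i. a i \<in> J" "1 = (\<Sum>i\<le>Suc n. a i * z ^ i)"
    and g: "\<forall>i. g i \<in> J" "1 = (\<Sum>i\<le>m. g i * inverse z ^ i)"
    and z: "z \<noteq> 0" and mn: "m \<le> Suc n"
  shows "\<exists>b. (\<forall>i. b i \<in> J) \<and> 1 = (\<Sum>i\<le>n. b i * z ^ i)"
proof -
  define h where "h i = (if i \<le> m then g i else 0)" for i
  have h: "h i \<in> J" for i using g(1) J(1) by (simp add: h_def)
  have "(\<Sum>i\<le>Suc n. h i * inverse z ^ i) = (\<Sum>i\<le>m. g i * inverse z ^ i)"
    by (rule sum.mono_neutral_cong_right) (use mn in \<open>auto simp: h_def\<close>)
  then have "z ^ Suc n = (\<Sum>i\<le>Suc n. h i * inverse z ^ i) * z ^ Suc n" using g(2) by simp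
  also have "\<dots> = (\<Sum>i\<le>Suc n. h i * z ^ (Suc n - i))"
    unfolding sum_distrib_right
  proof (rule sum.cong)
    fix i assume "i \<in> {..Suc n}"
    then have "z ^ Suc n = z ^ i * z ^ (Suc n - i)" by (simp flip: power_add)
    then show "h i * inverse z ^ i * z ^ Suc n = h i * z ^ (Suc n - i)" using z by (simp add: power_inverse)
  qed simp
  also have "\<dots> = (\<Sum>i\<le>Suc n. h (Suc n - i) * z ^ i)"
    by (rule sum.reindex_bij_witness[of _ "\<lambda>i. Suc n - i" "\<lambda>i. Suc n - i"]) auto
  also have "\<dots> = (\<Sum>i\<le>n. h (Suc n - i) * z ^ i) + h 0 * z ^ Suc n" by simp
  finally have "z ^ Suc n - h 0 * z ^ Suc n = (\<Sum>i\<le>n. h (Suc n - i) * z ^ i)" by (metis add_diff_cancel_right')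
  then have top: "(1 - h 0) * z ^ Suc n = (\<Sum>i\<le>n. h (Suc n - i) * z ^ i)" by (simp only: left_diff_distrib mult_1)
  define b where "b i = (if i = 0 then h 0 else 0) + ((1 - h 0) * a i + a (Suc n) * h (Suc n - i))" for i
  have "b i \<in> J" for i
  proof -
    have "1 - h 0 \<in> R" using h J(2) sringD(1,3)[OF R] by blast
    moreover have "a (Suc n) \<in> R" using a(1) J(2) by blast
    ultimately show ?thesis unfolding b_def using h a(1) J by simp
  qed
  moreover have "1 = (\<Sum>i\<le>n. b i * z ^ i)"
  proof -
    have 1: "1 = (\<Sum>i\<le>n. a i * z ^ i) + a (Suc n) * z ^ Suc n" using a(2) by simp
    have "(\<Sum>i\<le>n. b i * z ^ i) = (\<Sum>i\<le>n. (if i = 0 then h 0 else 0) * z ^ i)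
        + ((1 - h 0) * (\<Sum>i\<le>n. a i * z ^ i) + a (Suc n) * (\<Sum>i\<le>n. h (Suc n - i) * z ^ i))"
      by (simp only: b_def sum_distrib_left sum.distrib[symmetric] distrib_right mult.assoc)
    also have "(\<Sum>i\<le>n. (if i = 0 then h 0 else 0) * z ^ i) = h 0"
      using sum.delta[of "{..n}" 0 "\<lambda>i. h 0 * z ^ i"] by (simp add: if_distrib[of "\<lambda>x. x * _"] cong: if_cong)
    also have "(\<Sum>i\<le>n. h (Suc n - i) * z ^ i) = (1 - h 0) * z ^ Suc n" using top by simp
    also have "h 0 + ((1 - h 0) * (\<Sum>i\<le>n. a i * z ^ i) + a (Suc n) * ((1 - h 0) * z ^ Suc n))
        = h 0 + (1 - h 0) * ((\<Sum>i\<le>n. a i * z ^ i) + a (Suc n) * z ^ Suc n)"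
      by (simp add: algebra_simps)
    finally show ?thesis unfolding 1[symmetric] by simp
  qed
  ultimately show ?thesis by blast
qed

text \<open>Take both relations of minimal degree; by symmetry in \<open>z\<close> and
  \<open>inverse z\<close> the longer one can be shortened, until degree 0 says that 1 lies in
  \<open>J\<close>.\<close>

lemma no_two_relations:
  fixes R :: "'a::field set"
  assumes R: "sring R" and J: "0 \<in> J" "J \<subseteq> R" "\<And>a b. a \<in> J \<Longrightarrow> b \<in> J \<Longrightarrow> a + b \<in> J" "\<And>a b. a \<in> R \<Longrightarrow> b \<in> J \<Longrightarrow> a * b \<in> J"
    and "1 \<notin> J" and z: "z \<noteq> 0"
    and a: "\<exists>a. (\<forall>i. a i \<in> J) \<and> 1 = (\<Sum>i\<le>n. a i * z ^ i)"
    and g: "\<exists>g. (\<forall>i. g i \<in> J) \<and> 1 = (\<Sum>i\<le>m. g i * inverse z ^ i)"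
  shows False
proof -
  have *: False if z: "z \<noteq> 0" and n: "\<exists>a. (\<forall>i. a i \<in> J) \<and> 1 = (\<Sum>i\<le>n. a i * z ^ i)"
      "\<And>n'. \<exists>a. (\<forall>i. a i \<in> J) \<and> 1 = (\<Sum>i\<le>n'. a i * z ^ i) \<Longrightarrow> n \<le> n'"
    and m: "\<exists>g. (\<forall>i. g i \<in> J) \<and> 1 = (\<Sum>i\<le>m. g i * inverse z ^ i)" "m \<le> n" for z :: 'a and n m
  proof (cases n)
    case 0
    obtain a where a: "\<forall>i. a i \<in> J" "1 = (\<Sum>i\<le>n. a i * z ^ i)" using n(1) by blast
    then have "1 = a 0" using 0 by simp
    then show False using a(1) \<open>1 \<notin> J\<close> by metis
  next
    case (Suc k)
    obtain a where a: "\<forall>i. a i \<in> J" "1 = (\<Sum>i\<le>Suc k. a i * z ^ i)" using n(1) Suc by auto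
    obtain g where g: "\<forall>i. g i \<in> J" "1 = (\<Sum>i\<le>m. g i * inverse z ^ i)" using m(1) by auto
    have "n \<le> k"
      using m(2) Suc by (intro n(2) shorten_relation[OF R J a g z]) auto
    then show False using Suc by simp
  qed
  define P where "P z n \<longleftrightarrow> (\<exists>a. (\<forall>i. a i \<in> J) \<and> 1 = (\<Sum>i\<le>n. a i * z ^ i))" for z and n :: nat
  obtain n0 where n0: "P z n0" "\<And>k. P z k \<Longrightarrow> n0 \<le> k"
    using a unfolding P_def[symmetric] by (metis LeastI Least_le)
  obtain m0 where m0: "P (inverse z) m0" "\<And>k. P (inverse z) k \<Longrightarrow> m0 \<le> k"
    using g unfolding P_def[symmetric] by (metis LeastI Least_le)
  show False
  proof (cases "m0 \<le> n0")
    case True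
    then show False using *[of z n0 m0] n0 m0 z unfolding P_def by blast
  next
    case False
    then show False using *[of "inverse z" m0 n0] n0 m0 z unfolding P_def by simp
  qed
qed

text \<open>A ring \<open>M\<close> maximal among those that contain \<open>R\<close> but not
  \<open>inverse \<pi>\<close> is a valuation ring. If \<open>z\<close> is not in \<open>M\<close>,
  maximality puts \<open>inverse \<pi>\<close> into \<open>M[z]\<close>, so 1 is a polynomial in
  \<open>z\<close> with coefficients in \<pi> M. This cannot happen for \<open>z\<close> and
  \<open>inverse z\<close> at once.\<close>

theorem valuation_ring_exists:
  fixes R :: "'a::field set"
  assumes R: "sring R" "\<pi> \<in> R" "inverse \<pi> \<notin> R"
  shows "\<exists>V. valuation_ring V \<and> R \<subseteq> V \<and> inverse \<pi> \<notin> V"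
proof -
  define \<A> where "\<A> = {S. sring S \<and> R \<subseteq> S \<and> inverse \<pi> \<notin> S}"
  have "\<exists>M\<in>\<A>. \<forall>S\<in>\<A>. M \<subseteq> S \<longrightarrow> S = M"
  proof (rule subset_Zorn_nonempty)
    show "\<A> \<noteq> {}" using R by (auto simp: \<A>_def)
    fix C assume C: "C \<noteq> {}" "subset.chain \<A> C"
    then have mem: "S \<in> \<A>" if "S \<in> C" for S using that by (auto simp: subset.chain_def)
    have "a - b \<in> \<Union>C \<and> a * b \<in> \<Union>C" if ab: "a \<in> \<Union>C" "b \<in> \<Union>C" for a b
    proof -
      obtain S1 S2 where "S1 \<in> C" "a \<in> S1" "S2 \<in> C" "b \<in> S2" using ab by blast
      then obtain S where "S \<in> C" "a \<in> S" "b \<in> S"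
        using C(2) unfolding subset_chain_def by blast
      then show ?thesis using mem[of S] sringD(3,4)[of S a b] unfolding \<A>_def by blast
    qed
    moreover obtain S0 where "S0 \<in> C" using C(1) by blast
    ultimately show "\<Union>C \<in> \<A>"
      using mem mem[of S0] sringD(1)[of S0] unfolding \<A>_def sring_def by blast
  qed
  then obtain M where M: "sring M" "R \<subseteq> M" "inverse \<pi> \<notin> M"
      and max: "\<And>S. sring S \<Longrightarrow> R \<subseteq> S \<Longrightarrow> inverse \<pi> \<notin> S \<Longrightarrow> M \<subseteq> S \<Longrightarrow> S = M"
    unfolding \<A>_def by auto
  have nz: "\<pi> \<noteq> 0" using R by auto
  define J where "J = {\<pi> * c | c. c \<in> M}"
  have piM: "\<pi> \<in> M" using R M by blast
  have rel: "\<exists>n a. (\<forall>i. a i \<in> J) \<and> 1 = (\<Sum>i\<le>n. a i * z ^ i)" if z: "z \<notin> M" for z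
  proof -
    define E where "E = {poly f z | f. coeffs_in M f}"
    note E = sring_adjoin[OF M(1), of z, folded E_def]
    have "inverse \<pi> \<in> E"
    proof (rule ccontr)
      assume "\<not> ?thesis"
      then have "E = M" using max[OF E(1)] E(2) M(2) by blast
      then show False using z E(3) by blast
    qed
    then obtain f where f: "inverse \<pi> = poly f z" "coeffs_in M f" unfolding E_def by blast
    have "1 = \<pi> * poly f z" using f(1)[symmetric] nz by simp
    also have "\<dots> = (\<Sum>i\<le>Polynomial.degree f. (\<pi> * poly.coeff f i) * z ^ i)"
      unfolding poly_altdef sum_distrib_left by (simp add: mult.assoc)
    finally show ?thesis using f(2) unfolding J_def coeffs_in_def
      by (intro exI[of _ "Polynomial.degree f"] exI[of _ "\<lambda>i. \<pi> * poly.coeff f i"]) auto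
  qed
  have J: "0 \<in> J" "J \<subseteq> M" "a \<in> J \<Longrightarrow> b \<in> J \<Longrightarrow> a + b \<in> J" "c \<in> M \<Longrightarrow> b \<in> J \<Longrightarrow> c * b \<in> J" for a b c
  proof -
    show "0 \<in> J" unfolding J_def using sringD(2)[OF M(1)] by auto
    show "J \<subseteq> M" unfolding J_def using sringD(4)[OF M(1)] piM by auto
    show "a \<in> J \<Longrightarrow> b \<in> J \<Longrightarrow> a + b \<in> J"
      unfolding J_def using sringD(6)[OF M(1)] by (auto simp flip: distrib_left)
    assume "c \<in> M" "b \<in> J"
    then obtain d where d: "b = \<pi> * d" "d \<in> M" unfolding J_def by blast
    then have "c * b = \<pi> * (c * d)" "c * d \<in> M" using sringD(4)[OF M(1) \<open>c \<in> M\<close>] by simp_all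
    then show "c * b \<in> J" unfolding J_def by blast
  qed
  have "1 \<notin> J"
  proof
    assume "1 \<in> J"
    then obtain c where "c \<in> M" "1 = \<pi> * c" by (auto simp: J_def)
    then show False using M(3) inverse_unique[of \<pi> c] by simp
  qed
  have "z \<in> M \<or> inverse z \<in> M" for z
  proof (rule ccontr)
    assume *: "\<not> ?thesis"
    then have "z \<noteq> 0" using sringD(2)[OF M(1)] by auto
    obtain n m where "\<exists>a. (\<forall>i. a i \<in> J) \<and> 1 = (\<Sum>i\<le>n. a i * z ^ i)"
      "\<exists>a. (\<forall>i. a i \<in> J) \<and> 1 = (\<Sum>i\<le>m. a i * inverse z ^ i)"
      using rel[of z] rel[of "inverse z"] * by blast
    then show False
      using no_two_relations[OF M(1) J(1,2), of z n m] J(3,4) \<open>1 \<notin> J\<close> \<open>z \<noteq> 0\<close> by blast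
  qed
  then have "valuation_ring M" using M by unfold_locales
  then show ?thesis using M by blast
qed

context valuation_ring
begin

text \<open>Membership in the maximal ideal; 0 is listed separately because its inverse is 0 by
  convention and lies in \<open>V\<close>.\<close>

definition "small z \<longleftrightarrow> z = 0 \<or> inverse z \<notin> V"
definition "unit z \<longleftrightarrow> z \<noteq> 0 \<and> z \<in> V \<and> inverse z \<in> V"

lemmas ringD = sringD[OF sring]

lemma small_0 [simp]: "small 0" by (simp add: small_def)
lemma unit_1 [simp]: "unit 1" by (simp add: unit_def ringD)
lemma small_in: "small z \<Longrightarrow> z \<in> V" using total[of z] by (auto simp: small_def ringD)
lemma unit_in: "unit z \<Longrightarrow> z \<in> V" "unit z \<Longrightarrow> z \<noteq> 0" by (auto simp: unit_def)
lemma not_small_unit: "unit z \<Longrightarrow> \<not> small z" by (simp add: unit_def small_def)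
lemma in_cases: "z \<in> V \<Longrightarrow> \<not> small z \<Longrightarrow> unit z" by (auto simp: unit_def small_def)
lemma small_inverse: "z \<notin> V \<Longrightarrow> small (inverse z)" by (simp add: small_def)
lemma inverse_small: "small z \<Longrightarrow> z \<noteq> 0 \<Longrightarrow> inverse z \<notin> V" by (simp add: small_def)

lemma small_mult: assumes "small a" "b \<in> V" shows "small (a * b)" "small (b * a)"
proof -
  show "small (a * b)"
  proof (rule ccontr)
    assume "\<not> ?thesis"
    then have ab: "a * b \<noteq> 0" "inverse (a * b) \<in> V" by (auto simp: small_def)
    then have "inverse a = b * inverse (a * b)" by simp
    moreover have "b * inverse (a * b) \<in> V" by (rule ringD(4)[OF assms(2) ab(2)])
    ultimately have "inverse a \<in> V" by (simp only:)
    then show False using assms(1) ab(1) unfolding small_def by simp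
  qed
  then show "small (b * a)" by (simp add: mult.commute)
qed

lemma small_add: assumes "small a" "small b" shows "small (a + b)"
proof (cases "a = 0 \<or> b = 0")
  case False
  have "a + b = b * (a / b + 1)" "a + b = a * (b / a + 1)" using False by (simp_all add: field_simps)
  moreover have "a / b \<in> V \<or> b / a \<in> V" using total[of "a / b"] by simp
  ultimately show ?thesis
  proof (elim disjE)
    assume "a / b \<in> V"
    then have "small (b * (a / b + 1))" by (intro small_mult(1) assms ringD(1,6))
    then show ?thesis using \<open>a + b = b * (a / b + 1)\<close> by simp
  next
    assume "b / a \<in> V"
    then have "small (a * (b / a + 1))" by (intro small_mult(1) assms ringD(1,6))
    then show ?thesis using \<open>a + b = a * (b / a + 1)\<close> by simp
  qed
qed (use assms in auto)

lemma small_minus: "small a \<Longrightarrow> small (- a)"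
  using small_mult(1)[of a "- 1"] ringD(1,5) by simp

lemma small_diff: "small a \<Longrightarrow> small b \<Longrightarrow> small (a - b)"
  using small_add[of a "- b"] small_minus by simp

lemma small_sum: "(\<And>i. i \<in> B \<Longrightarrow> small (f i)) \<Longrightarrow> small (\<Sum>i\<in>B. f i)"
  by (induction B rule: infinite_finite_induct) (auto intro: small_add)

lemma unit_mult: "unit a \<Longrightarrow> unit b \<Longrightarrow> unit (a * b)"
  by (simp add: unit_def ringD)

lemma unit_inverse: "unit a \<Longrightarrow> unit (inverse a)"
  by (simp add: unit_def)

lemma unit_divide: "unit a \<Longrightarrow> unit b \<Longrightarrow> unit (a / b)"
  unfolding field_class.field_divide_inverse by (intro unit_mult unit_inverse)

lemma unit_power: "unit a \<Longrightarrow> unit (a ^ n)"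
  by (induction n) (auto intro: unit_mult)

lemma unit_powi: "unit a \<Longrightarrow> unit (a powi n)"
  unfolding power_int_def by (auto intro: unit_power unit_inverse)

lemma unit_add_small: assumes "unit u" "small s" shows "unit (u + s)"
proof (rule in_cases)
  show "u + s \<in> V" using assms by (intro ringD unit_in small_in)
  show "\<not> small (u + s)"
  proof
    assume "small (u + s)"
    then have "small (u + s - s)" using assms(2) by (rule small_diff)
    then show False using assms(1) not_small_unit by simp
  qed
qed

lemma unit_minus: "unit u \<Longrightarrow> unit (- u)"
  by (simp add: unit_def ringD)

lemma unit_diff_small: "unit u \<Longrightarrow> small s \<Longrightarrow> unit (u - s)"
  using unit_add_small[of u "- s"] small_minus by simp

lemma small_diff_unit: "small s \<Longrightarrow> unit u \<Longrightarrow> unit (s - u)"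
  using unit_add_small[of "- u" s] unit_minus by simp

lemma small_power: "small z \<Longrightarrow> n > 0 \<Longrightarrow> small (z ^ n)"
proof (induction n)
  case (Suc n)
  then show ?case using small_mult(1)[of z "z ^ n"] small_in ringD(7) by simp
qed simp

lemma in_power_iff: assumes "n > 0" shows "z ^ n \<in> V \<longleftrightarrow> z \<in> V"
proof
  assume z: "z ^ n \<in> V"
  show "z \<in> V"
  proof (rule ccontr)
    assume n: "z \<notin> V"
    then have "small (inverse z ^ n)" using small_inverse small_power assms by blast
    moreover have "z \<noteq> 0" using n ringD(2) by auto
    ultimately show False using z by (simp add: small_def power_inverse)
  qed
qed (rule ringD)

lemma small_power_iff: assumes "n > 0" shows "small (z ^ n) \<longleftrightarrow> small z"
  using in_power_iff[OF assms, of "inverse z"] assms by (simp add: small_def power_inverse)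

lemma big_mult: assumes "z \<notin> V" "w \<notin> V \<or> unit w" shows "z * w \<notin> V"
proof
  assume zw: "z * w \<in> V"
  have "inverse w \<in> V" "w \<noteq> 0" using assms(2) small_in[OF small_inverse] ringD(2) by (auto simp: unit_def)
  moreover have "z = z * w * inverse w" using \<open>w \<noteq> 0\<close> by simp
  ultimately show False using ringD(4)[OF zw] assms(1) by metis
qed

lemma big_add: "z \<notin> V \<Longrightarrow> w \<in> V \<Longrightarrow> z + w \<notin> V"
  using ringD(3)[of "z + w" w] by auto

lemma integrally_closed:
  assumes "coeffs_in V f" "lead_coeff f = 1" "poly f z = 0"
  shows "z \<in> V"
proof (rule ccontr)
  assume z: "z \<notin> V"
  then have nz: "z \<noteq> 0" using ringD(2) by auto
  define n where "n = Polynomial.degree f"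
  have s: "small (inverse z)" using z by (rule small_inverse)
  have "0 = inverse z ^ n * poly f z" using assms(3) by simp
  also have "\<dots> = (\<Sum>i\<le>n. poly.coeff f i * inverse z ^ (n - i))"
    unfolding poly_altdef sum_distrib_left n_def[symmetric]
  proof (rule sum.cong)
    fix i assume "i \<in> {..n}"
    then have "inverse z ^ n = inverse z ^ (n - i) * inverse z ^ i" by (simp flip: power_add)
    then show "inverse z ^ n * (poly.coeff f i * z ^ i) = poly.coeff f i * inverse z ^ (n - i)"
      using nz by (simp add: power_inverse)
  qed simp
  also have "\<dots> = 1 + (\<Sum>i<n. poly.coeff f i * inverse z ^ (n - i))"
    using assms(2) by (simp add: n_def lessThan_Suc_atMost[symmetric])
  finally have "unit (0::'a)"
  proof (rule ssubst)
    have "small (\<Sum>i<n. poly.coeff f i * inverse z ^ (n - i))"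
      by (intro small_sum small_mult(2) small_power s) (use assms(1) in \<open>auto simp: coeffs_in_def\<close>)
    then show "unit (1 + (\<Sum>i<n. poly.coeff f i * inverse z ^ (n - i)))" by (intro unit_add_small unit_1)
  qed
  then show False by (simp add: unit_def)
qed

text \<open>The value group of \<open>V\<close> need not be the integers. This says that the value
  of \<open>z\<close> is \<open>n\<close> times that of \<pi>, which is all that ramification
  arguments require.\<close>

definition "val \<pi> z n \<longleftrightarrow> (\<exists>u. unit u \<and> z = \<pi> powi n * u)"

lemma val_nz: "val \<pi> z n \<Longrightarrow> \<pi> \<noteq> 0 \<Longrightarrow> z \<noteq> 0" by (auto simp: val_def unit_def)

lemma val_mult: assumes "val \<pi> a m" "val \<pi> b n" "\<pi> \<noteq> 0" shows "val \<pi> (a * b) (m + n)"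
proof -
  obtain u w where "unit u" "a = \<pi> powi m * u" "unit w" "b = \<pi> powi n * w" using assms by (auto simp: val_def)
  then have "a * b = \<pi> powi (m + n) * (u * w)" "unit (u * w)"
    using assms(3) unit_mult by (simp_all add: power_int_add ac_simps)
  then show ?thesis unfolding val_def by blast
qed

lemma val_inverse: assumes "val \<pi> a m" shows "val \<pi> (inverse a) (- m)"
proof -
  obtain u where "unit u" "a = \<pi> powi m * u" using assms by (auto simp: val_def)
  then have "inverse a = \<pi> powi (- m) * inverse u" "unit (inverse u)"
    using unit_inverse by (simp_all add: power_int_minus)
  then show ?thesis unfolding val_def by blast
qed

lemma val_trans: assumes "val \<pi> a m" "val a b n" shows "val \<pi> b (m * n)"
proof -
  obtain u w where "unit u" "a = \<pi> powi m * u" "unit w" "b = a powi n * w" using assms by (auto simp: val_def)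
  then have "b = \<pi> powi (m * n) * (u powi n * w)" "unit (u powi n * w)"
    using unit_mult unit_powi by (simp_all add: power_int_mult power_int_mult_distrib ac_simps)
  then show ?thesis unfolding val_def by blast
qed

lemma val_unit: "unit u \<Longrightarrow> val \<pi> u 0" by (auto simp: val_def)
lemma val_power: "val \<pi> (\<pi> ^ n) (int n)" by (auto simp: val_def intro!: exI[of _ 1])

lemma val_add:
  assumes "val \<pi> a m" "val \<pi> b n" "m < n" "\<pi> \<noteq> 0" "small \<pi>"
  shows "val \<pi> (a + b) m"
proof -
  obtain u w where u: "unit u" "a = \<pi> powi m * u" "unit w" "b = \<pi> powi n * w" using assms by (auto simp: val_def)
  define k where "k = nat (n - m)"
  have "\<pi> powi n = \<pi> powi m * \<pi> ^ k"
    using assms(3,4) power_int_add[of \<pi> m "n - m"] by (simp add: k_def flip: power_int_of_nat)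
  then have "a + b = \<pi> powi m * (u + \<pi> ^ k * w)" by (simp add: u algebra_simps)
  moreover have "k > 0" using assms(3) by (simp add: k_def)
  then have "unit (u + \<pi> ^ k * w)" by (intro unit_add_small small_mult(1) small_power u unit_in assms(5))
  ultimately show ?thesis unfolding val_def by blast
qed

text \<open>Terms of pairwise different values cannot cancel; the smallest value dominates.\<close>

lemma val_sum:
  assumes "finite S" "S \<noteq> {}" "inj_on n S" "\<And>i. i \<in> S \<Longrightarrow> val \<pi> (z i) (n i)" "\<pi> \<noteq> 0" "small \<pi>"
  shows "\<exists>k \<in> n ` S. val \<pi> (\<Sum>i\<in>S. z i) k"
  using assms(1-4)
proof (induction rule: finite_ne_induct)
  case (insert i S)
  have "inj_on n S" using insert.prems(1) by auto
  then obtain k where k: "k \<in> n ` S" "val \<pi> (sum z S) k" using insert.IH insert.prems(2) by blast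
  have i: "val \<pi> (z i) (n i)" using insert.prems(2) by simp
  have "n i \<noteq> k" using k(1) insert.prems(1) insert.hyps by auto
  then consider "n i < k" | "k < n i" by linarith
  then show ?case
  proof cases
    case 1
    then show ?thesis using val_add[OF i k(2) 1 assms(5,6)] insert.hyps by auto
  next
    case 2
    then show ?thesis using val_add[OF k(2) i 2 assms(5,6)] insert.hyps k(1) by (auto simp: add.commute)
  qed
qed auto

end

lemma gen_field_fractions:
  fixes M :: "'a::field set"
  assumes M: "sfield M" and z: "z \<in> gen_field (M \<union> {x})"
  shows "\<exists>f g. coeffs_in M f \<and> coeffs_in M g \<and> poly g x \<noteq> 0 \<and> z = poly f x / poly g x"
proof -
  note s = sfield_sring[OF M]
  define E where "E = {poly f x / poly g x | f g. coeffs_in M f \<and> coeffs_in M g \<and> poly g x \<noteq> 0}"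
  have "sfield E"
    unfolding sfield_def
  proof (intro conjI ballI)
    have "1 = poly 1 x / poly 1 x" by simp
    then show "1 \<in> E" unfolding E_def using coeffs_in_1[OF s] by force
    fix a assume "a \<in> E"
    then obtain f g where fg: "a = poly f x / poly g x" "coeffs_in M f" "coeffs_in M g" "poly g x \<noteq> 0"
      unfolding E_def by blast
    show "inverse a \<in> E"
    proof (cases "poly f x = 0")
      case True
      then show ?thesis using \<open>a \<in> E\<close> fg by simp
    next
      case False
      have "inverse a = poly g x / poly f x" by (simp add: fg)
      then show ?thesis unfolding E_def using fg False by blast
    qed
    fix b assume "b \<in> E"
    then obtain f' g' where fg': "b = poly f' x / poly g' x" "coeffs_in M f'" "coeffs_in M g'" "poly g' x \<noteq> 0"
      unfolding E_def by blast
    have "a - b = poly (f * g' - f' * g) x / poly (g * g') x" "a * b = poly (f * f') x / poly (g * g') x"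
      unfolding fg(1) fg'(1) using fg(4) fg'(4) by (simp_all add: diff_frac_eq)
    moreover have "coeffs_in M (f * g' - f' * g)" "coeffs_in M (g * g')" "coeffs_in M (f * f')"
      by (intro coeffs_in_diff[OF s] coeffs_in_mult[OF s] fg fg')+
    moreover have "poly (g * g') x \<noteq> 0" using fg fg' by simp
    ultimately show "a - b \<in> E" "a * b \<in> E" unfolding E_def by blast+
  qed
  moreover have "M \<union> {x} \<subseteq> E"
  proof
    fix c assume "c \<in> M \<union> {x}"
    then obtain f where "c = poly f x / poly 1 x" "coeffs_in M f"
    proof
      assume "c \<in> M" then show thesis using that[of "[:c:]"] s by simp
    next
      assume "c \<in> {x}" then show thesis using that[of "[:0, 1:]"] s sringD[OF s] by simp
    qed
    then show "c \<in> E" unfolding E_def using coeffs_in_1[OF s] by force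
  qed
  ultimately have "z \<in> E" using z gen_field_minimal by blast
  then show ?thesis unfolding E_def by blast
qed

context valuation_ring
begin

lemma field_unit: "sfield M \<Longrightarrow> M \<subseteq> V \<Longrightarrow> c \<in> M \<Longrightarrow> c \<noteq> 0 \<Longrightarrow> unit c"
  using sfieldD(5)[of M c] by (auto simp: unit_def)

lemma val_poly:
  assumes M: "sfield M" "M \<subseteq> V" and x: "small x" "x \<noteq> 0" and f: "coeffs_in M f" "f \<noteq> 0"
  shows "\<exists>n. val x (poly f x) n"
  using f
proof (induction f)
  case (pCons a f)
  have a: "a \<in> M" "coeffs_in M f" using pCons.prems(1) sfield_sring[OF M(1)] by auto
  show ?case
  proof (cases "a = 0")
    case True
    then have "f \<noteq> 0" using pCons.prems(2) by auto
    then obtain n where "val x (poly f x) n" using pCons.IH a by auto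
    then have "val x (x * poly f x) (1 + n)" using val_mult[of x x 1] val_power[of x 1] x by simp
    then show ?thesis using True by auto
  next
    case False
    have "poly f x \<in> V" by (intro poly_in[OF sring] coeffs_in_mono[OF a(2) M(2)] small_in x)
    then have "unit (a + x * poly f x)"
      by (intro unit_add_small field_unit[OF M] a False small_mult(1) x)
    then show ?thesis using val_unit by auto
  qed
qed simp

text \<open>On \<open>M(x)\<close> the ring \<open>V\<close> induces the place \<open>x = 0\<close>:
  the constants of \<open>M\<close> are units, so every nonzero element is a power of
  \<open>x\<close> times a unit.\<close>

lemma val_field:
  assumes M: "sfield M" "M \<subseteq> V" and x: "small x" "x \<noteq> 0" and z: "z \<in> gen_field (M \<union> {x})" "z \<noteq> 0"
  shows "\<exists>n. val x z n"
proof -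
  obtain f g where fg: "coeffs_in M f" "coeffs_in M g" "poly g x \<noteq> 0" "z = poly f x / poly g x"
    using gen_field_fractions[OF M(1) z(1)] by blast
  then have "f \<noteq> 0" "g \<noteq> 0" using z(2) by auto
  then obtain m n where "val x (poly f x) m" "val x (poly g x) n" using val_poly[OF M x] fg by meson
  then show ?thesis using val_mult[OF _ val_inverse x(2)] unfolding fg(4) field_class.field_divide_inverse by blast
qed

text \<open>If \<open>x\<close> has \<open>e\<close> times the value of \<pi>, coefficients from
  \<open>M(x)\<close> have values divisible by \<open>e\<close>. The terms of a polynomial of degree
  below \<open>e\<close> at \<pi> then have values distinct modulo \<open>e\<close> and cannot
  cancel.\<close>

lemma ramification:
  assumes M: "sfield M" "M \<subseteq> V" and x: "small x" "x \<noteq> 0" and \<pi>: "small \<pi>" "\<pi> \<noteq> 0" "val \<pi> x (int e)"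
    and f: "coeffs_in (gen_field (M \<union> {x})) f" "f \<noteq> 0" "poly f \<pi> = 0"
  shows "e \<le> Polynomial.degree f"
proof (rule ccontr)
  assume e: "\<not> ?thesis"
  define S where "S = {i. i \<le> Polynomial.degree f \<and> poly.coeff f i \<noteq> 0}"
  have "\<exists>n. val x (poly.coeff f i) n" if "i \<in> S" for i
    using val_field[OF M x, of "poly.coeff f i"] f(1) that by (auto simp: coeffs_in_def S_def)
  then obtain n where n: "\<And>i. i \<in> S \<Longrightarrow> val x (poly.coeff f i) (n i)" by metis
  define k where "k i = int e * n i + int i" for i
  have k: "val \<pi> (poly.coeff f i * \<pi> ^ i) (k i)" if "i \<in> S" for i
    unfolding k_def using val_mult[OF val_trans[OF \<pi>(3) n[OF that]] val_power \<pi>(2)] .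
  have inj: "inj_on k S"
  proof (rule inj_onI)
    fix i j assume ij: "i \<in> S" "j \<in> S" "k i = k j"
    then have lt: "i < e" "j < e" using e by (auto simp: S_def)
    have "k i mod int e = k j mod int e" using ij by simp
    then show "i = j" unfolding k_def using lt by (simp add: mod_mult_self2)
  qed
  have "Polynomial.degree f \<in> S" using f(2) by (simp add: S_def)
  then have S: "finite S" "S \<noteq> {}" by (auto simp: S_def)
  obtain j where "val \<pi> (\<Sum>i\<in>S. poly.coeff f i * \<pi> ^ i) j"
    using val_sum[OF S inj k \<pi>(2,1)] by blast
  moreover have "(\<Sum>i\<in>S. poly.coeff f i * \<pi> ^ i) = poly f \<pi>"
    unfolding poly_altdef S_def by (rule sum.mono_neutral_left) auto
  ultimately show False using f(3) val_nz[OF _ \<pi>(2)] by auto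
qed

end

section \<open>Degrees in the tower\<close>

text \<open>The equation between \<lambda>_0 and \<lambda>_1 for a rational function
  \<open>P / Q\<close> of \<lambda>_0, with denominators cleared. A common root of \<open>P\<close>
  and \<open>Q\<close> is cancelled by induction, any other root of \<open>Q\<close> is impossible,
  and for constant \<open>Q\<close> the numerator must be a monomial, for which the terms are
  compared.\<close>

lemma (in frobenius_field) no_rational_solution:
  fixes P Q :: "'a poly"
  assumes C: "C \<noteq> 0" "D \<noteq> 0" "C \<noteq> D" and Q: "Q \<noteq> 0"
    and eq: "[:0, 1:] * P ^ (q + 1) + Polynomial.smult D ([:0, 1:] ^ q * Q ^ (q + 1))
      = [:0, 1:] ^ (q + 1) * (P ^ q * Q) + Polynomial.smult C (P * Q ^ q)"
  shows False
  using Q eq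
proof (induction "Polynomial.degree Q" arbitrary: P Q rule: less_induct)
  case less
  let ?X = "[:0, 1:] :: 'a poly"
  show ?case
  proof (cases "\<exists>b. poly Q b = 0")
    case True
    then obtain b where b: "poly Q b = 0" by blast
    define L where "L = [:- b, 1:]"
    have L: "L \<noteq> 0" by (simp add: L_def)
    obtain Q1 where Q1: "Q = L * Q1" using b unfolding L_def poly_eq_0_iff_dvd by blast
    show False
    proof (cases "poly P b = 0")
      case True
      then obtain P1 where P1: "P = L * P1" unfolding L_def poly_eq_0_iff_dvd by blast
      have "L ^ (q + 1) * (?X * P1 ^ (q + 1) + Polynomial.smult D (?X ^ q * Q1 ^ (q + 1)))
          = L ^ (q + 1) * (?X ^ (q + 1) * (P1 ^ q * Q1) + Polynomial.smult C (P1 * Q1 ^ q))"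
        using less.prems(2) unfolding P1 Q1
        by (simp only: power_mult_distrib distrib_left mult_smult_right power_add power_one_right ac_simps)
      then have eq: "?X * P1 ^ (q + 1) + Polynomial.smult D (?X ^ q * Q1 ^ (q + 1))
          = ?X ^ (q + 1) * (P1 ^ q * Q1) + Polynomial.smult C (P1 * Q1 ^ q)"
        using L by (metis mult_left_cancel power_not_zero)
      have nz: "Q1 \<noteq> 0" using less.prems(1) Q1 by auto
      then have "Polynomial.degree Q = Suc (Polynomial.degree Q1)" unfolding Q1 degree_mult_eq[OF L nz] by (simp add: L_def)
      then show False using less.hyps[OF _ nz eq] by simp
    next
      case False
      \<comment> \<open>\<open>X G\<close> collects the terms with a high power of \<open>P\<close>;
        the others are divisible by \<open>Q ^ q\<close>, hence by \<open>(X - b)^2\<close> as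
        \<open>q \<ge> 2\<close>. Since \<open>G\<close> does not vanish at \<open>b\<close>, the
        single factor \<open>X\<close> would have to absorb both linear factors.\<close>
      define G where "G = P ^ q * (P - ?X ^ q * Q)"
      have G: "poly G b \<noteq> 0" using False b by (simp add: G_def)
      have swap: "a - e = f - d" if "a + d = e + f" for a d e f :: "'a poly"
      proof -
        have "a = e + f - d" using that by (metis add_diff_cancel_right')
        then show ?thesis by simp
      qed
      have "?X * G = Q ^ q * (Polynomial.smult C P - Polynomial.smult D (?X ^ q * Q))"
      proof -
        have "?X * G = ?X * P ^ (q + 1) - ?X ^ (q + 1) * (P ^ q * Q)"
          by (simp only: G_def power_add power_one_right right_diff_distrib ac_simps)
        also have "\<dots> = Polynomial.smult C (P * Q ^ q) - Polynomial.smult D (?X ^ q * Q ^ (q + 1))"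
          by (rule swap[OF less.prems(2)])
        also have "\<dots> = Q ^ q * (Polynomial.smult C P - Polynomial.smult D (?X ^ q * Q))"
          by (simp only: power_add power_one_right right_diff_distrib mult_smult_right mult_smult_left ac_simps)
        finally show ?thesis .
      qed
      moreover have "Q ^ 2 dvd Q ^ q" using q_ge_2 by (rule le_imp_power_dvd)
      moreover have "L ^ 2 dvd Q ^ 2" using Q1 by (intro dvd_power_same) simp
      ultimately have dvd: "L * L dvd ?X * G" unfolding power2_eq_square[symmetric] by (metis dvd_mult2 dvd_trans)
      then have "L dvd ?X * G" by (rule dvd_mult_left)
      then have "b = 0" using G unfolding L_def poly_eq_0_iff_dvd[symmetric] by auto
      then have "L * L dvd L * G" using dvd by (simp add: L_def)
      then have "L dvd G" using L by simp
      then show False using G unfolding L_def poly_eq_0_iff_dvd[symmetric] by blast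
    qed
  next
    case False
    then have "Polynomial.degree Q = 0" using alg_closed_imp_poly_has_root[of Q] by auto
    then obtain c where c: "Q = [:c:]" by (auto elim: degree_eq_zeroE)
    have cnz: "c \<noteq> 0" using less.prems(1) c by simp
    have Pnz: "P \<noteq> 0"
    proof
      assume "P = 0"
      then have "Polynomial.smult D (?X ^ q * Q ^ (q + 1)) = 0" using less.prems(2) q_pos by simp
      then show False using C(2) less.prems(1) by simp
    qed
    define n where "n = order 0 P"
    obtain P1 where P1: "P = ?X ^ n * P1" "\<not> ?X dvd P1"
      using order_decomp[OF Pnz, of 0] by (auto simp: n_def)
    have "poly P1 a \<noteq> 0" for a
    proof
      assume a: "poly P1 a = 0"
      then have "poly P a = 0" by (simp add: P1)
      then have "D * (a ^ q * c ^ (q + 1)) = 0"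
        using arg_cong[OF less.prems(2), of "\<lambda>f. poly f a"] q_pos(1)
        by (simp add: c zero_power del: power_Suc mult_eq_0_iff)
      then have "a = 0" using C(2) cnz by simp
      then show False using a P1(2) poly_eq_0_iff_dvd[of P1 0] by simp
    qed
    then have "Polynomial.degree P1 = 0" using alg_closed_imp_poly_has_root[of P1] by auto
    then obtain k where k: "P1 = [:k:]" by (auto elim: degree_eq_zeroE)
    have knz: "k \<noteq> 0" using Pnz P1 k by auto
    define m where "m i = poly.coeff (Polynomial.monom (k ^ (q + 1)) (1 + n * (q + 1))) i
        + poly.coeff (Polynomial.monom (D * c ^ (q + 1)) q) i
      - (poly.coeff (Polynomial.monom (k ^ q * c) (q + 1 + n * q)) i
        + poly.coeff (Polynomial.monom (C * (k * c ^ q)) n) i)" for i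
    have Pm: "P = Polynomial.monom k n" by (simp add: P1 k monom_altdef)
    have Xm: "?X = Polynomial.monom 1 1" by (simp add: monom_altdef)
    have Qm: "Q = Polynomial.monom c 0" by (simp add: c monom_0)
    have meq: "Polynomial.monom (k ^ (q + 1)) (1 + n * (q + 1)) + Polynomial.monom (D * c ^ (q + 1)) q
      = Polynomial.monom (k ^ q * c) (q + 1 + n * q) + Polynomial.monom (C * (k * c ^ q)) n"
      using less.prems(2) unfolding Pm Xm Qm
      by (simp only: mult_monom monom_power smult_monom) (simp add: algebra_simps)
    have coeff: "m i = 0" for i unfolding m_def Polynomial.coeff_add[symmetric] meq by (rule diff_self)
    \<comment> \<open>For \<open>n < q\<close> only the term with \<open>C\<close> has degree
      \<open>n\<close>; for \<open>n > q\<close> only the one with \<open>D\<close> has degree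
      \<open>q\<close>. For \<open>n = q\<close> the four monomials pair up and give
      \<open>k = c\<close> and \<open>D * c = C * k\<close>, against
      \<open>C \<noteq> D\<close>.\<close>
    consider "n < q" | "n = q" | "q < n" by linarith
    then show False
    proof cases
      case 1
      then have "n < 1 + n * (q + 1)" "n < q + 1 + n * q" by (simp_all add: trans_less_add1)
      then have "m n = - (C * (k * c ^ q))" using 1 by (simp add: m_def)
      then show False using coeff C(1) knz cnz by simp
    next
      case 2
      have "m q = D * c ^ (q + 1) - C * (k * c ^ q)" by (simp add: m_def 2)
      also have "\<dots> = (D * c - C * k) * c ^ q" by (simp add: algebra_simps)
      finally have "(D * c - C * k) * c ^ q = 0" using coeff by simp
      then have 1: "D * c = C * k" using cnz by auto
      have "m (q + 1 + q * q) = k ^ (q + 1) - k ^ q * c" by (simp add: m_def 2)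
      also have "\<dots> = (k - c) * k ^ q" by (simp add: algebra_simps)
      finally have "(k - c) * k ^ q = 0" using coeff by simp
      then have "k = c" using knz by simp
      then show False using 1 C(3) cnz by simp
    next
      case 3
      then have "q < 1 + n * (q + 1)" "q < q + 1 + n * q" by (simp_all add: trans_less_add1)
      then have "m q = D * c ^ (q + 1)" using 3 by (simp add: m_def)
      then show False using coeff C(2) cnz by simp
    qed
  qed
qed

section \<open>Alternation of zeros and poles along the tower\<close>

locale valued_frobenius = frobenius_field q "TYPE('a::alg_closed_field)" + valuation_ring V
  for q :: nat and V :: "'a::alg_closed_field set"
begin

lemma ex_root: "\<exists>\<theta>. \<theta> ^ q = (z::'a)"
  using nth_root_exists[OF q_pos(1), of z] by blast

text \<open>With \<theta> a q-th root of \<open>l\<close> and \<open>Y = \<theta> * r\<close> the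
  equation becomes \<open>Y * (Y ^ q - C) = w * (Y ^ q - D)\<close> with small \<open>w\<close>. A
  pole of \<open>Y\<close> is impossible, and a small \<open>Y\<close> would make \<open>r\<close>
  integral; so \<open>Y\<close> is a unit.\<close>

lemma large_root:
  assumes l: "small l" "l \<noteq> 0" and u: "unit C" "unit D" and r: "r \<notin> V"
    and eq: "l * r ^ (q + 1) + D * l ^ q = l ^ (q + 1) * r ^ q + C * r"
  shows "unit (r ^ q * l)"
proof -
  obtain \<theta> where \<theta>: "\<theta> ^ q = l" using ex_root by blast
  have \<theta>nz: "\<theta> \<noteq> 0" using \<theta> l(2) q_pos by auto
  have \<theta>s: "small \<theta>" using small_power_iff[OF q_pos(1), of \<theta>] l(1) \<theta> by simp
  define Y where "Y = \<theta> * r"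
  have Yq: "Y ^ q = r ^ q * l" by (simp add: Y_def power_mult_distrib \<theta> mult.commute)
  define w where "w = \<theta> * l ^ q"
  have ws: "small w" unfolding w_def using \<theta>s l(1) by (intro small_mult(1) ringD small_in)
  have eqY: "Y * (Y ^ q - C) = w * (Y ^ q - D)"
  proof -
    have "Y * (Y ^ q - C) = \<theta> * (l * r ^ (q + 1) - C * r)" unfolding Yq by (simp add: Y_def algebra_simps)
    also have "l * r ^ (q + 1) - C * r = l ^ (q + 1) * r ^ q - D * l ^ q" using eq by (simp add: algebra_simps)
    also have "\<theta> * (l ^ (q + 1) * r ^ q - D * l ^ q) = w * (Y ^ q - D)" unfolding Yq by (simp add: w_def algebra_simps)
    finally show ?thesis .
  qed
  have "Y \<in> V"
  proof (rule ccontr)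
    assume Y: "Y \<notin> V"
    then have s: "small (inverse (Y ^ q))" using small_power[OF small_inverse q_pos(1)] by (simp add: power_inverse)
    have u1: "unit (1 - C * inverse (Y ^ q))" "unit (1 - D * inverse (Y ^ q))"
      by (rule unit_diff_small[OF unit_1 small_mult(2)[OF s unit_in(1)]], rule u)+
    have nz: "Y ^ q \<noteq> 0" using Y ringD(2) by auto
    have "(Y * (1 - C * inverse (Y ^ q))) * Y ^ q = (w * (1 - D * inverse (Y ^ q))) * Y ^ q"
      using eqY nz by (simp add: algebra_simps)
    then have "Y * (1 - C * inverse (Y ^ q)) = w * (1 - D * inverse (Y ^ q))" using nz by simp
    moreover have "Y * (1 - C * inverse (Y ^ q)) \<notin> V" using big_mult Y u1(1) by blast
    moreover have "w * (1 - D * inverse (Y ^ q)) \<in> V" by (intro ringD(4) small_in ws unit_in u1)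
    ultimately show False by simp
  qed
  moreover have "\<not> small Y"
  proof
    assume Y: "small Y"
    have u1: "unit (Y ^ q - C)" "unit (Y ^ q - D)"
      by (rule small_diff_unit[OF small_power[OF Y q_pos(1)]], rule u)+
    then have "Y = w * ((Y ^ q - D) / (Y ^ q - C))" using eqY unit_in(2)[OF u1(1)] by (simp add: field_simps)
    then have "\<theta> * r = \<theta> * (l ^ q * ((Y ^ q - D) / (Y ^ q - C)))" by (simp only: w_def Y_def[symmetric] mult.assoc)
    then have "r = l ^ q * ((Y ^ q - D) / (Y ^ q - C))" using \<theta>nz mult_left_cancel by blast
    moreover have "l ^ q * ((Y ^ q - D) / (Y ^ q - C)) \<in> V"
      by (intro ringD small_in l unit_in unit_divide u1)
    ultimately show False using r by simp
  qed
  ultimately have "unit Y" by (rule in_cases)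
  then show ?thesis unfolding Yq[symmetric] by (rule unit_power)
qed

text \<open>Over a pole of \<open>l\<close> one type of root is close to \<open>l ^ q\<close>, while
  for the others \<open>r ^ q * l\<close> is close to \<open>D\<close>. The assumption on
  \<open>r - l ^ q\<close> excludes the first type.\<close>

lemma root_over_large:
  assumes l: "l \<notin> V" and u: "unit C" "unit D" and r: "r - l ^ q \<notin> V"
    and eq: "l * r ^ (q + 1) + D * l ^ q = l ^ (q + 1) * r ^ q + C * r"
  shows "unit (r ^ q * l)"
proof -
  obtain \<theta> where \<theta>: "\<theta> ^ q = inverse l" using ex_root by blast
  have lnz: "l \<noteq> 0" using l ringD(2) by auto
  have \<theta>nz: "\<theta> \<noteq> 0" using \<theta> lnz q_pos(1) by (metis inverse_nonzero_iff_nonzero zero_power)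
  have \<theta>s: "small \<theta>" using small_power_iff[OF q_pos(1), of \<theta>] small_inverse[OF l] \<theta> by simp
  define Y where "Y = r / \<theta>"
  have lq: "l * \<theta> ^ q = 1" using \<theta> lnz by simp
  have r: "r = \<theta> * Y" "r - l ^ q \<notin> V" using \<theta>nz r by (simp_all add: Y_def)
  have Yq: "Y ^ q = r ^ q * l" using \<theta> unfolding Y_def power_divide \<theta> by (simp add: divide_inverse)
  define w where "w = (\<theta> ^ q) ^ q"
  have wl: "w * l ^ q = 1" using lq by (simp add: w_def mult.commute flip: power_mult_distrib)
  have ws: "small w" unfolding w_def by (intro small_power \<theta>s q_pos(1))
  \<comment> \<open>This is \<open>r / l ^ q\<close>. If \<open>Y\<close> had a pole,
    \<open>Z\<close> would be congruent to 1, and then \<open>r - l ^ q\<close> would be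
    integral.\<close>
  define Z where "Z = w * \<theta> * Y"
  have eqZ: "Y ^ q * (Z - 1) = C * Z - D"
  proof -
    have "Y ^ q * (Z - 1) = w * (l * r ^ (q + 1)) - (w * l ^ q) * (r ^ q * l)"
      unfolding wl Yq by (simp add: Z_def r(1) algebra_simps)
    also have "\<dots> = w * (l * r ^ (q + 1) - l ^ (q + 1) * r ^ q)" by (simp add: algebra_simps)
    also have "l * r ^ (q + 1) - l ^ (q + 1) * r ^ q = C * r - D * l ^ q" using eq by (simp add: algebra_simps)
    also have "w * (C * r - D * l ^ q) = C * Z - D * (w * l ^ q)" by (simp add: Z_def r(1) algebra_simps)
    finally show ?thesis by (simp add: wl)
  qed
  have "Y \<in> V"
  proof (rule ccontr)
    assume Y: "Y \<notin> V"
    have Ynz: "Y \<noteq> 0" using Y ringD(2) by auto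
    have Ys: "small (inverse (Y ^ q))" using small_power[OF small_inverse[OF Y] q_pos(1)] by (simp add: power_inverse)
    have Z1: "Z - 1 = (C * Z - D) * inverse (Y ^ q)" using eqZ Ynz by (simp add: field_simps)
    have "Z \<in> V"
    proof (rule ccontr)
      assume Z: "Z \<notin> V"
      then have Znz: "Z \<noteq> 0" using ringD(2) by auto
      have "1 - inverse Z = (Z - 1) * inverse Z" using Znz by (simp add: algebra_simps)
      also have "\<dots> = (C - D * inverse Z) * inverse (Y ^ q)" unfolding Z1 using Znz by (simp add: algebra_simps)
      finally have "1 - inverse Z = (C - D * inverse Z) * inverse (Y ^ q)" .
      moreover have "small ((C - D * inverse Z) * inverse (Y ^ q))"
        by (intro small_mult(2) Ys ringD(3,4) unit_in u small_in small_inverse Z)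
      moreover have "unit (1 - inverse Z)" by (intro unit_diff_small unit_1 small_inverse Z)
      ultimately show False using not_small_unit by auto
    qed
    then have CZ: "C * Z - D \<in> V" by (intro ringD(3,4) unit_in(1)[OF u(1)] unit_in(1)[OF u(2)])
    then have Zs: "small (Z - 1)" unfolding Z1 by (intro small_mult(2) Ys)
    then have Zu: "unit Z" using unit_add_small[OF unit_1 Zs] by (metis add.commute diff_add_cancel)
    have Znz: "Z \<noteq> 0" by (rule unit_in(2)[OF Zu])
    have X: "r - l ^ q = w ^ (q - 1) * \<theta> ^ q * ((C * Z - D) / Z ^ q)"
    proof -
      have wnz: "w \<noteq> 0" using wl by auto
      have "w * (r - l ^ q) = Z - 1" using wl by (simp add: right_diff_distrib Z_def r(1) ac_simps)
      also have "\<dots> = (C * Z - D) * inverse (Y ^ q)" by (rule Z1)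
      also have "inverse (Y ^ q) = w ^ q * \<theta> ^ q / Z ^ q"
        using Ynz wnz \<theta>nz by (simp add: Z_def power_mult_distrib field_simps)
      also have "(C * Z - D) * (w ^ q * \<theta> ^ q / Z ^ q) = w * (w ^ (q - 1) * \<theta> ^ q * ((C * Z - D) / Z ^ q))"
        unfolding pow_q_minus_1[of w] by simp
      finally show ?thesis using wnz mult_left_cancel by blast
    qed
    have "w ^ (q - 1) * \<theta> ^ q * ((C * Z - D) / Z ^ q) \<in> V"
    proof -
      have "inverse (Z ^ q) \<in> V" by (intro unit_in unit_inverse unit_power Zu)
      then show ?thesis
        unfolding divide_inverse by (intro ringD(4,7) CZ small_in[OF \<theta>s] small_in[OF ws]) simp
    qed
    then show False using r(2) X by simp
  qed
  have "Y ^ q = D + w * \<theta> * (Y ^ (q + 1) - C * Y)"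
    using eqZ by (simp add: Z_def algebra_simps)
  also have "unit \<dots>"
    by (intro unit_add_small u small_mult(1) ws ringD(3,4,7) unit_in \<open>Y \<in> V\<close> small_in \<theta>s)
  finally show ?thesis unfolding Yq .
qed

lemma alternate:
  assumes l: "l \<noteq> 0" "small l \<or> l \<notin> V" "unit (l' ^ q * l)"
  shows "small l \<and> l' \<notin> V \<or> l \<notin> V \<and> small l'"
proof (cases "small l")
  case True
  have "l' \<notin> V"
  proof
    assume "l' \<in> V"
    then have "small (l' ^ q * l)" by (intro small_mult(2) True ringD)
    then show False using l(3) not_small_unit by blast
  qed
  then show ?thesis using True by simp
next
  case False
  then have lV: "l \<notin> V" using l(2) by blast
  have "small l'"
  proof (rule ccontr)
    assume "\<not> small l'"
    then have "unit l' \<or> l' \<notin> V" using in_cases by blast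
    then have "unit (l' ^ q) \<or> l' ^ q \<notin> V" using unit_power in_power_iff[OF q_pos(1)] by blast
    then have "l * l' ^ q \<notin> V" using big_mult[OF lV] by blast
    then show False using unit_in(1)[OF l(3)] by (simp add: mult.commute)
  qed
  then show ?thesis using lV by simp
qed

text \<open>By \<open>geometric_q\<close> the equation is \<open>z * (z - c) ^ (q - 1) = d\<close>.
  Whether \<open>l\<close> has a zero or a pole, \<open>c\<close> is integral and \<open>d\<close>
  is not, so \<open>z\<close> cannot be integral.\<close>

lemma tower_large:
  assumes l: "l \<noteq> 0" "small l \<or> l \<notin> V" "unit (l' ^ q * l)" and ab: "unit a" "unit b"
    and eq: "(\<Sum>i = 0..q - 1. (a * l ^ (q - 1) / (l' - l ^ q)) ^ i * z ^ (q - i))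
       - b * ((l' - l ^ q) / l ^ (q - 1)) * l' ^ (q - 1) = 0"
  shows "z \<notin> V"
proof
  assume z: "z \<in> V"
  have l'nz: "l' \<noteq> 0" using unit_in(2)[OF l(3)] q_pos by auto
  have q1: "q - 1 > 0" using q_ge_2 by simp
  define c where "c = a * l ^ (q - 1) / (l' - l ^ q)"
  define d where "d = b * ((l' - l ^ q) / l ^ (q - 1)) * l' ^ (q - 1)"
  have main: "c \<in> V \<and> d \<notin> V"
    using alternate[OF l]
  proof (elim disjE conjE)
    assume ls: "small l" and l': "l' \<notin> V"
    have w: "l' - l ^ q \<notin> V" using big_add[OF l', of "- (l ^ q)"] small_in[OF ls] ringD by simp
    have "small (a * l ^ (q - 1) * inverse (l' - l ^ q))"
      by (intro small_mult(2) small_inverse w ringD(4,7) unit_in ab small_in ls)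
    then have "c \<in> V" unfolding c_def divide_inverse by (rule small_in)
    moreover have "d \<notin> V"
    proof -
      have "inverse l \<notin> V" using ls l(1) by (rule inverse_small)
      then have "inverse l ^ (q - 1) \<notin> V" using in_power_iff[OF q1] by blast
      moreover have "l' ^ (q - 1) \<notin> V" using in_power_iff[OF q1] l' by blast
      ultimately have "(l' - l ^ q) * inverse l ^ (q - 1) * l' ^ (q - 1) * b \<notin> V"
        using w ab(2) big_mult by meson
      then show ?thesis unfolding d_def by (simp add: divide_inverse power_inverse ac_simps)
    qed
    ultimately show ?thesis by simp
  next
    assume lV: "l \<notin> V" and l': "small l'"
    define v where "v = l' * inverse l ^ q - 1"
    have ls: "small (inverse l)" using lV by (rule small_inverse)
    have vu: "unit v" unfolding v_def
      by (intro small_diff_unit unit_1 small_mult(1) l' ringD(7) small_in ls)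
    have vnz: "v \<noteq> 0" by (rule unit_in(2)[OF vu])
    have w: "l' - l ^ q = l ^ q * v" unfolding v_def using l(1) by (simp add: power_inverse algebra_simps)
    have lq: "l ^ q = l * l ^ (q - 1)" by (rule pow_q_minus_1)
    have "c = a * inverse l * inverse v" unfolding c_def w unfolding lq using l(1) vnz by (simp add: field_simps)
    moreover have "a * inverse l * inverse v \<in> V"
      by (intro ringD(4) unit_in unit_inverse small_in ab ls vu)
    moreover have "d = (b * v * (l' ^ q * l)) * inverse l'"
      unfolding d_def w unfolding lq pow_q_minus_1[of l'] using l(1) l'nz by (simp add: field_simps)
    moreover have "inverse l' * (b * v * (l' ^ q * l)) \<notin> V"
      using big_mult[OF inverse_small[OF l' l'nz]] unit_mult ab(2) vu l(3) by blast
    ultimately show ?thesis by (simp add: mult.commute)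
  qed
  have "z * (z - c) ^ (q - 1) = d" using eq geometric_q[of c z] unfolding c_def[symmetric] d_def[symmetric] by simp
  moreover have "z * (z - c) ^ (q - 1) \<in> V" using z main by (intro ringD(3,4,7)) auto
  ultimately show False using main by simp
qed

text \<open>Over a zero of \<open>l'\<close> the pole of \<open>l'' - l' ^ q\<close> is a pole of
  \<open>l''\<close>, and \<open>large_root\<close> applies; over a pole of \<open>l'\<close> it is
  just what \<open>root_over_large\<close> requires.\<close>

lemma tower_step:
  assumes l: "l \<noteq> 0" "small l \<or> l \<notin> V" "unit (l' ^ q * l)" and ab: "unit a" "unit b"
    and eq: "(\<Sum>i = 0..q - 1. (a * l ^ (q - 1) / (l' - l ^ q)) ^ i * (l'' - l' ^ q) ^ (q - i))
       - b * ((l' - l ^ q) / l ^ (q - 1)) * l' ^ (q - 1) = 0"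
    and u: "unit C" "unit D" and rel: "l' * l'' ^ (q + 1) + D * l' ^ q = l' ^ (q + 1) * l'' ^ q + C * l''"
  shows "unit (l'' ^ q * l')"
proof (cases "l' \<in> V")
  case True
  have l': "small l'" "l' \<noteq> 0" using alternate[OF l] True unit_in(2)[OF l(3)] q_pos by auto
  have "l'' - l' ^ q + l' ^ q \<notin> V" by (intro big_add tower_large[OF l ab eq] ringD True)
  then show ?thesis using large_root[OF l' u _ rel] by simp
next
  case False
  show ?thesis by (rule root_over_large[OF False u tower_large[OF l ab eq] rel])
qed

end

lemma gen_field_adjoin: "gen_field (gen_field S \<union> {x}) = gen_field (S \<union> {x :: 'a::field})"
proof (intro equalityI gen_field_minimal[OF sfield_gen_field])
  have S: "S \<union> {x} \<subseteq> gen_field (S \<union> {x})" by (rule gen_field_incl)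
  then have "gen_field S \<subseteq> gen_field (S \<union> {x})" by (intro gen_field_minimal[OF sfield_gen_field]) blast
  then show "gen_field S \<union> {x} \<subseteq> gen_field (S \<union> {x})" using S by blast
  show "S \<union> {x} \<subseteq> gen_field (gen_field S \<union> {x})"
    using gen_field_incl[of S] gen_field_incl[of "gen_field S \<union> {x}"] by blast
qed

section \<open>The first step of the tower\<close>

context drinfeld_setup
begin

text \<open>Consecutive parameters satisfy
  \<open>l * r^(q+1) + DD * l^q = l^(q+1) * r^q + CC * r\<close>, with conjugate constants at odd
  places. The constants differ only in \<open>t - \<zeta>^q\<close> versus
  \<open>t - \<zeta>\<close>, and their inequality is what excludes a rational root.\<close>

definition "CC = (1 / \<zeta> ^ q - 1 / \<zeta>) * (t - \<zeta> ^ q) * \<nu>"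
definition "DD = (1 / \<zeta> ^ q - 1 / \<zeta>) * (t - \<zeta>) * \<nu>"

lemma zeta_inverse_diff: "1 / \<zeta> ^ q - 1 / \<zeta> \<noteq> 0"
  by (simp add: field_simps)

lemma CC_nz: "CC \<noteq> 0" and DD_nz: "DD \<noteq> 0" and CC_neq_DD: "CC \<noteq> DD"
  unfolding CC_def DD_def using zeta_inverse_diff by auto

lemma CC_DD_K: "base K \<Longrightarrow> CC \<in> K" "base K \<Longrightarrow> DD \<in> K"
  unfolding CC_def DD_def by (intro sfieldD[OF sf] base_elts(1-3); assumption)+

definition "tower_poly l = Polynomial.monom 1 (q + 1) - Polynomial.smult (l ^ q) (Polynomial.monom 1 q)
  - Polynomial.smult (CC / l) (Polynomial.monom 1 1) + [:DD * l ^ (q - 1):]"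

lemma poly_tower_poly:
  assumes "l \<noteq> 0"
  shows "poly (tower_poly l) r = 0 \<longleftrightarrow> l * r ^ (q + 1) + DD * l ^ q = l ^ (q + 1) * r ^ q + CC * r"
proof -
  have "l * poly (tower_poly l) r = (l * r ^ (q + 1) + DD * l ^ q) - (l ^ (q + 1) * r ^ q + CC * r)"
    unfolding tower_poly_def using assms by (simp add: poly_monom pow_q_minus_1[of l] algebra_simps)
  then show ?thesis using assms by (metis mult_eq_0_iff right_minus_eq)
qed

lemma tower_poly_coeff:
  "Polynomial.degree (tower_poly l) = q + 1" "lead_coeff (tower_poly l) = 1" "poly.coeff (tower_poly l) 1 = - (CC / l)"
proof -
  have c: "poly.coeff (tower_poly l) i = (if i = q + 1 then 1 else 0) - (if i = q then l ^ q else 0)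
      - (if i = 1 then CC / l else 0) + (if i = 0 then DD * l ^ (q - 1) else 0)" for i
    unfolding tower_poly_def by (auto simp: coeff_pCons split: nat.splits)
  have "Polynomial.degree (tower_poly l) \<le> q + 1" by (rule degree_le) (use q_ge_2 in \<open>auto simp: c\<close>)
  moreover have 1: "poly.coeff (tower_poly l) (q + 1) = 1" using q_ge_2 by (simp add: c)
  ultimately show deg: "Polynomial.degree (tower_poly l) = q + 1" using le_degree[of "tower_poly l" "q + 1"] by simp
  show "lead_coeff (tower_poly l) = 1" unfolding deg by (rule 1)
  show "poly.coeff (tower_poly l) 1 = - (CC / l)" using q_ge_2 by (simp add: c)
qed

text \<open>The summand with exponent \<open>q + 1\<close> in the constant coefficient equals
  \<open>1 / \<zeta>^q - 1 / \<zeta>\<close> times \<open>\<zeta>^q - \<zeta>\<close>; it shifts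
  \<open>t - \<zeta>^q\<close> to \<open>t - \<zeta>\<close>, whence \<open>DD\<close>.\<close>

lemma isog_tower_poly:
  assumes l: "l \<noteq> 0" and isg: "isog q t \<zeta> \<nu> l l'"
  shows "poly (tower_poly l) l' = 0"
proof -
  have 1: "(\<zeta> powi (1 - int q) - 1) / (\<zeta> * l) * (t - \<zeta> ^ q) * \<nu> = CC / l"
    unfolding CC_def zeta_powi using l by (simp add: field_simps)
  have "(\<zeta> powi (- int q) - \<zeta> powi (-1)) * (t - \<zeta> ^ q) + (\<zeta> ^ (q - 1) - 1) ^ (q + 1)
      = (1 / \<zeta> ^ q - 1 / \<zeta>) * (t - \<zeta> ^ q) + (1 - \<zeta> / \<zeta> ^ q) * (1 - \<zeta> ^ q / \<zeta>)"
    unfolding kappa(2) by (simp add: power_int_minus divide_inverse)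
  also have "(1 - \<zeta> / \<zeta> ^ q) * (1 - \<zeta> ^ q / \<zeta>) = (1 / \<zeta> ^ q - 1 / \<zeta>) * (\<zeta> ^ q - \<zeta>)"
    by (simp add: field_simps)
  also have "(1 / \<zeta> ^ q - 1 / \<zeta>) * (t - \<zeta> ^ q) + \<dots> = (1 / \<zeta> ^ q - 1 / \<zeta>) * (t - \<zeta>)"
    unfolding distrib_left[symmetric] by simp
  finally have 2: "((\<zeta> powi (- int q) - \<zeta> powi (-1)) * (t - \<zeta> ^ q) + (\<zeta> ^ (q - 1) - 1) ^ (q + 1)) * \<nu> * l ^ (q - 1)
      = DD * l ^ (q - 1)" by (simp only: DD_def)
  have "tower_eq1 q t \<zeta> \<nu> l l'" using tower_eq1_iff[OF l] isg by simp
  then show ?thesis unfolding tower_eq1_def 1 2 tower_poly_def by (simp add: poly_monom)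
qed

lemma tower_poly_K:
  assumes "base K" "l \<in> K"
  shows "coeffs_in K (tower_poly l)"
proof -
  note s = sfieldD[OF sf[OF assms(1)]]
  note r = sfield_sring[OF sf[OF assms(1)]]
  show ?thesis unfolding tower_poly_def
    by (intro coeffs_in_add[OF r] coeffs_in_diff[OF r] coeffs_in_smult[OF r] coeffs_in_monom[OF r] s CC_DD_K assms)
      (use r assms in \<open>simp add: s CC_DD_K\<close>)
qed

lemma base_adjoin: "base M \<Longrightarrow> base (gen_field (M \<union> S))"
  using sfield_gen_field gen_field_incl[of "M \<union> S"] unfolding base_def by blast

context
  fixes M :: "'a set" and l :: 'a
  assumes M: "base M" and l: "transcendental_over M l"
begin

lemma M_ring: "sring M" by (rule sfield_sring[OF sf[OF M]])

lemma l_nz: "l \<noteq> 0"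
proof
  assume "l = 0"
  then have "[:0, 1 :: 'a:] = 0"
    by (intro transcendental_over_root[OF l]) (auto simp: coeff_pCons sringD[OF M_ring] split: nat.splits)
  then show False by simp
qed

lemma tower_poly_no_root:
  assumes r: "r \<in> gen_field (M \<union> {l})"
  shows "poly (tower_poly l) r \<noteq> 0"
proof
  assume root: "poly (tower_poly l) r = 0"
  obtain f g where fg: "coeffs_in M f" "coeffs_in M g" "poly g l \<noteq> 0" "r = poly f l / poly g l"
    using gen_field_fractions[OF sf[OF M] r] by blast
  let ?X = "[:0, 1:] :: 'a poly"
  define F where "F = ?X * f ^ (q + 1) + Polynomial.smult DD (?X ^ q * g ^ (q + 1))
      - (?X ^ (q + 1) * (f ^ q * g) + Polynomial.smult CC (f * g ^ q))"
  have x: "coeffs_in M ?X" using M_ring sringD[OF M_ring] by simp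
  have "coeffs_in M F"
    unfolding F_def
    by (intro coeffs_in_add[OF M_ring] coeffs_in_diff[OF M_ring] coeffs_in_smult[OF M_ring]
        coeffs_in_mult[OF M_ring] coeffs_in_power[OF M_ring] x fg CC_DD_K M)
  moreover have "poly F l = 0"
  proof -
    have f: "poly f l = r * poly g l" using fg(3,4) by simp
    have "poly F l = poly g l ^ (q + 1) * ((l * r ^ (q + 1) + DD * l ^ q) - (l ^ (q + 1) * r ^ q + CC * r))"
      unfolding F_def by (simp add: f power_mult_distrib algebra_simps)
    then show ?thesis using root unfolding poly_tower_poly[OF l_nz] by simp
  qed
  ultimately have "F = 0" using transcendental_over_root[OF l] by (simp add: coeffs_in_def)
  moreover have "g \<noteq> 0" using fg(3) by auto
  ultimately show False
    unfolding F_def right_minus_eq by (intro no_rational_solution[OF CC_nz DD_nz CC_neq_DD])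
qed

text \<open>If all roots were integral, so would be all coefficients; but the linear coefficient
  \<open>- (CC / l)\<close> has a pole.\<close>

lemma tower_poly_large_root:
  assumes V: "valuation_ring V" "M \<subseteq> V" "valuation_ring.small V l"
  shows "\<exists>r. r \<notin> V \<and> poly (tower_poly l) r = 0"
proof (rule ccontr)
  assume *: "\<not> ?thesis"
  interpret v: valuation_ring V by (rule V(1))
  obtain A where "size A = Polynomial.degree (tower_poly l)"
      and A: "tower_poly l = Polynomial.smult (lead_coeff (tower_poly l)) (\<Prod>x\<in>#A. [:- x, 1:])"
    using alg_closed_imp_factorization[of "tower_poly l"] tower_poly_coeff(2)[of l] by (metis coeff_0 zero_neq_one)
  have "coeffs_in V [:- x, 1:]" if x: "x \<in># A" for x
  proof -
    obtain B where B: "A = add_mset x B" using multi_member_split[OF x] by blast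
    have "poly (tower_poly l) x = 0" by (subst A) (simp add: B)
    then have "x \<in> V" using * by blast
    then show ?thesis using v.sring v.ringD by simp
  qed
  then have "coeffs_in V (\<Prod>x\<in>#A. [:- x, 1:])" by (intro coeffs_in_prod_mset[OF v.sring])
  then have "coeffs_in V (tower_poly l)" using A by (simp add: tower_poly_coeff(2))
  then have "- (CC / l) \<in> V" using tower_poly_coeff(3)[of l] unfolding coeffs_in_def by metis
  moreover have "inverse CC \<in> V" using CC_DD_K(1)[OF M] sfieldD(5)[OF sf[OF M]] V(2) by blast
  ultimately have "- (CC / l) * - inverse CC \<in> V" by (rule v.ringD(4)[OF _ v.ringD(5)])
  moreover have "- (CC / l) * - inverse CC = inverse l" using CC_nz by (simp add: field_simps)
  ultimately show False using v.inverse_small[OF V(3) l_nz] by simp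
qed

lemma ex_small_place: "\<exists>V. valuation_ring V \<and> M \<subseteq> V \<and> valuation_ring.small V l"
proof -
  define R where "R = {poly f l | f. coeffs_in M f}"
  note R = sring_adjoin[OF M_ring, of l, folded R_def]
  have "inverse l \<notin> R"
  proof
    assume "inverse l \<in> R"
    then obtain f where f: "inverse l = poly f l" "coeffs_in M f" unfolding R_def by blast
    have "pCons (- 1) f = 0"
    proof (rule transcendental_over_root[OF l])
      show "poly.coeff (pCons (- 1) f) i \<in> M" for i
        using f(2) sringD[OF M_ring] by (cases i) (auto simp: coeffs_in_def)
      show "poly (pCons (- 1) f) l = 0" using l_nz by (simp add: f(1)[symmetric])
    qed
    then show False by simp
  qed
  then obtain V where V: "valuation_ring V" "R \<subseteq> V" "inverse l \<notin> V"
    using valuation_ring_exists[OF R(1,3)] by blast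
  then have "valuation_ring.small V l" by (simp add: valuation_ring.small_def[OF V(1)])
  then show ?thesis using R(2) V by blast
qed

text \<open>A factor of degree at least \<open>q\<close> is forced by ramification, and a linear one is excluded.\<close>

lemma tower_poly_minimal:
  assumes r: "poly (tower_poly l) r = 0"
  shows "ext_degree (q + 1) (gen_field (M \<union> {l})) (gen_field (M \<union> {l} \<union> {r}))"
    "coeffs_in (gen_field (M \<union> {l})) f \<Longrightarrow> poly f r = 0 \<Longrightarrow> tower_poly l dvd f"
proof -
  define K where "K = gen_field (M \<union> {l})"
  have K: "sfield K" "base K" "l \<in> K" 
    unfolding K_def using base_adjoin[OF M, of "{l}"] sfield_gen_field gen_field_incl[of "M \<union> {l}"] by blast+
  note kr = sfield_sring[OF K(1)]
  have FK: "coeffs_in K (tower_poly l)" by (rule tower_poly_K[OF K(2,3)])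
  have Fnz: "tower_poly l \<noteq> 0" using tower_poly_coeff(2)[of l] by auto
  obtain m where m: "coeffs_in K m" "lead_coeff m = 1" "poly m r = 0"
      "ext_degree (Polynomial.degree m) K (gen_field (K \<union> {r}))"
      "\<And>f. coeffs_in K f \<Longrightarrow> poly f r = 0 \<Longrightarrow> \<exists>h. coeffs_in K h \<and> f = h * m"
    using minimal_polynomial[OF K(1) FK Fnz r] by blast
  obtain h where h: "coeffs_in K h" "tower_poly l = h * m" using m(5)[OF FK r] by blast
  have nz: "h \<noteq> 0" "m \<noteq> 0" using Fnz h(2) by auto
  have deg: "Polynomial.degree h + Polynomial.degree m = q + 1"
    using tower_poly_coeff(1)[of l] unfolding h(2) by (simp add: degree_mult_eq nz)
  have lin: "\<exists>y\<in>K. poly g y = 0" if g: "coeffs_in K g" "Polynomial.degree g = 1" for g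
  proof -
    obtain a b where ab: "g = [:a, b:]" using poly_degree_le_1[of g] g(2) by auto
    then have "b \<noteq> 0" using g(2) by auto
    then have "poly g (- a / b) = 0" by (simp add: ab)
    moreover have "- a / b \<in> K" using g(1) unfolding ab by (simp add: coeffs_in_pCons[OF kr] sfieldD[OF K(1)])
    ultimately show ?thesis by blast
  qed
  have no1: "Polynomial.degree h \<noteq> 1" "Polynomial.degree m \<noteq> 1"
    using lin[OF h(1)] lin[OF m(1)] tower_poly_no_root h(2) unfolding K_def[symmetric] by auto
  have m0: "Polynomial.degree m \<noteq> 0"
  proof
    assume "Polynomial.degree m = 0"
    then obtain c where "m = [:c:]" by (auto elim: degree_eq_zeroE)
    then show False using m(2,3) by simp
  qed
  obtain V where V: "valuation_ring V" "M \<subseteq> V" "valuation_ring.small V l" using ex_small_place by blast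
  interpret v: valued_frobenius q V by (intro valued_frobenius.intro frobenius_field_axioms V)
  obtain r0 where r0: "r0 \<notin> V" "poly (tower_poly l) r0 = 0" using tower_poly_large_root[OF V] by blast
  have r0nz: "r0 \<noteq> 0" using r0(1) v.ringD(2) by auto
  have uCD: "v.unit CC" "v.unit DD"
    using v.field_unit[OF sf[OF M] V(2)] CC_DD_K[OF M] CC_nz DD_nz by auto
  have u: "v.unit (r0 ^ q * l)"
    by (rule v.large_root[OF V(3) l_nz uCD r0(1)]) (use r0(2) poly_tower_poly[OF l_nz] in simp)
  \<comment> \<open>As \<open>r0\<close> has a pole, \<open>ramification\<close> is applied to its
    inverse: \<open>l\<close> is the q-th power of \<open>inverse r0\<close> times a unit, and the
    reversed polynomial vanishes there.\<close>
  have big: "q \<le> Polynomial.degree g" if g: "coeffs_in K g" "g \<noteq> 0" "poly g r0 = 0" for g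
  proof -
    define \<pi> where "\<pi> = inverse r0"
    have "v.val \<pi> l (int q)"
      unfolding v.val_def by (rule exI[of _ "r0 ^ q * l"]) (use u r0nz in \<open>simp add: \<pi>_def power_inverse\<close>)
    moreover have "v.small \<pi>" unfolding \<pi>_def by (rule v.small_inverse[OF r0(1)])
    moreover have "coeffs_in K (reflect_poly g)"
      using g(1) sringD(2)[OF kr] by (simp add: coeffs_in_def coeff_reflect_poly)
    moreover have "poly (reflect_poly g) \<pi> = 0"
      using g(3) r0nz by (simp add: poly_reflect_poly_nz \<pi>_def)
    ultimately have "q \<le> Polynomial.degree (reflect_poly g)"
      using v.ramification[OF sf[OF M] V(2,3) l_nz, of \<pi> q "reflect_poly g"] g(2) r0nz
      by (simp add: K_def \<pi>_def)
    also have "\<dots> \<le> Polynomial.degree g" by (rule degree_reflect_poly_le)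
    finally show ?thesis .
  qed
  \<comment> \<open>It is not yet known that \<open>r0\<close> is conjugate to \<open>r\<close>, so
    the bound falls on either factor. The other one then has degree at most 1; a linear factor would
    have a root in \<open>K\<close>, and \<open>m\<close> is not constant, so \<open>h\<close>
    is.\<close>
  have "poly h r0 = 0 \<or> poly m r0 = 0" using r0(2) h(2) by simp
  then have "q \<le> Polynomial.degree h \<or> q \<le> Polynomial.degree m" using big h(1) m(1) nz by blast
  then have d: "Polynomial.degree h = 0" "Polynomial.degree m = q + 1" using deg no1 m0 by auto
  show "ext_degree (q + 1) (gen_field (M \<union> {l})) (gen_field (M \<union> {l} \<union> {r}))"
    using m(4) unfolding d(2) K_def gen_field_adjoin .
  assume f: "coeffs_in (gen_field (M \<union> {l})) f" "poly f r = 0"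
  obtain c where c: "h = [:c:]" using d(1) by (auto elim: degree_eq_zeroE)
  have "lead_coeff (tower_poly l) = c" unfolding h(2) c lead_coeff_mult m(2) by simp
  then have "c = 1" unfolding tower_poly_coeff(2) by simp
  then have "tower_poly l = m" using c h(2) by simp
  then show "tower_poly l dvd f" using m(5)[of f] f by (auto simp: K_def)
qed

text \<open>If no valuation made \<open>r\<close> non-integral, then \<open>r\<close> would be integral over \<open>M[l]\<close>, and so would be
  all its conjugates, against \<open>tower_poly_large_root\<close>.\<close>

lemma ex_ramified_place:
  assumes r: "poly (tower_poly l) r = 0"
  shows "\<exists>V. valuation_ring V \<and> M \<subseteq> V \<and> valuation_ring.small V l \<and> r \<notin> V"
proof -
  define R0 where "R0 = {poly f l | f. coeffs_in M f}"
  note R0 = sring_adjoin[OF M_ring, of l, folded R0_def]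
  define R where "R = {poly f (inverse r) | f. coeffs_in R0 f}"
  note R = sring_adjoin[OF R0(1), of "inverse r", folded R_def]
  have rel: "l * r ^ (q + 1) + DD * l ^ q = l ^ (q + 1) * r ^ q + CC * r"
    using r poly_tower_poly[OF l_nz] by simp
  have rnz: "r \<noteq> 0"
  proof
    assume "r = 0"
    then show False using rel q_pos l_nz DD_nz by simp
  qed
  have "inverse (inverse r) \<notin> R"
  proof
    assume "inverse (inverse r) \<in> R"
    then obtain f where f: "r = poly f (inverse r)" "coeffs_in R0 f" unfolding R_def by auto
    \<comment> \<open>Multiplying \<open>r = f (1 / r)\<close> by the power of \<open>r\<close>
      given by the degree of \<open>f\<close> yields a monic equation for \<open>r\<close> over
      \<open>M[l]\<close>.\<close>
    define g where "g = Polynomial.monom 1 (Suc (Polynomial.degree f)) - reflect_poly f"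
    have gR: "coeffs_in R0 g" unfolding g_def
      using f(2) sringD(1,2)[OF R0(1)]
      by (intro coeffs_in_diff[OF R0(1)] coeffs_in_monom[OF R0(1)]) (simp_all add: coeffs_in_def coeff_reflect_poly)
    have "Polynomial.degree (reflect_poly f) < Suc (Polynomial.degree f)"
      using degree_reflect_poly_le[of f] by simp
    then have lc: "lead_coeff g = 1" "Polynomial.degree g = Suc (Polynomial.degree f)"
    proof -
      assume *: "Polynomial.degree (reflect_poly f) < Suc (Polynomial.degree f)"
      then show "Polynomial.degree g = Suc (Polynomial.degree f)"
        unfolding g_def diff_conv_add_uminus by (subst degree_add_eq_left) (simp_all add: degree_monom_eq)
      then show "lead_coeff g = 1" using * by (simp add: g_def coeff_eq_0)
    qed
    have "poly (reflect_poly f) r = r ^ Suc (Polynomial.degree f)"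
      unfolding poly_reflect_poly_nz[OF rnz] f(1)[symmetric] by simp
    then have "poly g r = 0" by (simp add: g_def poly_monom)
    moreover have "coeffs_in (gen_field (M \<union> {l})) g"
    proof (rule coeffs_in_mono[OF gR])
      have "M \<subseteq> gen_field (M \<union> {l})" "l \<in> gen_field (M \<union> {l})" using gen_field_incl by blast+
      then show "R0 \<subseteq> gen_field (M \<union> {l})"
        unfolding R0_def using poly_in[OF sfield_sring[OF sfield_gen_field] coeffs_in_mono] by blast
    qed
    ultimately have dvd: "tower_poly l dvd g" using tower_poly_minimal(2)[OF r] by blast
    obtain V where V: "valuation_ring V" "M \<subseteq> V" "valuation_ring.small V l" using ex_small_place by blast
    interpret v: valuation_ring V by (rule V(1))
    obtain r0 where r0: "r0 \<notin> V" "poly (tower_poly l) r0 = 0" using tower_poly_large_root[OF V] by blast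
    have "poly g r0 = 0" using dvd r0(2) by (metis dvd_def mult_zero_left poly_mult)
    moreover have "R0 \<subseteq> V"
      unfolding R0_def using poly_in[OF v.sring coeffs_in_mono[OF _ V(2)] v.small_in[OF V(3)]] by blast
    ultimately show False using v.integrally_closed[OF coeffs_in_mono[OF gR] lc(1)] r0(1) by blast
  qed
  then obtain V where V: "valuation_ring V" "R \<subseteq> V" "r \<notin> V"
    using valuation_ring_exists[OF R(1,3)] by auto
  interpret v: valuation_ring V by (rule V(1))
  have MV: "M \<subseteq> V" and lV: "l \<in> V" using R0(2,3) R(2) V(2) by blast+
  define z where "z = inverse r"
  have z: "v.small z" unfolding z_def by (rule v.small_inverse[OF V(3)])
  \<comment> \<open>The equation divided by \<open>r ^ (q + 1)\<close>: it exhibits \<open>l\<close>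
    as an integral multiple of the small element \<open>z\<close>.\<close>
  have "l = z * (l ^ (q + 1) + CC * z ^ (q - 1) - DD * l ^ q * z ^ q)"
  proof -
    have "r * z = 1" using rnz by (simp add: z_def)
    then have rz: "r ^ q * z ^ q = 1" by (simp flip: power_mult_distrib)
    have "l = (r * z) * (l * (r ^ q * z ^ q))" unfolding rz \<open>r * z = 1\<close> by simp
    also have "\<dots> = (l * r ^ (q + 1)) * (z * z ^ q)" by (simp add: ac_simps)
    also have "l * r ^ (q + 1) = l ^ (q + 1) * r ^ q + CC * r - DD * l ^ q" using rel by (simp add: algebra_simps)
    also have "\<dots> * (z * z ^ q) = z * (l ^ (q + 1) * (r ^ q * z ^ q) + CC * (r * z) * z ^ (q - 1) - DD * l ^ q * z ^ q)"
      using pow_q_minus_1[of z] by (simp add: algebra_simps)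
    finally show ?thesis unfolding rz \<open>r * z = 1\<close> by simp
  qed
  moreover have "CC \<in> V" "DD \<in> V" using CC_DD_K[OF M] MV by auto
  then have "v.small (z * (l ^ (q + 1) + CC * z ^ (q - 1) - DD * l ^ q * z ^ q))"
    by (intro v.small_mult(1) z v.ringD(3,4,6,7) lV v.small_in[OF z])
  ultimately have "v.small l" by simp
  then show ?thesis using V MV by blast
qed

end

lemma base_seq: "base K \<Longrightarrow> drinfeld_setup.base q t (zs i) (ns i) K"
  using base_conj by (simp add: zs_def ns_def)

end

section \<open>Degrees of all steps of the tower\<close>

context tower_setup
begin

context
  fixes ls :: "'a list" and k :: nat
  assumes ls: "ls \<in> tower_points q t \<zeta> \<nu> \<sigma> k" and trans: "transcendental_over (H_plus q t \<zeta> \<nu>) (ls ! 0)"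
begin

abbreviation (input) "M \<equiv> H_plus q t \<zeta> \<nu>"

definition "F j = gen_field (M \<union> set (take (Suc j) ls))"

lemma base_M: "base M"
  using sfield_gen_field gen_field_incl[of "Fq q \<union> {t, \<zeta>, \<nu>}"] unfolding base_def H_plus_def by blast

lemma F_0: "F 0 = gen_field (M \<union> {ls ! 0})"
proof -
  have "ls \<noteq> []" using ls by (auto simp: tower_points_def)
  then have "take (Suc 0) ls = [ls ! 0]" by (simp add: take_Suc_conv_app_nth)
  then show ?thesis by (simp add: F_def)
qed

lemma F_Suc: "Suc j \<le> k \<Longrightarrow> F (Suc j) = gen_field (F j \<union> {ls ! Suc j})"
proof -
  assume "Suc j \<le> k"
  then have "Suc j < length ls" using ls by (auto simp: tower_points_def)
  then have "set (take (Suc (Suc j)) ls) = set (take (Suc j) ls) \<union> {ls ! Suc j}"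
    by (auto simp: take_Suc_conv_app_nth)
  then show ?thesis unfolding F_def gen_field_adjoin Un_assoc by simp
qed

lemma F_base: "base (F j)"
  unfolding F_def by (rule base_adjoin[OF base_M])

lemma ls_F: "i \<le> j \<Longrightarrow> j \<le> k \<Longrightarrow> ls ! i \<in> F j"
proof -
  assume "i \<le> j" "j \<le> k"
  then have "ls ! i \<in> set (take (Suc j) ls)"
    using ls nth_mem[of i "take (Suc j) ls"] by (auto simp: tower_points_def)
  then show ?thesis unfolding F_def using gen_field_incl by blast
qed

lemma ls_chain: "length ls = Suc k" "chain q t \<zeta> \<nu> ls"
  using ls by (auto simp: tower_points_iff)

lemma ls_isog: "i < k \<Longrightarrow> isog q t (zs i) (ns i) (ls ! i) (ls ! Suc i)"
  using ls_chain chain_nth[OF drinfeld_setup_axioms, of ls] by auto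

lemma ls_nz: "i \<le> k \<Longrightarrow> ls ! i \<noteq> 0"
proof (induction i)
  case 0
  then show ?case using ls by (simp add: tower_points_def)
next
  case (Suc i)
  interpret z: drinfeld_setup q t "zs i" "ns i" by (rule setup_seq)
  show ?case using z.isog_nz[OF _ ls_isog[of i]] Suc by simp
qed

lemma ls_tower_eq:
  assumes "Suc (Suc i) \<le> k"
  shows "ls ! Suc i - (ls ! i) ^ q \<noteq> 0"
    "(\<Sum>j = 0..q - 1. (ns i * (1 - \<zeta> powi (1 - int q)) ^ (q + 1) * (ls ! i) ^ (q - 1) / (ls ! Suc i - (ls ! i) ^ q)) ^ j
        * (ls ! Suc (Suc i) - (ls ! Suc i) ^ q) ^ (q - j))
     - ns (Suc i) / ns i * ((ls ! Suc i - (ls ! i) ^ q) / (ls ! i) ^ (q - 1)) * (ls ! Suc i) ^ (q - 1) = 0"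
proof -
  have "tower_eq q \<zeta> \<nu> \<sigma> (Suc (Suc i)) (ls ! i) (ls ! Suc i) (ls ! Suc (Suc i))"
    using ls assms unfolding tower_points_def by (elim CollectE conjE allE[of _ "Suc (Suc i)"]) simp
  moreover have "ns (Suc (Suc i)) = ns i" by (simp add: ns_def)
  ultimately show "ls ! Suc i - (ls ! i) ^ q \<noteq> 0"
    "(\<Sum>j = 0..q - 1. (ns i * (1 - \<zeta> powi (1 - int q)) ^ (q + 1) * (ls ! i) ^ (q - 1) / (ls ! Suc i - (ls ! i) ^ q)) ^ j
        * (ls ! Suc (Suc i) - (ls ! Suc i) ^ q) ^ (q - j))
     - ns (Suc i) / ns i * ((ls ! Suc i - (ls ! i) ^ q) / (ls ! i) ^ (q - 1)) * (ls ! Suc i) ^ (q - 1) = 0"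
    unfolding tower_eq_def \<sigma>_seq by simp_all
qed

lemma seq_K:
  assumes "base K"
  shows "ns i \<in> K" "ns i \<noteq> 0" "(1 - \<zeta> powi (1 - int q)) ^ (q + 1) \<in> K" "(1 - \<zeta> powi (1 - int q)) ^ (q + 1) \<noteq> 0"
proof -
  interpret z: drinfeld_setup q t "zs i" "ns i" by (rule setup_seq)
  show "ns i \<in> K" by (rule z.base_elts(3)[OF base_seq[OF assms]])
  show "ns i \<noteq> 0" by (rule z.\<nu>_nz)
  note s = sfieldD[OF sf[OF assms]]
  show "(1 - \<zeta> powi (1 - int q)) ^ (q + 1) \<in> K"
    unfolding zeta_powi by (intro s base_elts(1-3)[OF assms])
  show "(1 - \<zeta> powi (1 - int q)) ^ (q + 1) \<noteq> 0"
    unfolding kappa by simp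
qed

lemma first_root: "k \<ge> 1 \<Longrightarrow> poly (tower_poly (ls ! 0)) (ls ! 1) = 0"
  using isog_tower_poly[OF ls_nz[of 0]] ls_isog[of 0] by (simp add: zs_def ns_def)

lemma first_degree: "k \<ge> 1 \<Longrightarrow> ext_degree (q + 1) (F 0) (F 1)"
  using tower_poly_minimal(1)[OF base_M trans first_root] F_Suc[of 0] unfolding F_0 gen_field_adjoin by simp

lemma step_degree:
  assumes j: "Suc (Suc i) \<le> k"
  shows "\<exists>d\<le>q. ext_degree d (F (Suc i)) (F (Suc (Suc i)))"
proof -
  let ?K = "F (Suc i)"
  have sK: "sfield ?K" by (rule sf[OF F_base])
  note s = sfieldD[OF sK] and r = sfield_sring[OF sK]
  define l where "l = ls ! i"
  define l' where "l' = ls ! Suc i"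
  define c where "c = ns i * (1 - \<zeta> powi (1 - int q)) ^ (q + 1) * l ^ (q - 1) / (l' - l ^ q)"
  define d where "d = ns (Suc i) / ns i * ((l' - l ^ q) / l ^ (q - 1)) * l' ^ (q - 1)"
  have lK: "l \<in> ?K" "l' \<in> ?K" using ls_F j by (simp_all add: l_def l'_def)
  note nK = seq_K(1,3)[OF F_base]
  have cK: "c \<in> ?K" unfolding c_def by (intro s(3,4,8,9) nK lK)
  have dK: "d \<in> ?K" unfolding d_def by (intro s(3,4,8,9) nK lK)
  \<comment> \<open>The tower equation as a polynomial in the new variable, after the sum has been
    rewritten by \<open>geometric_q\<close>: \<open>b\<close> is the variable minus
    \<open>l' ^ q\<close>.\<close>
  define G1 where "G1 = [:- (l' ^ q), 1:] * [:- (l' ^ q + c), 1:] ^ (q - 1)"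
  define G where "G = G1 - [:d:]"
  have "Polynomial.degree G1 = q"
    unfolding G1_def using q_ge_2 by (simp add: degree_mult_eq degree_power_eq del: mult_pCons_left)
  then have deg: "Polynomial.degree G \<le> q" "poly.coeff G q \<noteq> 0"
  proof -
    assume dG: "Polynomial.degree G1 = q"
    show "Polynomial.degree G \<le> q" unfolding G_def by (rule degree_diff_le) (simp_all add: dG)
    have "G1 \<noteq> 0" using dG q_pos by auto
    then have "poly.coeff G1 q \<noteq> 0" using dG by (metis leading_coeff_0_iff)
    then show "poly.coeff G q \<noteq> 0" using q_pos by (cases q) (simp_all add: G_def)
  qed
  have GK: "coeffs_in ?K G"
    unfolding G_def G1_def using cK dK lK s r
    by (intro coeffs_in_diff[OF r] coeffs_in_mult[OF r] coeffs_in_power[OF r]) simp_all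
  have root: "poly G (ls ! Suc (Suc i)) = 0"
    using ls_tower_eq(2)[OF j] unfolding l_def[symmetric] l'_def[symmetric] c_def[symmetric] d_def[symmetric] geometric_q
    by (simp add: G_def G1_def poly_power algebra_simps)
  have Gnz: "G \<noteq> 0" using deg(2) by auto
  obtain m where m: "ext_degree (Polynomial.degree m) ?K (gen_field (?K \<union> {ls ! Suc (Suc i)}))"
      "\<exists>h. coeffs_in ?K h \<and> G = h * m"
    using minimal_polynomial[OF sK GK Gnz root] GK root by blast
  then obtain h where "G = h * m" by blast
  then have "Polynomial.degree m \<le> Polynomial.degree G" using Gnz by (auto simp: degree_mult_eq)
  then have "Polynomial.degree m \<le> q" using deg(1) by simp
  then show ?thesis using m(1) F_Suc[OF j] by auto
qed

lemma total_degree: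
  assumes "Suc i \<le> k"
  shows "\<exists>N \<le> (q + 1) * q ^ i. ext_degree N (F 0) (F (Suc i))"
  using assms
proof (induction i)
  case 0
  then show ?case using first_degree by (intro exI[of _ "q + 1"]) simp
next
  case (Suc i)
  then obtain N where N: "N \<le> (q + 1) * q ^ i" "ext_degree N (F 0) (F (Suc i))" by auto
  obtain d where d: "d \<le> q" "ext_degree d (F (Suc i)) (F (Suc (Suc i)))" using step_degree[OF Suc.prems] by blast
  have "ext_degree (N * d) (F 0) (F (Suc (Suc i)))"
    by (rule dimension_tower[OF sf[OF F_base] sf[OF F_base] N(2) d(2)])
  moreover have "N * d \<le> (q + 1) * q ^ Suc i"
    using mult_le_mono[OF N(1) d(1)] by (simp add: ac_simps)
  ultimately show ?case by blast
qed

text \<open>Above a place where \<open>\<lambda>\<^sub>0\<close> has a zero and \<open>\<lambda>\<^sub>1\<close> a pole the tower is totally ramified: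
  the \<open>\<lambda>\<^sub>i\<close> have zeros and poles alternately, and the order of \<open>\<lambda>\<^sub>i\<close> is \<open>- q\<close> times that of \<open>\<lambda>\<^bsub>i+1\<^esub>\<close>.\<close>

lemma degree_lower_bound:
  assumes k: "k \<ge> 1" and N: "ext_degree N (F 0) (F k)"
  shows "q ^ k \<le> N"
proof -
  obtain V where V: "valuation_ring V" "M \<subseteq> V" "valuation_ring.small V (ls ! 0)" "ls ! 1 \<notin> V"
    using ex_ramified_place[OF base_M trans first_root[OF k]] by blast
  interpret v: valued_frobenius q V by (intro valued_frobenius.intro frobenius_field_axioms V)
  have unitM: "v.unit c" if "c \<in> M" "c \<noteq> 0" for c by (rule v.field_unit[OF sf[OF base_M] V(2) that])
  have uC: "v.unit (drinfeld_setup.CC q t (zs i) (ns i))" "v.unit (drinfeld_setup.DD q t (zs i) (ns i))" for i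
  proof -
    interpret z: drinfeld_setup q t "zs i" "ns i" by (rule setup_seq)
    show "v.unit z.CC" "v.unit z.DD"
      using unitM z.CC_DD_K[OF base_seq[OF base_M]] z.CC_nz z.DD_nz by auto
  qed
  have rel: "ls ! i * (ls ! Suc i) ^ (q + 1) + drinfeld_setup.DD q t (zs i) (ns i) * (ls ! i) ^ q
      = (ls ! i) ^ (q + 1) * (ls ! Suc i) ^ q + drinfeld_setup.CC q t (zs i) (ns i) * ls ! Suc i" if "i < k" for i
  proof -
    interpret z: drinfeld_setup q t "zs i" "ns i" by (rule setup_seq)
    have nz: "ls ! i \<noteq> 0" using ls_nz \<open>i < k\<close> by simp
    show ?thesis using z.isog_tower_poly[OF nz ls_isog[OF \<open>i < k\<close>]] z.poly_tower_poly[OF nz] by simp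
  qed
  have step: "v.unit ((ls ! Suc i) ^ q * ls ! i) \<and>
      (if even i then v.small (ls ! i) \<and> ls ! Suc i \<notin> V else ls ! i \<notin> V \<and> v.small (ls ! Suc i))" if "Suc i \<le> k" for i
    using that
  proof (induction i)
    case 0
    have "v.unit ((ls ! Suc 0) ^ q * ls ! 0)"
      by (rule v.large_root[OF V(3) ls_nz[of 0] uC[of 0] _ rel[of 0]]) (use k V(4) in simp_all)
    then show ?case using V(3,4) by simp
  next
    case (Suc i)
    then have IH: "v.unit ((ls ! Suc i) ^ q * ls ! i)"
      "if even i then v.small (ls ! i) \<and> ls ! Suc i \<notin> V else ls ! i \<notin> V \<and> v.small (ls ! Suc i)" by auto
    note nM = seq_K[OF base_M]
    have "v.unit (ns i * (1 - \<zeta> powi (1 - int q)) ^ (q + 1))" "v.unit (ns (Suc i) / ns i)"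
      by (intro v.unit_mult v.unit_divide unitM nM)+
    moreover have "v.small (ls ! i) \<or> ls ! i \<notin> V" using IH(2) by (auto split: if_splits)
    moreover have "ls ! i \<noteq> 0" "ls ! Suc i \<noteq> 0" using ls_nz Suc.prems by simp_all
    ultimately have u: "v.unit ((ls ! Suc (Suc i)) ^ q * ls ! Suc i)"
      using Suc.prems by (intro v.tower_step[OF _ _ IH(1) _ _ ls_tower_eq(2) uC[of "Suc i"] rel]) simp_all
    have "v.small (ls ! Suc i) \<or> ls ! Suc i \<notin> V" using IH(2) by (auto split: if_splits)
    from v.alternate[OF \<open>ls ! Suc i \<noteq> 0\<close> this u] show ?case
      using u IH(2) v.small_in by (auto split: if_splits)
  qed
  have val: "v.val (ls ! i) (ls ! 0) ((- int q) ^ i)" if "i \<le> k" for i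
    using that
  proof (induction i)
    case 0
    show ?case unfolding v.val_def by (rule exI[of _ 1]) simp
  next
    case (Suc i)
    have "v.val (ls ! Suc i) (ls ! i) (- int q)"
      unfolding v.val_def
      by (rule exI[of _ "(ls ! Suc i) ^ q * ls ! i"]) (use step[OF Suc.prems] ls_nz[OF Suc.prems] in \<open>simp add: power_int_minus\<close>)
    moreover have "v.val (ls ! i) (ls ! 0) ((- int q) ^ i)" using Suc by simp
    ultimately show ?case unfolding power_Suc by (rule v.val_trans)
  qed
  have lk: "ls ! k \<noteq> 0" using ls_nz by simp
  have small_k: "if even k then v.small (ls ! k) else ls ! k \<notin> V"
    using k step[of "k - 1"] by (cases k) (auto split: if_splits)
  \<comment> \<open>The last coordinate has a zero for even \<open>k\<close> and a pole for odd
    \<open>k\<close>. Inverting it in the odd case also compensates the sign of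
    \<open>(- q) ^ k\<close>.\<close>
  define \<pi> where "\<pi> = (if even k then ls ! k else inverse (ls ! k))"
  have \<pi>: "v.small \<pi>" "\<pi> \<noteq> 0" using small_k lk v.small_inverse by (auto simp: \<pi>_def)
  have "v.val \<pi> (ls ! 0) (int (q ^ k))"
  proof (cases "even k")
    case True
    then show ?thesis using val[of k] by (simp add: \<pi>_def)
  next
    case False
    have "v.val \<pi> (ls ! k) (- 1)"
      unfolding v.val_def by (rule exI[of _ 1]) (use False in \<open>simp add: \<pi>_def power_int_minus\<close>)
    then have "v.val \<pi> (ls ! 0) (- 1 * (- int q) ^ k)" using v.val_trans val[of k] by blast
    then show ?thesis using False by simp
  qed
  then have ram: "q ^ k \<le> Polynomial.degree f" if "coeffs_in (F 0) f" "f \<noteq> 0" "poly f \<pi> = 0" for f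
    using v.ramification[OF sf[OF base_M] V(2,3) ls_nz[of 0] \<pi>] that unfolding F_0 by blast
  have "ls ! k \<in> F k" using ls_F by simp
  then have "\<pi> \<in> F k" using sfieldD(5)[OF sf[OF F_base]] by (auto simp: \<pi>_def)
  moreover have "F 0 \<subseteq> F k"
  proof -
    have "set (take (Suc 0) ls) \<subseteq> set (take (Suc k) ls)" by (rule set_take_subset_set_take) simp
    then show ?thesis unfolding F_def using gen_field_incl[of "M \<union> set (take (Suc k) ls)"]
      by (intro gen_field_minimal sfield_gen_field) blast
  qed
  ultimately show ?thesis
    by (intro dimension_lower_bound[OF sf[OF F_base] sf[OF F_base] _ _ N ram])
qed

lemma tower_degree:
  assumes k: "k \<ge> 1"
  shows "ext_degree (if k = 1 then q + 1 else q) (tower_field q t \<zeta> \<nu> (butlast ls)) (tower_field q t \<zeta> \<nu> ls)"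
proof -
  have tf: "tower_field q t \<zeta> \<nu> ls = F k" "tower_field q t \<zeta> \<nu> (butlast ls) = F (k - 1)"
    using ls_chain(1) k by (simp_all add: tower_field_def F_def butlast_conv_take)
  show ?thesis
  proof (cases "k = 1")
    case True
    then show ?thesis using first_degree tf by simp
  next
    case False
    then have "k = Suc (Suc (k - 2))" using k by simp
    then obtain i where i: "k = Suc (Suc i)" by blast
    obtain N where N: "N \<le> (q + 1) * q ^ i" "ext_degree N (F 0) (F (Suc i))" using total_degree[of i] i by auto
    obtain d where d: "d \<le> q" "ext_degree d (F (Suc i)) (F k)" using step_degree[of i] i by auto
    have "ext_degree (N * d) (F 0) (F k)" by (rule dimension_tower[OF sf[OF F_base] sf[OF F_base] N(2) d(2)])
    then have "q ^ k \<le> N * d" by (rule degree_lower_bound[OF k])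
    also have "q ^ k = q * q * q ^ i" by (simp add: i)
    also have "N * d \<le> (q + 1) * q ^ i * d" using N(1) by (rule mult_le_mono1)
    also have "\<dots> = ((q + 1) * d) * q ^ i" by (simp only: ac_simps)
    finally have "q * q * q ^ i \<le> ((q + 1) * d) * q ^ i" .
    then have qd: "q * q \<le> (q + 1) * d"
      using zero_less_power[OF q_pos(1), of i] by (metis mult_le_cancel2)
    have "d = q"
    proof (rule ccontr)
      assume "d \<noteq> q"
      then obtain n where n: "q = Suc n" "d \<le> n" using d(1) q_pos by (cases q) auto
      have "(q + 1) * d \<le> (q + 1) * n" by (rule mult_le_mono2[OF n(2)])
      then show False using qd by (simp add: n(1) algebra_simps)
    qed
    then show ?thesis using d(2) tf i by simp
  qed
qed

end

end

theorem theorem1: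
  fixes p e q :: nat
    and t \<zeta> \<nu> :: "'a::alg_closed_field"
    and \<sigma> :: "'a \<Rightarrow> 'a"
  assumes p: "prime p" "CHAR('a) = p"
    and q: "e > 0" "q = p ^ e"
    and \<zeta>: "\<zeta> \<in> Fq (q ^ 2)" "\<zeta> \<notin> Fq q"
    and t: "transcendental_over (Fq q) t"
    and \<nu>: "\<nu> ^ (q + 1) = - 1 / ((t - \<zeta>) * (t ^ q - \<zeta>))"
    and \<sigma>: "\<sigma> \<in> ring_iso (H_plus_ring q t \<zeta> \<nu>) (H_plus_ring q t \<zeta> \<nu>)"
      "\<And>a. a \<in> K_field q t \<Longrightarrow> \<sigma> a = a"
      "\<sigma> \<zeta> = \<zeta> ^ q" "\<sigma> \<nu> = - x_elt q t \<zeta> / \<nu>"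
  shows "\<exists>\<Psi> :: nat \<Rightarrow> 'a list \<Rightarrow> ('a \<Rightarrow> 'a poly) \<times> 'a set. \<forall>k.
     \<comment> \<open>tuples correspond one-to-one to pairs, with \<open>\<lambda>\<^sub>0\<close> the parameter of the Drinfeld module\<close>
     bij_betw (\<Psi> k) (tower_points q t \<zeta> \<nu> \<sigma> k)
       (x0_family_points q t \<zeta> \<nu> (I_inf_pow q t \<zeta> k)) \<and>
     (\<forall>ls \<in> tower_points q t \<zeta> \<nu> \<sigma> k. is_phi q t \<zeta> \<nu> (ls ! 0) (fst (\<Psi> k ls))) \<and>
     \<comment> \<open>up to isomorphism these are all the pairs\<close>
     (\<forall>P \<in> x0_points q t \<zeta> (I_inf_pow q t \<zeta> k).
        \<exists>P' \<in> x0_family_points q t \<zeta> \<nu> (I_inf_pow q t \<zeta> k). pair_iso q t \<zeta> P P') \<and>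
     \<comment> \<open>forgetting the last coordinate is the covering of modular curves\<close>
     (\<forall>ls \<in> tower_points q t \<zeta> \<nu> \<sigma> (Suc k).
        \<Psi> k (butlast ls) = covering q t \<zeta> (\<Psi> (Suc k) ls)) \<and>
     \<comment> \<open>function fields, and the degrees in the tower\<close>
     (\<forall>ls \<in> tower_points q t \<zeta> \<nu> \<sigma> k. transcendental_over (H_plus q t \<zeta> \<nu>) (ls ! 0) \<longrightarrow>
        tower_field q t \<zeta> \<nu> ls =
          field_of_definition q t \<zeta> (H_plus q t \<zeta> \<nu>) (\<Psi> k ls) \<and>
        (k \<ge> 1 \<longrightarrow> ext_degree (if k = 1 then q + 1 else q)
           (tower_field q t \<zeta> \<nu> (butlast ls)) (tower_field q t \<zeta> \<nu> ls)))"
proof -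
  have "prime CHAR('a)" "\<exists>e>0. q = CHAR('a) ^ e" using p q by auto
  then interpret drinfeld_setup q t \<zeta> \<nu>
    using \<zeta> t \<nu> by unfold_locales auto
  let ?M = "H_plus q t \<zeta> \<nu>"
  have base: "base ?M"
    using sfield_gen_field gen_field_incl[of "Fq q \<union> {t, \<zeta>, \<nu>}"] unfolding base_def H_plus_def by blast
  note s = sfieldD[OF sf[OF base]]
  have hom: "\<sigma> (a * b) = \<sigma> a * \<sigma> b" if "a \<in> ?M" "b \<in> ?M" for a b
    using \<sigma>(1) that by (auto simp: ring_iso_def ring_hom_def)
  have xK: "xA \<in> K_field q t"
  proof -
    note k = sfieldD[OF sfield_gen_field[of "Fq q \<union> {t}"]]
    have gens: "t \<in> K_field q t" "tr \<in> K_field q t" "nm \<in> K_field q t"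
      unfolding K_field_def using gen_field_incl[of "Fq q \<union> {t}"] tr_Fq nm_Fq by blast+
    have "\<rho> = t ^ 2 - tr * t + nm"
      by (simp add: rho_def tr_def nm_def algebra_simps power2_eq_square)
    also have "\<dots> \<in> K_field q t" using gens unfolding K_field_def by (intro k)
    finally have "1 / \<rho> \<in> K_field q t" unfolding K_field_def by (intro k)
    then show ?thesis by (simp add: x_elt_def)
  qed
  \<comment> \<open>The product of \<nu> and \<open>\<nu>'\<close> is \<open>- xA\<close>, which
    lies in the fixed field \<open>K_field q t\<close>; multiplicativity of \<sigma> then determines
    the image of \<open>\<nu>'\<close>, so \<nu> has period two.\<close>
  have "\<sigma> \<nu>' = \<nu>"
  proof -
    have nK: "\<nu> \<in> ?M" "xA \<in> ?M" by (rule base_elts(3)[OF base], rule xA_K(1)[OF base])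
    then have n': "\<nu>' \<in> ?M" by (intro s)
    have "\<nu> * \<nu>' = - xA" by simp
    moreover have "\<sigma> (- xA) = - xA"
      using xK sfieldD(6)[OF sfield_gen_field] by (intro \<sigma>(2)) (simp add: K_field_def)
    moreover have "\<sigma> \<nu> = \<nu>'" using \<sigma>(4) by simp
    ultimately have "\<nu>' * \<sigma> \<nu>' = \<nu>' * \<nu>" using hom[OF nK(1) n'] by (simp add: mult.commute)
    moreover have "\<nu>' \<noteq> 0" using drinfeld_setup.\<nu>_nz[OF conj] .
    ultimately show ?thesis by (metis mult_left_cancel)
  qed
  then have seq: "(\<sigma> ^^ m) \<nu> = ns m" for m
    by (induction m) (use \<sigma>(4) in \<open>auto simp: ns_def\<close>)
  then interpret tower_setup q t \<zeta> \<nu> \<sigma> by unfold_locales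
  have hd: "hd ls = ls ! 0" if "ls \<in> tower_points q t \<zeta> \<nu> \<sigma> k" for ls k
    using that by (cases ls) (auto simp: tower_points_def)
  have phi: "is_phi q t \<zeta> \<nu> (ls ! 0) (fst (\<Psi> ls))" if "ls \<in> tower_points q t \<zeta> \<nu> \<sigma> k" for ls k
    using that hd[OF that] is_phi_iff[of "ls ! 0" "Phi (ls ! 0)"] family_drinfeld(1)[of "ls ! 0"]
    by (auto simp: \<Psi>_def tower_points_def)
  show ?thesis
    using \<Psi>_bij phi all_points \<Psi>_covering tower_field_eq tower_degree
    by (intro exI[of _ "\<lambda>k. \<Psi>"] allI conjI ballI impI) auto
qed

end
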